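(* For all real $\beta$, all $0<\eta\le 1$ and all $\lambda>0$, the limit $g_1(\lambda):=\lim_{Q\to\infty} g_1^{\beta,\eta}(\lambda;Q)$ exists, is independent of $\beta$ and $\eta$, and equals \[ g_1(\lambda)=\frac{6}{\pi^2}\begin{cases} \frac{\pi^2}{6}-\lambda, & 0<\lambda<1,\\[4pt] \log^2 2-\frac{2\pi^2}{3}-1+\left(\frac{\lambda}{2}-\frac{2}{\lambda}\right)\log\!\left(\frac{2-\lambda}{\lambda-1}\right)+\frac{3\lambda}{2}\log\!\left(\frac{\lambda}{\lambda-1}\right)-\log\!\left(\frac{4}{\lambda}\right)\log\lambda+4\operatorname{Li}_2\!\left(\frac1\lambda\right)+2\operatorname{Li}_2\!\left(\frac\lambda2\right), & 1<\lambda<2,\\[4pt] -1+\left(\frac{\lambda}{2}-\frac{2}{\lambda}\right)\log\!\left(\frac{\lambda-2}{\lambda-1}\right)+\frac{3\lambda}{2}\log\!\left(\frac{\lambda}{\lambda-1}\right)+4\operatorname{Li}_2\!\left(\frac1\lambda\right)-2\operatorname{Li}_2\!\left(\frac2\lambda\right), & 2<\lambda. \end{cases} \] Moreover, for every $\epsilon>0$, \[ \left|g_1^{\beta,\eta}(\lambda;Q)-g_1(\lambda)\right|\ll_\epsilon (1+\lambda)\,\frac{Q^{\epsilon-1/2}}{\eta}, \] with implied constant depending only on $\epsilon$.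
   Context: For real $\alpha$ and an integer $Q\ge 1$, let $S_Q(\alpha)$ be the set of fractional parts $\{n\alpha\}$, $0\le n<Q$, placed on $[0,1]$ with $0$ and $1$ identified, so that $Q$ gaps appear between consecutive points (circularly). Let $\sigma=\sigma(\alpha,Q)$ be the permutation of $\{0,\dots,Q-1\}$ such that $\{\sigma_0\alpha\}<\{\sigma_1\alpha\}<\dots<\{\sigma_{Q-1}\alpha\}$ (for irrational $\alpha$), and interpret $\{\sigma_Q\alpha\}$ as $1$ (i.e. $\{\sigma_0\alpha\}+1$), so the $n$-th gap is $\{\sigma_{n+1}\alpha\}-\{\sigma_n\alpha\}$ for $0\le n<Q$. Define \[ g_1^{\beta,\eta}(\lambda;Q)=\frac1\eta\int_\beta^{\beta+\eta}\frac{\#\{0\le n<Q:\ \{\sigma_{n+1}\alpha\}-\{\sigma_n\alpha\}\ge \lambda/Q\}}{Q}\,d\alpha . \] $\operatorname{Li}_2(z)=\sum_{n\ge1} z^n/n^2$ for $|z|\le1$. *)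

theory Defs
  imports "HOL-Analysis.Analysis"
begin

definition sorted_fracs :: "real \<Rightarrow> nat \<Rightarrow> real list" where
  "sorted_fracs \<alpha> Q = sort (map (\<lambda>n. frac (real n * \<alpha>)) [0..<Q])"

definition gaps :: "real \<Rightarrow> nat \<Rightarrow> real list" where
  "gaps \<alpha> Q = (let xs = sorted_fracs \<alpha> Q in
     map (\<lambda>i. (if Suc i < Q then xs ! Suc i else xs ! 0 + 1) - xs ! i) [0..<Q])"

definition big_gap_count :: "real \<Rightarrow> real \<Rightarrow> nat \<Rightarrow> nat" where
  "big_gap_count lam \<alpha> Q = length (filter (\<lambda>g. g \<ge> lam / real Q) (gaps \<alpha> Q))"

definition g1_fin :: "real \<Rightarrow> real \<Rightarrow> real \<Rightarrow> nat \<Rightarrow> real" where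
  "g1_fin \<beta> \<eta> lam Q =
     (1 / \<eta>) * integral {\<beta>..\<beta>+\<eta>} (\<lambda>\<alpha>. real (big_gap_count lam \<alpha> Q) / real Q)"

definition Li2 :: "real \<Rightarrow> real" where
  "Li2 z = (\<Sum>n. z ^ Suc n / (real (Suc n))\<^sup>2)"

definition g1_formula :: "real \<Rightarrow> real" where
  "g1_formula lam = 6 / pi\<^sup>2 *
    (if lam < 1 then pi\<^sup>2 / 6 - lam
     else if lam < 2 then
       (ln 2)\<^sup>2 - 2 * pi\<^sup>2 / 3 - 1
       + (lam / 2 - 2 / lam) * ln ((2 - lam) / (lam - 1))
       + 3 * lam / 2 * ln (lam / (lam - 1))
       - ln (4 / lam) * ln lam
       + 4 * Li2 (1 / lam) + 2 * Li2 (lam / 2)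
     else
       - 1 + (lam / 2 - 2 / lam) * ln ((lam - 2) / (lam - 1))
       + 3 * lam / 2 * ln (lam / (lam - 1))
       + 4 * Li2 (1 / lam) - 2 * Li2 (2 / lam))"

end

theory Submission
  imports Defs "HOL-Computational_Algebra.Computational_Algebra" "HOL-Number_Theory.Cong"
    "HOL-Algebra.Algebraic_Closure_Type" "HOL-Real_Asymp.Real_Asymp" "Berlekamp_Zassenhaus.Finite_Field"
begin

text \<open>
  For irrational \<open>\<alpha>\<close> the gaps of \<open>\<alpha>, \<dots>, (Q - 1) \<alpha>\<close> modulo 1 take at most three values, which are determined by the
  two Farey neighbours of \<open>\<alpha>\<close> with denominators \<open>L < K < Q \<le> K + L\<close>. Integrating over \<open>\<alpha>\<close> turns the
  gap count into a sum over such pairs and over the numerators \<open>b\<close> of the arcs inside the window, where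
  \<open>b K \<equiv> \<plusminus>1\<close> modulo \<open>L\<close>. Weil's bound for Kloosterman sums, proved by Stepanov's method,
  equidistributes the inverses \<open>b\<close>, so that the window only enters through its length, with an error
  \<open>Q powr (\<epsilon> - 1 / 2)\<close>. The remaining sum over coprime pairs is a Riemann sum of an explicit density on
  a triangle, weighted by \<open>\<Sum> \<mu>(d) / d\<^sup>2\<close>; the normalisation \<open>6 / \<pi>\<^sup>2\<close> is read off from the trivial case \<open>\<lambda> = 0\<close>,
  and the integral over the triangle is evaluated with dilogarithms.
\<close>

text \<open>The exponent -1/2 has two sources. The discrepancy of the inverses modulo
  \<open>L\<close> is about the square root of \<open>L\<close>, which after averaging over
  \<open>L\<close> leaves \<open>1 / sqrt Q\<close> up to factors \<open>Q powr \<epsilon>\<close>.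
  Independently, the density is only bounded by a multiple of \<open>1 / t\<close> near the corner
  (1, 0) of the triangle, and the cheap majorant \<open>12 / sqrt (1 - s)\<close> used there costs
  another \<open>1 / sqrt Q\<close>. Weil's bound is proved for prime moduli only. At primes whose
  square divides the modulus the trivial bound is used; the loss is the square root of the
  squarefull part of \<open>L\<close>, and large squarefull parts are so rare that the average over
  \<open>L\<close> suffers only logarithms. Stepanov's argument gives one-sided point counts over
  fields with \<open>p ^ (2 * k)\<close> elements, with a poor constant. The L-function of the
  Kloosterman sum, shown to be a quadratic polynomial, carries this down to the prime field: the
  growth rate in \<open>k\<close> alone decides how large its two reciprocal roots can be.\<close>

hide_const (open) Polynomials.degree Polynomials.lead_coeff Coset.order Divisibility.prime up_ring.coeff up_ring.monom module.smult

section \<open>Weil's bound for Kloosterman sums modulo a prime\<close>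

text \<open>Gaussian elimination, one equation \<open>v\<close> at a time: an unknown
  \<open>u0\<close> with nonzero coefficient is solved for and removed. This supplies the
  coefficients of Stepanov's auxiliary polynomial, where unknowns outnumber conditions.\<close>

lemma underdetermined_system:
  fixes M :: "'u \<Rightarrow> 'v \<Rightarrow> 'a::field"
  assumes "finite U" "finite V" "card V < card U"
  shows "\<exists>c. (\<exists>u\<in>U. c u \<noteq> 0) \<and> (\<forall>v\<in>V. (\<Sum>u\<in>U. c u * M u v) = 0)"
  using assms(2,1,3)
proof (induction V arbitrary: U M rule: finite_induct)
  case empty
  then obtain u where "u \<in> U" by fastforce
  then show ?case by (intro exI[of _ "\<lambda>_. 1"]) auto
next
  case (insert v V)
  show ?case
  proof (cases "\<forall>u\<in>U. M u v = 0")
    case True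
    have "card V < card U" using insert by auto
    from insert.IH[OF insert.prems(1) this, of M] obtain c where
      "\<exists>u\<in>U. c u \<noteq> 0" "\<forall>v\<in>V. (\<Sum>u\<in>U. c u * M u v) = 0" by blast
    with True show ?thesis by (intro exI[of _ c]) auto
  next
    case False
    then obtain u0 where u0: "u0 \<in> U" "M u0 v \<noteq> 0" by auto
    define U' where "U' = U - {u0}"
    have U: "U = insert u0 U'" "u0 \<notin> U'" "finite U'" using u0 insert.prems by (auto simp: U'_def)
    define M' where "M' = (\<lambda>u w. M u w - M u v / M u0 v * M u0 w)"
    have "card V < card U'" using insert U by auto
    from insert.IH[OF U(3) this, of M'] obtain c where c: "\<exists>u\<in>U'. c u \<noteq> 0"
      "\<forall>w\<in>V. (\<Sum>u\<in>U'. c u * M' u w) = 0" by auto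
    define c' where "c' = c(u0 := - (\<Sum>u\<in>U'. c u * M u v) / M u0 v)"
    have eq: "(\<Sum>u\<in>U. c' u * M u w) = (\<Sum>u\<in>U'. c u * M' u w)" for w
    proof -
      have "(\<Sum>u\<in>U. c' u * M u w) = c' u0 * M u0 w + (\<Sum>u\<in>U'. c' u * M u w)"
        using U by (subst U(1), subst sum.insert) auto
      also have "(\<Sum>u\<in>U'. c' u * M u w) = (\<Sum>u\<in>U'. c u * M u w)"
        using U by (intro sum.cong) (auto simp: c'_def)
      also have "c' u0 * M u0 w = (\<Sum>u\<in>U'. - (c u * (M u v / M u0 v * M u0 w)))"
        by (simp add: c'_def sum_distrib_right sum_distrib_left sum_divide_distrib sum_negf field_simps)
      finally show ?thesis
        by (simp add: M'_def sum.distrib[symmetric] algebra_simps sum_subtractf)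
    qed
    have "\<exists>u\<in>U. c' u \<noteq> 0" using c(1) U by (auto simp: c'_def)
    moreover have "M' u v = 0" for u using u0 by (simp add: M'_def)
    ultimately show ?thesis using c(2) by (intro exI[of _ c']) (auto simp: eq)
  qed
qed

text \<open>Among the terms with nonzero coefficient one has strictly largest degree, and its
  leading term cannot cancel. The auxiliary polynomial is thereby seen to be nonzero although its
  coefficients are not explicit.\<close>

lemma sum_distinct_degrees_nonzero:
  fixes P :: "'u \<Rightarrow> 'a::idom poly"
  assumes "finite U" "inj_on (\<lambda>u. degree (P u)) U" "\<And>u. u \<in> U \<Longrightarrow> P u \<noteq> 0" "u \<in> U" "c u \<noteq> 0"
  shows "(\<Sum>u\<in>U. smult (c u) (P u)) \<noteq> 0"
proof -
  define W where "W = {u\<in>U. c u \<noteq> 0}"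
  have W: "finite W" "W \<noteq> {}" using assms by (auto simp: W_def)
  have "Max ((\<lambda>u. degree (P u)) ` W) \<in> (\<lambda>u. degree (P u)) ` W" using W by (intro Max_in) auto
  then obtain w where w: "w \<in> W" "degree (P w) = Max ((\<lambda>u. degree (P u)) ` W)" by auto
  then have w: "w \<in> W" "\<And>x. x \<in> W \<Longrightarrow> degree (P x) \<le> degree (P w)"
    using W by auto
  have "coeff (\<Sum>u\<in>U. smult (c u) (P u)) (degree (P w)) = (\<Sum>u\<in>U. if u = w then c w * lead_coeff (P w) else 0)"
    unfolding coeff_sum
  proof (intro sum.cong refl)
    fix x assume x: "x \<in> U"
    show "coeff (smult (c x) (P x)) (degree (P w)) = (if x = w then c w * lead_coeff (P w) else 0)"
    proof (cases "x \<in> W \<and> x \<noteq> w")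
      case True
      then have "degree (P x) < degree (P w)"
        using w assms(2) x by (metis (mono_tags, lifting) W_def inj_onD le_neq_implies_less mem_Collect_eq)
      then show ?thesis using True by (simp add: coeff_eq_0)
    qed (use x in \<open>auto simp: W_def\<close>)
  qed
  also have "\<dots> = c w * lead_coeff (P w)" using w assms(1) by (auto simp: W_def)
  also have "\<dots> \<noteq> 0" using w assms(3) by (auto simp: W_def)
  finally show ?thesis by fastforce
qed

section \<open>Finite fields inside an algebraically closed field, and their characters\<close>

lemma size_proots_alg_closed:
  fixes P :: "'a :: alg_closed_field poly"
  shows "size (proots P) = degree P"
proof (cases "P = 0")
  case False
  then obtain A where A: "size A = degree P" "P = smult (lead_coeff P) (\<Prod>x\<in>#A. [:-x, 1:])"
    using alg_closed_imp_factorization by blast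
  have "proots P = proots (\<Prod>x\<in>#A. [:-x, 1:])"
    using A(2) False by (metis leading_coeff_0_iff proots_smult)
  also have "\<dots> = A"
  proof (induction A)
    case (add x A)
    have "0 \<notin># image_mset (\<lambda>x. [:-x, 1:]) A" by auto
    then have "(\<Prod>x\<in>#A. [:-x, 1:]) \<noteq> 0" by (simp only: prod_mset_zero_iff not_False_eq_True)
    then show ?case using add by (simp add: proots_mult del: mult_pCons_left)
  qed auto
  finally show ?thesis using A by simp
qed auto

lemma sum_order_alg_closed:
  fixes P :: "'a :: alg_closed_field poly"
  assumes "P \<noteq> 0"
  shows "(\<Sum>x | poly P x = 0. order x P) = degree P"
  using size_proots_alg_closed[of P] assms by (simp add: size_multiset_overloaded_eq)

text \<open>Inside one algebraically closed field all fields with \<open>p ^ n\<close> elements are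
  visible at once, as fixed sets of powers of Frobenius. It also provides roots of polynomials and
  the \<open>p ^ k\<close>-th roots of coefficients taken in \<open>stepanov\<close>. The equations
  for \<open>a\<close> and \<open>b\<close> place them in the prime field.\<close>

locale kloosterman_field =
  fixes a b :: "'a :: alg_closed_field" and p :: nat
  assumes char: "CHAR('a) = p" and p: "prime p"
    and a: "a ^ p = a" "a \<noteq> 0" and b: "b ^ p = b" "b \<noteq> 0"
begin

definition Fq :: "nat \<Rightarrow> 'a set" where "Fq n = {x. x ^ (p ^ n) = x}"
text \<open>On \<open>Fq n\<close> this is the trace to the prime field. On larger fields it is a
  partial trace, and \<open>stepanov\<close> works with such a half trace.\<close>

definition tr :: "nat \<Rightarrow> 'a \<Rightarrow> 'a" where "tr n x = (\<Sum>i<n. x ^ (p ^ i))"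

lemma p_ge_2: "p \<ge> 2" using p prime_ge_2_nat by blast

lemma frob_add: "(x + y :: 'a) ^ (p ^ n) = x ^ (p ^ n) + y ^ (p ^ n)"
  by (rule freshmans_dream') (use char p in auto)

lemma frob_diff: "(x - y :: 'a) ^ (p ^ n) = x ^ (p ^ n) - y ^ (p ^ n)"
  using frob_add[of "x - y" y n] by (simp add: algebra_simps)

lemma frob_sum: "(\<Sum>i\<in>I. f i :: 'a) ^ (p ^ n) = (\<Sum>i\<in>I. f i ^ (p ^ n))"
  by (rule freshmans_dream_sum') (use char p in auto)

lemma frob_inj: "x ^ (p ^ n) = y ^ (p ^ n) \<longleftrightarrow> x = (y :: 'a)"
proof
  assume "x ^ (p ^ n) = y ^ (p ^ n)"
  then have "(x - y) ^ (p ^ n) = 0" by (simp add: frob_diff)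
  then show "x = y" by simp
qed simp

lemma Fq_pow: "x ^ p = x \<Longrightarrow> x ^ (p ^ n) = (x :: 'a)"
  by (induction n) (simp_all add: power_mult)

lemma Fq_poly: "Fq n = {x. poly (monom 1 (p ^ n) - monom 1 1) x = 0}"
  by (auto simp: Fq_def poly_monom)

text \<open>The derivative of \<open>X ^ (p ^ n) - X\<close> is -1, so all roots are simple and
  their number is the degree.\<close>

lemma finite_Fq [simp]: "n > 0 \<Longrightarrow> finite (Fq n)" and card_Fq: "n > 0 \<Longrightarrow> card (Fq n) = p ^ n"
proof -
  assume n: "n > 0"
  define P where "P = monom 1 (p ^ n) - (monom 1 1 :: 'a poly)"
  have 1: "p ^ n > 1" using n p_ge_2 by (metis Suc_1 Suc_le_lessD one_less_power)
  have "coeff P (p ^ n) = 1" using 1 by (simp add: P_def)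
  then have P0: "P \<noteq> 0" by auto
  have degP: "degree P = p ^ n"
  proof (rule antisym)
    show "degree P \<le> p ^ n" using 1 by (auto simp: P_def intro!: degree_diff_le degree_monom_le order.trans[OF degree_monom_le])
    show "p ^ n \<le> degree P" using \<open>coeff P (p ^ n) = 1\<close> by (intro le_degree) auto
  qed
  show "finite (Fq n)" unfolding Fq_poly P_def[symmetric] by (rule poly_roots_finite[OF P0])
  have "(of_nat (p ^ n) :: 'a) = 0" using char n by (simp add: of_nat_eq_0_iff_char_dvd)
  then have pd: "pderiv P = [:- 1:]"
    by (simp add: P_def pderiv_diff pderiv_monom monom_0 del: of_nat_power)
  have ord: "order x P = 1" if "poly P x = 0" for x
  proof (rule antisym)
    show "1 \<le> order x P" using that P0 by (simp add: Suc_le_eq order_gt_0_iff)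
    show "order x P \<le> 1"
    proof (rule ccontr)
      assume "\<not> order x P \<le> 1"
      then have "[:-x, 1:] ^ 2 dvd P" by (simp add: order_divides P0)
      then obtain R where R: "P = [:-x, 1:] ^ 2 * R" by (elim dvdE)
      have "poly (pderiv (A ^ 2 * R)) x = 0" if "poly A x = 0" for A
        using that by (simp add: pderiv_mult power2_eq_square)
      from this[of "[:-x, 1:]"] have "poly (pderiv P) x = 0" unfolding R by simp
      with pd show False by simp
    qed
  qed
  have "card (Fq n) = (\<Sum>x | poly P x = 0. order x P)"
    unfolding Fq_poly P_def[symmetric] using ord by simp
  then show "card (Fq n) = p ^ n" using sum_order_alg_closed[OF P0] degP by simp
qed

lemma Fq1I: "x ^ p = x \<Longrightarrow> x \<in> Fq n" by (simp add: Fq_def Fq_pow)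
lemma Fq1_iff: "x \<in> Fq 1 \<longleftrightarrow> x ^ p = x" by (simp add: Fq_def)
lemma Fq_0 [simp]: "0 \<in> Fq n" using p_ge_2 by (simp add: Fq_def power_0_left)
lemma Fq_1 [simp]: "1 \<in> Fq n" by (simp add: Fq_def)
lemma Fq_add: "x \<in> Fq n \<Longrightarrow> y \<in> Fq n \<Longrightarrow> x + y \<in> Fq n" by (simp add: Fq_def frob_add)
lemma Fq_diff: "x \<in> Fq n \<Longrightarrow> y \<in> Fq n \<Longrightarrow> x - y \<in> Fq n" by (simp add: Fq_def frob_diff)
lemma Fq_uminus: "x \<in> Fq n \<Longrightarrow> - x \<in> Fq n" using Fq_diff[of 0 n x] by simp
lemma Fq_mult: "x \<in> Fq n \<Longrightarrow> y \<in> Fq n \<Longrightarrow> x * y \<in> Fq n" by (simp add: Fq_def power_mult_distrib)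
lemma Fq_divide: "x \<in> Fq n \<Longrightarrow> y \<in> Fq n \<Longrightarrow> x / y \<in> Fq n" by (simp add: Fq_def power_divide)
lemma a_Fq: "a \<in> Fq n" and b_Fq: "b \<in> Fq n" using a b by (simp_all add: Fq1I)
lemmas Fq_closed = Fq_add Fq_diff Fq_uminus Fq_mult Fq_divide a_Fq b_Fq

lemma of_nat_Fq: "of_nat i \<in> Fq n"
  by (induction i) (auto intro: Fq_add)

lemma of_nat_inj: "inj_on (of_nat :: nat \<Rightarrow> 'a) {..<p}"
proof (rule linorder_inj_onI)
  fix i j assume "i < j" "i \<in> {..<p}" "j \<in> {..<p}"
  then have "\<not> p dvd j - i" by (auto dest: dvd_imp_le)
  then have "(of_nat (j - i) :: 'a) \<noteq> 0" using char by (simp only: of_nat_eq_0_iff_char_dvd not_False_eq_True)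
  then show "(of_nat i :: 'a) \<noteq> of_nat j" using \<open>i < j\<close> by (auto simp: of_nat_diff)
qed auto

lemma Fq1_eq: "Fq 1 = of_nat ` {..<p}"
proof (rule card_subset_eq[symmetric])
  show "card ((of_nat :: nat \<Rightarrow> 'a) ` {..<p}) = card (Fq 1)" using of_nat_inj by (simp add: card_image card_Fq)
qed (auto simp: of_nat_Fq)

text \<open>A nontrivial additive character of the prime field \<open>Fq 1\<close>; outside of it
  the inverse map, and with it the value, is unspecified.\<close>

definition psi :: "'a \<Rightarrow> complex" where
  "psi x = cis (2 * pi * real (the_inv_into {..<p} of_nat x) / real p)"

lemma psi_of_nat: "psi (of_nat i) = cis (2 * pi * real i / real p)"
proof -
  have "(of_nat (i mod p) :: 'a) = of_nat i"
  proof -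
    have "(of_nat i :: 'a) = of_nat (p * (i div p) + i mod p)" by simp
    also have "\<dots> = of_nat p * of_nat (i div p) + of_nat (i mod p)" by (simp only: of_nat_add of_nat_mult)
    finally show ?thesis using char of_nat_CHAR[where 'a='a] by simp
  qed
  then have "the_inv_into {..<p} of_nat (of_nat i :: 'a) = i mod p"
    using the_inv_into_f_f[OF of_nat_inj, of "i mod p"] p_ge_2 by simp
  then have "psi (of_nat i) = cis (2 * pi * real (i mod p) / real p)" by (simp add: psi_def)
  also have "2 * pi * real i / real p = 2 * pi * real (i mod p) / real p + 2 * pi * real (i div p)"
  proof -
    have "real i = real (p * (i div p) + i mod p)" by simp
    also have "\<dots> = real p * real (i div p) + real (i mod p)" by (simp only: of_nat_add of_nat_mult)
    finally show ?thesis using p_ge_2 by (simp add: field_simps)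
  qed
  then have "cis (2 * pi * real i / real p) = cis (2 * pi * real (i mod p) / real p)"
    by (simp add: cis_mult[symmetric] cis_multiple_2pi[of "real (i div p)"])
  finally show ?thesis by simp
qed

lemma psi_0 [simp]: "psi 0 = 1" using psi_of_nat[of 0] by simp
lemma norm_psi [simp]: "norm (psi x) = 1" by (simp add: psi_def)

lemma psi_add: assumes "x \<in> Fq 1" "y \<in> Fq 1" shows "psi (x + y) = psi x * psi y"
proof -
  obtain i j where ij: "x = of_nat i" "y = of_nat j" using assms unfolding Fq1_eq by auto
  then have "psi (x + y) = cis (2 * pi * real (i + j) / real p)" using psi_of_nat[of "i + j"] by simp
  also have "\<dots> = psi x * psi y" by (simp add: ij psi_of_nat cis_mult add_divide_distrib ring_distribs)
  finally show ?thesis .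
qed

lemma psi_1: "psi 1 \<noteq> 1"
proof
  assume "psi 1 = 1"
  then have "cis (2 * pi / real p) = 1" using psi_of_nat[of 1] by simp
  then have *: "cos (2 * pi / real p) = 1" by (simp add: complex_eq_iff)
  have "2 * pi / real p \<le> pi" "0 < 2 * pi / real p" using p_ge_2 by (auto simp: field_simps)
  then have "cos (2 * pi / real p) < cos 0" by (intro cos_monotone_0_pi) auto
  with * show False by simp
qed

lemma sum_psi: assumes "t \<in> Fq 1" "t \<noteq> 0" shows "(\<Sum>x\<in>Fq 1. psi (t * x)) = 0"
proof -
  have "(\<Sum>x\<in>Fq 1. psi (t * x)) = (\<Sum>x\<in>Fq 1. psi (t * (x + 1 / t)))"
    by (rule sum.reindex_bij_witness[of _ "\<lambda>x. x + 1/t" "\<lambda>x. x - 1/t"])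
       (use assms in \<open>auto intro!: Fq_closed\<close>)
  also have "\<dots> = (\<Sum>x\<in>Fq 1. psi (t * x) * psi 1)"
    using assms by (intro sum.cong refl) (simp add: ring_distribs psi_add Fq_closed)
  also have "\<dots> = psi 1 * (\<Sum>x\<in>Fq 1. psi (t * x))" by (simp add: sum_distrib_left mult.commute)
  finally show ?thesis using psi_1 by (simp add: mult_cancel_right1)
qed

lemma tr_in: "x \<in> Fq n \<Longrightarrow> tr n x \<in> Fq 1"
proof -
  assume x: "x \<in> Fq n"
  have "tr n x ^ (p ^ 1) = (\<Sum>i<n. x ^ (p ^ Suc i))"
    unfolding tr_def frob_sum by (simp add: power_mult[symmetric] mult.commute)
  also have "\<dots> = (\<Sum>i<n. x ^ (p ^ i)) + x ^ (p ^ n) - x"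
    using sum.lessThan_Suc_shift[of "\<lambda>i. x ^ (p ^ i)" n] by simp
  also have "\<dots> = tr n x" using x by (simp add: Fq_def tr_def)
  finally show ?thesis by (simp add: Fq_def)
qed

section \<open>Stepanov's point count over fields of square order\<close>

definition kf :: "'a \<Rightarrow> 'a" where "kf x = a * x + b / x"

lemma kf_in: "x \<in> Fq n \<Longrightarrow> kf x \<in> Fq n" by (auto simp: kf_def intro!: Fq_closed)

lemma kf_pow: "kf x ^ (p ^ n) = a * x ^ (p ^ n) + b / x ^ (p ^ n)"
  using a b by (simp add: kf_def frob_add power_mult_distrib power_divide Fq_pow)

lemma tr_add_pow: "tr (k + l) x = tr k x + tr l x ^ (p ^ k)"
proof -
  have "tr l x ^ (p ^ k) = (\<Sum>i<l. x ^ (p ^ (k + i)))"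
    unfolding tr_def frob_sum by (simp add: power_mult[symmetric] power_add mult.commute)
  moreover have "(\<Sum>i<k + l. x ^ (p ^ i)) = (\<Sum>i<k. x ^ (p ^ i)) + (\<Sum>i<l. x ^ (p ^ (k + i)))"
    by (induction l) (simp_all add: algebra_simps)
  ultimately show ?thesis by (simp add: tr_def)
qed

definition fibre :: "nat \<Rightarrow> 'a \<Rightarrow> 'a set" where
  "fibre n c = {x \<in> Fq n - {0}. tr n (kf x) = c}"

text \<open>In a field with \<open>r * r\<close> elements, \<open>r = p ^ k\<close>, the method
  works without derivatives. With \<open>y = tr k (kf x)\<close>, each \<open>x\<close> in the fibre
  satisfies \<open>x ^ (r * r) = x\<close> and \<open>y ^ r = c - y\<close>. So the
  \<open>r\<close>-th power of a polynomial in \<open>x\<close>, \<open>x ^ r\<close> and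
  \<open>y\<close> agrees there, up to powers of \<open>x\<close>, with a polynomial of low degree,
  and the coefficients are chosen to make the latter vanish identically. The fibre then consists of
  zeros of the nonzero polynomial \<open>G\<close>, and \<open>degree G\<close> is the
  bound.\<close>

lemma stepanov:
  assumes k: "k > 0"
  shows "card (fibre (2 * k) c) \<le> p ^ (2 * k - 1) + 4 * p ^ k"
proof -
  define r where "r = p ^ k"
  \<comment> \<open>The largest exponent in the half trace, hence its pole order at 0:
    \<open>X ^ D\<close> clears the denominator, giving the polynomial \<open>g\<close>.\<close>
  define D where "D = p ^ (k - 1)"
  have rD: "r = p * D" using k by (simp add: r_def D_def power_Suc[symmetric] del: power_Suc)
  have D: "D > 0" using p_ge_2 by (simp add: D_def)
  have le_D: "p ^ i \<le> D" if "i < k" for i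
    unfolding D_def using that p_ge_2 by (intro power_increasing) auto
  define g where "g = (\<Sum>i<k. monom a (D + p ^ i) + monom b (D - p ^ i))"
  have poly_g: "poly g x = x ^ D * tr k (kf x)" if "x \<noteq> 0" for x
    unfolding g_def tr_def poly_sum sum_distrib_left
  proof (intro sum.cong refl)
    fix i assume "i \<in> {..<k}"
    then have "x ^ D = x ^ (D - p ^ i) * x ^ (p ^ i)" using le_D by (simp add: power_add[symmetric])
    then show "poly (monom a (D + p ^ i) + monom b (D - p ^ i)) x = x ^ D * kf x ^ (p ^ i)"
      using that by (simp add: kf_pow poly_monom power_add field_simps)
  qed
  have deg_g_le: "degree g \<le> 2 * D" unfolding g_def
    using le_D by (intro degree_sum_le) (auto intro!: degree_add_le order.trans[OF degree_monom_le] simp: mult_2 add_le_mono)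
  have "coeff g (2 * D) = (\<Sum>i<k. if i = k - 1 then a else 0)"
    unfolding g_def coeff_sum
  proof (intro sum.cong refl)
    fix i assume i: "i \<in> {..<k}"
    have "D + p ^ i = 2 * D \<longleftrightarrow> i = k - 1"
      using p_ge_2 by (auto simp: D_def)
    moreover have "D - p ^ i \<noteq> 2 * D" using D by auto
    ultimately show "coeff (monom a (D + p ^ i) + monom b (D - p ^ i)) (2 * D) = (if i = k - 1 then a else 0)"
      by auto
  qed
  then have cg: "coeff g (2 * D) = a" using k by simp
  then have deg_g: "degree g = 2 * D" using deg_g_le a le_degree[of g "2 * D"] by simp
  have g0: "g \<noteq> 0" using cg a by auto
  \<comment> \<open>The index \<open>i\<close> belongs to \<open>x ^ r\<close>, \<open>j\<close> to
    \<open>y\<close> and \<open>e\<close> to \<open>x\<close>. There are \<open>(D + 3) * r\<close>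
    unknowns against \<open>D * r + r + 3\<close> coefficients, and \<open>2 * r > 3\<close>. The
    monomials with exponent \<open>(p - 1 - j) * D\<close> give all powers of \<open>y\<close> the
    same factor \<open>x ^ ((p - 1) * D)\<close>.\<close>
  define U where "U = {..<D + 3} \<times> {..<p} \<times> {..<D}"
  define B where "B = (\<lambda>(i, j, e). monom 1 (e * r + i) * ((monom c D - g) ^ j * monom 1 ((p - 1 - j) * D)) :: 'a poly)"
  define V where "V = {..<D * r + r + 3}"
  have jD: "2 * D * j + (p - 1 - j) * D \<le> 2 * r - 2 * D" if "j < p" for j
  proof -
    have "2 * D * j + (p - 1 - j) * D \<le> 2 * D * j + (p - 1 - j) * D * 2" by simp
    also have "\<dots> = 2 * (D * (j + (p - 1 - j)))" by (simp add: algebra_simps)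
    also have "\<dots> = 2 * D * (p - 1)" using that by simp
    also have "\<dots> = 2 * r - 2 * D" by (simp add: rD algebra_simps)
    finally show ?thesis .
  qed
  have degB: "degree (B u) < D * r + r + 3" if "u \<in> U" for u
  proof -
    obtain i j e where u: "u = (i, j, e)" "i < D + 3" "j < p" "e < D" using \<open>u \<in> U\<close> by (auto simp: U_def)
    have "degree (monom c D - g) \<le> 2 * D" using deg_g by (intro degree_diff_le order.trans[OF degree_monom_le]) auto
    then have "degree ((monom c D - g) ^ j) \<le> 2 * D * j"
      by (meson degree_power_le mult_le_mono1 order_trans)
    then have "degree (B u) \<le> (e * r + i) + (2 * D * j + (p - 1 - j) * D)"
      unfolding B_def u(1) prod.case
      by (intro order.trans[OF degree_mult_le] add_mono degree_monom_le) auto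
    also have "\<dots> \<le> (e * r + i) + (2 * r - 2 * D)" using jD[OF u(3)] by simp
    also have "\<dots> < D * r + r + 3"
    proof -
      have "(e + 1) * r \<le> D * r" using u(4) by (intro mult_le_mono1) auto
      then have "e * r + r \<le> D * r" by simp
      moreover have "D \<le> r" using rD p_ge_2 by simp
      ultimately show ?thesis using u(2) by linarith
    qed
    finally show ?thesis .
  qed
  have "card V < card U"
  proof -
    have "card U = (D + 3) * r" by (simp add: U_def rD)
    moreover have "r \<ge> 2" using rD p_ge_2 D
      by (metis One_nat_def Suc_leI less_eq_nat.simps(1) mult_le_mono nat_mult_1_right)
    ultimately show ?thesis by (simp add: V_def algebra_simps)
  qed
  from underdetermined_system[OF _ _ this, of "\<lambda>u v. coeff (B u) v"] obtain c1 where
    c1: "\<exists>u\<in>U. c1 u \<noteq> 0" "\<And>v. v \<in> V \<Longrightarrow> (\<Sum>u\<in>U. c1 u * coeff (B u) v) = 0"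
    by (auto simp: U_def V_def)
  have E0: "(\<Sum>u\<in>U. smult (c1 u) (B u)) = 0"
  proof (rule poly_eqI)
    fix v show "coeff (\<Sum>u\<in>U. smult (c1 u) (B u)) v = coeff 0 v"
    proof (cases "v \<in> V")
      case False
      then have "coeff (B u) v = 0" if "u \<in> U" for u
        using degB[OF that] by (intro coeff_eq_0) (auto simp: V_def)
      then show ?thesis by (simp add: coeff_sum)
    qed (simp add: coeff_sum c1)
  qed
  \<comment> \<open>The relation found concerns the \<open>r\<close>-th power of \<open>G\<close>;
    taking \<open>r\<close>-th roots of its coefficients gives those of \<open>G\<close>
    itself.\<close>
  have "\<exists>y. y ^ r = c1 u" for u
    by (rule nth_root_exists) (use p_ge_2 in \<open>auto simp: r_def\<close>)
  then obtain c2 where c2: "\<And>u. c2 u ^ r = c1 u" by metis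
  have r0: "r > 0" using p_ge_2 by (auto simp: r_def)
  define P where "P = (\<lambda>(i, j, e). monom 1 (e + r * i) * (g ^ j * monom 1 ((p - 1 - j) * D)) :: 'a poly)"
  define G where "G = (\<Sum>u\<in>U. smult (c2 u) (P u))"
  \<comment> \<open>Up to the constant \<open>(p - 1) * D\<close> the degree is
    \<open>e + D * (j + p * i)\<close>, a mixed radix expansion with digits \<open>e < D\<close> and
    \<open>j < p\<close>. Distinct indices therefore give distinct degrees.\<close>
  have degP: "degree (P (i, j, e)) = (p - 1) * D + (e + D * (j + p * i))" if "j < p" for i j e
  proof -
    have "degree (P (i, j, e)) = (e + r * i) + (2 * D * j + (p - 1 - j) * D)"
      using g0 deg_g by (simp add: P_def degree_mult_eq degree_power_eq degree_monom_eq mult_ac)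
    also have "2 * D * j + (p - 1 - j) * D = D * j + D * (j + (p - 1 - j))" by (simp add: algebra_simps)
    also have "j + (p - 1 - j) = p - 1" using that by simp
    finally show ?thesis by (simp add: rD algebra_simps)
  qed
  have inj: "inj_on (\<lambda>u. degree (P u)) U"
  proof (rule inj_onI)
    fix u v assume "u \<in> U" "v \<in> U" and eq: "degree (P u) = degree (P v)"
    obtain i j e where u: "u = (i, j, e)" "i < D + 3" "j < p" "e < D" using \<open>u \<in> U\<close> by (auto simp: U_def)
    obtain i' j' e' where v: "v = (i', j', e')" "i' < D + 3" "j' < p" "e' < D" using \<open>v \<in> U\<close> by (auto simp: U_def)
    have *: "e + D * (j + p * i) = e' + D * (j' + p * i')" using eq u v by (simp add: degP)
    have e: "e = e'" using arg_cong[OF *, of "\<lambda>z. z mod D"] u v by simp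
    have **: "j + p * i = j' + p * i'" using * e D by simp
    have "(j + p * i) mod p = j" "(j' + p * i') mod p = j'" using u v by simp_all
    with ** have j: "j = j'" by simp
    with ** p_ge_2 have "i = i'" by simp
    with e j u v show "u = v" by simp
  qed
  obtain u0 where u0: "u0 \<in> U" "c1 u0 \<noteq> 0" using c1 by auto
  then have c20: "c2 u0 \<noteq> 0" using c2[of u0] r0 by (metis zero_power)
  have G0: "G \<noteq> 0" unfolding G_def
  proof (rule sum_distinct_degrees_nonzero[of _ _ u0])
    show "P u \<noteq> 0" if "u \<in> U" for u using g0 by (cases u) (auto simp: P_def)
  qed (use inj u0 c20 in \<open>auto simp: U_def\<close>)
  have degG: "degree G \<le> D * r + 4 * r" unfolding G_def
  proof (rule degree_sum_le)
    fix u assume "u \<in> U"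
    then obtain i j e where u: "u = (i, j, e)" "i < D + 3" "j < p" "e < D" by (auto simp: U_def)
    have "degree (P u) = (e + r * i) + (2 * D * j + (p - 1 - j) * D)"
      using g0 deg_g by (simp add: u P_def degree_mult_eq degree_power_eq degree_monom_eq mult_ac)
    also have "\<dots> \<le> (e + r * i) + (2 * r - 2 * D)" using jD[OF u(3)] by simp
    also have "r * i \<le> r * (D + 2)" using u(2) by (intro mult_le_mono2) auto
    then have "(e + r * i) + (2 * r - 2 * D) \<le> D * r + 4 * r" using u(4)
      by (auto simp: algebra_simps) (use diff_le_self[of "r * 2" "D * 2"] rD p_ge_2 mult_le_mono1[of 2 p D] in linarith)
    finally show "degree (smult (c2 u) (P u)) \<le> D * r + 4 * r"
      using degree_smult_le order_trans by blast
  qed (auto simp: U_def)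
  have "poly G x = 0" if x: "x \<in> fibre (2 * k) c" for x
  proof -
    have x0: "x \<noteq> 0" and xq: "x ^ (p ^ (2 * k)) = x" and tc: "tr (2 * k) (kf x) = c"
      using x by (auto simp: fibre_def Fq_def)
    define y where "y = tr k (kf x)"
    have yr: "y ^ r = c - y" using tc tr_add_pow[of k k "kf x"] unfolding y_def r_def mult_2 by (simp add: eq_diff_eq add.commute)
    have xrr: "x ^ (r * r) = x" using xq by (simp add: r_def power_add[symmetric] mult_2)
    define H where "H = (p - 1) * D"
    have split: "x ^ (D * j) * x ^ ((p - 1 - j) * D) = x ^ H" if "j < p" for j
    proof -
      have "D * j + (p - 1 - j) * D = D * (j + (p - 1 - j))" by (simp add: algebra_simps)
      also have "\<dots> = H" using that by (simp add: H_def)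
      finally show ?thesis by (simp add: power_add[symmetric])
    qed
    have PB: "poly (P (i, j, e)) x = x ^ H * (x ^ (e + r * i) * y ^ j)"
      "poly (B (i, j, e)) x = x ^ H * (x ^ (e * r + i) * (c - y) ^ j)" if "j < p" for i j e
    proof -
      have "poly g x ^ j * x ^ ((p - 1 - j) * D) = x ^ H * y ^ j"
        using split[OF that] poly_g[OF x0] by (simp add: y_def power_mult_distrib power_mult[symmetric] mult_ac)
      then show "poly (P (i, j, e)) x = x ^ H * (x ^ (e + r * i) * y ^ j)" by (simp add: P_def poly_monom mult_ac)
      have "poly (monom c D - g) x = x ^ D * (c - y)" using poly_g[OF x0] by (simp add: y_def poly_monom algebra_simps)
      then have "poly (monom c D - g) x ^ j * x ^ ((p - 1 - j) * D) = x ^ H * (c - y) ^ j"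
        using split[OF that] by (simp add: power_mult_distrib power_mult[symmetric] mult_ac)
      then show "poly (B (i, j, e)) x = x ^ H * (x ^ (e * r + i) * (c - y) ^ j)"
        by (simp add: B_def poly_monom mult_ac)
    qed
    \<comment> \<open>Raising to the power \<open>r\<close> folds \<open>x ^ (r * i)\<close> down to
      \<open>x ^ i\<close> and turns \<open>y ^ j\<close> into \<open>(c - y) ^ j\<close>. This is
      where the degree is gained.\<close>
    have key: "x ^ H * poly (P u) x ^ r = x ^ (H * r) * poly (B u) x" if "u \<in> U" for u
    proof -
      obtain i j e where u: "u = (i, j, e)" "j < p" using \<open>u \<in> U\<close> by (auto simp: U_def)
      have "(x ^ (e + r * i)) ^ r = x ^ (e * r) * (x ^ (r * r)) ^ i"
        by (simp add: power_mult[symmetric] power_add algebra_simps)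
      then have 1: "(x ^ (e + r * i)) ^ r = x ^ (e * r + i)" by (simp add: xrr power_add)
      have "(y ^ j) ^ r = (c - y) ^ j" by (metis yr power_mult mult.commute)
      then show ?thesis unfolding u(1) PB[OF u(2)] using 1
        by (simp add: power_mult_distrib power_mult[symmetric] mult_ac)
    qed
    have "x ^ H * poly G x ^ r = x ^ H * (\<Sum>u\<in>U. c1 u * poly (P u) x ^ r)"
      unfolding G_def poly_sum r_def frob_sum by (simp add: power_mult_distrib c2[unfolded r_def])
    also have "\<dots> = (\<Sum>u\<in>U. c1 u * (x ^ (H * r) * poly (B u) x))"
      unfolding sum_distrib_left by (intro sum.cong refl) (metis key mult.left_commute)
    also have "\<dots> = x ^ (H * r) * poly (\<Sum>u\<in>U. smult (c1 u) (B u)) x"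
      by (simp add: poly_sum sum_distrib_left mult_ac)
    also have "\<dots> = 0" by (simp add: E0)
    finally show ?thesis using x0 by simp
  qed
  then have "card (fibre (2 * k) c) \<le> card {x. poly G x = 0}"
    by (intro card_mono poly_roots_finite G0) auto
  also have "\<dots> \<le> degree G" by (rule card_poly_roots_bound[OF G0])
  also have "\<dots> \<le> D * r + 4 * r" by (rule degG)
  also have "D * r = p ^ (2 * k - 1)" using k by (simp add: D_def r_def power_add[symmetric] mult_2)
  finally show ?thesis by (simp add: r_def)
qed

definition K :: "nat \<Rightarrow> complex" where "K n = (\<Sum>x\<in>Fq n - {0}. psi (tr n (kf x)))"

text \<open>Upper bounds for the fibres suffice. All \<open>p\<close> fibres have at most
  \<open>W\<close> elements, their sizes add up to \<open>p ^ (2 * k) - 1\<close>, which is only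
  \<open>4 * p ^ (k + 1) + 1\<close> less than \<open>p * W\<close>, and a constant subtracted from
  every size is invisible to the character sum.\<close>

lemma K_even_bound:
  assumes "k > 0"
  shows "norm (K (2 * k)) \<le> 4 * real p ^ (k + 1) + 1"
proof -
  let ?n = "2 * k"
  define W where "W = real (p ^ (?n - 1) + 4 * p ^ k)"
  have fin: "finite (Fq ?n - {0})" using assms by auto
  have img: "(\<lambda>x. tr ?n (kf x)) ` (Fq ?n - {0}) \<subseteq> Fq 1" using tr_in kf_in by auto
  have "K ?n = (\<Sum>c\<in>Fq 1. \<Sum>x | x \<in> Fq ?n - {0} \<and> tr ?n (kf x) = c. psi (tr ?n (kf x)))"
    unfolding K_def using sum.group[OF fin _ img, of "\<lambda>x. psi (tr ?n (kf x))"] by simp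
  also have "\<dots> = (\<Sum>c\<in>Fq 1. of_nat (card (fibre ?n c)) * psi c)"
    by (intro sum.cong refl) (simp add: fibre_def)
  also have "\<dots> = (\<Sum>c\<in>Fq 1. (of_nat (card (fibre ?n c)) - of_real W) * psi c) + of_real W * (\<Sum>c\<in>Fq 1. psi c)"
    by (simp add: sum.distrib[symmetric] sum_distrib_left algebra_simps)
  also have "(\<Sum>c\<in>Fq 1. psi c) = 0" using sum_psi[of 1] by simp
  finally have "norm (K ?n) \<le> (\<Sum>c\<in>Fq 1. norm ((of_nat (card (fibre ?n c)) - of_real W) * psi c))"
    using norm_sum by simp
  also have "\<dots> = (\<Sum>c\<in>Fq 1. W - real (card (fibre ?n c)))"
  proof (intro sum.cong refl)
    fix c
    have "real (card (fibre ?n c)) \<le> W" unfolding W_def using stepanov[OF assms, of c] by (simp only: of_nat_le_iff)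
    moreover have "(of_nat (card (fibre ?n c)) - of_real W :: complex) = of_real (real (card (fibre ?n c)) - W)" by simp
    ultimately show "norm ((of_nat (card (fibre ?n c)) - of_real W) * psi c) = W - real (card (fibre ?n c))"
      by (simp only: norm_mult norm_psi norm_of_real) simp
  qed
  also have "\<dots> = real p * W - real (\<Sum>c\<in>Fq 1. card (fibre ?n c))"
    by (simp add: sum_subtractf card_Fq)
  also have "(\<Sum>c\<in>Fq 1. card (fibre ?n c)) = card (Fq ?n - {0})"
    using sum.group[OF fin _ img, of "\<lambda>x. 1::nat"] by (simp add: fibre_def)
  also have "card (Fq ?n - {0}) = p ^ ?n - 1" using assms by (simp add: card_Fq)
  also have "real p * W - real (p ^ ?n - 1) = 4 * real p ^ (k + 1) + 1"
  proof -
    have "p ^ ?n \<ge> 1" using p_ge_2 by simp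
    moreover have "real p * real p ^ (?n - 1) = real p ^ ?n" using assms by (simp add: power_Suc[symmetric] del: power_Suc)
    ultimately show ?thesis by (simp add: W_def of_nat_diff algebra_simps)
  qed
  finally show ?thesis .
qed

section \<open>Monic polynomials over the prime field and the L-function\<close>

definition fr :: "'a poly \<Rightarrow> 'a poly" where "fr f = map_poly (\<lambda>c. c ^ p) f"

lemma coeff_fr [simp]: "coeff (fr f) i = coeff f i ^ p"
  using p_ge_2 by (simp add: fr_def coeff_map_poly power_0_left)

lemma frob_sum1: "(\<Sum>i\<in>I. f i :: 'a) ^ p = (\<Sum>i\<in>I. f i ^ p)"
  using frob_sum[of f I 1] by simp

lemma fr_mult: "fr (f * g) = fr f * fr g"
  by (rule poly_eqI) (simp add: coeff_mult frob_sum1 power_mult_distrib)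

lemma fr_1 [simp]: "fr 1 = 1"
  using p_ge_2 by (intro poly_eqI) (simp add: power_0_left)

lemma fr_power: "fr (f ^ n) = fr f ^ n"
  by (induction n) (simp_all add: fr_mult)

lemma fr_linear [simp]: "fr [:- x, 1:] = [:- (x ^ p), 1:]"
proof (rule poly_eqI)
  fix n
  have "(- x) ^ p = - (x ^ p)" using frob_diff[of 0 x 1] p_ge_2 by (simp add: power_0_left)
  then show "coeff (fr [:- x, 1:]) n = coeff [:- (x ^ p), 1:] n"
    using p_ge_2 by (cases n rule: nat.exhaust; simp add: coeff_pCons power_0_left split: nat.split)
qed

lemma fr_prod: "fr (\<Prod>i\<in>I. f i) = (\<Prod>i\<in>I. fr (f i))"
  by (induction I rule: infinite_finite_induct) (simp_all add: fr_mult)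

lemma poly_fr: "poly (fr f) (x ^ p) = poly f x ^ p"
proof -
  have "poly (fr f) (x ^ p) = (\<Sum>i\<le>degree f. coeff (fr f) i * (x ^ p) ^ i)"
    unfolding poly_altdef
    by (intro sum.mono_neutral_left) (auto simp: fr_def coeff_eq_0 intro!: map_poly_degree_leq)
  also have "\<dots> = poly f x ^ p"
    by (simp add: poly_altdef frob_sum1 power_mult_distrib power_mult[symmetric] mult.commute)
  finally show ?thesis .
qed

text \<open>The last condition says that all coefficients lie in the prime field, the one before
  that \<open>f\<close> is prime to \<open>X\<close>. These polynomials take the place of the
  positive integers in the L-function.\<close>

definition M :: "nat \<Rightarrow> 'a poly set" where
  "M d = {f. degree f = d \<and> lead_coeff f = 1 \<and> coeff f 0 \<noteq> 0 \<and> fr f = f}"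

lemma M_coeff: "f \<in> M d \<Longrightarrow> coeff f i \<in> Fq 1"
  by (metis (mono_tags, lifting) M_def mem_Collect_eq coeff_fr Fq1_iff)

lemma finite_M [simp]: "finite (M d)"
proof (rule finite_subset)
  show "M d \<subseteq> Poly ` {xs. set xs \<subseteq> Fq 1 \<and> length xs \<le> d + 1}"
  proof
    fix f assume f: "f \<in> M d"
    have "set (coeffs f) \<subseteq> Fq 1" using M_coeff[OF f] by (auto simp: coeffs_def)
    moreover have "length (coeffs f) \<le> d + 1" using f by (auto simp: length_coeffs M_def coeffs_def)
    ultimately show "f \<in> Poly ` {xs. set xs \<subseteq> Fq 1 \<and> length xs \<le> d + 1}"
      by (intro image_eqI[of _ _ "coeffs f"]) auto
  qed
  show "finite (Poly ` {xs. set xs \<subseteq> Fq 1 \<and> length xs \<le> d + 1})"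
    by (intro finite_imageI finite_lists_length_le) simp
qed

text \<open>By Vieta the sum of the roots of a monic polynomial, while \<open>rinv\<close> is the
  sum of their reciprocals. Written with coefficients, both visibly lie in the prime field; both are
  additive under products, so \<open>chi\<close> is multiplicative.\<close>

definition rsum :: "'a poly \<Rightarrow> 'a" where "rsum f = - coeff (reflect_poly f) 1"
definition rinv :: "'a poly \<Rightarrow> 'a" where "rinv f = - coeff f 1 / coeff f 0"
definition chi :: "'a poly \<Rightarrow> complex" where "chi f = psi (a * rsum f + b * rinv f)"

lemma coeff_mult_1: "coeff (f * g) (Suc 0) = coeff f 0 * coeff g (Suc 0) + coeff f (Suc 0) * coeff (g :: 'a poly) 0"
  by (simp add: coeff_mult)

lemma rsum_mult: "lead_coeff f = 1 \<Longrightarrow> lead_coeff g = 1 \<Longrightarrow> rsum (f * g) = rsum f + rsum g"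
  by (simp add: rsum_def reflect_poly_mult coeff_mult_1)

lemma rinv_mult: "coeff f 0 \<noteq> 0 \<Longrightarrow> coeff g 0 \<noteq> 0 \<Longrightarrow> rinv (f * g) = rinv f + rinv g"
  by (simp add: rinv_def coeff_mult_1 coeff_mult_0 field_simps)

lemma rsum_in: "f \<in> M d \<Longrightarrow> rsum f \<in> Fq 1"
  unfolding rsum_def coeff_reflect_poly using M_coeff[of f d] by (auto intro: Fq_uminus)

lemma rinv_in: "f \<in> M d \<Longrightarrow> rinv f \<in> Fq 1"
  unfolding rinv_def using M_coeff[of f d] by (auto intro!: Fq_closed)

lemma chi_mult: "f \<in> M d \<Longrightarrow> g \<in> M e \<Longrightarrow> chi (f * g) = chi f * chi g"
  using rsum_in[of f d] rsum_in[of g e] rinv_in[of f d] rinv_in[of g e]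
  unfolding chi_def
  by (subst rsum_mult) (auto simp: rinv_mult M_def psi_add[symmetric] Fq_closed algebra_simps)

text \<open>For \<open>x\<close> in \<open>Fq j\<close> the characteristic polynomial of
  \<open>x\<close> over the prime field, a power of its minimal polynomial. It translates sums over
  field elements into sums over divisors of polynomials.\<close>

definition gx :: "nat \<Rightarrow> 'a \<Rightarrow> 'a poly" where "gx j x = (\<Prod>i<j. [:- (x ^ (p ^ i)), 1:])"

lemma gx_props:
  assumes "x \<noteq> 0"
  shows "degree (gx j x) = j" "lead_coeff (gx j x) = 1" "coeff (gx j x) 0 \<noteq> 0"
    "rsum (gx j x) = tr j x" "rinv (gx j x) = tr j (1 / x)"
proof (induction j)
  case 0
  { case 1 show ?case by (simp add: gx_def) }
  { case 2 show ?case by (simp add: gx_def) }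
  { case 3 show ?case by (simp add: gx_def) }
  { case 4 show ?case by (simp add: gx_def tr_def rsum_def) }
  { case 5 show ?case by (simp add: gx_def tr_def rinv_def) }
next
  case (Suc j)
  define l where "l = [:- (x ^ (p ^ j)), 1:]"
  have l: "degree l = 1" "lead_coeff l = 1" "coeff l 0 \<noteq> 0" "rsum l = x ^ (p ^ j)" "rinv l = (1 / x) ^ (p ^ j)"
    using assms by (auto simp: l_def rsum_def rinv_def coeff_reflect_poly power_divide)
  have g: "gx (Suc j) x = gx j x * l" by (simp add: gx_def l_def)
  have nz: "gx j x \<noteq> 0" "l \<noteq> 0" using Suc(2) l by auto
  { case 1 show ?case using Suc l nz by (simp add: g degree_mult_eq) }
  { case 2 show ?case using Suc l by (simp add: g lead_coeff_mult) }
  { case 3 show ?case using Suc l by (simp add: g coeff_mult_0) }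
  { case 4 show ?case using Suc l by (simp add: g rsum_mult tr_def) }
  { case 5 show ?case using Suc l by (simp add: g rinv_mult tr_def) }
qed

lemma fr_gx: assumes "x \<in> Fq j" shows "fr (gx j x) = gx j x"
proof -
  have "fr (gx j x) * [:- x, 1:] = (\<Prod>i<j. [:- (x ^ (p ^ Suc i)), 1:]) * [:- (x ^ (p ^ 0)), 1:]"
    unfolding gx_def fr_prod by (simp add: power_mult[symmetric] mult.commute)
  also have "\<dots> = (\<Prod>i<Suc j. [:- (x ^ (p ^ i)), 1:])"
    by (subst prod.lessThan_Suc_shift) (simp only: mult.commute)
  also have "\<dots> = gx j x * [:- (x ^ (p ^ j)), 1:]" by (simp only: gx_def prod.lessThan_Suc)
  also have "x ^ (p ^ j) = x" using assms by (simp add: Fq_def)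
  finally have "(fr (gx j x) - gx j x) * [:- x, 1:] = 0" by (simp only: left_diff_distrib diff_self)
  then show ?thesis by (metis eq_iff_diff_eq_0 mult_eq_0_iff pCons_eq_0_iff one_neq_zero)
qed

lemma gx_M: "x \<in> Fq j - {0} \<Longrightarrow> gx j x \<in> M j"
  using gx_props[of x j] fr_gx[of x j] by (simp add: M_def)

lemma tr_linear: "c ^ p = c \<Longrightarrow> tr j (c * x + y) = c * tr j x + tr j y"
  by (simp add: tr_def frob_add power_mult_distrib Fq_pow sum.distrib sum_distrib_left)

lemma chi_gx: "x \<in> Fq j - {0} \<Longrightarrow> chi (gx j x) = psi (tr j (kf x))"
  using gx_props[of x j] tr_linear[OF a(1), of j x "b / x"] tr_linear[OF b(1), of j "1/x" 0] p_ge_2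
  by (simp add: chi_def kf_def) (simp add: tr_def power_0_left)

lemma gx_dvd_M_iff:
  assumes x: "x \<in> Fq j - {0}" and "j \<le> d"
  shows "bij_betw (\<lambda>h. gx j x * h) (M (d - j)) {f \<in> M d. gx j x dvd f}"
proof (rule bij_betwI')
  note g = gx_M[OF x]
  have g0: "gx j x \<noteq> 0" using g by (auto simp: M_def)
  fix h h' show "(gx j x * h = gx j x * h') = (h = h')" using g0 by simp
next
  note g = gx_M[OF x]
  have g0: "gx j x \<noteq> 0" using g by (auto simp: M_def)
  fix h assume h: "h \<in> M (d - j)"
  then have "h \<noteq> 0" by (auto simp: M_def)
  then show "gx j x * h \<in> {f \<in> M d. gx j x dvd f}"
    using g h g0 assms(2) lead_coeff_mult[of "gx j x" h]
    by (auto simp: M_def degree_mult_eq coeff_mult_0 fr_mult)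
next
  note g = gx_M[OF x]
  have g0: "gx j x \<noteq> 0" using g by (auto simp: M_def)
  fix f assume "f \<in> {f \<in> M d. gx j x dvd f}"
  then obtain h where f: "f \<in> M d" "f = gx j x * h" by (auto elim: dvdE)
  have h0: "h \<noteq> 0" using f by (auto simp: M_def)
  have "gx j x * fr h = gx j x * h" using f g by (simp add: M_def fr_mult)
  then have "fr h = h" using g0 by simp
  moreover have "degree h = d - j" using f g g0 h0 by (auto simp: M_def degree_mult_eq)
  moreover have "lead_coeff h = 1" using f g g0 h0 by (auto simp: M_def lead_coeff_mult)
  moreover have "coeff h 0 \<noteq> 0" using f by (auto simp: M_def coeff_mult_0)
  ultimately show "\<exists>h\<in>M (d - j). f = gx j x * h" using f by (auto simp: M_def)
qed

text \<open>Frobenius maps the finite root set injectively into itself, so every orbit returns to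
  its start.\<close>

lemma M_root_period:
  assumes f: "f \<in> M d" and x: "poly f x = 0"
  shows "\<exists>m>0. x ^ (p ^ m) = x"
proof -
  have f0: "f \<noteq> 0" using f by (auto simp: M_def)
  have "poly f (x ^ (p ^ i)) = 0" for i
  proof (induction i)
    case (Suc i)
    have "poly f ((x ^ (p ^ i)) ^ p) = poly (fr f) ((x ^ (p ^ i)) ^ p)" using f by (simp add: M_def)
    also have "\<dots> = 0" using Suc p_ge_2 by (simp add: poly_fr power_0_left)
    finally show ?case by (simp add: power_mult[symmetric] mult.commute)
  qed (use x in simp)
  then have "range (\<lambda>i. x ^ (p ^ i)) \<subseteq> {y. poly f y = 0}" by auto
  then have "finite (range (\<lambda>i. x ^ (p ^ i)))" using poly_roots_finite[OF f0] finite_subset by blast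
  then have "\<not> inj (\<lambda>i. x ^ (p ^ i))" using finite_imageD[of "\<lambda>i. x ^ (p ^ i)" UNIV] by auto
  then obtain i j where "i < j" "x ^ (p ^ i) = x ^ (p ^ j)"
    by (metis (mono_tags, lifting) linorder_inj_onI' UNIV_I)
  moreover from this have "x ^ (p ^ j) = (x ^ (p ^ (j - i))) ^ (p ^ i)"
    by (simp add: power_mult[symmetric] power_add[symmetric])
  ultimately have "x = x ^ (p ^ (j - i))" by (metis frob_inj)
  then show ?thesis using \<open>i < j\<close> by (intro exI[of _ "j - i"]) auto
qed

text \<open>Let \<open>m\<close> be the period of \<open>x\<close> under Frobenius and
  \<open>e\<close> its multiplicity in \<open>f\<close>. The admissible \<open>j\<close> are exactly
  \<open>m\<close>, \<open>2 * m\<close>, up to \<open>e * m\<close>: \<open>gx (m * s) x\<close> is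
  the \<open>s\<close>-th power of the minimal polynomial of \<open>x\<close>, which divides
  \<open>f\<close> exactly \<open>e\<close> times.\<close>

lemma M_root_count:
  assumes f: "f \<in> M d" and x: "poly f x = 0"
  shows "card {j \<in> {1..d}. x \<in> Fq j \<and> gx j x dvd f} = order x f"
proof -
  have f0: "f \<noteq> 0" using f by (auto simp: M_def)
  have x0: "x \<noteq> 0" using f x by (auto simp: M_def poly_0_coeff_0)
  define m where "m = (LEAST m. m > 0 \<and> x ^ (p ^ m) = x)"
  have m: "m > 0" "x ^ (p ^ m) = x"
    using LeastI_ex[OF M_root_period[OF f x]] by (auto simp: m_def)
  have m_min: "m \<le> i" if "i > 0" "x ^ (p ^ i) = x" for i
    unfolding m_def using that by (intro Least_le) auto
  define z where "z = (\<lambda>i. x ^ (p ^ i))"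
  have z_add: "z (i + j) = z i ^ (p ^ j)" for i j by (simp add: z_def power_mult[symmetric] power_add)
  have z_period: "z (m * s + i) = z i" for s i
  proof -
    have "z (m * s) = x" by (induction s) (simp_all add: z_def m power_add power_mult mult.commute[of "p ^ m"])
    then show ?thesis by (simp add: z_add) (simp add: z_def)
  qed
  have inj: "inj_on z {..<m}"
  proof (rule linorder_inj_onI)
    fix i j assume ij: "i < j" "i \<in> {..<m}" "j \<in> {..<m}"
    have "z (j - i + i) = z (j - i) ^ (p ^ i)" by (rule z_add)
    then have "z j = z (j - i) ^ (p ^ i)" using ij by simp
    then have "z i = z j \<longleftrightarrow> x = z (j - i)" by (auto simp: z_def frob_inj)
    then show "z i \<noteq> z j" using m_min[of "j - i"] ij by (auto simp: z_def)
  qed auto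
  have Fq_iff: "x \<in> Fq j \<longleftrightarrow> m dvd j" for j
  proof -
    have "z j = z (j mod m)" using z_period[of "j div m" "j mod m"] by simp
    then have "x \<in> Fq j \<longleftrightarrow> z (j mod m) = z 0" by (auto simp: Fq_def z_def)
    also have "\<dots> \<longleftrightarrow> j mod m = 0" using inj_onD[OF inj, of "j mod m" 0] m by auto
    finally show ?thesis by auto
  qed
  have gx_pow: "gx (m * s) x = gx m x ^ s" for s
  proof (induction s)
    case (Suc s)
    have "gx (m * s + n) x = gx (m * s) x * gx n x" for n
      using z_period by (induction n) (simp_all add: gx_def z_def mult.assoc del: mult_pCons_left mult_pCons_right)
    from this[of m] Suc show ?case by (simp add: add.commute mult.commute)
  qed (simp add: gx_def)
  define e where "e = order x f"
  have ord: "e \<le> order (z i) f" for i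
  proof (induction i)
    case (Suc i)
    have "[:- z i, 1:] ^ e dvd f" using Suc by (simp add: order_divides)
    then obtain h where "f = [:- z i, 1:] ^ e * h" by (elim dvdE)
    then have "fr f = [:- z (Suc i), 1:] ^ e * fr h"
      using z_add[of i 1] by (simp add: fr_mult fr_power del: mult_pCons_left)
    then have "[:- z (Suc i), 1:] ^ e dvd fr f" by simp
    then have "[:- z (Suc i), 1:] ^ e dvd f" using f by (simp add: M_def)
    then show ?case using f0 by (simp add: order_divides)
  qed (simp add: z_def e_def)
  have dvd_iff: "gx m x ^ s dvd f \<longleftrightarrow> s \<le> e" for s
  proof
    assume "gx m x ^ s dvd f"
    moreover have "[:- x, 1:] dvd gx m x" unfolding gx_def
      using m by (intro dvd_trans[OF _ dvd_prodI[of _ 0]]) auto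
    ultimately have "[:- x, 1:] ^ s dvd f" using dvd_power_same dvd_trans by blast
    then show "s \<le> e" using f0 by (simp add: order_divides e_def)
  next
    assume s: "s \<le> e"
    define A where "A = proots f"
    obtain A' where A': "f = smult (lead_coeff f) (\<Prod>x\<in>#A'. [:-x, 1:])"
      using alg_closed_imp_factorization[OF f0] by blast
    have "lead_coeff f = 1" using f by (auto simp: M_def)
    then have fA': "f = (\<Prod>x\<in>#A'. [:-x, 1:])" using A' by (metis smult_1_left)
    have "proots (\<Prod>x\<in>#A'. [:-x, 1:]) = A'"
    proof (induction A')
      case (add x A')
      have "0 \<notin># image_mset (\<lambda>x. [:-x, 1:]) A'" by auto
      then have "(\<Prod>x\<in>#A'. [:-x, 1:]) \<noteq> 0" by (simp only: prod_mset_zero_iff not_False_eq_True)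
      then show ?case using add by (simp add: proots_mult del: mult_pCons_left)
    qed auto
    then have A: "A' = A" using fA' by (simp add: A_def)
    \<comment> \<open>The \<open>m\<close> conjugates \<open>z i\<close> are distinct roots of
      multiplicity at least \<open>s\<close>, so \<open>s\<close> copies of each fit into the
      multiset of roots.\<close>
    define B where "B = (\<Sum>i<m. replicate_mset s (z i))"
    have "B \<subseteq># A"
    proof (rule mset_subset_eqI)
      fix y
      have "count B y = (\<Sum>i<m. if z i = y then s else 0)" unfolding B_def count_sum by (intro sum.cong) auto
      also have "\<dots> \<le> order y f"
      proof (cases "\<exists>i<m. z i = y")
        case True
        then obtain i where i: "i < m" "z i = y" by auto
        have "(\<Sum>i<m. if z i = y then s else 0) = (\<Sum>j<m. if j = i then s else 0)"
        proof (intro sum.cong refl)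
          fix j assume "j \<in> {..<m}"
          then have "z j = y \<longleftrightarrow> j = i" using inj_on_eq_iff[OF inj, of j i] i by (metis lessThan_iff)
          then show "(if z j = y then s else 0) = (if j = i then s else 0)" by (simp only:)
        qed
        also have "\<dots> = s" using i(1) by simp
        also have "s \<le> order y f" using ord[of i] s unfolding i(2) by (rule order.trans[rotated])
        finally show ?thesis .
      next
        case False
        then have "(\<Sum>i<m. if z i = y then s else 0) = 0" by (intro sum.neutral) auto
        then show ?thesis by simp
      qed
      also have "order y f = count A y" unfolding A_def using f0 by simp
      finally show "count B y \<le> count A y" .
    qed
    then have "A = B + (A - B)" by simp
    then have "f = (\<Prod>x\<in>#B. [:-x, 1:]) * (\<Prod>x\<in>#A - B. [:-x, 1:])"
      using fA' A by (metis image_mset_union prod_mset.union)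
    moreover have "(\<Prod>x\<in>#B. [:-x, 1:]) = gx m x ^ s"
    proof -
      have "(\<Prod>x\<in>#(\<Sum>i<n. replicate_mset s (z i)). [:-x, 1:]) = (\<Prod>i<n. [:- z i, 1:] ^ s)" for n
        by (induction n) simp_all
      then show ?thesis by (simp add: B_def gx_def z_def prod_power_distrib)
    qed
    ultimately show "gx m x ^ s dvd f" by (metis dvd_triv_left)
  qed
  have "{j \<in> {1..d}. x \<in> Fq j \<and> gx j x dvd f} = (\<lambda>s. m * s) ` {1..e}"
  proof (intro Set.set_eqI iffI)
    fix j assume "j \<in> {j \<in> {1..d}. x \<in> Fq j \<and> gx j x dvd f}"
    then obtain s where "j = m * s" "1 \<le> j" "gx m x ^ s dvd f" by (auto simp: Fq_iff gx_pow)
    then show "j \<in> (\<lambda>s. m * s) ` {1..e}" by (intro image_eqI[of _ _ s]) (auto simp: dvd_iff Suc_le_eq)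
  next
    fix j assume "j \<in> (\<lambda>s. m * s) ` {1..e}"
    then obtain s where s: "j = m * s" "s \<in> {1..e}" by (rule imageE)
    have dvd: "gx j x dvd f" using s(2) unfolding s(1) gx_pow dvd_iff by simp
    have "j = degree (gx j x)" using gx_props[OF x0] by simp
    also have "\<dots> \<le> d" using dvd_imp_degree_le[OF dvd f0] f by (simp add: M_def)
    finally show "j \<in> {j \<in> {1..d}. x \<in> Fq j \<and> gx j x dvd f}"
      using s dvd m by (auto simp: Fq_iff Suc_le_eq)
  qed
  then show ?thesis using m by (simp add: card_image inj_on_def e_def)
qed

text \<open>The analogue of writing \<open>log n\<close> as a sum of the von Mangoldt function over
  the divisors of \<open>n\<close>: the \<open>s\<close>-th power of an irreducible polynomial is
  represented by each of its roots \<open>x\<close>, hence as often as its degree.\<close>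

lemma M_degree_count:
  assumes f: "f \<in> M d"
  shows "(\<Sum>j=1..d. card {x \<in> Fq j - {0}. gx j x dvd f}) = d"
proof -
  have f0: "f \<noteq> 0" using f by (auto simp: M_def)
  define R where "R = {x. poly f x = 0}"
  have finR: "finite R" unfolding R_def by (rule poly_roots_finite[OF f0])
  have eq: "{x \<in> Fq j - {0}. gx j x dvd f} = {x \<in> R. x \<in> Fq j \<and> gx j x dvd f}" if "j \<in> {1..d}" for j
  proof -
    have "poly f x = 0" if "gx j x dvd f" for x
    proof -
      have "[:- x, 1:] dvd gx j x" unfolding gx_def
        using \<open>j \<in> {1..d}\<close> by (intro dvd_trans[OF _ dvd_prodI[of _ 0]]) auto
      then show ?thesis using that dvd_trans poly_eq_0_iff_dvd by blast
    qed
    moreover have "poly f 0 \<noteq> 0" using f by (simp add: M_def poly_0_coeff_0)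
    ultimately show ?thesis by (auto simp: R_def)
  qed
  have "(\<Sum>j=1..d. card {x \<in> Fq j - {0}. gx j x dvd f}) =
      (\<Sum>j=1..d. \<Sum>x\<in>R. if x \<in> Fq j \<and> gx j x dvd f then 1 else 0)"
    using finR by (intro sum.cong refl) (subst eq, auto simp: sum.If_cases Int_def)
  also have "\<dots> = (\<Sum>x\<in>R. \<Sum>j=1..d. if x \<in> Fq j \<and> gx j x dvd f then 1 else 0)" by (rule sum.swap)
  also have "\<dots> = (\<Sum>x\<in>R. order x f)"
    using M_root_count[OF f] by (intro sum.cong refl) (simp add: sum.If_cases Int_def R_def)
  also have "\<dots> = d" using sum_order_alg_closed[OF f0] f by (simp add: R_def M_def)
  finally show ?thesis .
qed

definition cc :: "nat \<Rightarrow> complex" where "cc d = (\<Sum>f\<in>M d. chi f)"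

text \<open>Newton's identity between the power sums \<open>K\<close> and the coefficients
  \<open>cc\<close> of the L-function. It is the logarithmic derivative of the Euler product,
  obtained by counting divisors instead of factoring into irreducibles.\<close>

lemma newton: "of_nat d * cc d = (\<Sum>j=1..d. K j * cc (d - j))"
proof -
  have "of_nat d * cc d = (\<Sum>f\<in>M d. of_nat (\<Sum>j=1..d. card {x \<in> Fq j - {0}. gx j x dvd f}) * chi f)"
    by (simp only: M_degree_count cc_def sum_distrib_left cong: sum.cong)
  also have "\<dots> = (\<Sum>f\<in>M d. \<Sum>j=1..d. \<Sum>x\<in>Fq j - {0}. if gx j x dvd f then chi f else 0)"
    by (simp add: sum_distrib_right sum.If_cases Int_def)
  also have "\<dots> = (\<Sum>j=1..d. \<Sum>f\<in>M d. \<Sum>x\<in>Fq j - {0}. if gx j x dvd f then chi f else 0)"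
    by (rule sum.swap)
  also have "\<dots> = (\<Sum>j=1..d. \<Sum>x\<in>Fq j - {0}. \<Sum>f\<in>M d. if gx j x dvd f then chi f else 0)"
    by (intro sum.cong refl sum.swap)
  also have "\<dots> = (\<Sum>j=1..d. \<Sum>x\<in>Fq j - {0}. psi (tr j (kf x)) * cc (d - j))"
  proof (intro sum.cong refl)
    fix j x assume j: "j \<in> {1..d}" and x: "x \<in> Fq j - {0}"
    have "(\<Sum>f\<in>M d. if gx j x dvd f then chi f else 0) = (\<Sum>f\<in>{f \<in> M d. gx j x dvd f}. chi f)"
      by (simp add: sum.If_cases Int_def)
    also have "\<dots> = (\<Sum>h\<in>M (d - j). chi (gx j x * h))"
      by (rule sum.reindex_bij_betw[symmetric]) (use gx_dvd_M_iff[OF x] j in auto)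
    also have "\<dots> = (\<Sum>h\<in>M (d - j). psi (tr j (kf x)) * chi h)"
      using chi_mult[OF gx_M[OF x]] chi_gx[OF x] by (intro sum.cong) auto
    finally show "(\<Sum>f\<in>M d. if gx j x dvd f then chi f else 0) = psi (tr j (kf x)) * cc (d - j)"
      by (simp add: cc_def sum_distrib_left)
  qed
  finally show ?thesis by (simp add: K_def sum_distrib_right)
qed

lemma cc_0: "cc 0 = 1"
proof -
  have "M 0 = {1}"
  proof (intro Set.set_eqI iffI)
    fix f assume "f \<in> M 0"
    then have "degree f = 0" "lead_coeff f = 1" by (auto simp: M_def)
    then show "f \<in> {1}" by (metis degree_eq_zeroE lead_coeff_pCons(2) one_pCons singletonI)
  qed (simp add: M_def)
  then show ?thesis by (simp add: cc_def chi_def rsum_def rinv_def)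
qed

lemma M_mem_iff: "f \<in> M d \<longleftrightarrow> degree f = d \<and> coeff f d = 1 \<and> coeff f 0 \<noteq> 0 \<and> (\<forall>i. coeff f i \<in> Fq 1)"
  unfolding M_def poly_eq_iff Fq1_iff by auto

text \<open>For \<open>[:u, t, 1:]\<close> the argument of \<open>psi\<close> is linear in
  \<open>t\<close> with slope \<open>- (a + b / u)\<close>, so the sum over \<open>t\<close>
  vanishes unless \<open>u = - b / a\<close>.\<close>

lemma cc_2: "cc 2 = of_nat p"
proof -
  have M2: "M 2 = (\<lambda>(u, t). [:u, t, 1:]) ` ((Fq 1 - {0}) \<times> Fq 1)"
  proof (intro Set.set_eqI iffI)
    fix f assume f: "f \<in> M 2"
    then have "f = [:coeff f 0, coeff f 1, 1:]"
      by (intro poly_eqI) (auto simp: M_mem_iff coeff_pCons numeral_2_eq_2 coeff_eq_0 split: nat.split)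
    moreover have "coeff f 0 \<in> Fq 1 - {0}" "coeff f 1 \<in> Fq 1" using f by (auto simp: M_mem_iff)
    ultimately show "f \<in> (\<lambda>(u, t). [:u, t, 1:]) ` ((Fq 1 - {0}) \<times> Fq 1)"
      by (intro image_eqI[of _ _ "(coeff f 0, coeff f 1)"]) auto
  next
    fix f assume "f \<in> (\<lambda>(u, t). [:u, t, 1:]) ` ((Fq 1 - {0}) \<times> Fq 1)"
    then show "f \<in> M 2" by (auto simp: M_mem_iff coeff_pCons numeral_2_eq_2 split: nat.split)
  qed
  have "cc 2 = (\<Sum>(u, t)\<in>(Fq 1 - {0}) \<times> Fq 1. chi [:u, t, 1:])"
    unfolding cc_def M2 by (subst sum.reindex) (auto simp: inj_on_def case_prod_unfold)
  also have "\<dots> = (\<Sum>u\<in>Fq 1 - {0}. \<Sum>t\<in>Fq 1. chi [:u, t, 1:])" by (rule sum.cartesian_product[symmetric])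
  also have "\<dots> = (\<Sum>u\<in>Fq 1 - {0}. if u = - b / a then of_nat p else 0)"
  proof (intro sum.cong refl)
    fix u assume u: "u \<in> Fq 1 - {0}"
    have "chi [:u, t, 1:] = psi (- (a + b / u) * t)" for t
      using u by (simp add: chi_def rsum_def rinv_def coeff_reflect_poly algebra_simps)
    moreover have "a + b / u = 0 \<longleftrightarrow> u = - b / a"
      using u a b by (auto simp: field_simps add_eq_0_iff)
    moreover have "- (a + b / u) \<in> Fq 1" using u by (auto intro!: Fq_closed)
    ultimately show "(\<Sum>t\<in>Fq 1. chi [:u, t, 1:]) = (if u = - b / a then of_nat p else 0)"
      using sum_psi[of "- (a + b / u)"] by (cases "a + b / u = 0") (simp_all add: card_Fq del: minus_add_distrib)
  qed
  also have "\<dots> = of_nat p" using a b by (auto simp: intro!: Fq_closed)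
  finally show ?thesis .
qed

text \<open>Adding \<open>1 / a\<close> to the coefficient of \<open>X ^ (d - 1)\<close> permutes
  \<open>M d\<close> and multiplies \<open>chi\<close> by \<open>psi (- 1)\<close>, which is not 1.
  From \<open>d = 3\<close> on this coefficient is none of the two lowest, so \<open>rinv\<close>
  does not change.\<close>

lemma cc_ge_3: assumes "d \<ge> 3" shows "cc d = 0"
proof -
  define s where "s = monom (1 / a) (d - 1)"
  have s: "coeff s i \<in> Fq 1" "i \<noteq> d - 1 \<Longrightarrow> coeff s i = 0" for i
    by (auto simp: s_def intro!: Fq_closed)
  have degs: "degree s < d" using assms by (auto simp: s_def intro: le_less_trans[OF degree_monom_le])
  have shift: "f + s \<in> M d" "f - s \<in> M d" if "f \<in> M d" for f
    using that s degs assms degree_add_eq_left[of s f] degree_add_eq_left[of "- s" f]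
    by (auto simp: M_mem_iff intro!: Fq_closed)
  have "cc d = (\<Sum>f\<in>M d. chi (f + s))"
    unfolding cc_def by (rule sum.reindex_bij_witness[of _ "\<lambda>f. f + s" "\<lambda>f. f - s"]) (use shift in auto)
  also have "\<dots> = (\<Sum>f\<in>M d. psi (- 1) * chi f)"
  proof (intro sum.cong refl)
    fix f assume f: "f \<in> M d"
    have "rsum (f + s) = rsum f - 1 / a"
      using f shift(1)[OF f] assms by (simp add: rsum_def coeff_reflect_poly M_mem_iff s_def)
    moreover have "rinv (f + s) = rinv f" using assms s(2)[of 0] s(2)[of 1] by (simp add: rinv_def)
    ultimately have "a * rsum (f + s) + b * rinv (f + s) = - 1 + (a * rsum f + b * rinv f)"
      using a by (simp add: right_diff_distrib)
    then have "chi (f + s) = psi (- 1 + (a * rsum f + b * rinv f))" by (simp only: chi_def)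
    also have "\<dots> = psi (- 1) * chi f" unfolding chi_def
      using rsum_in[OF f] rinv_in[OF f] by (intro psi_add) (auto intro!: Fq_closed)
    finally show "chi (f + s) = psi (- 1) * chi f" .
  qed
  also have "\<dots> = psi (- 1) * cc d" by (simp add: cc_def sum_distrib_left)
  finally have "cc d = psi (- 1) * cc d" .
  moreover have "psi (- 1) \<noteq> 1"
    using psi_add[of 1 "- 1"] psi_1 by (auto simp: Fq_uminus)
  ultimately show ?thesis by simp
qed

text \<open>The L-function is \<open>1 + K 1 * T + p * T ^ 2\<close>, so \<open>K n\<close> is minus
  the sum of the \<open>n\<close>-th powers of its reciprocal roots, whose product is
  \<open>p\<close>. Were one of them larger than \<open>sqrt p\<close> in modulus, the other would
  be smaller, and the even power sums would outgrow \<open>K_even_bound\<close>.\<close>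

theorem K_1_bound: "norm (K 1) \<le> 2 * sqrt (real p)"
proof -
  define S where "S = K 1"
  have cc1: "cc 1 = S" using newton[of 1] cc_0 by (simp add: S_def)
  have K2: "K 2 = 2 * of_nat p - S * S"
    using newton[of 2] cc_0 cc_2 cc1 by (simp add: S_def numeral_2_eq_2 algebra_simps)
  have Krec: "K (n + 3) = - S * K (n + 2) - of_nat p * K (n + 1)" for n
  proof -
    have "(\<Sum>j=1..n + 3. K j * cc (n + 3 - j)) = (\<Sum>j\<in>{n + 1, n + 2, n + 3}. K j * cc (n + 3 - j))"
      by (rule sum.mono_neutral_right) (auto intro!: cc_ge_3)
    also have "\<dots> = K (n + 1) * cc 2 + K (n + 2) * cc 1 + K (n + 3) * cc 0" by (simp add: numeral_2_eq_2)
    finally have "K (n + 1) * cc 2 + K (n + 2) * cc 1 + K (n + 3) * cc 0 = 0"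
      using newton[of "n + 3"] cc_ge_3[of "n + 3"] by simp
    then have h: "K (n + 1) * of_nat p + K (n + 2) * S + K (n + 3) = 0" unfolding cc_0 cc_2 cc1 by simp
    have "K (n + 3) = (K (n + 1) * of_nat p + K (n + 2) * S + K (n + 3)) - K (n + 1) * of_nat p - K (n + 2) * S" by simp
    also have "\<dots> = - S * K (n + 2) - of_nat p * K (n + 1)" unfolding h by simp
    finally show ?thesis .
  qed
  define \<alpha> where "\<alpha> = (- S + csqrt (S\<^sup>2 - 4 * of_nat p)) / 2"
  define \<beta> where "\<beta> = (- S - csqrt (S\<^sup>2 - 4 * of_nat p)) / 2"
  have sum: "\<alpha> + \<beta> = - S" by (simp add: \<alpha>_def \<beta>_def field_simps)
  have "\<alpha> * \<beta> = (S\<^sup>2 - csqrt (S\<^sup>2 - 4 * of_nat p) ^ 2) / 4"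
    by (simp add: \<alpha>_def \<beta>_def power2_eq_square field_simps)
  then have prd: "\<alpha> * \<beta> = of_nat p" by simp
  have K: "K (Suc n) = - (\<alpha> ^ Suc n + \<beta> ^ Suc n)" for n
  proof (induction n rule: less_induct)
    case (less n)
    consider "n = 0" | "n = 1" | m where "n = m + 2" by (metis One_nat_def Suc_eq_plus1 add_2_eq_Suc' not0_implies_Suc)
    then show ?case
    proof cases
      case 1 then show ?thesis using sum by (simp add: S_def)
    next
      case 2
      have "K 2 = - (\<alpha> ^ 2 + \<beta> ^ 2)"
      proof -
        have "S * S = (\<alpha> + \<beta>) * (\<alpha> + \<beta>)" unfolding sum by simp
        then show ?thesis unfolding K2 prd[symmetric] by (simp add: power2_eq_square algebra_simps)
      qed
      then show ?thesis using 2 by (simp add: numeral_2_eq_2)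
    next
      case 3
      have "K (m + 3) = (\<alpha> + \<beta>) * K (m + 2) - \<alpha> * \<beta> * K (m + 1)"
        unfolding Krec prd sum by simp
      also have "\<dots> = - (\<alpha> ^ (m + 3) + \<beta> ^ (m + 3))"
      proof -
        have "K (m + 2) = - (\<alpha> ^ (m + 2) + \<beta> ^ (m + 2))" "K (m + 1) = - (\<alpha> ^ (m + 1) + \<beta> ^ (m + 1))"
          using less[of "m + 1"] less[of m] 3 by simp_all
        then show ?thesis by (simp only:) (simp add: algebra_simps eval_nat_numeral)
      qed
      finally show ?thesis using 3 by (simp add: eval_nat_numeral)
    qed
  qed
  have main: "norm x \<le> sqrt (real p)"
    if xy: "x * y = of_nat p" and Kxy: "\<And>k. k > 0 \<Longrightarrow> K (2 * k) = - (x ^ (2 * k) + y ^ (2 * k))" for x y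
  proof (rule ccontr)
    assume "\<not> ?thesis"
    then have nx: "norm x > sqrt (real p)" by simp
    have p0: "real p > 0" using p_ge_2 by simp
    define q where "q = norm x ^ 2 / real p"
    have "sqrt (real p) ^ 2 < norm x ^ 2" using nx by (intro power_strict_mono) auto
    then have q: "q > 1" using p0 by (simp add: q_def)
    have "norm x * norm y = real p" using xy by (metis norm_mult norm_of_nat)
    then have "norm y \<le> sqrt (real p)"
      using nx p0 mult_strict_mono[of "sqrt (real p)" "norm x" "sqrt (real p)" "norm y"]
      by (metis less_irrefl less_imp_le norm_ge_zero not_le order.strict_trans1 real_sqrt_ge_zero real_sqrt_mult_self abs_of_pos)
    then have ny: "norm y ^ 2 \<le> real p" using p0 by (metis norm_ge_zero power_mono real_sqrt_pow2 less_imp_le)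
    have "q ^ k \<le> 4 * real p + 2" if k: "k > 0" for k
    proof -
      have "norm x ^ (2 * k) = norm (- K (2 * k) - y ^ (2 * k))" by (simp add: Kxy[OF k] norm_power)
      also have "\<dots> \<le> norm (K (2 * k)) + norm y ^ (2 * k)"
        by (metis norm_minus_cancel norm_power norm_triangle_ineq4)
      also have "\<dots> \<le> (4 * real p ^ (k + 1) + 1) + real p ^ k"
        using K_even_bound[OF k] power_mono[OF ny, of k] by (simp add: power_mult)
      also have "\<dots> \<le> (4 * real p + 2) * real p ^ k"
        using p_ge_2 by (simp add: algebra_simps one_le_power)
      finally have "(norm x ^ 2) ^ k \<le> (4 * real p + 2) * real p ^ k" by (simp add: power_mult)
      then show ?thesis using p0 by (simp add: q_def power_divide divide_le_eq)
    qed
    moreover obtain k where "q ^ k > 4 * real p + 2" using real_arch_pow[OF q] by blast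
    moreover have "q ^ k \<le> q ^ Suc k" using q by (intro power_increasing) auto
    ultimately show False by (meson zero_less_Suc not_le order_trans less_le_trans)
  qed
  have K': "K (2 * k) = - (\<alpha> ^ (2 * k) + \<beta> ^ (2 * k))" if "k > 0" for k
    using K[of "2 * k - 1"] that by simp
  have "norm \<alpha> \<le> sqrt (real p)" using main[OF prd] K' by blast
  moreover have "norm \<beta> \<le> sqrt (real p)"
    using main[of \<beta> \<alpha>] prd K' by (simp add: mult.commute add.commute)
  moreover have "norm (K 1) \<le> norm \<alpha> + norm \<beta>"
    using norm_triangle_ineq[of \<alpha> \<beta>] sum by (simp add: S_def)
  ultimately show ?thesis by simp
qed

end

section \<open>Kloosterman sums modulo an integer\<close>

definition inverse_pairs :: "nat \<Rightarrow> (nat \<times> nat) set" where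
  "inverse_pairs L = {(x, y). x < L \<and> y < L \<and> [x * y = 1] (mod L)}"

text \<open>Summing over pairs of inverse residues avoids an inverse function and makes the symmetry
  between the two frequencies evident.\<close>

definition kloosterman :: "int \<Rightarrow> int \<Rightarrow> nat \<Rightarrow> complex" where
  "kloosterman m n L =
     (\<Sum>(x, y)\<in>inverse_pairs L. cis (2 * pi * (of_int (m * int x + n * int y) / real L)))"

lemma cis_cong:
  assumes "[i = j] (mod int L)"
  shows "cis (2 * pi * (of_int i / real L)) = cis (2 * pi * (of_int j / real L))"
proof (cases "L = 0")
  case False
  from cong_sym[OF assms] obtain k where k: "i = j + int L * k"
    by (auto simp: cong_iff_lin)
  have "2 * pi * (of_int i / real L) = 2 * pi * (of_int j / real L) + 2 * pi * of_int k"
    using False unfolding k by (simp add: add_divide_distrib ring_distribs)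
  then have "cis (2 * pi * (of_int i / real L)) = cis (2 * pi * (of_int j / real L)) * cis (2 * pi * of_int k)"
    by (simp only: cis_mult)
  then show ?thesis by (simp add: cis_multiple_2pi)
qed simp

context kloosterman_field
begin

lemma psi_of_int: "psi (of_int i) = cis (2 * pi * (of_int i / real p))"
proof -
  have pp: "int p > 0" using p_ge_2 by simp
  have "(of_int i :: 'a) = of_int (i mod int p)"
  proof -
    have "(of_int i :: 'a) = of_int (int p * (i div int p) + i mod int p)" by simp
    also have "\<dots> = of_nat p * of_int (i div int p) + of_int (i mod int p)" by (simp only: of_int_add of_int_mult of_int_of_nat_eq)
    finally show ?thesis using char of_nat_CHAR[where 'a='a] by simp
  qed
  also have "\<dots> = of_nat (nat (i mod int p))" using pp by (metis of_int_of_nat_eq pos_mod_sign int_nat_eq)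
  finally have "psi (of_int i) = cis (2 * pi * (of_int (i mod int p) / real p))"
    using pp by (simp only: psi_of_nat) (simp add: of_nat_nat)
  also have "\<dots> = cis (2 * pi * (of_int i / real p))" by (rule cis_cong) (simp add: cong_def)
  finally show ?thesis .
qed

lemma of_nat_eq_iff: "(of_nat i :: 'a) = of_nat j \<longleftrightarrow> [i = j] (mod p)"
  using char by (metis of_nat_eq_iff_cong_CHAR)

lemma K_1_kloosterman:
  assumes "a = of_int m" "b = of_int n"
  shows "K 1 = kloosterman m n p"
proof -
  have inv: "(of_nat y :: 'a) = 1 / of_nat x" "(of_nat x :: 'a) \<noteq> 0" if "[x * y = 1] (mod p)" for x y
  proof -
    have "(of_nat (x * y) :: 'a) = of_nat 1" using that by (simp only: of_nat_eq_iff)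
    then have *: "(of_nat x :: 'a) * of_nat y = 1" by simp
    then show "(of_nat x :: 'a) \<noteq> 0" by auto
    with * show "(of_nat y :: 'a) = 1 / of_nat x" by (simp add: field_simps)
  qed
  have bij: "bij_betw (\<lambda>(x, y). of_nat x) (inverse_pairs p) (Fq 1 - {0})"
  proof (rule bij_betwI')
    fix u v assume uv: "u \<in> inverse_pairs p" "v \<in> inverse_pairs p"
    obtain x y x' y' where u: "u = (x, y)" and v: "v = (x', y')" by fastforce
    show "((case u of (x, y) \<Rightarrow> of_nat x) = (case v of (x, y) \<Rightarrow> (of_nat x :: 'a))) = (u = v)"
    proof
      assume "(case u of (x, y) \<Rightarrow> of_nat x) = (case v of (x, y) \<Rightarrow> (of_nat x :: 'a))"
      then have eq: "(of_nat x :: 'a) = of_nat x'" using u v by simp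
      then have "(of_nat y :: 'a) = of_nat y'" using uv u v inv(1)[of x y] inv(1)[of x' y'] by (simp add: inverse_pairs_def)
      with eq uv u v show "u = v" using inj_onD[OF of_nat_inj] by (auto simp: inverse_pairs_def)
    qed simp
  next
    fix u assume "u \<in> inverse_pairs p"
    then show "(case u of (x, y) \<Rightarrow> of_nat x) \<in> Fq 1 - {0}"
      using inv(2) of_nat_Fq[of _ 1] by (auto simp: inverse_pairs_def simp del: One_nat_def)
  next
    fix z assume z: "z \<in> Fq 1 - {0}"
    then obtain x where x: "z = of_nat x" "x < p" unfolding Fq1_eq by auto
    have "1 / z \<in> Fq 1" using z by (auto intro!: Fq_closed)
    then obtain y where y: "1 / z = of_nat y" "y < p" unfolding Fq1_eq by auto
    have "z * (1 / z) = 1" using z by simp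
    then have "z * of_nat y = 1" unfolding y(1) .
    then have "(of_nat (x * y) :: 'a) = of_nat 1" unfolding x(1) by simp
    then have "[x * y = 1] (mod p)" by (simp only: of_nat_eq_iff)
    then have "(x, y) \<in> inverse_pairs p" using x(2) y(2) by (simp add: inverse_pairs_def)
    then show "\<exists>u\<in>inverse_pairs p. z = (case u of (x, y) \<Rightarrow> of_nat x)" using x(1) by (intro bexI[of _ "(x, y)"]) simp_all
  qed
  have eq: "K 1 = (\<Sum>u\<in>inverse_pairs p. psi (tr 1 (kf (case u of (x, y) \<Rightarrow> of_nat x))))"
    unfolding K_def by (rule sum.reindex_bij_betw[OF bij, symmetric])
  show ?thesis unfolding eq kloosterman_def
  proof (intro sum.cong refl)
    fix u assume "u \<in> inverse_pairs p"
    then obtain x y where u: "u = (x, y)" "[x * y = 1] (mod p)" by (auto simp: inverse_pairs_def)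
    have "tr 1 (kf (of_nat x)) = of_int (m * int x + n * int y)"
      unfolding tr_def kf_def using inv[OF u(2)] by (simp add: assms)
    then show "psi (tr 1 (kf (case u of (x, y) \<Rightarrow> of_nat x))) =
        (case u of (x, y) \<Rightarrow> cis (2 * pi * (of_int (m * int x + n * int y) / real p)))"
      unfolding u(1) prod.case psi_of_int[symmetric] by simp
  qed
qed

end

definition weil_at :: "nat \<Rightarrow> bool" where
  "weil_at p \<longleftrightarrow> (\<forall>m n. \<not> int p dvd m \<longrightarrow> \<not> int p dvd n \<longrightarrow> norm (kloosterman m n p) \<le> 2 * sqrt (real p))"

text \<open>
  A type with \<open>p\<close> elements cannot depend on a variable \<open>p\<close>.  Choosing \<open>p\<close> as a prime that
  violates the bound, if there is one, makes it a closed term, so that the field exists as a type.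
\<close>
definition test_prime :: nat where
  "test_prime = (SOME p. prime p \<and> (weil_at p \<longrightarrow> (\<forall>q. prime q \<longrightarrow> weil_at q)))"

lemma test_prime: "prime test_prime" "weil_at test_prime \<Longrightarrow> prime q \<Longrightarrow> weil_at q"
proof -
  have "\<exists>p. prime p \<and> (weil_at p \<longrightarrow> (\<forall>q. prime q \<longrightarrow> weil_at q))"
    using two_is_prime_nat by blast
  from someI_ex[OF this] show "prime test_prime" "weil_at test_prime \<Longrightarrow> prime q \<Longrightarrow> weil_at q"
    unfolding test_prime_def by blast+
qed

typedef test_index = "{..<test_prime}"
  using prime_gt_0_nat[OF test_prime(1)] by auto

lemma card_test_index: "CARD(test_index) = test_prime"
  using type_definition.card[OF type_definition_test_index] by simp

instance test_index :: prime_card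
  by standard (simp add: card_test_index test_prime)

text \<open>\<open>test_prime\<close> violates the bound if any prime does. The locale applies in
  the algebraic closure of the field with that many elements and shows that it does not violate it,
  so no prime does.\<close>

theorem weil_bound:
  assumes "prime p" "\<not> int p dvd m" "\<not> int p dvd n"
  shows "norm (kloosterman m n p) \<le> 2 * sqrt (real p)"
proof -
  have char: "CHAR(test_index mod_ring alg_closure) = test_prime"
    by (simp add: card_test_index)
  have pow: "(of_int m :: test_index mod_ring alg_closure) ^ test_prime = of_int m" for m
  proof -
    have "(of_int m :: test_index mod_ring) ^ card (UNIV :: test_index mod_ring set) = of_int m"
      by (rule finite_field_power_card_eq_same)
    then have "to_ac ((of_int m :: test_index mod_ring) ^ test_prime) = to_ac (of_int m)"
      by (simp only: CARD_mod_ring card_test_index)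
    then show ?thesis by (simp only: to_ac_power to_ac_of_int)
  qed
  have nz: "(of_int m :: test_index mod_ring alg_closure) \<noteq> 0" if "\<not> int test_prime dvd m" for m
    using that char by (simp add: of_int_eq_0_iff_char_dvd)
  have "weil_at test_prime" unfolding weil_at_def
  proof (intro allI impI)
    fix m n :: int assume mn: "\<not> int test_prime dvd m" "\<not> int test_prime dvd n"
    interpret kloosterman_field "of_int m :: test_index mod_ring alg_closure" "of_int n" test_prime
      by standard (use char pow nz mn test_prime(1) in auto)
    show "norm (kloosterman m n test_prime) \<le> 2 * sqrt (real test_prime)"
      using K_1_bound K_1_kloosterman[of m n] by simp
  qed
  from test_prime(2)[OF this assms(1)] assms(2,3) show ?thesis by (simp add: weil_at_def)
qed

section \<open>Equidistribution of modular inverses\<close>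

lemma finite_inverse_pairs [simp]: "finite (inverse_pairs L)"
  by (rule finite_subset[of _ "{..<L} \<times> {..<L}"]) (auto simp: inverse_pairs_def)

lemma inverse_pairs_unique:
  assumes "(x, y) \<in> inverse_pairs L" "(x, y') \<in> inverse_pairs L"
  shows "y = y'"
proof -
  have *: "[x * y = 1] (mod L)" "[x * y' = 1] (mod L)" "y < L" "y' < L"
    using assms by (auto simp: inverse_pairs_def)
  have "[y * (x * y') = y * 1] (mod L)" using * by (intro cong_mult cong_refl)
  moreover have "[y' * (x * y) = y' * 1] (mod L)" using * by (intro cong_mult cong_refl)
  ultimately have "[y = y'] (mod L)" by (simp add: mult_ac) (meson cong_sym cong_trans)
  then show ?thesis using * by (simp add: cong_less_modulus_unique_nat)
qed

lemma inverse_pairs_swap: "(x, y) \<in> inverse_pairs L \<longleftrightarrow> (y, x) \<in> inverse_pairs L"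
  by (auto simp: inverse_pairs_def mult.commute)

lemma inj_on_fst_inverse_pairs: "inj_on fst (inverse_pairs L)"
  by (auto intro!: inj_onI dest: inverse_pairs_unique)

lemma kloosterman_commute: "kloosterman m n L = kloosterman n m L"
  unfolding kloosterman_def
  by (rule sum.reindex_bij_witness[of _ prod.swap prod.swap])
     (auto simp: inverse_pairs_swap add.commute)

lemma kloosterman_trivial_bound: "norm (kloosterman m n L) \<le> real L"
proof -
  have "norm (kloosterman m n L) \<le> (\<Sum>u\<in>inverse_pairs L. 1)"
    unfolding kloosterman_def by (rule sum_norm_le) auto
  also have "\<dots> = real (card (fst ` inverse_pairs L))"
    by (simp add: card_image[OF inj_on_fst_inverse_pairs])
  also have "\<dots> \<le> real (card {..<L})"
    by (intro of_nat_mono card_mono) (auto simp: inverse_pairs_def)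
  finally show ?thesis by simp
qed

lemma kloosterman_mult_aux:
  fixes L1 L2 :: nat
  assumes u: "[u * L2 = 1] (mod L1)"
  shows "(((x * u mod L1) * L2 + z * L1) mod (L1 * L2)) mod L1 = x mod L1"
proof -
  have "(((x * u mod L1) * L2 + z * L1) mod (L1 * L2)) mod L1 = ((x * u mod L1) * L2) mod L1"
    by (simp add: mod_mod_cancel)
  also have "\<dots> = (x * (u * L2)) mod L1" unfolding mod_mult_left_eq by (simp only: mult.assoc)
  also have "\<dots> = x mod L1" using cong_scalar_left[OF u, of x] by (simp add: cong_def)
  finally show ?thesis .
qed

text \<open>Chinese remaindering with \<open>x = x1 * L2 + x2 * L1\<close> keeps the frequency
  \<open>m\<close> in both factors, since \<open>x / (L1 * L2) = x1 / L1 + x2 / L2\<close>. Modulo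
  \<open>L1\<close> the inverse of \<open>x\<close> is \<open>y1 * u2\<close>; bringing it into the
  same shape puts the twist \<open>u2 * u2\<close> on the second frequency. Bounds depending only on
  the first frequency therefore survive factorisation.\<close>

lemma kloosterman_mult:
  assumes cop: "coprime L1 L2" and pos: "L1 > 0" "L2 > 0"
  shows "\<exists>n1 n2. kloosterman m n (L1 * L2) = kloosterman m n1 L1 * kloosterman m n2 L2"
proof -
  obtain u2 where u2: "[u2 * L2 = 1] (mod L1)"
    using cong_solve_coprime_nat[of L2 L1] cop by (auto simp: mult.commute coprime_commute)
  obtain u1 where u1: "[u1 * L1 = 1] (mod L2)"
    using cong_solve_coprime_nat[of L1 L2] cop by (auto simp: mult.commute)
  define L where "L = L1 * L2"
  have L0: "L > 0" using pos by (simp add: L_def)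
  have eqL: "a = b" if "a < L" "b < L" "a mod L1 = b mod L1" "a mod L2 = b mod L2" for a b :: nat
    using that coprime_cong_mult_nat[of a b L1 L2] cop by (auto simp: cong_def L_def)
  define i where "i = (\<lambda>((x1, y1), (x2, y2)). ((x1 * L2 + x2 * L1) mod L, (y1 * u2 * u2 * L2 + y2 * u1 * u1 * L1) mod L))"
  define j where "j = (\<lambda>(x, y). ((x * u2 mod L1, y * L2 mod L1), (x * u1 mod L2, y * L1 mod L2)))"
  have one1: "(u2 * L2) mod L1 = 1 mod L1" and one2: "(u1 * L1) mod L2 = 1 mod L2"
    using u1 u2 by (simp_all add: cong_def)
  have c1: "[y * u2 * L2 = y] (mod L1)" for y
    using cong_scalar_left[OF u2, of y] by (simp add: mult.assoc)
  have c2: "[y * u1 * L1 = y] (mod L2)" for y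
    using cong_scalar_left[OF u1, of y] by (simp add: mult.assoc)
  have modL: "(a mod L) mod L1 = a mod L1" "(a mod L) mod L2 = a mod L2" for a
    by (simp_all add: L_def mod_mod_cancel)
  have i_in: "i w \<in> inverse_pairs L" if w: "w \<in> inverse_pairs L1 \<times> inverse_pairs L2" for w
  proof -
    obtain x1 y1 x2 y2 where e: "w = ((x1, y1), (x2, y2))" "[x1 * y1 = 1] (mod L1)" "[x2 * y2 = 1] (mod L2)"
      using w by (auto simp: inverse_pairs_def)
    define X0 where "X0 = x1 * L2 + x2 * L1"
    define Y where "Y = y1 * u2 * u2 * L2 + y2 * u1 * u1 * L1"
    have "[X0 = x1 * L2] (mod L1)" by (simp add: X0_def cong_def)
    moreover have "[Y = y1 * u2 * u2 * L2] (mod L1)" by (simp add: Y_def cong_def)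
    ultimately have "[X0 * Y = (x1 * L2) * (y1 * u2 * u2 * L2)] (mod L1)" by (rule cong_mult)
    also have "(x1 * L2) * (y1 * u2 * u2 * L2) = (x1 * y1) * ((u2 * L2) * (u2 * L2))" by (simp add: mult_ac)
    also have "[\<dots> = 1 * (1 * 1)] (mod L1)" by (intro cong_mult e u2)
    finally have 1: "[X0 * Y = 1] (mod L1)" by simp
    have "[X0 = x2 * L1] (mod L2)" by (simp add: X0_def cong_def)
    moreover have "[Y = y2 * u1 * u1 * L1] (mod L2)" by (simp add: Y_def cong_def)
    ultimately have "[X0 * Y = (x2 * L1) * (y2 * u1 * u1 * L1)] (mod L2)" by (rule cong_mult)
    also have "(x2 * L1) * (y2 * u1 * u1 * L1) = (x2 * y2) * ((u1 * L1) * (u1 * L1))" by (simp add: mult_ac)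
    also have "[\<dots> = 1 * (1 * 1)] (mod L2)" by (intro cong_mult e u1)
    finally have 2: "[X0 * Y = 1] (mod L2)" by simp
    have "[X0 * Y = 1] (mod L)" unfolding L_def using 1 2 cop by (rule coprime_cong_mult_nat)
    then show ?thesis using L0 unfolding e(1) i_def
      by (simp add: inverse_pairs_def X0_def[symmetric] Y_def[symmetric] cong_def mod_mult_eq)
  qed
  have j_in: "j w \<in> inverse_pairs L1 \<times> inverse_pairs L2" if w: "w \<in> inverse_pairs L" for w
  proof -
    obtain x y where e: "w = (x, y)" "[x * y = 1] (mod L)" using w by (auto simp: inverse_pairs_def)
    have e1: "[x * y = 1] (mod L1)" "[x * y = 1] (mod L2)"
      using e(2) unfolding L_def by (auto intro: cong_modulus_mult_nat) (metis cong_modulus_mult_nat mult.commute)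
    have "[(x * u2) * (y * L2) = 1] (mod L1)" "[(x * u1) * (y * L1) = 1] (mod L2)"
      using cong_mult[OF e1(1) u2] cong_mult[OF e1(2) u1] by (simp_all add: mult_ac)
    then show ?thesis using pos unfolding e(1) j_def
      by (simp add: inverse_pairs_def cong_def mod_mult_eq)
  qed
  have ij: "i (j w) = w" if w: "w \<in> inverse_pairs L" for w
  proof -
    obtain x y where e: "w = (x, y)" "x < L" "y < L" using w by (auto simp: inverse_pairs_def)
    have "((x * u2 mod L1) * L2 + (x * u1 mod L2) * L1) mod L = x"
    proof (rule eqL)
      show "((x * u2 mod L1) * L2 + (x * u1 mod L2) * L1) mod L mod L1 = x mod L1"
        unfolding L_def by (rule kloosterman_mult_aux[OF u2])
      have "((x * u1 mod L2) * L1 + (x * u2 mod L1) * L2) mod (L2 * L1) mod L2 = x mod L2"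
        by (rule kloosterman_mult_aux[OF u1])
      then show "((x * u2 mod L1) * L2 + (x * u1 mod L2) * L1) mod L mod L2 = x mod L2"
        unfolding L_def by (simp only: add.commute[of "(x * u1 mod L2) * L1"] mult.commute[of L2 L1])
    qed (use L0 e in auto)
    moreover have "((y * L2 mod L1) * u2 * u2 * L2 + (y * L1 mod L2) * u1 * u1 * L1) mod L = y"
    proof (rule eqL)
      have "[(y * L2 mod L1) * u2 * u2 * L2 + (y * L1 mod L2) * u1 * u1 * L1 = (y * L2 mod L1) * u2 * u2 * L2] (mod L1)"
        by (simp add: cong_def)
      also have "[(y * L2 mod L1) * u2 * u2 * L2 = (y * L2) * u2 * u2 * L2] (mod L1)"
        by (intro cong_mult cong_refl) (simp add: cong_def)
      also have "(y * L2) * u2 * u2 * L2 = (y * u2 * L2) * u2 * L2" by (simp add: mult_ac)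
      also have "[(y * u2 * L2) * u2 * L2 = y] (mod L1)" using c1 cong_trans by blast
      finally show "(((y * L2 mod L1) * u2 * u2 * L2 + (y * L1 mod L2) * u1 * u1 * L1) mod L) mod L1 = y mod L1"
        by (simp add: cong_def modL)
      have "[(y * L2 mod L1) * u2 * u2 * L2 + (y * L1 mod L2) * u1 * u1 * L1 = (y * L1 mod L2) * u1 * u1 * L1] (mod L2)"
        by (simp add: cong_def)
      also have "[(y * L1 mod L2) * u1 * u1 * L1 = (y * L1) * u1 * u1 * L1] (mod L2)"
        by (intro cong_mult cong_refl) (simp add: cong_def)
      also have "(y * L1) * u1 * u1 * L1 = (y * u1 * L1) * u1 * L1" by (simp add: mult_ac)
      also have "[(y * u1 * L1) * u1 * L1 = y] (mod L2)" using c2 cong_trans by blast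
      finally show "(((y * L2 mod L1) * u2 * u2 * L2 + (y * L1 mod L2) * u1 * u1 * L1) mod L) mod L2 = y mod L2"
        by (simp add: cong_def modL)
    qed (use L0 e in auto)
    ultimately show ?thesis by (simp add: e i_def j_def)
  qed
  have ji: "j (i w) = w" if w: "w \<in> inverse_pairs L1 \<times> inverse_pairs L2" for w
  proof -
    obtain x1 y1 x2 y2 where e: "w = ((x1, y1), (x2, y2))" "x1 < L1" "y1 < L1" "x2 < L2" "y2 < L2"
      using w by (auto simp: inverse_pairs_def)
    have A: "(z mod L) * v mod L1 = z * v mod L1" "(z mod L) * v mod L2 = z * v mod L2" for z v
      by (metis mod_mult_left_eq modL(1)) (metis mod_mult_left_eq modL(2))
    have "[(x1 * L2 + x2 * L1) * u2 = (x1 * u2 * L2) + (x2 * u2) * L1] (mod L1)" by (simp add: algebra_simps)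
    also have "[(x1 * u2 * L2) + (x2 * u2) * L1 = (x1 * u2 * L2)] (mod L1)" by (simp add: cong_def)
    also have "[x1 * u2 * L2 = x1] (mod L1)" by (rule c1)
    finally have 1: "(x1 * L2 + x2 * L1) * u2 mod L1 = x1" using e by (simp add: cong_def)
    have "[(x1 * L2 + x2 * L1) * u1 = (x2 * u1 * L1) + (x1 * u1) * L2] (mod L2)" by (simp add: algebra_simps)
    also have "[(x2 * u1 * L1) + (x1 * u1) * L2 = (x2 * u1 * L1)] (mod L2)" by (simp add: cong_def)
    also have "[x2 * u1 * L1 = x2] (mod L2)" by (rule c2)
    finally have 2: "(x1 * L2 + x2 * L1) * u1 mod L2 = x2" using e by (simp add: cong_def)
    have "[(y1 * u2 * u2 * L2 + y2 * u1 * u1 * L1) * L2 = (y1 * u2 * L2) * u2 * L2 + (y2 * u1 * u1 * L2) * L1] (mod L1)"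
      by (simp add: algebra_simps)
    also have "[(y1 * u2 * L2) * u2 * L2 + (y2 * u1 * u1 * L2) * L1 = (y1 * u2 * L2) * u2 * L2] (mod L1)" by (simp add: cong_def)
    also have "[(y1 * u2 * L2) * u2 * L2 = y1] (mod L1)" using c1 cong_trans by blast
    finally have 3: "(y1 * u2 * u2 * L2 + y2 * u1 * u1 * L1) * L2 mod L1 = y1" using e by (simp add: cong_def)
    have "[(y1 * u2 * u2 * L2 + y2 * u1 * u1 * L1) * L1 = (y2 * u1 * L1) * u1 * L1 + (y1 * u2 * u2 * L1) * L2] (mod L2)"
      by (simp add: algebra_simps)
    also have "[(y2 * u1 * L1) * u1 * L1 + (y1 * u2 * u2 * L1) * L2 = (y2 * u1 * L1) * u1 * L1] (mod L2)" by (simp add: cong_def)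
    also have "[(y2 * u1 * L1) * u1 * L1 = y2] (mod L2)" using c2 cong_trans by blast
    finally have 4: "(y1 * u2 * u2 * L2 + y2 * u1 * u1 * L1) * L1 mod L2 = y2" using e by (simp add: cong_def)
    show ?thesis unfolding e(1) i_def j_def prod.case A 1 2 3 4 by simp
  qed
  define n1 where "n1 = n * int (u2 * u2)"
  define n2 where "n2 = n * int (u1 * u1)"
  have "kloosterman m n1 L1 * kloosterman m n2 L2 =
     (\<Sum>w\<in>inverse_pairs L1 \<times> inverse_pairs L2.
       (case fst w of (x, y) \<Rightarrow> cis (2 * pi * (of_int (m * int x + n1 * int y) / real L1))) *
       (case snd w of (x, y) \<Rightarrow> cis (2 * pi * (of_int (m * int x + n2 * int y) / real L2))))"
    unfolding kloosterman_def sum_product sum.cartesian_product by (simp add: case_prod_unfold)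
  also have "\<dots> = kloosterman m n L" unfolding kloosterman_def
  proof (rule sum.reindex_bij_witness[of _ j i])
    fix w assume w: "w \<in> inverse_pairs L1 \<times> inverse_pairs L2"
    obtain x1 y1 x2 y2 where e: "w = ((x1, y1), (x2, y2))" by (metis prod.exhaust)
    define X0 where "X0 = x1 * L2 + x2 * L1"
    define Y where "Y = y1 * u2 * u2 * L2 + y2 * u1 * u1 * L1"
    have iw: "i w = (X0 mod L, Y mod L)" by (simp add: e i_def X0_def Y_def)
    have "[m * int (X0 mod L) + n * int (Y mod L) = m * int X0 + n * int Y] (mod int L)"
      by (intro cong_add cong_mult cong_refl) (simp_all add: cong_def zmod_int)
    then have "cis (2 * pi * (of_int (m * int (X0 mod L) + n * int (Y mod L)) / real L)) =
      cis (2 * pi * (of_int (m * int X0 + n * int Y) / real L))" by (rule cis_cong)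
    also have "of_int (m * int X0 + n * int Y) / real L =
      of_int (m * int x1 + n1 * int y1) / real L1 + of_int (m * int x2 + n2 * int y2) / real L2"
      using pos by (simp add: X0_def Y_def L_def n1_def n2_def field_simps)
    also have "cis (2 * pi * \<dots>) = cis (2 * pi * (of_int (m * int x1 + n1 * int y1) / real L1)) *
       cis (2 * pi * (of_int (m * int x2 + n2 * int y2) / real L2))"
      by (simp only: cis_mult ring_distribs)
    finally show "(case i w of (x, y) \<Rightarrow> cis (2 * pi * (of_int (m * int x + n * int y) / real L))) =
       (case fst w of (x, y) \<Rightarrow> cis (2 * pi * (of_int (m * int x + n1 * int y) / real L1))) *
       (case snd w of (x, y) \<Rightarrow> cis (2 * pi * (of_int (m * int x + n2 * int y) / real L2)))"
      unfolding iw unfolding e by simp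
  qed (use i_in j_in ij ji in auto)
  finally show ?thesis unfolding L_def by metis
qed

section \<open>Exponential sums over intervals, and bounds for composite moduli\<close>

lemma sum_cis_complete:
  assumes "L > 0"
  shows "(\<Sum>k<L. cis (2 * pi * (of_int (m * int k) / real L))) = (if int L dvd m then of_nat L else 0)"
proof (cases "int L dvd m")
  case True
  have "cis (2 * pi * (of_int (m * int k) / real L)) = 1" for k
    using cis_cong[of "m * int k" 0 L] True by (simp add: cong_def)
  then show ?thesis using True by simp
next
  case False
  define z where "z = cis (2 * pi * (of_int m / real L))"
  have zk: "cis (2 * pi * (of_int (m * int k) / real L)) = z ^ k" for k
    unfolding z_def Complex.DeMoivre by (rule arg_cong[where f = cis]) (simp add: field_simps)
  have "z ^ L = 1" using cis_cong[of "m * int L" 0 L] zk[of L] by (simp add: cong_def)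
  moreover have "z \<noteq> 1"
  proof
    assume "z = 1"
    then have "cos (2 * pi * (of_int m / real L)) = 1" by (simp add: z_def complex_eq_iff)
    then obtain i where "2 * pi * (of_int m / real L) = of_int i * 2 * pi"
      unfolding cos_one_2pi_int by blast
    then have "real_of_int m = of_int (i * int L)" using assms by (simp add: field_simps)
    then have "m = i * int L" by (simp only: of_int_eq_iff)
    with False show False by simp
  qed
  ultimately show ?thesis using False by (simp only: zk) (simp add: sum_gp_basic geometric_sum)
qed

text \<open>A weak Jordan inequality: \<open>x / 2 \<le> sin x\<close> up to \<open>pi / 2\<close>
  is enough because \<open>pi / 2 \<ge> 1\<close>. Up to \<open>pi / 3\<close> the cosine is at
  least \<open>1 / 2\<close>; beyond, \<open>sin x\<close> is at least \<open>sqrt 3 / 2\<close>,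
  which exceeds \<open>pi / 4\<close>.\<close>

lemma sin_pi_ge:
  assumes "0 \<le> t" "t \<le> 1/2"
  shows "t \<le> sin (pi * t)"
proof -
  have half: "x / 2 \<le> sin x" if x: "0 \<le> x" "x \<le> pi / 2" for x
  proof (cases "x \<le> pi / 3")
    case True
    have "sin 0 - 0 / 2 \<le> sin x - x / 2"
    proof (rule DERIV_nonneg_imp_nondecreasing[OF x(1)])
      fix y assume y: "0 \<le> y" "y \<le> x"
      have "cos y \<ge> cos (pi / 3)" using y True x by (intro cos_monotone_0_pi_le) auto
      then show "\<exists>d. ((\<lambda>x. sin x - x / 2) has_real_derivative d) (at y) \<and> 0 \<le> d"
        by (intro exI[of _ "cos y - 1 / 2"]) (auto intro!: derivative_eq_intros simp: cos_60)
    qed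
    then show ?thesis by simp
  next
    case False
    have "x / 2 \<le> 8 / 10" using x pi_less_4 pi_approx by simp
    also have "8 / 10 \<le> sqrt 3 / 2"
      using real_le_rsqrt[of "16/10" 3] by (simp add: power2_eq_square)
    also have "\<dots> = sin (pi / 3)" by (simp add: sin_60)
    also have "\<dots> \<le> sin x" using False x by (intro sin_monotone_2pi_le) auto
    finally show ?thesis .
  qed
  have "pi * t / 2 \<le> sin (pi * t)" using assms by (intro half) (auto simp: field_simps)
  moreover have "2 * t \<le> pi * t" using assms pi_ge_two by (intro mult_right_mono) auto
  ultimately show ?thesis by simp
qed

text \<open>A geometric series whose ratio has distance \<open>2 * sin (pi * m / L)\<close> from 1;
  the length of the interval does not enter. Bounding by two reciprocals, instead of by the distance
  to the nearest integer, makes later sums symmetric under exchanging \<open>m\<close> and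
  \<open>L - m\<close>.\<close>

lemma norm_sum_cis_interval:
  fixes u v :: int
  assumes "0 < m" "m < L"
  shows "norm (\<Sum>b\<in>{u..<v}. cis (2 * pi * (of_int (int m * b) / real L))) \<le> real L * (1 / real m + 1 / real (L - m))"
proof -
  define x where "x = real m / real L"
  have x: "0 < x" "x < 1" using assms by (auto simp: x_def)
  define z where "z = cis (2 * pi * x)"
  define N where "N = nat (v - u)"
  have "(\<Sum>b\<in>{u..<v}. cis (2 * pi * (of_int (int m * b) / real L))) = (\<Sum>k<N. cis (2 * pi * (of_int (int m * (u + int k)) / real L)))"
    by (rule sum.reindex_bij_witness[of _ "\<lambda>k. u + int k" "\<lambda>b. nat (b - u)"]) (auto simp: N_def)
  also have "\<dots> = (\<Sum>k<N. cis (2 * pi * (of_int (int m * u) / real L)) * z ^ k)"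
    unfolding z_def Complex.DeMoivre cis_mult
    by (intro sum.cong refl arg_cong[where f = cis]) (simp add: x_def add_divide_distrib ring_distribs)
  finally have *: "norm (\<Sum>b\<in>{u..<v}. cis (2 * pi * (of_int (int m * b) / real L))) = norm (\<Sum>k<N. z ^ k)"
    by (simp add: sum_distrib_left[symmetric] norm_mult)
  have sinpos: "sin (pi * x) > 0" using x by (intro sin_gt_zero) auto
  have nz1: "norm (z - 1) = 2 * sin (pi * x)"
  proof -
    have "norm (z - 1) ^ 2 = (cos (2 * pi * x) - 1)^2 + sin (2 * pi * x)^2" by (simp add: z_def cmod_power2)
    also have "\<dots> = 2 - 2 * cos (2 * (pi * x))"
      using sin_cos_squared_add[of "2 * pi * x"] by (simp add: power2_eq_square algebra_simps)
    also have "\<dots> = (2 * sin (pi * x)) ^ 2" by (simp add: cos_double_sin power2_eq_square)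
    finally show ?thesis using sinpos by (subst (asm) power2_eq_iff_nonneg) auto
  qed
  then have z1: "z \<noteq> 1" using sinpos by auto
  have "norm (\<Sum>k<N. z ^ k) = norm (z ^ N - 1) / norm (z - 1)"
    using z1 by (simp add: geometric_sum norm_divide)
  also have "\<dots> \<le> 2 / (2 * sin (pi * x))"
  proof -
    have "norm (z ^ N - 1) \<le> norm (z ^ N) + norm (1::complex)" by (rule norm_triangle_ineq4)
    also have "\<dots> = 2" by (simp add: z_def norm_power)
    finally show ?thesis using sinpos unfolding nz1 by (intro divide_right_mono) auto
  qed
  also have "\<dots> = 1 / sin (pi * x)" by simp
  also have "\<dots> \<le> 1 / min x (1 - x)"
  proof -
    have "sin (pi * x) \<ge> min x (1 - x)"
    proof (cases "x \<le> 1/2")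
      case True then show ?thesis using sin_pi_ge[of x] x by (simp add: min_def)
    next
      case False
      then have "sin (pi * (1 - x)) \<ge> 1 - x" using x by (intro sin_pi_ge) auto
      moreover have "sin (pi * (1 - x)) = sin (pi * x)" by (simp add: ring_distribs)
      ultimately show ?thesis by linarith
    qed
    then show ?thesis using x sinpos by (intro divide_left_mono) auto
  qed
  also have "\<dots> \<le> 1 / x + 1 / (1 - x)" using x by (auto simp: min_def)
  also have "\<dots> = real L * (1 / real m + 1 / real (L - m))"
    using assms by (simp add: x_def of_nat_diff field_simps)
  finally show ?thesis using * by simp
qed

text \<open>If \<open>p\<close> divides \<open>m\<close>, the gcd factor raises the right side to
  \<open>2 * p\<close> and the trivial bound applies. If \<open>p\<close> divides only
  \<open>n\<close>, the sum is a Ramanujan sum and equals -1.\<close>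

lemma kloosterman_prime_bound:
  assumes p: "prime p"
  shows "norm (kloosterman m n p) \<le> 2 * sqrt (real p) * sqrt (of_int (gcd m (int p)))"
proof -
  have p2: "p \<ge> 2" using p prime_ge_2_nat by blast
  have g1: "gcd m (int p) \<ge> 1" using p2 by (simp add: int_one_le_iff_zero_less)
  have s1: "sqrt (real p) * 1 \<le> sqrt (real p) * sqrt (of_int (gcd m (int p)))"
    using g1 by (intro mult_left_mono) auto
  consider "int p dvd m" | "\<not> int p dvd m" "\<not> int p dvd n" | "\<not> int p dvd m" "int p dvd n" by blast
  then show ?thesis
  proof cases
    case 1
    then have "gcd m (int p) = int p" by (simp add: gcd_proj2_if_dvd)
    then show ?thesis using kloosterman_trivial_bound[of m n p] by (simp add: mult.assoc)
  next
    case 2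
    then show ?thesis using weil_bound[OF p 2] s1 by linarith
  next
    case 3
    have img: "fst ` inverse_pairs p = {1..<p}"
    proof (intro equalityI subsetI)
      fix x assume "x \<in> fst ` inverse_pairs p"
      then obtain y where "[x * y = 1] (mod p)" "x < p" by (auto simp: inverse_pairs_def)
      then show "x \<in> {1..<p}" using p2 by (cases x) (auto simp: cong_def)
    next
      fix x assume x: "x \<in> {1..<p}"
      then have "\<not> p dvd x" by (auto dest: dvd_imp_le)
      then have "coprime x p" using p by (simp add: prime_imp_coprime coprime_commute)
      then obtain y where "[x * y = Suc 0] (mod p)" using cong_solve_coprime_nat by blast
      then have "(x, y mod p) \<in> inverse_pairs p" using x p2 by (auto simp: inverse_pairs_def cong_def mod_mult_right_eq)
      then show "x \<in> fst ` inverse_pairs p" by force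
    qed
    have "kloosterman m n p = (\<Sum>u\<in>inverse_pairs p. cis (2 * pi * (of_int (m * int (fst u)) / real p)))"
      unfolding kloosterman_def
    proof (intro sum.cong refl)
      fix u assume "u \<in> inverse_pairs p"
      have "[m * int (fst u) + n * int (snd u) = m * int (fst u)] (mod int p)"
        using 3 by (simp add: cong_iff_dvd_diff)
      then show "(case u of (x, y) \<Rightarrow> cis (2 * pi * (of_int (m * int x + n * int y) / real p))) =
          cis (2 * pi * (of_int (m * int (fst u)) / real p))"
        unfolding case_prod_unfold by (rule cis_cong)
    qed
    also have "\<dots> = (\<Sum>x\<in>{1..<p}. cis (2 * pi * (of_int (m * int x) / real p)))"
      unfolding img[symmetric] by (simp add: sum.reindex[OF inj_on_fst_inverse_pairs])
    also have "\<dots> = (\<Sum>x<p. cis (2 * pi * (of_int (m * int x) / real p))) - 1"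
    proof -
      have "{..<p} = insert 0 {1..<p}" using p2 by auto
      then show ?thesis by simp
    qed
    also have "\<dots> = - 1" using sum_cis_complete[of p m] 3 p2 by simp
    finally have "norm (kloosterman m n p) = 1" by simp
    moreover have "1 \<le> sqrt (real p)" using p2 by simp
    ultimately show ?thesis using s1 by linarith
  qed
qed

text \<open>At these primes Weil's bound is applied. The cofactor \<open>L div exact_part L\<close>
  is squarefull and is estimated trivially.\<close>

definition exact_primes :: "nat \<Rightarrow> nat set" where
  "exact_primes L = {p \<in> prime_factors L. \<not> p\<^sup>2 dvd L}"

definition exact_part :: "nat \<Rightarrow> nat" where "exact_part L = \<Prod>(exact_primes L)"

lemma finite_exact_primes [simp]: "finite (exact_primes L)" by (simp add: exact_primes_def)

lemma exact_primes_prime: "p \<in> exact_primes L \<Longrightarrow> prime p" by (auto simp: exact_primes_def)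

lemma prod_primes_dvd:
  fixes L :: nat
  assumes "finite P" "\<And>p. p \<in> P \<Longrightarrow> prime p \<and> p dvd L"
  shows "\<Prod>P dvd L"
  using assms
proof (induction P rule: finite_induct)
  case (insert q P)
  have "coprime q (\<Prod>P)"
    using insert by (intro prod_coprime_right) (metis insertI1 insertI2 primes_coprime)
  then show ?case using insert by (simp add: divides_mult)
qed auto

lemma exact_part_dvd: "exact_part L dvd L"
  unfolding exact_part_def by (rule prod_primes_dvd) (auto simp: exact_primes_def)

lemma exact_part_pos: "exact_part L > 0"
  unfolding exact_part_def by (rule prod_pos) (auto dest: exact_primes_prime prime_gt_0_nat)

lemma exact_part_coprime:
  assumes "L > 0" "p \<in> exact_primes L"
  shows "\<not> p dvd L div exact_part L"
proof
  assume "p dvd L div exact_part L"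
  moreover have "p dvd exact_part L" unfolding exact_part_def using assms by (intro dvd_prodI) auto
  ultimately have "p * p dvd exact_part L * (L div exact_part L)" by (intro mult_dvd_mono)
  then show False using assms exact_part_dvd[of L] by (simp add: exact_primes_def power2_eq_square)
qed

lemma kloosterman_bound_aux:
  fixes P :: "nat set"
  assumes "finite P" "\<And>p. p \<in> P \<Longrightarrow> prime p \<and> \<not> p dvd M" "M > 0"
  shows "norm (kloosterman m n (\<Prod>P * M)) \<le> (\<Prod>p\<in>P. 2 * sqrt (real p) * sqrt (of_int (gcd m (int p)))) * real M"
  using assms(1,2)
proof (induction P arbitrary: n rule: finite_induct)
  case empty
  then show ?case using kloosterman_trivial_bound by simp
next
  case (insert q P)
  have q: "prime q" using insert by auto
  have "coprime q (\<Prod>P)"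
    using insert by (intro prod_coprime_right) (metis insertI1 insertI2 primes_coprime)
  moreover have "coprime q M" using insert q by (simp add: prime_imp_coprime)
  ultimately have cop: "coprime q (\<Prod>P * M)" by simp
  have "\<Prod>P * M > 0" using insert assms(3) by (auto intro!: prod_pos prime_gt_0_nat)
  then obtain n1 n2 where *: "kloosterman m n (q * (\<Prod>P * M)) = kloosterman m n1 q * kloosterman m n2 (\<Prod>P * M)"
    using kloosterman_mult[OF cop, of m n] prime_gt_0_nat[OF q] by auto
  have "norm (kloosterman m n (q * (\<Prod>P * M))) \<le>
    (2 * sqrt (real q) * sqrt (of_int (gcd m (int q)))) *
    ((\<Prod>p\<in>P. 2 * sqrt (real p) * sqrt (of_int (gcd m (int p)))) * real M)"
    unfolding * norm_mult using insert kloosterman_prime_bound[OF q]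
    by (intro mult_mono) auto
  then show ?case using insert by (simp add: mult.assoc)
qed

lemma sqrt_prod: "sqrt (real (\<Prod>A)) = (\<Prod>p\<in>A. sqrt (real p))"
  by (induction A rule: infinite_finite_induct) (simp_all add: real_sqrt_mult)

text \<open>The frequencies are exchanged so that the gcds involve the second one. In
  \<open>hyperbola_discrepancy\<close> that is the frequency of the window, which is nonzero modulo
  \<open>L\<close>.\<close>

lemma kloosterman_bound:
  assumes "L > 0"
  shows "norm (kloosterman m n L) \<le>
    2 ^ card (exact_primes L) * sqrt (real (exact_part L)) * real (L div exact_part L) *
    (\<Prod>p\<in>exact_primes L. sqrt (of_int (gcd n (int p))))"
proof -
  have L: "\<Prod>(exact_primes L) * (L div exact_part L) = L"
    using exact_part_dvd[of L] by (simp add: exact_part_def)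
  have "norm (kloosterman n m L) \<le>
     (\<Prod>p\<in>exact_primes L. 2 * sqrt (real p) * sqrt (of_int (gcd n (int p)))) * real (L div exact_part L)"
    using kloosterman_bound_aux[of "exact_primes L" "L div exact_part L" n m]
      exact_part_coprime[OF assms] exact_primes_prime assms exact_part_dvd[of L] exact_part_pos[of L]
    unfolding L by (auto simp: dvd_imp_le div_greater_zero_iff)
  also have "(\<Prod>p\<in>exact_primes L. 2 * sqrt (real p) * sqrt (of_int (gcd n (int p)))) =
     2 ^ card (exact_primes L) * sqrt (real (exact_part L)) * (\<Prod>p\<in>exact_primes L. sqrt (of_int (gcd n (int p))))"
    unfolding exact_part_def sqrt_prod by (simp add: prod.distrib)
  finally show ?thesis by (simp add: kloosterman_commute[of m n] mult_ac)
qed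

lemma harm_le_ln: "n > 0 \<Longrightarrow> (\<Sum>k=1..n. 1 / real k) \<le> 1 + ln (real n)"
proof -
  assume "n > 0"
  then obtain k where k: "n = Suc k" by (cases n) auto
  have "harm (Suc k) - ln (Suc k) \<le> harm (Suc 0) - ln (Suc 0)"
    using decseqD[OF decseq_harm_diff_ln, of 0 k] by simp
  then show ?thesis by (simp add: k harm_def inverse_eq_divide)
qed

text \<open>The product is \<open>sqrt d\<close>, where \<open>d\<close> is the product of those
  exact primes that divide \<open>m\<close>. Summing instead over all sets of exact primes whose
  product \<open>d\<close> divides \<open>m\<close> costs the power of 2; each set contributes
  \<open>sqrt d / d \<le> 1\<close> times a harmonic sum.\<close>

lemma sum_prod_sqrt_gcd_le:
  assumes "L > 0"
  shows "(\<Sum>m=1..<L. (\<Prod>p\<in>exact_primes L. sqrt (of_int (gcd (int m) (int p)))) / real m)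
     \<le> 2 ^ card (exact_primes L) * (1 + ln (real L))"
proof -
  define P where "P = exact_primes L"
  have P: "finite P" "\<And>p. p \<in> P \<Longrightarrow> prime p" by (auto simp: P_def exact_primes_prime)
  have pw: "(\<Prod>p\<in>P. sqrt (of_int (gcd (int m) (int p)))) / real m \<le>
      (\<Sum>A\<in>Pow P. if \<Prod>A dvd m then sqrt (real (\<Prod>A)) / real m else 0)" if "m > 0" for m
  proof -
    define A where "A = {p\<in>P. p dvd m}"
    have "(\<Prod>p\<in>P. sqrt (of_int (gcd (int m) (int p)))) = (\<Prod>p\<in>A. sqrt (of_int (gcd (int m) (int p))))"
    proof (rule prod.mono_neutral_right)
      show "\<forall>p\<in>P - A. sqrt (of_int (gcd (int m) (int p))) = 1"
      proof
        fix p assume "p \<in> P - A"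
        then have "coprime p m" using P by (auto simp: A_def intro: prime_imp_coprime)
        then have "gcd (int m) (int p) = 1" by (metis coprime_iff_gcd_eq_1 gcd.commute gcd_int_int_eq of_nat_1)
        then show "sqrt (of_int (gcd (int m) (int p))) = 1" by simp
      qed
    qed (use P in \<open>auto simp: A_def\<close>)
    also have "\<dots> = (\<Prod>p\<in>A. sqrt (real p))"
      by (intro prod.cong refl) (auto simp: A_def gcd_proj2_if_dvd)
    also have "\<dots> = sqrt (real (\<Prod>A))" by (simp only: sqrt_prod)
    finally have eq1: "(\<Prod>p\<in>P. sqrt (of_int (gcd (int m) (int p)))) = sqrt (real (\<Prod>A))" .
    have "finite A" "\<And>p. p \<in> A \<Longrightarrow> prime p \<and> p dvd m" using P by (simp_all add: A_def)
    then have "\<Prod>A dvd m" by (rule prod_primes_dvd)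
    then have eq: "(\<Prod>p\<in>P. sqrt (of_int (gcd (int m) (int p)))) / real m =
        (if \<Prod>A dvd m then sqrt (real (\<Prod>A)) / real m else 0)"
      unfolding eq1 by (simp only: if_True)
    have "A \<in> Pow P" by (auto simp: A_def)
    then show ?thesis unfolding eq using P(1) by (intro member_le_sum) (simp_all del: of_nat_prod)
  qed
  have inner: "(\<Sum>m=1..<L. if \<Prod>A dvd m then sqrt (real (\<Prod>A)) / real m else 0) \<le> 1 + ln (real L)"
    if A: "A \<in> Pow P" for A
  proof -
    define d where "d = \<Prod>A"
    have d: "d > 0" unfolding d_def using A P(2) by (intro prod_pos) (meson PowD prime_gt_0_nat subsetD)
    have "(\<Sum>m=1..<L. if d dvd m then sqrt (real d) / real m else 0) = (\<Sum>m\<in>{m\<in>{1..<L}. d dvd m}. sqrt (real d) / real m)"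
      by (rule sum.inter_filter[symmetric]) simp
    also have "\<dots> \<le> (\<Sum>m\<in>(\<lambda>k. d * k) ` {1..L}. sqrt (real d) / real m)"
    proof (intro sum_mono2)
      show "{m \<in> {1..<L}. d dvd m} \<subseteq> (\<lambda>k. d * k) ` {1..L}"
      proof
        fix m assume "m \<in> {m \<in> {1..<L}. d dvd m}"
        then obtain k where k: "m = d * k" "1 \<le> m" "m < L" by auto
        have "k \<le> d * k" using d by simp
        then have "k \<le> L" "1 \<le> k" using k by (linarith, cases k) auto
        then show "m \<in> (\<lambda>k. d * k) ` {1..L}" using k(1) by (intro image_eqI[of _ _ k]) auto
      qed
    qed auto
    also have "\<dots> = (\<Sum>k=1..L. sqrt (real d) / real (d * k))"
      using d by (subst sum.reindex) (auto simp: inj_on_def)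
    also have "\<dots> = sqrt (real d) / real d * (\<Sum>k=1..L. 1 / real k)"
      by (simp add: sum_distrib_left)
    also have "\<dots> \<le> 1 * (1 + ln (real L))"
    proof (intro mult_mono)
      have "sqrt (real d) \<le> real d" using d by (intro real_le_lsqrt) (auto simp: power2_eq_square)
      then show "sqrt (real d) / real d \<le> 1" using d by simp
      show "(\<Sum>k=1..L. 1 / real k) \<le> 1 + ln (real L)" by (rule harm_le_ln[OF assms])
    qed (auto intro: sum_nonneg)
    finally show ?thesis unfolding d_def by simp
  qed
  have "(\<Sum>m=1..<L. (\<Prod>p\<in>P. sqrt (of_int (gcd (int m) (int p)))) / real m)
     \<le> (\<Sum>m=1..<L. \<Sum>A\<in>Pow P. if \<Prod>A dvd m then sqrt (real (\<Prod>A)) / real m else 0)"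
    by (intro sum_mono pw) auto
  also have "\<dots> = (\<Sum>A\<in>Pow P. \<Sum>m=1..<L. if \<Prod>A dvd m then sqrt (real (\<Prod>A)) / real m else 0)"
    by (rule sum.swap)
  also have "\<dots> \<le> (\<Sum>A\<in>Pow P. 1 + ln (real L))" by (intro sum_mono inner)
  also have "\<dots> = 2 ^ card P * (1 + ln (real L))" using P by (simp add: card_Pow)
  finally show ?thesis by (simp add: P_def)
qed

section \<open>Completion of the count of modular inverses\<close>

abbreviation ecis :: "nat \<Rightarrow> int \<Rightarrow> complex" where
  "ecis L i \<equiv> cis (2 * pi * (of_int i / real L))"

lemma ecis_add: "ecis L (i + j) = ecis L i * ecis L j"
  by (simp add: cis_mult add_divide_distrib ring_distribs)

lemma orthogonality:
  assumes "L > 0"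
  shows "(if [i = j] (mod int L) then 1 else 0) = (1 / of_nat L) * (\<Sum>k<L. ecis L (int k * i) * ecis L (- int k * j))"
proof -
  have "(\<Sum>k<L. ecis L (int k * i) * ecis L (- int k * j)) = (\<Sum>k<L. ecis L ((i - j) * int k))"
    unfolding ecis_add[symmetric] by (simp add: algebra_simps)
  also have "\<dots> = (if int L dvd i - j then of_nat L else 0)" by (rule sum_cis_complete[OF assms])
  finally show ?thesis using assms by (simp add: cong_iff_dvd_diff)
qed

text \<open>Conditions on \<open>K\<close> become sums over pairs of inverse residues: coprimality
  means that \<open>K\<close> is some \<open>x\<close>, and \<open>b * K = c\<close> means in
  addition that \<open>b = c * y\<close>. In this form the conditions on \<open>K\<close> and on
  \<open>b\<close> separate, and each can be expanded in characters.\<close>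

lemma inverse_pairs_sum_unit:
  fixes K :: int
  assumes "L > 0"
  shows "(\<Sum>(x, y)\<in>inverse_pairs L. if [K = int x] (mod int L) then 1 else 0) = (if coprime K (int L) then 1 else (0::complex))"
    and "[c * c = 1] (mod int L) \<Longrightarrow>
      (\<Sum>(x, y)\<in>inverse_pairs L. (if [K = int x] (mod int L) then 1 else 0) * (if [b = c * int y] (mod int L) then 1 else 0)) =
      (if [b * K = c] (mod int L) then 1 else (0::complex))"
proof -
  define x0 where "x0 = nat (K mod int L)"
  have x0: "x0 < L" "[K = int x0] (mod int L)" using assms by (auto simp: x0_def nat_less_iff cong_def)
  have x_unique: "x = x0" if "[K = int x] (mod int L)" "x < L" for x
  proof -
    have "[int x = int x0] (mod int L)" by (rule cong_trans[OF cong_sym[OF that(1)] x0(2)])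
    then have "[x = x0] (mod L)" by (simp only: cong_int_iff)
    then show ?thesis using that(2) x0(1) by (rule cong_less_modulus_unique_nat)
  qed
  have cong_pair: "[int x * int y = 1] (mod int L)" if "(x, y) \<in> inverse_pairs L" for x y
  proof -
    have "[x * y = 1] (mod L)" using that by (simp add: inverse_pairs_def)
    then have "[int (x * y) = int 1] (mod int L)" by (simp only: cong_int_iff)
    then show ?thesis by simp
  qed
  have not_unit: "coprime K (int L)" if "(x, y) \<in> inverse_pairs L" "[K = int x] (mod int L)" for x y
  proof -
    have "[K * int y = 1] (mod int L)" using cong_trans[OF cong_scalar_right[OF that(2)] cong_pair[OF that(1)]] .
    then show ?thesis using coprime_iff_invertible_int by blast
  qed
  have ex: "\<exists>y. (x0, y) \<in> inverse_pairs L" if "coprime K (int L)"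
  proof -
    have "coprime (int x0) (int L)" using cong_imp_coprime[OF x0(2)] that by simp
    then have "coprime x0 L" by simp
    then obtain y where "[x0 * y = Suc 0] (mod L)" using cong_solve_coprime_nat by blast
    then have "(x0, y mod L) \<in> inverse_pairs L" using x0 assms by (auto simp: inverse_pairs_def cong_def mod_mult_right_eq)
    then show ?thesis by blast
  qed
  have pair_iff: "[K = int (fst u)] (mod int L) \<longleftrightarrow> u = (x0, y0)"
    if y0: "(x0, y0) \<in> inverse_pairs L" and u: "u \<in> inverse_pairs L" for u y0
  proof
    assume K: "[K = int (fst u)] (mod int L)"
    have "fst u < L" using u by (auto simp: inverse_pairs_def)
    then have f: "fst u = x0" by (rule x_unique[OF K])
    have "(x0, snd u) \<in> inverse_pairs L" using u unfolding f[symmetric] by simp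
    then have "snd u = y0" using y0 by (rule inverse_pairs_unique)
    with f show "u = (x0, y0)" by (simp add: prod_eq_iff)
  qed (use x0(2) in simp)
  show "(\<Sum>(x, y)\<in>inverse_pairs L. if [K = int x] (mod int L) then 1 else 0) = (if coprime K (int L) then 1 else (0::complex))"
  proof (cases "coprime K (int L)")
    case True
    then obtain y0 where y0: "(x0, y0) \<in> inverse_pairs L" using ex by blast
    have "(\<Sum>(x, y)\<in>inverse_pairs L. if [K = int x] (mod int L) then 1 else 0) =
       (\<Sum>u\<in>inverse_pairs L. if u = (x0, y0) then 1 else (0::complex))"
    proof (intro sum.cong refl)
      fix u assume u: "u \<in> inverse_pairs L"
      have "[K = int (fst u)] (mod int L) \<longleftrightarrow> u = (x0, y0)"
        by (rule pair_iff[OF y0 u])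
      then show "(case u of (x, y) \<Rightarrow> if [K = int x] (mod int L) then 1 else 0) = (if u = (x0, y0) then 1 else (0::complex))"
        by (simp add: case_prod_unfold)
    qed
    then show ?thesis using y0 True by simp
  next
    case False
    then show ?thesis using not_unit by (auto intro!: sum.neutral)
  qed
  assume cc: "[c * c = 1] (mod int L)"
  show "(\<Sum>(x, y)\<in>inverse_pairs L. (if [K = int x] (mod int L) then 1 else 0) * (if [b = c * int y] (mod int L) then 1 else 0)) =
      (if [b * K = c] (mod int L) then 1 else (0::complex))"
  proof (cases "coprime K (int L)")
    case True
    then obtain y0 where y0: "(x0, y0) \<in> inverse_pairs L" using ex by blast
    have "(\<Sum>(x, y)\<in>inverse_pairs L. (if [K = int x] (mod int L) then 1 else 0) * (if [b = c * int y] (mod int L) then 1 else 0)) =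
       (\<Sum>u\<in>inverse_pairs L. if u = (x0, y0) then (if [b = c * int y0] (mod int L) then 1 else 0) else (0::complex))"
    proof (intro sum.cong refl)
      fix u assume u: "u \<in> inverse_pairs L"
      have "[K = int (fst u)] (mod int L) \<longleftrightarrow> u = (x0, y0)"
        by (rule pair_iff[OF y0 u])
      then show "(case u of (x, y) \<Rightarrow> (if [K = int x] (mod int L) then 1 else 0) * (if [b = c * int y] (mod int L) then 1 else 0)) =
         (if u = (x0, y0) then (if [b = c * int y0] (mod int L) then 1 else 0) else (0::complex))"
        by (simp add: case_prod_unfold)
    qed
    also have "\<dots> = (if [b = c * int y0] (mod int L) then 1 else 0)" using y0 by simp
    also have "[b = c * int y0] (mod int L) \<longleftrightarrow> [b * K = c] (mod int L)"
    proof
      have Ky: "[int y0 * K = 1] (mod int L)"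
        using cong_trans[OF cong_scalar_left[OF x0(2), of "int y0"]] cong_pair[OF y0] by (simp add: mult.commute)
      { assume "[b = c * int y0] (mod int L)"
        then have "[b * K = c * int y0 * K] (mod int L)" by (rule cong_scalar_right)
        also have "[c * int y0 * K = c * 1] (mod int L)" using cong_scalar_left[OF Ky, of c] by (simp add: mult.assoc)
        finally show "[b * K = c] (mod int L)" by simp }
      assume "[b * K = c] (mod int L)"
      then have "[b * K * int y0 = c * int y0] (mod int L)" by (rule cong_scalar_right)
      moreover have "[b * K * int y0 = b * 1] (mod int L)" using cong_scalar_left[OF Ky, of b] by (simp add: mult_ac)
      ultimately show "[b = c * int y0] (mod int L)" by simp (meson cong_sym cong_trans)
    qed
    finally show ?thesis .
  next
    case False
    have "\<not> [b * K = c] (mod int L)"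
    proof
      assume "[b * K = c] (mod int L)"
      then have "[b * K * c = c * c] (mod int L)" by (rule cong_scalar_right)
      then have "[K * (b * c) = 1] (mod int L)" using cong_trans cc by (simp add: mult_ac) blast
      then show False using False coprime_iff_invertible_int by blast
    qed
    then show ?thesis using False not_unit by (auto intro!: sum.neutral)
  qed
qed

text \<open>One factor \<open>2 ^ card (exact_primes L)\<close> comes from Weil's bound, the other
  from the gcd sum over frequencies. Completing the two intervals costs one logarithm each.\<close>

definition discrepancy_bound :: "nat \<Rightarrow> real" where
  "discrepancy_bound L = 4 * 4 ^ card (exact_primes L) * sqrt (real (exact_part L)) *
     real (L div exact_part L) * (2 + ln (real L))\<^sup>2"

text \<open>Both intervals are expanded in additive characters. Frequency 0 of \<open>b\<close> is
  the main term; all other frequencies of \<open>b\<close>, paired with every frequency of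
  \<open>K\<close>, carry Kloosterman sums. The interval of \<open>K\<close> has length at most
  \<open>L\<close>, which bounds its own zero frequency by \<open>L\<close>. The window of
  \<open>b\<close> may be of any length.\<close>

lemma hyperbola_discrepancy:
  fixes b1 b2 k1 k2 c :: int
  assumes L: "L > 0" and c: "c * c = 1" and J: "k2 - k1 \<le> int L"
  shows "\<bar>(\<Sum>K\<in>{k1..<k2}. \<Sum>b\<in>{b1..<b2}. if [b * K = c] (mod int L) then 1 else 0) -
     real (card {b1..<b2}) / real L * (\<Sum>K\<in>{k1..<k2}. if coprime K (int L) then 1 else 0)\<bar> \<le> discrepancy_bound L"
proof -
  define Bh where "Bh = (\<lambda>m. \<Sum>b\<in>{b1..<b2}. ecis L (int m * b))"
  define Jh where "Jh = (\<lambda>n. \<Sum>K\<in>{k1..<k2}. ecis L (int n * K))"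
  define I where "I = inverse_pairs L"
  define ind where "ind = (\<lambda>i j. if [i = j] (mod int L) then 1 else (0::complex))"
  have cc: "[c * c = 1] (mod int L)" by (simp add: c)
  have al: "(\<Sum>K\<in>{k1..<k2}. ind K (int x)) = (1 / of_nat L) * (\<Sum>n<L. Jh n * ecis L (- int n * int x))" for x
  proof -
    have "(\<Sum>K\<in>{k1..<k2}. ind K (int x)) = (\<Sum>K\<in>{k1..<k2}. (1 / of_nat L) * (\<Sum>n<L. ecis L (int n * K) * ecis L (- int n * int x)))"
      unfolding ind_def by (intro sum.cong refl orthogonality[OF L])
    also have "\<dots> = (1 / of_nat L) * (\<Sum>K\<in>{k1..<k2}. \<Sum>n<L. ecis L (int n * K) * ecis L (- int n * int x))"
      by (rule sum_distrib_left[symmetric])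
    also have "(\<Sum>K\<in>{k1..<k2}. \<Sum>n<L. ecis L (int n * K) * ecis L (- int n * int x)) =
       (\<Sum>n<L. \<Sum>K\<in>{k1..<k2}. ecis L (int n * K) * ecis L (- int n * int x))" by (rule sum.swap)
    also have "\<dots> = (\<Sum>n<L. Jh n * ecis L (- int n * int x))" by (simp only: Jh_def sum_distrib_right)
    finally show ?thesis .
  qed
  define be where "be = (\<lambda>y. (1 / of_nat L) * (\<Sum>m=1..<L. Bh m * ecis L (- int m * (c * int y))))"
  have bl: "(\<Sum>b\<in>{b1..<b2}. ind b (c * int y)) = of_nat (card {b1..<b2}) / of_nat L + be y" for y
  proof -
    have "(\<Sum>b\<in>{b1..<b2}. ind b (c * int y)) = (\<Sum>b\<in>{b1..<b2}. (1 / of_nat L) * (\<Sum>m<L. ecis L (int m * b) * ecis L (- int m * (c * int y))))"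
      unfolding ind_def by (intro sum.cong refl orthogonality[OF L])
    also have "\<dots> = (1 / of_nat L) * (\<Sum>b\<in>{b1..<b2}. \<Sum>m<L. ecis L (int m * b) * ecis L (- int m * (c * int y)))"
      by (rule sum_distrib_left[symmetric])
    also have "(\<Sum>b\<in>{b1..<b2}. \<Sum>m<L. ecis L (int m * b) * ecis L (- int m * (c * int y))) =
       (\<Sum>m<L. \<Sum>b\<in>{b1..<b2}. ecis L (int m * b) * ecis L (- int m * (c * int y)))" by (rule sum.swap)
    also have "\<dots> = (\<Sum>m<L. Bh m * ecis L (- int m * (c * int y)))" by (simp only: Bh_def sum_distrib_right)
    also have "{..<L} = insert 0 {1..<L}" using L by auto
    also have "(\<Sum>m\<in>insert 0 {1..<L}. Bh m * ecis L (- int m * (c * int y))) =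
       of_nat (card {b1..<b2}) + (\<Sum>m=1..<L. Bh m * ecis L (- int m * (c * int y)))"
      by (simp add: Bh_def)
    finally show ?thesis by (simp add: be_def ring_distribs)
  qed
  have main: "(\<Sum>K\<in>{k1..<k2}. \<Sum>b\<in>{b1..<b2}. ind (b * K) c) =
     of_nat (card {b1..<b2}) / of_nat L * (\<Sum>K\<in>{k1..<k2}. if coprime K (int L) then 1 else 0) +
     (\<Sum>(x, y)\<in>I. (\<Sum>K\<in>{k1..<k2}. ind K (int x)) * be y)"
  proof -
    have "(\<Sum>K\<in>{k1..<k2}. \<Sum>b\<in>{b1..<b2}. ind (b * K) c) =
       (\<Sum>K\<in>{k1..<k2}. \<Sum>b\<in>{b1..<b2}. \<Sum>u\<in>I. ind K (int (fst u)) * ind b (c * int (snd u)))"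
      unfolding ind_def I_def using inverse_pairs_sum_unit(2)[OF L cc] by (simp add: case_prod_unfold)
    also have "\<dots> = (\<Sum>K\<in>{k1..<k2}. \<Sum>u\<in>I. \<Sum>b\<in>{b1..<b2}. ind K (int (fst u)) * ind b (c * int (snd u)))"
      by (intro sum.cong refl sum.swap)
    also have "\<dots> = (\<Sum>u\<in>I. \<Sum>K\<in>{k1..<k2}. \<Sum>b\<in>{b1..<b2}. ind K (int (fst u)) * ind b (c * int (snd u)))"
      by (rule sum.swap)
    also have "\<dots> = (\<Sum>u\<in>I. (\<Sum>K\<in>{k1..<k2}. ind K (int (fst u))) * (\<Sum>b\<in>{b1..<b2}. ind b (c * int (snd u))))"
      by (simp only: sum_product)
    also have "\<dots> = (\<Sum>u\<in>I. (of_nat (card {b1..<b2}) / of_nat L) * (\<Sum>K\<in>{k1..<k2}. ind K (int (fst u))) +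
         (\<Sum>K\<in>{k1..<k2}. ind K (int (fst u))) * be (snd u))"
      unfolding bl by (simp only: ring_distribs mult.commute)
    also have "\<dots> = (of_nat (card {b1..<b2}) / of_nat L) * (\<Sum>u\<in>I. \<Sum>K\<in>{k1..<k2}. ind K (int (fst u))) +
         (\<Sum>u\<in>I. (\<Sum>K\<in>{k1..<k2}. ind K (int (fst u))) * be (snd u))"
      by (simp only: sum.distrib sum_distrib_left)
    also have "(\<Sum>u\<in>I. \<Sum>K\<in>{k1..<k2}. ind K (int (fst u))) = (\<Sum>K\<in>{k1..<k2}. \<Sum>u\<in>I. ind K (int (fst u)))"
      by (rule sum.swap)
    also have "\<dots> = (\<Sum>K\<in>{k1..<k2}. if coprime K (int L) then 1 else 0)"
      unfolding ind_def I_def using inverse_pairs_sum_unit(1)[OF L] by (simp add: case_prod_unfold)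
    finally show ?thesis by (simp only: case_prod_unfold)
  qed
  define R where "R = 2 ^ card (exact_primes L) * sqrt (real (exact_part L)) * real (L div exact_part L)"
  define ga where "ga = (\<lambda>m. \<Prod>p\<in>exact_primes L. sqrt (of_int (gcd (int m) (int p))))"
  have R0: "R \<ge> 0" by (simp add: R_def)
  have ga0: "ga m \<ge> 0" for m by (auto simp: ga_def intro!: prod_nonneg)
  have H0: "1 + ln (real L) \<ge> 0" using L by (simp add: ln_ge_zero_iff Suc_leI add_nonneg_nonneg)
  have err: "(\<Sum>(x, y)\<in>I. (\<Sum>K\<in>{k1..<k2}. ind K (int x)) * be y) =
     (1 / of_nat L) * (1 / of_nat L) * (\<Sum>n<L. \<Sum>m=1..<L. Jh n * Bh m * kloosterman (- int n) (- int m * c) L)"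
  proof -
    have "(\<Sum>(x, y)\<in>I. (\<Sum>K\<in>{k1..<k2}. ind K (int x)) * be y) =
      (\<Sum>u\<in>I. (1 / of_nat L) * (1 / of_nat L) * (\<Sum>n<L. \<Sum>m=1..<L. Jh n * Bh m * (ecis L (- int n * int (fst u)) * ecis L (- int m * (c * int (snd u))))))"
    proof (unfold case_prod_unfold, intro sum.cong refl)
      fix u
      have "(\<Sum>K\<in>{k1..<k2}. ind K (int (fst u))) * be (snd u) = (1 / of_nat L) * (1 / of_nat L) *
        ((\<Sum>n<L. Jh n * ecis L (- int n * int (fst u))) * (\<Sum>m=1..<L. Bh m * ecis L (- int m * (c * int (snd u)))))"
        unfolding al be_def by (simp only: mult_ac)
      also have "((\<Sum>n<L. Jh n * ecis L (- int n * int (fst u))) * (\<Sum>m=1..<L. Bh m * ecis L (- int m * (c * int (snd u))))) =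
         (\<Sum>n<L. \<Sum>m=1..<L. Jh n * Bh m * (ecis L (- int n * int (fst u)) * ecis L (- int m * (c * int (snd u)))))"
        unfolding sum_product by (simp only: mult_ac)
      finally show "(\<Sum>K\<in>{k1..<k2}. ind K (int (fst u))) * be (snd u) = (1 / of_nat L) * (1 / of_nat L) *
         (\<Sum>n<L. \<Sum>m=1..<L. Jh n * Bh m * (ecis L (- int n * int (fst u)) * ecis L (- int m * (c * int (snd u)))))" .
    qed
    also have "\<dots> = (1 / of_nat L) * (1 / of_nat L) * (\<Sum>u\<in>I. \<Sum>n<L. \<Sum>m=1..<L. Jh n * Bh m * (ecis L (- int n * int (fst u)) * ecis L (- int m * (c * int (snd u)))))"
      by (rule sum_distrib_left[symmetric])
    also have "(\<Sum>u\<in>I. \<Sum>n<L. \<Sum>m=1..<L. Jh n * Bh m * (ecis L (- int n * int (fst u)) * ecis L (- int m * (c * int (snd u))))) =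
       (\<Sum>n<L. \<Sum>u\<in>I. \<Sum>m=1..<L. Jh n * Bh m * (ecis L (- int n * int (fst u)) * ecis L (- int m * (c * int (snd u)))))"
      by (rule sum.swap)
    also have "\<dots> = (\<Sum>n<L. \<Sum>m=1..<L. \<Sum>u\<in>I. Jh n * Bh m * (ecis L (- int n * int (fst u)) * ecis L (- int m * (c * int (snd u)))))"
      by (intro sum.cong refl sum.swap)
    also have "\<dots> = (\<Sum>n<L. \<Sum>m=1..<L. Jh n * Bh m * kloosterman (- int n) (- int m * c) L)"
      unfolding kloosterman_def I_def[symmetric] case_prod_unfold ecis_add sum_distrib_left
      by (simp only: mult.assoc)
    finally show ?thesis .
  qed
  have kl: "norm (kloosterman (- int n) (- int m * c) L) \<le> R * ga m" for n m
  proof -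
    have "\<bar>c\<bar> = 1" using c by (metis abs_mult abs_one zmult_eq_1_iff abs_minus_cancel)
    then have "gcd (- int m * c) (int p) = gcd (int m) (int p)" for p
      by (cases "c = 1") (auto simp: abs_if split: if_splits)
    then show ?thesis using kloosterman_bound[OF L, of "- int n" "- int m * c"] by (simp add: R_def ga_def)
  qed
  have Bb: "norm (Bh m) \<le> real L * (1 / real m + 1 / real (L - m))" if "m \<in> {1..<L}" for m
    unfolding Bh_def using that by (intro norm_sum_cis_interval) auto
  have refl_sum: "(\<Sum>m=1..<L. f (L - m)) = (\<Sum>m=1..<L. f m)" for f :: "nat \<Rightarrow> real"
    by (rule sum.reindex_bij_witness[of _ "\<lambda>m. L - m" "\<lambda>m. L - m"]) auto
  have ga_refl: "ga (L - m) = ga m" if "m \<in> {1..<L}" for m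
  proof -
    have "gcd (int (L - m)) (int p) = gcd (int m) (int p)" if "p \<in> exact_primes L" for p
    proof -
      have pL: "p dvd L" using that by (auto simp: exact_primes_def)
      have "gcd (int (L - m)) (int p) = gcd (int L - int m) (int p)" using \<open>m \<in> {1..<L}\<close> by (simp add: of_nat_diff)
      also have "\<dots> = gcd (- int m) (int p)"
        using pL by (intro cong_gcd_eq) (simp add: cong_iff_dvd_diff)
      finally show ?thesis by simp
    qed
    then show ?thesis by (simp add: ga_def)
  qed
  have sumB: "(\<Sum>m=1..<L. norm (Bh m) * ga m) \<le> 2 * real L * 2 ^ card (exact_primes L) * (1 + ln (real L))"
  proof -
    have "(\<Sum>m=1..<L. norm (Bh m) * ga m) \<le> (\<Sum>m=1..<L. real L * (1 / real m + 1 / real (L - m)) * ga m)"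
      by (intro sum_mono mult_right_mono Bb ga0)
    also have "\<dots> = (\<Sum>m=1..<L. real L * (ga m / real m)) + (\<Sum>m=1..<L. real L * (ga (L - m) / real (L - m)))"
      unfolding sum.distrib[symmetric] by (intro sum.cong refl) (simp add: ga_refl algebra_simps)
    also have "\<dots> = 2 * real L * (\<Sum>m=1..<L. ga m / real m)"
      using refl_sum[of "\<lambda>m. real L * (ga m / real m)"] by (simp add: sum_distrib_left mult.assoc)
    also have "\<dots> \<le> 2 * real L * (2 ^ card (exact_primes L) * (1 + ln (real L)))"
      unfolding ga_def by (intro mult_left_mono sum_prod_sqrt_gcd_le L) auto
    finally show ?thesis by (simp add: mult_ac)
  qed
  have sumJ: "(\<Sum>n<L. norm (Jh n)) \<le> real L * (1 + 2 * (1 + ln (real L)))"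
  proof -
    have "{..<L} = insert 0 {1..<L}" using L by auto
    then have "(\<Sum>n<L. norm (Jh n)) = norm (Jh 0) + (\<Sum>n=1..<L. norm (Jh n))" by simp
    also have "norm (Jh 0) \<le> real L" using J by (simp add: Jh_def)
    also have "(\<Sum>n=1..<L. norm (Jh n)) \<le> (\<Sum>n=1..<L. real L * (1 / real n + 1 / real (L - n)))"
      unfolding Jh_def by (intro sum_mono norm_sum_cis_interval) auto
    also have "\<dots> = 2 * real L * (\<Sum>n=1..<L. 1 / real n)"
      using refl_sum[of "\<lambda>m. real L * (1 / real m)"] by (simp add: sum_distrib_left ring_distribs sum.distrib)
    also have "\<dots> \<le> 2 * real L * (\<Sum>n=1..L. 1 / real n)" by (intro mult_left_mono sum_mono2) auto
    also have "\<dots> \<le> 2 * real L * (1 + ln (real L))" by (intro mult_left_mono harm_le_ln[OF L]) auto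
    finally show ?thesis by (simp add: algebra_simps)
  qed
  define x where "x = (\<Sum>K\<in>{k1..<k2}. \<Sum>b\<in>{b1..<b2}. if [b * K = c] (mod int L) then 1 else 0) -
     real (card {b1..<b2}) / real L * (\<Sum>K\<in>{k1..<k2}. if coprime K (int L) then 1 else 0)"
  have "complex_of_real x = (\<Sum>(x, y)\<in>I. (\<Sum>K\<in>{k1..<k2}. ind K (int x)) * be y)"
    using main unfolding x_def ind_def by (simp add: if_distrib[of complex_of_real] cong: if_cong)
  then have "\<bar>x\<bar> = norm ((1 / of_nat L) * (1 / of_nat L) * (\<Sum>n<L. \<Sum>m=1..<L. Jh n * Bh m * kloosterman (- int n) (- int m * c) L))"
    using err by (metis norm_of_real)
  also have "\<dots> = 1 / (real L)\<^sup>2 * norm (\<Sum>n<L. \<Sum>m=1..<L. Jh n * Bh m * kloosterman (- int n) (- int m * c) L)"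
    by (simp add: norm_mult norm_divide power2_eq_square)
  also have "\<dots> \<le> 1 / (real L)\<^sup>2 * (\<Sum>n<L. \<Sum>m=1..<L. norm (Jh n) * (norm (Bh m) * (R * ga m)))"
  proof (intro mult_left_mono order.trans[OF norm_sum] sum_mono)
    fix n m
    show "norm (Jh n * Bh m * kloosterman (- int n) (- int m * c) L) \<le> norm (Jh n) * (norm (Bh m) * (R * ga m))"
      unfolding norm_mult mult.assoc by (intro mult_left_mono kl) auto
  qed auto
  also have "(\<Sum>n<L. \<Sum>m=1..<L. norm (Jh n) * (norm (Bh m) * (R * ga m))) = (\<Sum>n<L. norm (Jh n)) * (R * (\<Sum>m=1..<L. norm (Bh m) * ga m))"
    unfolding sum_product[symmetric] by (simp only: sum_distrib_left mult_ac)
  also have "1 / (real L)\<^sup>2 * \<dots> \<le> 1 / (real L)\<^sup>2 * ((real L * (1 + 2 * (1 + ln (real L)))) * (R * (2 * real L * 2 ^ card (exact_primes L) * (1 + ln (real L)))))"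
    using R0 H0 by (intro mult_left_mono mult_mono sumJ sumB) (auto intro!: sum_nonneg mult_nonneg_nonneg ga0)
  also have "\<dots> = 2 * 2 ^ card (exact_primes L) * R * ((1 + 2 * (1 + ln (real L))) * (1 + ln (real L)))"
    using L by (simp add: power2_eq_square field_simps)
  also have "\<dots> \<le> 2 * 2 ^ card (exact_primes L) * R * (2 * (2 + ln (real L))\<^sup>2)"
    using R0 H0 L by (intro mult_left_mono) (auto simp: power2_eq_square algebra_simps)
  also have "\<dots> = discrepancy_bound L"
    by (simp add: discrepancy_bound_def R_def power_mult_distrib[symmetric] algebra_simps)
  finally show ?thesis by (simp only: x_def)
qed

section \<open>Averaging the discrepancy over the moduli\<close>

lemma four_pow_card_exact_primes_le:
  assumes "\<epsilon> > 0"
  shows "\<exists>C>0. \<forall>L>0. 4 ^ card (exact_primes L) \<le> C * real L powr \<epsilon>"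
proof -
  \<comment> \<open>A prime with \<open>p powr \<epsilon> \<ge> 4\<close> pays for its own factor 4,
    and fewer than \<open>N\<close> primes are too small for that.\<close>
  define N where "N = nat \<lceil>4 powr (1 / \<epsilon>)\<rceil>"
  have big: "4 \<le> real p powr \<epsilon>" if "N \<le> p" for p
  proof -
    have "4 powr (1 / \<epsilon>) \<le> real p" using that unfolding N_def by linarith
    then have "(4 powr (1 / \<epsilon>)) powr \<epsilon> \<le> real p powr \<epsilon>" using assms by (intro powr_mono2) auto
    then show ?thesis using assms by (simp add: powr_powr)
  qed
  have "4 ^ card (exact_primes L) \<le> 4 ^ N * real L powr \<epsilon>" if "L > 0" for L
  proof -
    define P where "P = exact_primes L"
    have P: "finite P" "\<And>p. p \<in> P \<Longrightarrow> prime p" by (auto simp: P_def exact_primes_prime)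
    have "(4::real) ^ card P = (\<Prod>p\<in>P. 4)" by simp
    also have "\<dots> \<le> (\<Prod>p\<in>P. (if p < N then 4 else 1) * real p powr \<epsilon>)"
    proof (rule prod_mono, safe)
      fix p assume "p \<in> P"
      then have "real p \<ge> 1" using P prime_gt_0_nat[of p] by (simp add: Suc_leI)
      then have "real p powr \<epsilon> \<ge> 1" using assms by (intro ge_one_powr_ge_zero) auto
      then show "4 \<le> (if p < N then 4 else 1) * real p powr \<epsilon>" using big[of p] by auto
    qed simp
    also have "\<dots> = (\<Prod>p\<in>P. if p < N then 4 else 1) * (\<Prod>p\<in>P. real p powr \<epsilon>)" by (rule prod.distrib)
    finally have 1: "(4::real) ^ card P \<le> (\<Prod>p\<in>P. if p < N then 4 else 1) * (\<Prod>p\<in>P. real p powr \<epsilon>)" .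
    have "(\<Prod>p\<in>P. if p < N then 4 else (1::real)) = 4 ^ card {p\<in>P. p < N}"
      using P(1) by (simp add: prod.If_cases Int_def)
    also have "(4::real) ^ card {p\<in>P. p < N} \<le> 4 ^ N"
    proof (rule power_increasing)
      have "card {p\<in>P. p < N} \<le> card {..<N}" by (rule card_mono) auto
      then show "card {p\<in>P. p < N} \<le> N" by simp
    qed simp
    finally have 2: "(\<Prod>p\<in>P. if p < N then 4 else (1::real)) \<le> 4 ^ N" .
    have "(\<Prod>p\<in>P. real p powr \<epsilon>) = real (exact_part L) powr \<epsilon>"
      using P(1) unfolding exact_part_def P_def[symmetric]
      by (induction P rule: finite_induct) (auto simp: powr_mult prod_nonneg)
    also have "\<dots> \<le> real L powr \<epsilon>"
      using dvd_imp_le[OF exact_part_dvd that] assms by (intro powr_mono2) auto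
    finally have 3: "(\<Prod>p\<in>P. real p powr \<epsilon>) \<le> real L powr \<epsilon>" .
    have "(\<Prod>p\<in>P. if p < N then 4 else (1::real)) * (\<Prod>p\<in>P. real p powr \<epsilon>) \<le> 4 ^ N * real L powr \<epsilon>"
      using 2 3 by (intro mult_mono) (auto intro!: prod_nonneg)
    with 1 show ?thesis unfolding P_def by linarith
  qed
  then show ?thesis by (intro exI[of _ "4 ^ N"]) auto
qed

text \<open>An even exponent goes into the square; an odd one is at least 3 and splits as
  \<open>3 + 2 * k\<close>.\<close>

lemma squarefull_decomp:
  fixes n :: nat
  assumes "n > 0" "\<And>p. prime p \<Longrightarrow> p dvd n \<Longrightarrow> p\<^sup>2 dvd n"
  shows "\<exists>b c. n = b ^ 3 * c\<^sup>2"
  using assms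
proof (induction n rule: less_induct)
  case (less n)
  show ?case
  proof (cases "n = 1")
    case True then show ?thesis by (intro exI[of _ 1]) auto
  next
    case False
    then obtain p where p: "prime p" "p dvd n" using prime_factor_nat by blast
    define e where "e = multiplicity p n"
    have "\<not> is_unit p" using p by auto
    obtain m where m: "n = p ^ e * m" "\<not> p dvd m"
      using multiplicity_decompose'[of n p] less.prems(1) \<open>\<not> is_unit p\<close> unfolding e_def by blast
    have "p\<^sup>2 dvd n" using less.prems p by blast
    then have e2: "e \<ge> 2" unfolding e_def using less.prems(1) \<open>\<not> is_unit p\<close>
      by (intro multiplicity_geI) auto
    have m0: "m > 0" using m less.prems by (auto intro: gr0I)
    have "p ^ e > 1" using e2 p prime_gt_1_nat[of p] by (intro one_less_power) auto
    then have "m < n" using m m0 by simp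
    moreover have "q\<^sup>2 dvd m" if q: "prime q" "q dvd m" for q
    proof -
      have "q \<noteq> p" using q m by auto
      then have "coprime q p" using p q by (intro primes_coprime)
      then have "coprime (q\<^sup>2) (p ^ e)" by simp
      moreover have "q\<^sup>2 dvd p ^ e * m" using less.prems(2)[of q] q m by simp
      ultimately show ?thesis by (simp add: coprime_dvd_mult_right_iff)
    qed
    ultimately obtain b c where bc: "m = b ^ 3 * c\<^sup>2" using less.IH[of m] m0 by blast
    show ?thesis
    proof (cases "even e")
      case True
      then obtain i where "e = 2 * i" by (elim evenE)
      then have "n = b ^ 3 * (c * p ^ i)\<^sup>2" using m bc by (simp add: power_mult_distrib power_mult[symmetric] mult_ac)
      then show ?thesis by blast
    next
      case False
      then obtain i where "e = 2 * i + 1" by (elim oddE)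
      moreover obtain k where "i = Suc k" using calculation e2 by (cases i) auto
      ultimately have "e = 3 + 2 * k" by simp
      then have "n = (b * p) ^ 3 * (c * p ^ k)\<^sup>2"
        using m bc by (simp add: power_mult_distrib power_mult[symmetric] power_add mult_ac)
      then show ?thesis by blast
    qed
  qed
qed

lemma cofactor_decomp:
  assumes "L > 0"
  shows "\<exists>b c. L = b ^ 3 * c\<^sup>2 * exact_part L"
proof -
  define M where "M = L div exact_part L"
  have L: "L = exact_part L * M" using exact_part_dvd[of L] by (simp add: M_def)
  have "M > 0" using assms L by (auto intro: gr0I)
  moreover have "p\<^sup>2 dvd M" if p: "prime p" "p dvd M" for p
  proof -
    have "p dvd L" using p L by (metis dvd_mult)
    have np: "p \<notin> exact_primes L" using exact_part_coprime[OF assms] p by (auto simp: M_def)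
    then have p2: "p\<^sup>2 dvd L" using \<open>p dvd L\<close> p assms by (auto simp: exact_primes_def prime_factors_dvd)
    have "coprime p (exact_part L)" unfolding exact_part_def
      using np p exact_primes_prime by (intro prod_coprime_right) (metis primes_coprime)
    then have "coprime (p\<^sup>2) (exact_part L)" by simp
    moreover have "p\<^sup>2 dvd exact_part L * M" using p2 L by simp
    ultimately show ?thesis by (simp add: coprime_dvd_mult_right_iff)
  qed
  ultimately obtain b c where "M = b ^ 3 * c\<^sup>2" using squarefull_decomp by blast
  then show ?thesis using L by (metis mult.commute)
qed

lemma sum_inverse_sqrt: "(\<Sum>l=1..n. 1 / sqrt (real l)) \<le> 2 * sqrt (real n)"
proof (induction n)
  case (Suc n)
  have "1 / sqrt (real (Suc n)) \<le> 2 * sqrt (real (Suc n)) - 2 * sqrt (real n)"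
  proof -
    define x where "x = sqrt (real (Suc n))"
    define y where "y = sqrt (real n)"
    have xy: "x > 0" "y \<ge> 0" "y \<le> x" "x * x - y * y = 1" by (auto simp: x_def y_def)
    have "1 = (x - y) * (x + y)" using xy by (simp add: algebra_simps)
    also have "\<dots> \<le> (x - y) * (2 * x)" using xy by (intro mult_left_mono) auto
    finally have "1 / x \<le> (x - y) * (2 * x) / x" using xy(1) by (intro divide_right_mono) simp_all
    also have "\<dots> = (x - y) * 2" using xy(1) by simp
    finally have "1 / x \<le> 2 * x - 2 * y" by simp
    then show ?thesis by (simp add: x_def y_def)
  qed
  then show ?case using Suc by simp
qed simp

text \<open>With \<open>l\<close> the exact part and \<open>L = b ^ 3 * c ^ 2 * l\<close>, the map
  from \<open>L\<close> to \<open>(b, c, l)\<close> is injective. The sum over \<open>l\<close> up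
  to \<open>Q / (b ^ 3 * c ^ 2)\<close> is at most \<open>2 * sqrt Q / (b * c)\<close>, and two
  harmonic sums remain. Squarefull cofactors thus cost only logarithms on average.\<close>

lemma sum_inverse_sqrt_exact_part:
  assumes "Q > 0"
  shows "(\<Sum>L=1..Q. 1 / sqrt (real (exact_part L))) \<le> 2 * sqrt (real Q) * (1 + ln (real Q))\<^sup>2"
proof -
  have "\<forall>L\<in>{1..Q}. \<exists>bc. L = fst bc ^ 3 * (snd bc)\<^sup>2 * exact_part L"
    using cofactor_decomp by fastforce
  then obtain f where f: "\<And>L. L \<in> {1..Q} \<Longrightarrow> L = fst (f L) ^ 3 * (snd (f L))\<^sup>2 * exact_part L"
    by metis
  define T where "T = (\<Union>b\<in>{1..Q}. \<Union>c\<in>{1..Q}. (\<lambda>l. ((b, c), l)) ` {1..Q div (b ^ 3 * c\<^sup>2)})"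
  define h where "h = (\<lambda>L. (f L, exact_part L))"
  have inj: "inj_on h {1..Q}"
  proof (rule inj_onI)
    fix L L' assume LL: "L \<in> {1..Q}" "L' \<in> {1..Q}" and "h L = h L'"
    then have "f L = f L'" "exact_part L = exact_part L'" by (auto simp: h_def)
    then show "L = L'" using f[OF LL(1)] f[OF LL(2)] by metis
  qed
  have sub: "h ` {1..Q} \<subseteq> T"
  proof
    fix t assume "t \<in> h ` {1..Q}"
    then obtain L where L: "L \<in> {1..Q}" "t = h L" by auto
    define b where "b = fst (f L)" define c where "c = snd (f L)"
    have e: "L = b ^ 3 * c\<^sup>2 * exact_part L" using f[OF L(1)] by (simp add: b_def c_def)
    have pos: "b > 0" "c > 0" "exact_part L > 0" using L e exact_part_pos by (auto intro!: gr0I)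
    have "b \<le> b ^ 3 * c\<^sup>2 * exact_part L" using pos by (simp add: power3_eq_cube)
    moreover have "c \<le> b ^ 3 * c\<^sup>2 * exact_part L" using pos by (simp add: power2_eq_square)
    ultimately have "b \<in> {1..Q}" "c \<in> {1..Q}" using e L pos by auto
    moreover have "exact_part L \<le> Q div (b ^ 3 * c\<^sup>2)"
      using e L pos by (simp add: less_eq_div_iff_mult_less_eq mult.commute)
    ultimately show "t \<in> T" using L pos unfolding T_def h_def
      by (intro UN_I[of b] UN_I[of c] image_eqI[of _ _ "exact_part L"]) (auto simp: b_def c_def)
  qed
  have "(\<Sum>L=1..Q. 1 / sqrt (real (exact_part L))) = (\<Sum>t\<in>h ` {1..Q}. 1 / sqrt (real (snd t)))"
    by (subst sum.reindex[OF inj]) (simp add: h_def)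
  also have "\<dots> \<le> (\<Sum>t\<in>T. 1 / sqrt (real (snd t)))"
    by (rule sum_mono2) (use sub in \<open>auto simp: T_def\<close>)
  also have "\<dots> \<le> (\<Sum>b=1..Q. \<Sum>c=1..Q. \<Sum>l=1..Q div (b ^ 3 * c\<^sup>2). 1 / sqrt (real l))"
  proof -
    have "T = (\<lambda>(b, c, l). ((b, c), l)) ` (SIGMA b:{1..Q}. SIGMA c:{1..Q}. {1..Q div (b ^ 3 * c\<^sup>2)})"
      by (force simp: T_def)
    then have "(\<Sum>t\<in>T. 1 / sqrt (real (snd t))) = (\<Sum>(b, c, l)\<in>(SIGMA b:{1..Q}. SIGMA c:{1..Q}. {1..Q div (b ^ 3 * c\<^sup>2)}). 1 / sqrt (real l))"
      by (simp add: sum.reindex inj_on_def case_prod_unfold prod_eq_iff)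
    also have "\<dots> = (\<Sum>b=1..Q. \<Sum>c=1..Q. \<Sum>l=1..Q div (b ^ 3 * c\<^sup>2). 1 / sqrt (real l))"
      by (simp add: sum.Sigma)
    finally show ?thesis by simp
  qed
  also have "\<dots> \<le> (\<Sum>b=1..Q. \<Sum>c=1..Q. 2 * sqrt (real Q) * (1 / real b * (1 / real c)))"
  proof (intro sum_mono)
    fix b c assume bc: "b \<in> {1..Q}" "c \<in> {1..Q}"
    have "(\<Sum>l=1..Q div (b ^ 3 * c\<^sup>2). 1 / sqrt (real l)) \<le> 2 * sqrt (real (Q div (b ^ 3 * c\<^sup>2)))" by (rule sum_inverse_sqrt)
    also have "real (Q div (b ^ 3 * c\<^sup>2)) \<le> real Q / real (b ^ 3 * c\<^sup>2)"
    proof -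
      have "real (Q div (b ^ 3 * c\<^sup>2) * (b ^ 3 * c\<^sup>2)) \<le> real Q" by (simp only: of_nat_le_iff div_times_less_eq_dividend)
      moreover have "real (b ^ 3 * c\<^sup>2) > 0" using bc by simp
      ultimately show ?thesis by (simp only: of_nat_mult pos_le_divide_eq)
    qed
    also have "\<dots> \<le> real Q / (real b * real c)\<^sup>2"
    proof (rule divide_left_mono)
      have "(real b * real c)\<^sup>2 * 1 \<le> (real b * real c)\<^sup>2 * real b" using bc by (intro mult_left_mono) auto
      then show "(real b * real c)\<^sup>2 \<le> real (b ^ 3 * c\<^sup>2)"
        by (simp add: power_mult_distrib power2_eq_square power3_eq_cube mult_ac)
    qed (use bc in auto)
    finally show "(\<Sum>l=1..Q div (b ^ 3 * c\<^sup>2). 1 / sqrt (real l)) \<le> 2 * sqrt (real Q) * (1 / real b * (1 / real c))"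
      by (simp add: real_sqrt_divide)
  qed
  also have "\<dots> = 2 * sqrt (real Q) * ((\<Sum>b=1..Q. 1 / real b) * (\<Sum>c=1..Q. 1 / real c))"
    unfolding sum_product by (simp only: sum_distrib_left)
  also have "\<dots> \<le> 2 * sqrt (real Q) * ((1 + ln (real Q)) * (1 + ln (real Q)))"
    using assms by (intro mult_left_mono mult_mono harm_le_ln) (auto intro!: sum_nonneg)
  finally show ?thesis by (simp add: power2_eq_square)
qed

lemma ln_powr_bound: "\<epsilon> > 0 \<Longrightarrow> (x::real) \<ge> 1 \<Longrightarrow> 2 + ln x \<le> (2 + 1 / \<epsilon>) * x powr \<epsilon>"
proof -
  assume e: "\<epsilon> > 0" and x: "x \<ge> 1"
  have "ln (x powr \<epsilon>) \<le> x powr \<epsilon> - 1" using ln_le_minus_one[of "x powr \<epsilon>"] x by simp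
  then have "\<epsilon> * ln x \<le> x powr \<epsilon>" using x by (simp add: ln_powr)
  then have "ln x \<le> 1 / \<epsilon> * x powr \<epsilon>" using e by (simp add: field_simps)
  moreover have "1 \<le> x powr \<epsilon>" using x e by (intro ge_one_powr_ge_zero) auto
  ultimately show ?thesis by (simp add: ring_distribs)
qed

lemma sum_discrepancy_bound:
  assumes "\<epsilon> > 0"
  shows "\<exists>C. \<forall>Q>0. (\<Sum>L=1..Q. discrepancy_bound L / real L) \<le> C * real Q powr (1/2 + \<epsilon>)"
proof -
  \<comment> \<open>Five factors \<open>Q powr \<delta>\<close> are spent: one on the number of
    primes, two on the squared logarithm in \<open>discrepancy_bound\<close>, two on the one in
    \<open>sum_inverse_sqrt_exact_part\<close>.\<close>
  define \<delta> where "\<delta> = \<epsilon> / 5"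
  have d: "\<delta> > 0" using assms by (simp add: \<delta>_def)
  obtain C1 where C1: "C1 > 0" "\<And>L. L > 0 \<Longrightarrow> 4 ^ card (exact_primes L) \<le> C1 * real L powr \<delta>"
    using four_pow_card_exact_primes_le[OF d] by blast
  define C2 where "C2 = 2 + 1 / \<delta>"
  have C2: "C2 > 0" using d by (simp add: C2_def add_pos_pos)
  have "(\<Sum>L=1..Q. discrepancy_bound L / real L) \<le> 8 * C1 * C2 ^ 4 * real Q powr (1/2 + \<epsilon>)" if Q: "Q > 0" for Q
  proof -
    define X0 where "X0 = real Q powr \<delta>"
    have X1: "X0 \<ge> 1" unfolding X0_def using Q d by (intro ge_one_powr_ge_zero) auto
    have lnQ: "2 + ln (real Q) \<le> C2 * X0" unfolding X0_def C2_def using Q d by (intro ln_powr_bound) auto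
    have "discrepancy_bound L / real L \<le> 4 * C1 * X0 * (C2 * X0)\<^sup>2 * (1 / sqrt (real (exact_part L)))"
      if L: "L \<in> {1..Q}" for L
    proof -
      define s where "s = real (exact_part L)"
      have s: "s > 0" using exact_part_pos by (simp add: s_def)
      have "L = exact_part L * (L div exact_part L)" using exact_part_dvd[of L] by simp
      then have Ls: "real L = s * real (L div exact_part L)" unfolding s_def by (metis of_nat_mult)
      have M: "real (L div exact_part L) > 0" using Ls L by (cases "L div exact_part L = 0") auto
      have "discrepancy_bound L / real L = 4 * 4 ^ card (exact_primes L) * (2 + ln (real L))\<^sup>2 * (sqrt s / s)"
        unfolding discrepancy_bound_def s_def[symmetric] using Ls M s by (simp add: field_simps)
      also have "sqrt s / s = 1 / sqrt s" using s by (simp add: field_simps)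
      also have "4 * 4 ^ card (exact_primes L) * (2 + ln (real L))\<^sup>2 * (1 / sqrt s) \<le> 4 * (C1 * X0) * (C2 * X0)\<^sup>2 * (1 / sqrt s)"
      proof (intro mult_right_mono mult_mono power_mono)
        have "4 ^ card (exact_primes L) \<le> C1 * real L powr \<delta>" using C1 L by auto
        also have "\<dots> \<le> C1 * X0" unfolding X0_def using C1(1) L d by (intro mult_left_mono powr_mono2) auto
        finally show "4 ^ card (exact_primes L) \<le> C1 * X0" .
        have "ln (real L) \<le> ln (real Q)" using L by (subst ln_le_cancel_iff) auto
        then show "2 + ln (real L) \<le> C2 * X0" using lnQ by linarith
        show "0 \<le> 2 + ln (real L)" using L by (simp add: add_nonneg_nonneg)
      qed (use C1(1) X1 s in auto)
      finally show ?thesis by (simp add: s_def mult_ac)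
    qed
    then have "(\<Sum>L=1..Q. discrepancy_bound L / real L) \<le> (\<Sum>L=1..Q. 4 * C1 * X0 * (C2 * X0)\<^sup>2 * (1 / sqrt (real (exact_part L))))"
      by (intro sum_mono)
    also have "\<dots> = 4 * C1 * X0 * (C2 * X0)\<^sup>2 * (\<Sum>L=1..Q. 1 / sqrt (real (exact_part L)))" by (rule sum_distrib_left[symmetric])
    also have "\<dots> \<le> 4 * C1 * X0 * (C2 * X0)\<^sup>2 * (2 * sqrt (real Q) * (C2 * X0)\<^sup>2)"
    proof (intro mult_left_mono)
      have "(1 + ln (real Q))\<^sup>2 \<le> (C2 * X0)\<^sup>2" using lnQ Q by (intro power_mono) (auto simp: add_nonneg_nonneg)
      then have "2 * sqrt (real Q) * (1 + ln (real Q))\<^sup>2 \<le> 2 * sqrt (real Q) * (C2 * X0)\<^sup>2" by (intro mult_left_mono) auto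
      then show "(\<Sum>L=1..Q. 1 / sqrt (real (exact_part L))) \<le> 2 * sqrt (real Q) * (C2 * X0)\<^sup>2"
        using sum_inverse_sqrt_exact_part[OF Q] by linarith
    qed (use C1(1) X1 in auto)
    also have "\<dots> = 8 * C1 * C2 ^ 4 * (X0 ^ 5 * sqrt (real Q))" by (simp add: power_mult_distrib power2_eq_square eval_nat_numeral mult_ac)
    also have "X0 ^ 5 * sqrt (real Q) = real Q powr (1/2 + \<epsilon>)"
    proof -
      have "X0 ^ 5 = real Q powr (5 * \<delta>)" unfolding X0_def using Q by (simp add: powr_power mult.commute)
      also have "5 * \<delta> = \<epsilon>" by (simp add: \<delta>_def)
      finally show ?thesis using Q by (simp add: powr_add powr_half_sqrt mult.commute)
    qed
    finally show ?thesis .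
  qed
  then show ?thesis by blast
qed

section \<open>Gaps and Farey neighbours\<close>

text \<open>
  Importing the algebraic closure turns \<^typ>\<open>real\<close> into a Euclidean ring, where these rules undo
  the common denominators introduced by \<open>field_simps\<close>.
\<close>
declare div_mult_self1 [simp del] div_mult_self2 [simp del] div_mult_self3 [simp del] div_mult_self4 [simp del]

section \<open>From sorted points to successors on the circle\<close>

lemma frac_frac_diff: "frac (frac x - frac y) = frac (x - y :: real)"
proof -
  have "frac (w + of_int n) = frac w" for w :: real and n by (simp add: frac_def)
  from this[of "frac x - frac y" "\<lfloor>x\<rfloor> - \<lfloor>y\<rfloor>"] show ?thesis by (simp add: frac_def[of x] frac_def[of y])
qed

lemma irrational_mult_int:
  assumes "\<alpha> \<notin> \<rat>" "k \<noteq> (0::int)"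
  shows "of_int k * \<alpha> \<noteq> of_int l"
proof
  assume "of_int k * \<alpha> = of_int l"
  then have "\<alpha> = of_int l / of_int k" using assms by (simp add: field_simps)
  then show False using assms by (simp add: Rats_divide)
qed

text \<open>The gap after a point is the least forward distance on the circle to another point. This
  eliminates sorting and the permutation: each gap is indexed by the \<open>n\<close> whose point
  starts it.\<close>

lemma big_gap_count_eq_card:
  assumes irr: "\<alpha> \<notin> \<rat>" and Q: "Q \<ge> 2"
  shows "big_gap_count lam \<alpha> Q =
    card {n. n < Q \<and> (\<forall>m<Q. m \<noteq> n \<longrightarrow> lam / real Q \<le> frac ((real m - real n) * \<alpha>))}"
proof -
  define f where "f = (\<lambda>n. frac (real n * \<alpha>))"
  define d where "d = lam / real Q"
  define xs where "xs = sorted_fracs \<alpha> Q"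
  have inj: "inj_on f {..<Q}"
  proof (rule inj_onI)
    fix m n assume "f m = f n"
    then have "real m * \<alpha> - real n * \<alpha> = of_int (\<lfloor>real m * \<alpha>\<rfloor> - \<lfloor>real n * \<alpha>\<rfloor>)"
      by (simp add: f_def frac_def)
    then have "of_int (int m - int n) * \<alpha> = of_int (\<lfloor>real m * \<alpha>\<rfloor> - \<lfloor>real n * \<alpha>\<rfloor>)"
      by (simp add: algebra_simps)
    then have "int m - int n = 0" using irrational_mult_int[OF irr] by blast
    then show "m = n" by simp
  qed
  have xs_eq: "xs = sort (map f [0..<Q])" by (simp add: xs_def sorted_fracs_def f_def)
  have len: "length xs = Q" by (simp add: xs_eq)
  have set: "set xs = f ` {..<Q}" by (auto simp: xs_eq)
  have dist: "distinct xs" unfolding xs_eq using inj by (simp add: distinct_map atLeast0LessThan)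
  have srt: "xs ! i < xs ! j" if "i < j" "j < Q" for i j
  proof -
    have "xs ! i \<le> xs ! j" using that len by (intro sorted_nth_mono) (auto simp: xs_eq)
    moreover have "xs ! i \<noteq> xs ! j" using dist that len by (auto simp: nth_eq_iff_index_eq)
    ultimately show ?thesis by simp
  qed
  have rng: "0 \<le> xs ! i" "xs ! i < 1" if "i < Q" for i
  proof -
    have "xs ! i \<in> f ` {..<Q}" using that len set by (metis nth_mem)
    then show "0 \<le> xs ! i" "xs ! i < 1" by (auto simp: f_def frac_lt_1)
  qed
  define g where "g = (\<lambda>i. (if Suc i < Q then xs ! Suc i else xs ! 0 + 1) - xs ! i)"
  have frac_up: "frac (xs ! j - xs ! i) = xs ! j - xs ! i" if "i < j" "j < Q" for i j
    using srt[OF that] rng[of i] rng[of j] that by (subst frac_eq) auto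
  have frac_down: "frac (xs ! j - xs ! i) = xs ! j - xs ! i + 1" if "j < i" "i < Q" for i j
  proof -
    have "frac (xs ! j - xs ! i) = frac (xs ! j - xs ! i + 1)" by (simp add: frac_def)
    also have "\<dots> = xs ! j - xs ! i + 1" using srt[OF that] rng[of i] rng[of j] that by (subst frac_eq) auto
    finally show ?thesis .
  qed
  have gap_iff: "d \<le> g i \<longleftrightarrow> (\<forall>j<Q. j \<noteq> i \<longrightarrow> d \<le> frac (xs ! j - xs ! i))" if i: "i < Q" for i
  proof
    assume dg: "d \<le> g i"
    show "\<forall>j<Q. j \<noteq> i \<longrightarrow> d \<le> frac (xs ! j - xs ! i)"
    proof (intro allI impI)
      fix j assume j: "j < Q" "j \<noteq> i"
      show "d \<le> frac (xs ! j - xs ! i)"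
      proof (cases "i < j")
        case True
        then have "g i = xs ! Suc i - xs ! i" using j by (simp add: g_def)
        moreover have "xs ! Suc i \<le> xs ! j" using True j srt[of "Suc i" j] by (cases "Suc i = j") auto
        ultimately show ?thesis using dg frac_up[OF True j(1)] by simp
      next
        case False
        then have ji: "j < i" using j by simp
        have "g i \<le> xs ! j + 1 - xs ! i"
        proof (cases "Suc i < Q")
          case True then show ?thesis using rng[of "Suc i"] rng[of j] j by (simp add: g_def)
        next
          case False
          have "xs ! 0 \<le> xs ! j" using srt[of 0 j] j by (cases "j = 0") auto
          then show ?thesis using False by (simp add: g_def)
        qed
        then show ?thesis using dg frac_down[OF ji i] by simp
      qed
    qed
  next
    assume all: "\<forall>j<Q. j \<noteq> i \<longrightarrow> d \<le> frac (xs ! j - xs ! i)"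
    show "d \<le> g i"
    proof (cases "Suc i < Q")
      case True
      then have "d \<le> frac (xs ! Suc i - xs ! i)" using all by auto
      then show ?thesis using frac_up[of i "Suc i"] True by (simp add: g_def)
    next
      case False
      then have "i > 0" using i Q by simp
      then have "d \<le> frac (xs ! 0 - xs ! i)" using all Q by auto
      then show ?thesis using frac_down[of 0 i] False i \<open>i > 0\<close> by (simp add: g_def)
    qed
  qed
  define P where "P = (\<lambda>v. \<forall>w\<in>set xs. w \<noteq> v \<longrightarrow> d \<le> frac (w - v))"
  have "big_gap_count lam \<alpha> Q = length (filter (\<lambda>i. d \<le> g i) [0..<Q])"
    unfolding big_gap_count_def gaps_def Let_def xs_def[symmetric] g_def[symmetric] d_def[symmetric]
    by (simp add: filter_map o_def)
  also have "\<dots> = card {i. i < Q \<and> d \<le> g i}"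
    by (subst distinct_card[symmetric]) (auto intro: arg_cong[where f = card])
  also have "{i. i < Q \<and> d \<le> g i} = {i. i < Q \<and> P (xs ! i)}"
  proof -
    have "P (xs ! i) \<longleftrightarrow> d \<le> g i" if i: "i < Q" for i
    proof -
      have "P (xs ! i) \<longleftrightarrow> (\<forall>j<Q. xs ! j \<noteq> xs ! i \<longrightarrow> d \<le> frac (xs ! j - xs ! i))"
        unfolding P_def set_conv_nth len by blast
      also have "\<dots> \<longleftrightarrow> d \<le> g i" unfolding gap_iff[OF i]
        using nth_eq_iff_index_eq[OF dist] i len by simp
      finally show ?thesis .
    qed
    then show ?thesis by blast
  qed
  also have "card {i. i < Q \<and> P (xs ! i)} = card ((\<lambda>i. xs ! i) ` {i. i < Q \<and> P (xs ! i)})"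
    by (rule card_image[symmetric]) (use dist len in \<open>auto simp: inj_on_def nth_eq_iff_index_eq\<close>)
  also have "(\<lambda>i. xs ! i) ` {i. i < Q \<and> P (xs ! i)} = f ` {n. n < Q \<and> P (f n)}"
  proof -
    have "(\<lambda>i. xs ! i) ` {i. i < Q \<and> P (xs ! i)} = {v \<in> set xs. P v}"
      using len by (auto simp: in_set_conv_nth)
    also have "\<dots> = f ` {n. n < Q \<and> P (f n)}" unfolding set by auto
    finally show ?thesis .
  qed
  also have "card \<dots> = card {n. n < Q \<and> P (f n)}"
    by (rule card_image) (rule inj_on_subset[OF inj], auto)
  also have "{n. n < Q \<and> P (f n)} = {n. n < Q \<and> (\<forall>m<Q. m \<noteq> n \<longrightarrow> d \<le> frac ((real m - real n) * \<alpha>))}"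
  proof -
    have "P (f n) \<longleftrightarrow> (\<forall>m<Q. m \<noteq> n \<longrightarrow> d \<le> frac ((real m - real n) * \<alpha>))" if n: "n < Q" for n
    proof -
      have "P (f n) \<longleftrightarrow> (\<forall>m<Q. f m \<noteq> f n \<longrightarrow> d \<le> frac (f m - f n))"
        by (auto simp: P_def set)
      also have "\<dots> \<longleftrightarrow> (\<forall>m<Q. m \<noteq> n \<longrightarrow> d \<le> frac ((real m - real n) * \<alpha>))"
        using inj_on_eq_iff[OF inj] n by (auto simp: f_def frac_frac_diff left_diff_distrib)
      finally show ?thesis .
    qed
    then show ?thesis by blast
  qed
  finally show ?thesis by (simp add: d_def)
qed

text \<open>\<open>p / q < \<alpha> < p' / q'\<close> are neighbours in the Farey sequence of order
  \<open>Q - 1\<close>: they are unimodular, and \<open>q + q' \<ge> Q\<close> says that their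
  mediant has too large a denominator. The two positive numbers at the end are gap lengths.\<close>

definition farey_pair :: "real \<Rightarrow> nat \<Rightarrow> nat \<Rightarrow> int \<Rightarrow> nat \<Rightarrow> int \<Rightarrow> bool" where
  "farey_pair \<alpha> Q q p q' p' \<longleftrightarrow> 1 \<le> q \<and> q < Q \<and> 1 \<le> q' \<and> q' < Q \<and> Q \<le> q + q' \<and>
     p' * int q - p * int q' = 1 \<and> real q * \<alpha> - of_int p > 0 \<and> of_int p' - real q' * \<alpha> > 0"

text \<open>The pair survives the step from \<open>Q\<close> to \<open>Suc Q\<close> unless its
  mediant has denominator exactly \<open>Q\<close>. In that case the mediant replaces the neighbour
  on its side of \<open>\<alpha>\<close>, and irrationality excludes equality.\<close>

lemma farey_pair_exists:
  assumes irr: "\<alpha> \<notin> \<rat>" and Q: "Q \<ge> 2"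
  shows "\<exists>q p q' p'. farey_pair \<alpha> Q q p q' p'"
  using Q
proof (induction Q rule: dec_induct)
  case base
  have "\<alpha> \<noteq> of_int \<lfloor>\<alpha>\<rfloor>" using irr by (metis Rats_of_int)
  then have "of_int \<lfloor>\<alpha>\<rfloor> < \<alpha>" "\<alpha> < of_int \<lfloor>\<alpha>\<rfloor> + 1" by linarith+
  then have "farey_pair \<alpha> 2 1 \<lfloor>\<alpha>\<rfloor> 1 (\<lfloor>\<alpha>\<rfloor> + 1)" by (auto simp: farey_pair_def)
  then show ?case by blast
next
  case (step Q)
  then obtain q p q' p' where *: "farey_pair \<alpha> Q q p q' p'" by blast
  show ?case
  proof (cases "Q < q + q'")
    case True
    then have "farey_pair \<alpha> (Suc Q) q p q' p'" using * by (auto simp: farey_pair_def)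
    then show ?thesis by blast
  next
    case False
    have "of_int (int (q + q')) * \<alpha> \<noteq> of_int (p + p')"
      using * by (intro irrational_mult_int irr) (auto simp: farey_pair_def)
    then consider "real q * \<alpha> - of_int p > of_int p' - real q' * \<alpha>" | "real q * \<alpha> - of_int p < of_int p' - real q' * \<alpha>"
      by (auto simp: algebra_simps) (metis linorder_neqE_linordered_idom)
    then show ?thesis
    proof cases
      case 1
      then have "farey_pair \<alpha> (Suc Q) (q + q') (p + p') q' p'"
        using * False by (auto simp: farey_pair_def algebra_simps)
      then show ?thesis by blast
    next
      case 2
      then have "farey_pair \<alpha> (Suc Q) q p (q + q') (p + p')"
        using * False by (auto simp: farey_pair_def algebra_simps)
      then show ?thesis by blast
    qed
  qed
qed

text \<open>By the determinant condition \<open>(q, p)\<close> and \<open>(q', p')\<close> form a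
  basis of the integer lattice.\<close>

lemma farey_coords:
  assumes "farey_pair \<alpha> Q q p q' p'"
  shows "\<exists>i j. k = i * int q + j * int q' \<and>
    of_int k * \<alpha> - of_int l = of_int i * (real q * \<alpha> - of_int p) - of_int j * (of_int p' - real q' * \<alpha>)"
proof -
  have det: "p' * int q - p * int q' = 1" using assms by (simp add: farey_pair_def)
  define i where "i = k * p' - l * int q'"
  define j where "j = l * int q - k * p"
  have "i * int q + j * int q' = k * (p' * int q - p * int q')" "i * p + j * p' = l * (p' * int q - p * int q')"
    by (simp_all add: i_def j_def algebra_simps)
  then have kl: "k = i * int q + j * int q'" "l = i * p + j * p'" unfolding det by simp_all
  have "of_int k * \<alpha> - of_int l = of_int i * (real q * \<alpha> - of_int p) - of_int j * (of_int p' - real q' * \<alpha>)"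
    unfolding kl by (simp add: algebra_simps)
  with kl(1) show ?thesis by blast
qed

text \<open>From the point \<open>n\<close> only steps \<open>k\<close> with \<open>n + k\<close> in
  \<open>{0..<Q}\<close> are possible. If \<open>i\<close> and \<open>j\<close> have the same sign,
  the step is too long because \<open>q + q' \<ge> Q\<close>; if \<open>i\<close> is positive and
  \<open>j\<close> negative, the advance is at least \<open>x + y\<close>. On the axes it is a
  multiple of \<open>x\<close> or of \<open>y\<close>, and then the step \<open>q\<close> or
  \<open>- q'\<close> is itself possible.\<close>

lemma farey_lower:
  assumes fp: "farey_pair \<alpha> Q q p q' p'" and k: "- int n \<le> k" "k < int Q - int n" "0 \<le> int n" "int n < int Q" "k \<noteq> 0"
    and z: "of_int k * \<alpha> - of_int l > 0"
  defines "x \<equiv> real q * \<alpha> - of_int p" and "y \<equiv> of_int p' - real q' * \<alpha>"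
  shows "(int n + int q < int Q \<and> of_int k * \<alpha> - of_int l \<ge> x \<and> k \<ge> int q) \<or>
    (int n \<ge> int q' \<and> of_int k * \<alpha> - of_int l \<ge> y) \<or> of_int k * \<alpha> - of_int l \<ge> x + y"
proof -
  obtain i j where ij: "k = i * int q + j * int q'" "of_int k * \<alpha> - of_int l = of_int i * x - of_int j * y"
    using farey_coords[OF fp, of k l] unfolding x_def y_def by blast
  have f: "1 \<le> int q" "int q < int Q" "1 \<le> int q'" "int q' < int Q" "int Q \<le> int q + int q'" "x > 0" "y > 0"
    using fp by (auto simp: farey_pair_def x_def y_def)
  have iq: "i \<ge> 1 \<Longrightarrow> int q \<le> i * int q" "i \<le> -1 \<Longrightarrow> i * int q \<le> - int q"
    "j \<ge> 1 \<Longrightarrow> int q' \<le> j * int q'" "j \<le> -1 \<Longrightarrow> j * int q' \<le> - int q'"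
    using f mult_right_mono[of 1 i "int q"] mult_right_mono[of i "-1" "int q"] mult_right_mono[of 1 j "int q'"] mult_right_mono[of j "-1" "int q'"] by auto
  have ix: "i \<ge> 1 \<Longrightarrow> x \<le> of_int i * x" "i \<le> 0 \<Longrightarrow> of_int i * x \<le> 0" "j \<ge> 0 \<Longrightarrow> 0 \<le> of_int j * y" "j \<le> -1 \<Longrightarrow> of_int j * y \<le> - y"
    using f mult_right_mono[of 1 "real_of_int i" x] mult_right_mono[of "real_of_int j" "-1" y]
    by (auto simp: mult_nonpos_nonneg)
  consider "i \<ge> 1" "j \<ge> 1" | "i \<le> 0" "j \<ge> 0" | "i \<le> -1" "j \<le> -1" | "i \<ge> 1" "j \<le> -1" | "i \<ge> 1" "j = 0" | "i = 0" "j \<le> -1" by linarith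
  then show ?thesis
  proof cases
    case 1 then show ?thesis using iq f k ij(1) by linarith
  next
    case 2 then show ?thesis using ix f z ij(2) by linarith
  next
    case 3 then show ?thesis using iq f k ij(1) by linarith
  next
    case 4 then show ?thesis using ix ij(2) by linarith
  next
    case 5
    then have "k \<ge> int q" using iq ij(1) by simp
    then show ?thesis using ix ij(2) 5 k by simp
  next
    case 6
    then have "k \<le> - int q'" using iq ij(1) by simp
    then show ?thesis using ix ij(2) 6 k by simp
  qed
qed

text \<open>By \<open>farey_lower\<close> at \<open>n = 0\<close> the quantity \<open>x\<close> is
  the least positive advance by forward steps, and at \<open>n = Q - 1\<close> the quantity
  \<open>y\<close> is the least by backward steps. These extremal values depend on
  \<open>\<alpha>\<close> and \<open>Q\<close> alone, and irrationality recovers the fractions from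
  them.\<close>

lemma farey_pair_unique:
  assumes irr: "\<alpha> \<notin> \<rat>" and 1: "farey_pair \<alpha> Q q p q' p'" and 2: "farey_pair \<alpha> Q r s r' s'"
  shows "q = r \<and> p = s \<and> q' = r' \<and> p' = s'"
proof -
  have le: "real q * \<alpha> - of_int p \<le> real r * \<alpha> - of_int s" "of_int p' - real q' * \<alpha> \<le> of_int s' - real r' * \<alpha>"
    if 1: "farey_pair \<alpha> Q q p q' p'" and 2: "farey_pair \<alpha> Q r s r' s'" for q p q' p' r s r' s'
  proof -
    show "real q * \<alpha> - of_int p \<le> real r * \<alpha> - of_int s"
      using farey_lower[OF 1, of 0 "int r" s] 2 1 by (auto simp: farey_pair_def)
    have "of_int (- int r') * \<alpha> - of_int (- s') > 0" using 2 by (simp add: farey_pair_def)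
    from farey_lower[OF 1, of "Q - 1" "- int r'" "- s'"] this
    show "of_int p' - real q' * \<alpha> \<le> of_int s' - real r' * \<alpha>"
      using 2 1 by (auto simp: farey_pair_def of_nat_diff)
  qed
  have "real q * \<alpha> - of_int p = real r * \<alpha> - of_int s" using le(1)[OF 1 2] le(1)[OF 2 1] by simp
  then have "of_int (int q - int r) * \<alpha> = of_int (p - s)" by (simp add: algebra_simps)
  then have qr: "int q - int r = 0" using irrational_mult_int[OF irr] by blast
  with \<open>of_int (int q - int r) * \<alpha> = of_int (p - s)\<close> have "p = s" by simp
  have "of_int p' - real q' * \<alpha> = of_int s' - real r' * \<alpha>" using le(2)[OF 1 2] le(2)[OF 2 1] by simp
  then have e: "of_int (int q' - int r') * \<alpha> = of_int (p' - s')" by (simp add: algebra_simps)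
  then have "int q' - int r' = 0" using irrational_mult_int[OF irr] by blast
  with e have "p' = s'" by simp
  show ?thesis using qr \<open>p = s\<close> \<open>p' = s'\<close> \<open>int q' - int r' = 0\<close> by simp
qed

text \<open>The three gap theorem: the successor of \<open>n\<close> is \<open>n + q\<close> if this
  is below \<open>Q\<close>, else \<open>n - q'\<close> if this is nonnegative, else
  \<open>n + q - q'\<close>. The first two cases exclude each other since
  \<open>q + q' \<ge> Q\<close>, and the three ranges have \<open>Q - q\<close>,
  \<open>Q - q'\<close> and \<open>q + q' - Q\<close> elements.\<close>

lemma three_gap_count:
  fixes lam :: real
  assumes irr: "\<alpha> \<notin> \<rat>" and Q: "Q \<ge> 3" and fp: "farey_pair \<alpha> Q q p q' p'"
  defines "x \<equiv> real q * \<alpha> - of_int p" and "y \<equiv> of_int p' - real q' * \<alpha>" and "d \<equiv> lam / real Q"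
  shows "real (big_gap_count lam \<alpha> Q) = (real Q - real q) * of_bool (d \<le> x) +
     (real Q - real q') * of_bool (d \<le> y) + (real q + real q' - real Q) * of_bool (d \<le> x + y)"
proof -
  have f: "1 \<le> q" "q < Q" "1 \<le> q'" "q' < Q" "Q \<le> q + q'" "x > 0" "y > 0" and det: "p' * int q - p * int q' = 1"
    using fp by (auto simp: farey_pair_def x_def y_def)
  have rdet: "real_of_int p' * real q - real_of_int p * real q' = 1"
    using arg_cong[OF det, of real_of_int] by simp
  have qy: "real q * y + real q' * x = 1" unfolding x_def y_def using rdet by (simp add: algebra_simps)
  \<comment> \<open>Equal denominators would both be 1 by the determinant, against
    \<open>q + q' \<ge> 3\<close>. Distinctness makes \<open>n + q - q'\<close> a different point
    and gives \<open>x + y < 1\<close>, so that no fractional part wraps around.\<close>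
  have qq: "q \<noteq> q'"
  proof
    assume "q = q'"
    then have "(p' - p) * int q = 1" using det by (simp add: algebra_simps)
    then have "int q = 1" using f by (simp add: pos_zmult_eq_1_iff_lemma zmult_eq_1_iff)
    then show False using f Q \<open>q = q'\<close> by simp
  qed
  have xy1: "x + y < 1"
  proof -
    have "q \<ge> 2 \<or> q' \<ge> 2" using qq f by linarith
    then show ?thesis
    proof
      assume "q \<ge> 2"
      then have "2 * y \<le> real q * y" using f by (intro mult_right_mono) auto
      moreover have "1 * x \<le> real q' * x" using f by (intro mult_right_mono) auto
      ultimately show ?thesis using qy f by linarith
    next
      assume "q' \<ge> 2"
      then have "2 * x \<le> real q' * x" using f by (intro mult_right_mono) auto
      moreover have "1 * y \<le> real q * y" using f by (intro mult_right_mono) auto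
      ultimately show ?thesis using qy f by linarith
    qed
  qed
  define G where "G = (\<lambda>n. if n + q < Q then x else if q' \<le> n then y else x + y)"
  have fr: "frac (of_int k * \<alpha>) = of_int k * \<alpha> - of_int l" if "0 \<le> of_int k * \<alpha> - of_int l" "of_int k * \<alpha> - of_int l < 1" for k l
    using that by (metis add_diff_cancel_left' diff_add_cancel frac_unique_iff Ints_of_int)
  have iff: "(\<forall>m<Q. m \<noteq> n \<longrightarrow> d \<le> frac ((real m - real n) * \<alpha>)) \<longleftrightarrow> d \<le> G n" if n: "n < Q" for n
  proof
    assume all: "\<forall>m<Q. m \<noteq> n \<longrightarrow> d \<le> frac ((real m - real n) * \<alpha>)"
    consider "n + q < Q" | "\<not> n + q < Q" "q' \<le> n" | "\<not> n + q < Q" "\<not> q' \<le> n" by blast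
    then show "d \<le> G n"
    proof cases
      case 1
      then have "d \<le> frac ((real (n + q) - real n) * \<alpha>)" using all f by (metis add_eq_self_zero not_one_le_zero)
      then have "d \<le> frac (of_int (int q) * \<alpha>)" by simp
      moreover have "frac (of_int (int q) * \<alpha>) = x" using fr[of "int q" p] f xy1 by (simp add: x_def)
      ultimately show ?thesis using 1 by (simp add: G_def)
    next
      case 2
      then have "n - q' < Q" "n - q' \<noteq> n" using f n by auto
      then have "d \<le> frac ((real (n - q') - real n) * \<alpha>)" using all[rule_format, of "n - q'"] by blast
      then have "d \<le> frac (of_int (- int q') * \<alpha>)" using 2 by (simp add: of_nat_diff)
      moreover have "frac (of_int (- int q') * \<alpha>) = y" using fr[of "- int q'" "- p'"] f xy1 by (simp add: y_def)
      ultimately show ?thesis using 2 by (simp add: G_def)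
    next
      case 3
      have "n + q - q' < Q" "n + q - q' \<noteq> n" using 3 f qq n by auto
      then have "d \<le> frac ((real (n + q - q') - real n) * \<alpha>)" using all by auto
      moreover have "real (n + q - q') - real n = of_int (int q - int q')" using 3 f by (simp add: of_nat_diff)
      ultimately have "d \<le> frac (of_int (int q - int q') * \<alpha>)" by simp
      moreover have "frac (of_int (int q - int q') * \<alpha>) = x + y"
        using fr[of "int q - int q'" "p - p'"] f xy1 by (simp add: x_def y_def algebra_simps)
      ultimately show ?thesis using 3 by (simp add: G_def)
    qed
  next
    assume dG: "d \<le> G n"
    show "\<forall>m<Q. m \<noteq> n \<longrightarrow> d \<le> frac ((real m - real n) * \<alpha>)"
    proof (intro allI impI)
      fix m assume m: "m < Q" "m \<noteq> n"
      define k where "k = int m - int n"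
      have k0: "k \<noteq> 0" using m by (simp add: k_def)
      have eq: "frac ((real m - real n) * \<alpha>) = of_int k * \<alpha> - of_int \<lfloor>of_int k * \<alpha>\<rfloor>" by (simp add: k_def frac_def)
      have "of_int k * \<alpha> \<noteq> of_int \<lfloor>of_int k * \<alpha>\<rfloor>" by (rule irrational_mult_int[OF irr k0])
      then have pos: "of_int k * \<alpha> - of_int \<lfloor>of_int k * \<alpha>\<rfloor> > 0" by (metis diff_gt_0_iff_gt of_int_floor_le order_le_imp_less_or_eq)
      have "(int n + int q < int Q \<and> of_int k * \<alpha> - of_int \<lfloor>of_int k * \<alpha>\<rfloor> \<ge> x \<and> k \<ge> int q) \<or>
         (int n \<ge> int q' \<and> of_int k * \<alpha> - of_int \<lfloor>of_int k * \<alpha>\<rfloor> \<ge> y) \<or> of_int k * \<alpha> - of_int \<lfloor>of_int k * \<alpha>\<rfloor> \<ge> x + y"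
        unfolding x_def y_def by (rule farey_lower[OF fp _ _ _ _ k0 pos]) (use m n in \<open>auto simp: k_def\<close>)
      moreover have "G n \<le> x + y" "int n \<ge> int q' \<Longrightarrow> G n = y" "int n + int q < int Q \<Longrightarrow> G n = x"
        using f by (auto simp: G_def)
      ultimately show "d \<le> frac ((real m - real n) * \<alpha>)" unfolding eq using dG by linarith
    qed
  qed
  define S where "S = {n. n < Q \<and> d \<le> G n}"
  define S1 where "S1 = (if d \<le> x then {..<Q - q} else {})"
  define S2 where "S2 = (if d \<le> y then {q'..<Q} else {})"
  define S3 where "S3 = (if d \<le> x + y then {Q - q..<q'} else {})"
  have S: "S = S1 \<union> S2 \<union> S3"
    unfolding S_def S1_def S2_def S3_def using f by (auto simp: G_def split: if_splits)
  have "S1 \<subseteq> {..<Q - q}" "S2 \<subseteq> {q'..<Q}" "S3 \<subseteq> {Q - q..<q'}" by (auto simp: S1_def S2_def S3_def)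
  moreover have "{..<Q - q} \<inter> {q'..<Q} = {}" "{..<Q - q} \<inter> {Q - q..<q'} = {}" "{q'..<Q} \<inter> {Q - q..<q'} = {}"
    using f by auto
  ultimately have disj: "S1 \<inter> S2 = {}" "(S1 \<union> S2) \<inter> S3 = {}" by blast+
  have fin: "finite S1" "finite S2" "finite S3" by (auto simp: S1_def S2_def S3_def)
  have "{n. n < Q \<and> (\<forall>m<Q. m \<noteq> n \<longrightarrow> d \<le> frac ((real m - real n) * \<alpha>))} = S"
    unfolding S_def using iff by blast
  then have "big_gap_count lam \<alpha> Q = card S"
    using big_gap_count_eq_card[OF irr, of Q lam] Q unfolding d_def[symmetric] by simp
  also have "\<dots> = card S1 + card S2 + card S3"
    unfolding S using disj fin by (simp add: card_Un_disjoint)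
  finally have "real (big_gap_count lam \<alpha> Q) = real (card S1) + real (card S2) + real (card S3)" by simp
  moreover have "real (card S1) = (real Q - real q) * of_bool (d \<le> x)" using f by (simp add: S1_def of_nat_diff)
  moreover have "real (card S2) = (real Q - real q') * of_bool (d \<le> y)" using f by (simp add: S2_def of_nat_diff)
  moreover have "real (card S3) = (real q + real q' - real Q) * of_bool (d \<le> x + y)" using f by (simp add: S3_def of_nat_diff)
  ultimately show ?thesis by simp
qed

text \<open>
  Below, \<open>L < K\<close> are the denominators of a Farey pair of order \<open>Q - 1\<close>, \<open>b / L\<close> is the endpoint with
  the smaller denominator, and \<open>s\<close> tells on which side of \<open>\<alpha>\<close> it lies.
\<close>

definition gap_weight :: "nat \<Rightarrow> real \<Rightarrow> nat \<Rightarrow> int \<Rightarrow> real \<Rightarrow> real" where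
  "gap_weight Q d L K u = of_bool (0 < u \<and> of_int K * u < 1) *
     ((real Q - real L) * of_bool (d \<le> u) + (real Q - of_int K) * of_bool (d \<le> (1 - of_int K * u) / real L) +
      (of_int K + real L - real Q) * of_bool (d \<le> u + (1 - of_int K * u) / real L)) / real Q"

definition larger_denoms :: "nat \<Rightarrow> nat \<Rightarrow> int set" where
  "larger_denoms Q L = {max (int Q - int L) (int L + 1)..<int Q}"

text \<open>\<open>R L\<close> is a finite range of numerators, later chosen to contain those of all
  arcs that meet the window.\<close>

definition gap_index :: "nat \<Rightarrow> (nat \<Rightarrow> int set) \<Rightarrow> (int \<times> nat \<times> int \<times> int) set" where
  "gap_index Q R = (SIGMA s:{1, -1}. SIGMA L:{1..<Q}. SIGMA K:larger_denoms Q L. R L)"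

text \<open>The congruence is the solvability of the determinant equation for the missing numerator,
  and the bounds on \<open>u\<close> place \<open>\<alpha>\<close> between the two
  fractions.\<close>

lemma gap_index_farey:
  assumes "(s, L, K, b) \<in> gap_index Q R" and c: "[b * K = - s] (mod int L)"
    and u: "0 < of_int s * (real L * \<alpha> - of_int b)" "of_int K * (of_int s * (real L * \<alpha> - of_int b)) < 1"
  shows "s = 1 \<Longrightarrow> \<exists>p'. farey_pair \<alpha> Q L b (nat K) p' \<and> of_int p' - real (nat K) * \<alpha> = (1 - of_int K * (real L * \<alpha> - of_int b)) / real L"
    "s = -1 \<Longrightarrow> \<exists>p. farey_pair \<alpha> Q (nat K) p L b \<and> real (nat K) * \<alpha> - of_int p = (1 - of_int K * (of_int b - real L * \<alpha>)) / real L"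
proof -
  have LK: "1 \<le> L" "int L < K" "K < int Q" "int Q \<le> K + int L" "L < Q"
    using assms(1) by (auto simp: gap_index_def larger_denoms_def)
  then have K: "K = int (nat K)" by simp
  have L0: "real L > 0" using LK by simp
  { assume s: "s = 1"
    have "[b * K - (- 1) = 0] (mod int L)" using c s by (simp add: cong_iff_dvd_diff)
    then have "int L dvd 1 + b * K" by (simp add: cong_iff_dvd_diff add.commute)
    then obtain p' where p': "1 + b * K = int L * p'" by (elim dvdE)
    have "real_of_int (1 + b * K) = real_of_int (int L * p')" using p' by simp
    then have rp: "1 + of_int b * of_int K = real L * of_int p'" by simp
    have v: "of_int p' - of_int K * \<alpha> = (1 - of_int K * (real L * \<alpha> - of_int b)) / real L"
      using rp L0 by (simp add: field_simps)
    have "of_int p' - of_int K * \<alpha> > 0" unfolding v using u s L0 by (simp add: field_simps)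
    then have "farey_pair \<alpha> Q L b (nat K) p'"
      unfolding farey_pair_def using LK p' u s K by (auto simp: algebra_simps of_nat_nat)
    then show "\<exists>p'. farey_pair \<alpha> Q L b (nat K) p' \<and> of_int p' - real (nat K) * \<alpha> = (1 - of_int K * (real L * \<alpha> - of_int b)) / real L"
      using v LK by (intro exI[of _ p']) (simp add: of_nat_nat) }
  { assume s: "s = -1"
    have "int L dvd b * K - 1" using c s by (simp add: cong_iff_dvd_diff)
    then obtain p where p: "b * K - 1 = int L * p" by (elim dvdE)
    have "real_of_int (b * K - 1) = real_of_int (int L * p)" using p by simp
    then have rp: "of_int b * of_int K - 1 = real L * of_int p" by simp
    have v: "of_int K * \<alpha> - of_int p = (1 - of_int K * (of_int b - real L * \<alpha>)) / real L"
      using rp L0 by (simp add: field_simps)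
    have "of_int K * \<alpha> - of_int p > 0" unfolding v using u s L0 by (simp add: field_simps)
    then have "farey_pair \<alpha> Q (nat K) p L b"
      unfolding farey_pair_def using LK p u s K by (auto simp: algebra_simps of_nat_nat)
    then show "\<exists>p. farey_pair \<alpha> Q (nat K) p L b \<and> real (nat K) * \<alpha> - of_int p = (1 - of_int K * (of_int b - real L * \<alpha>)) / real L"
      using v LK by (intro exI[of _ p]) (simp add: of_nat_nat) }
qed

text \<open>Existence and uniqueness of the Farey pair leave a single index \<open>T\<close> that
  can contribute, and its term is the three gap count. A finite sum over explicit arcs can then be
  integrated termwise.\<close>

lemma gap_count_as_sum:
  assumes irr: "\<alpha> \<notin> \<rat>" and Q: "Q \<ge> 3" and fin: "\<And>L. finite (R L)"
    and R: "\<And>L b. L \<in> {1..<Q} \<Longrightarrow> \<bar>real L * \<alpha> - of_int b\<bar> < 1 \<Longrightarrow> b \<in> R L"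
  shows "real (big_gap_count lam \<alpha> Q) / real Q =
    (\<Sum>(s, L, K, b)\<in>gap_index Q R. of_bool ([b * K = - s] (mod int L)) *
       gap_weight Q (lam / real Q) L K (of_int s * (real L * \<alpha> - of_int b)))"
proof -
  define d where "d = lam / real Q"
  obtain q p q' p' where fp: "farey_pair \<alpha> Q q p q' p'" using farey_pair_exists[OF irr, of Q] Q by auto
  define x where "x = real q * \<alpha> - of_int p"
  define y where "y = of_int p' - real q' * \<alpha>"
  have f: "1 \<le> q" "q < Q" "1 \<le> q'" "q' < Q" "Q \<le> q + q'" "x > 0" "y > 0" and det: "p' * int q - p * int q' = 1"
    using fp by (auto simp: farey_pair_def x_def y_def)
  have rdet: "real_of_int p' * real q - real_of_int p * real q' = 1"
    using arg_cong[OF det, of real_of_int] by simp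
  have qy: "real q * y + real q' * x = 1" unfolding x_def y_def using rdet by (simp add: algebra_simps)
  have qq: "q \<noteq> q'"
  proof
    assume "q = q'"
    then have "(p' - p) * int q = 1" using det by (simp add: algebra_simps)
    then have "int q = 1" using f by (simp add: zmult_eq_1_iff)
    then show False using f Q \<open>q = q'\<close> by simp
  qed
  have cnt: "real (big_gap_count lam \<alpha> Q) = (real Q - real q) * of_bool (d \<le> x) +
     (real Q - real q') * of_bool (d \<le> y) + (real q + real q' - real Q) * of_bool (d \<le> x + y)"
    unfolding d_def x_def y_def by (rule three_gap_count[OF irr Q fp])
  define T where "T = (if q < q' then (1 :: int, q, int q', p) else (-1, q', int q, p'))"
  define val where "val = (\<lambda>(s, L, K, b). of_bool ([b * K = - s] (mod int L)) *
       gap_weight Q d L K (of_int s * (real L * \<alpha> - of_int b)))"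
  have fini: "finite (gap_index Q R)" unfolding gap_index_def using fin by (auto simp: larger_denoms_def)
  have x1: "real q' * x < 1" "real q * y < 1" 
  proof -
    have "real q * y > 0" "real q' * x > 0" using f by simp_all
    then show "real q' * x < 1" "real q * y < 1" using qy by linarith+
  qed
  have "x \<le> real q' * x" "y \<le> real q * y" using f by (simp_all add: mult_le_cancel_right1)
  then have xy1: "x < 1" "y < 1" using x1 by linarith+
  have Tin: "T \<in> gap_index Q R"
  proof -
    have "\<bar>real q * \<alpha> - of_int p\<bar> < 1" using f xy1 unfolding x_def[symmetric] by simp
    then have 1: "p \<in> R q" using f by (intro R) auto
    have "real q' * \<alpha> - of_int p' = - y" by (simp add: y_def)
    then have "\<bar>real q' * \<alpha> - of_int p'\<bar> < 1" using f xy1 by simp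
    then have 2: "p' \<in> R q'" using f by (intro R) auto
    show ?thesis
    proof (cases "q < q'")
      case True
      then show ?thesis unfolding T_def gap_index_def larger_denoms_def using 1 f by simp
    next
      case False
      then show ?thesis unfolding T_def gap_index_def larger_denoms_def using 2 f qq by simp
    qed
  qed
  have valT: "val T = real (big_gap_count lam \<alpha> Q) / real Q"
  proof (cases "q < q'")
    case True
    have "p * int q' - (- 1) = p' * int q" using det by simp
    then have "[p * int q' = - 1] (mod int q)" unfolding cong_iff_dvd_diff by (metis dvd_triv_right)
    moreover have v: "(1 - real q' * x) / real q = y" using qy f by (simp add: field_simps)
    have "gap_weight Q d q (int q') x = real (big_gap_count lam \<alpha> Q) / real Q"
      unfolding gap_weight_def cnt of_int_of_nat_eq v using f x1 by (simp add: add.commute[of "real q'"])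
    ultimately show ?thesis using True unfolding T_def val_def x_def by simp
  next
    case False
    have "p' * int q - 1 = p * int q'" using det by simp
    then have "[p' * int q = 1] (mod int q')" unfolding cong_iff_dvd_diff by (metis dvd_triv_right)
    moreover have v: "(1 - real q * y) / real q' = x" using qy f by (simp add: field_simps)
    have "gap_weight Q d q' (int q) y = real (big_gap_count lam \<alpha> Q) / real Q"
      unfolding gap_weight_def cnt of_int_of_nat_eq v using f x1 by (simp add: add.commute[of y] add.commute[of "(real Q - real q') * _"])
    ultimately show ?thesis using False unfolding T_def val_def y_def by simp
  qed
  have val0: "val t = 0" if t: "t \<in> gap_index Q R" "t \<noteq> T" for t
  proof (rule ccontr)
    assume nz: "val t \<noteq> 0"
    obtain s L K b where e: "t = (s, L, K, b)" by (metis prod.exhaust)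
    have c: "[b * K = - s] (mod int L)" "0 < of_int s * (real L * \<alpha> - of_int b)" "of_int K * (of_int s * (real L * \<alpha> - of_int b)) < 1"
      using nz unfolding e val_def gap_weight_def by (auto split: if_splits)
    have LK: "s = 1 \<or> s = -1" "int L < K" using t(1) by (auto simp: e gap_index_def larger_denoms_def)
    from LK(1) show False
    proof
      assume s: "s = 1"
      from gap_index_farey(1)[OF t(1)[unfolded e] c s] obtain r where "farey_pair \<alpha> Q L b (nat K) r" by blast
      from farey_pair_unique[OF irr fp this] have "q = L" "p = b" "q' = nat K" by auto
      then have "t = T" using LK s by (simp add: T_def e)
      with t(2) show False ..
    next
      assume s: "s = -1"
      from gap_index_farey(2)[OF t(1)[unfolded e] c s] obtain r where "farey_pair \<alpha> Q (nat K) r L b" by blast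
      from farey_pair_unique[OF irr fp this] have "q = nat K" "p' = b" "q' = L" by auto
      then have "t = T" using LK s by (auto simp: T_def e)
      with t(2) show False ..
    qed
  qed
  have "(\<Sum>t\<in>gap_index Q R. val t) = val T + (\<Sum>t\<in>gap_index Q R - {T}. val t)"
    by (rule sum.remove[OF fini Tin])
  also have "(\<Sum>t\<in>gap_index Q R - {T}. val t) = 0" using val0 by (intro sum.neutral) auto
  finally show ?thesis using valT by (simp add: val_def d_def)
qed

text \<open>The integral of \<open>gap_weight\<close> over one whole arc; dividing by
  \<open>L\<close> is the Jacobian of passing from \<open>\<alpha>\<close> to \<open>u\<close>. With
  \<open>c = max 0 (1 - d * L)\<close> the last quotient is
  \<open>min (1 / K) (c / (K - L))\<close>, the length of the range of \<open>u\<close> in which the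
  sum of the two gaps is at least \<open>d\<close>.\<close>

definition gap_mass :: "nat \<Rightarrow> real \<Rightarrow> nat \<Rightarrow> int \<Rightarrow> real" where
  "gap_mass Q d L K = ((real Q - real L) * max 0 (1 / of_int K - d) +
      (real Q - of_int K) * (max 0 (1 - d * real L) / of_int K) +
      (of_int K + real L - real Q) * (max 0 (1 - d * real L) / max (max 0 (1 - d * real L) * of_int K) (of_int K - real L)))
     / (real Q * real L)"

section \<open>Integrals over single arcs\<close>

lemma has_integral_of_bool_Icc:
  fixes \<beta> \<gamma> c1 c2 :: real
  shows "((\<lambda>\<alpha>. of_bool (c1 \<le> \<alpha> \<and> \<alpha> \<le> c2)) has_integral max 0 (min c2 \<gamma> - max c1 \<beta>)) {\<beta>..\<gamma>}"
proof -
  have "((\<lambda>x. 1 :: real) has_integral max 0 (min c2 \<gamma> - max c1 \<beta>)) ({c1..c2} \<inter> {\<beta>..\<gamma>})"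
  proof (cases "max c1 \<beta> \<le> min c2 \<gamma>")
    case True
    have "((\<lambda>x. 1 :: real) has_integral (min c2 \<gamma> - max c1 \<beta>)) {max c1 \<beta>..min c2 \<gamma>}"
      using has_integral_const_real[of "1::real" "max c1 \<beta>" "min c2 \<gamma>"] True by simp
    moreover have "{c1..c2} \<inter> {\<beta>..\<gamma>} = {max c1 \<beta>..min c2 \<gamma>}" by auto
    ultimately show ?thesis using True by simp
  next
    case False
    then have "{c1..c2} \<inter> {\<beta>..\<gamma>} = {}" by auto
    moreover have "max 0 (min c2 \<gamma> - max c1 \<beta>) = 0" using False by (auto simp: min_def max_def)
    ultimately show ?thesis by (metis has_integral_empty)
  qed
  then have "((\<lambda>x. if x \<in> {c1..c2} then 1 else 0 :: real) has_integral max 0 (min c2 \<gamma> - max c1 \<beta>)) {\<beta>..\<gamma>}"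
    by (subst has_integral_restrict_Int)
  then show ?thesis by (rule has_integral_eq[rotated]) auto
qed

text \<open>The range of \<open>u\<close> is an interval inside \<open>{0..1}\<close>, so in terms
  of \<open>\<alpha>\<close> it stays within \<open>1 / L\<close> of \<open>b / L\<close>. If
  \<open>b\<close> is at distance at least 1 from both \<open>L * \<beta>\<close> and
  \<open>L * \<gamma>\<close>, that interval lies entirely inside or entirely outside the
  window.\<close>

lemma has_integral_of_bool_affine:
  fixes s b :: int
  assumes s: "s = 1 \<or> s = -1" and L: "L > 0" and lo: "0 \<le> lo" and hi: "hi \<le> 1" and \<beta>\<gamma>: "\<beta> \<le> \<gamma>"
  shows "\<exists>I. ((\<lambda>\<alpha>. of_bool (lo \<le> of_int s * (real L * \<alpha> - of_int b) \<and> of_int s * (real L * \<alpha> - of_int b) \<le> hi)) has_integral I) {\<beta>..\<gamma>} \<and>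
    0 \<le> I \<and> I \<le> max 0 (hi - lo) / real L \<and>
    (1 \<le> \<bar>of_int b - real L * \<beta>\<bar> \<longrightarrow> 1 \<le> \<bar>of_int b - real L * \<gamma>\<bar> \<longrightarrow>
      I = (if real L * \<beta> \<le> of_int b \<and> of_int b < real L * \<gamma> then max 0 (hi - lo) / real L else 0))"
proof -
  define c1 where "c1 = (if s = 1 then (of_int b + lo) / real L else (of_int b - hi) / real L)"
  define c2 where "c2 = (if s = 1 then (of_int b + hi) / real L else (of_int b - lo) / real L)"
  have L0: "real L > 0" using L by simp
  have iff: "lo \<le> of_int s * (real L * \<alpha> - of_int b) \<and> of_int s * (real L * \<alpha> - of_int b) \<le> hi \<longleftrightarrow> c1 \<le> \<alpha> \<and> \<alpha> \<le> c2" for \<alpha>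
    using s L0 by (auto simp: c1_def c2_def field_simps)
  have len: "c2 - c1 = (hi - lo) / real L" using s by (auto simp: c1_def c2_def diff_divide_distrib add_divide_distrib)
  define I where "I = max 0 (min c2 \<gamma> - max c1 \<beta>)"
  have hI: "((\<lambda>\<alpha>. of_bool (lo \<le> of_int s * (real L * \<alpha> - of_int b) \<and> of_int s * (real L * \<alpha> - of_int b) \<le> hi)) has_integral I) {\<beta>..\<gamma>}"
    unfolding iff I_def by (rule has_integral_of_bool_Icc)
  have mx: "max 0 (hi - lo) / real L = max 0 (c2 - c1)" unfolding len using L0 by (auto simp: max_def field_simps)
  have le: "I \<le> max 0 (hi - lo) / real L" unfolding mx I_def by (auto simp: min_def max_def)
  have "I = (if real L * \<beta> \<le> of_int b \<and> of_int b < real L * \<gamma> then max 0 (hi - lo) / real L else 0)"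
    if far: "1 \<le> \<bar>of_int b - real L * \<beta>\<bar>" "1 \<le> \<bar>of_int b - real L * \<gamma>\<bar>"
  proof (cases "lo \<le> hi")
    case False
    then have "(hi - lo) / real L < 0" using L0 by (intro divide_neg_pos) auto
    then have "c2 < c1" using len by linarith
    then have "I = 0" unfolding I_def by (auto simp: min_def max_def)
    then show ?thesis using False by (simp add: max_def)
  next
    case True
    have c: "(of_int b - 1) / real L \<le> c1" "c2 \<le> (of_int b + 1) / real L" "c1 \<le> c2"
      using s lo hi True L0 by (auto simp: c1_def c2_def divide_right_mono)
    show ?thesis
    proof (cases "real L * \<beta> \<le> of_int b \<and> of_int b < real L * \<gamma>")
      case T: True
      then have "real L * \<beta> \<le> of_int b - 1" "of_int b + 1 \<le> real L * \<gamma>" using far by auto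
      then have "\<beta> \<le> (of_int b - 1) / real L" "(of_int b + 1) / real L \<le> \<gamma>" using L0 by (simp_all add: field_simps)
      then have "\<beta> \<le> c1" "c2 \<le> \<gamma>" using c by linarith+
      then show ?thesis using T unfolding mx I_def by (auto simp: min_def max_def)
    next
      case F: False
      then have "of_int b + 1 \<le> real L * \<beta> \<or> real L * \<gamma> \<le> of_int b - 1" using far by auto
      then have "(of_int b + 1) / real L \<le> \<beta> \<or> \<gamma> \<le> (of_int b - 1) / real L" using L0 by (simp add: field_simps)
      then have "c2 \<le> \<beta> \<or> \<gamma> \<le> c1" using c by linarith
      then have "I = 0" unfolding I_def using c(3) \<beta>\<gamma> by (auto simp: min_def max_def)
      then show ?thesis using F by (simp only: if_False)
    qed
  qed
  then show ?thesis using hI le by (intro exI[of _ I]) (auto simp: I_def)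
qed

lemma gap_weight_has_integral:
  fixes s b :: int
  assumes s: "s = 1 \<or> s = -1" and L: "L \<in> {1..<Q}" and K: "K \<in> larger_denoms Q L" and d: "d \<ge> 0" and \<beta>\<gamma>: "\<beta> \<le> \<gamma>"
  shows "\<exists>I. ((\<lambda>\<alpha>. gap_weight Q d L K (of_int s * (real L * \<alpha> - of_int b))) has_integral I) {\<beta>..\<gamma>} \<and>
     0 \<le> I \<and> I \<le> gap_mass Q d L K \<and>
     (1 \<le> \<bar>of_int b - real L * \<beta>\<bar> \<longrightarrow> 1 \<le> \<bar>of_int b - real L * \<gamma>\<bar> \<longrightarrow>
      I = (if real L * \<beta> \<le> of_int b \<and> of_int b < real L * \<gamma> then gap_mass Q d L K else 0))"
proof -
  have LK: "1 \<le> L" "int L < K" "K < int Q" "int Q \<le> K + int L" "L < Q"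
    using L K by (auto simp: larger_denoms_def)
  define k where "k = real_of_int K"
  define l where "l = real L"
  define N where "N = real Q"
  have r: "1 \<le> l" "l < k" "k < N" "N \<le> k + l"
    using LK unfolding k_def l_def N_def by (auto simp: of_int_less_iff[symmetric] simp del: of_int_less_iff)
  define c where "c = max 0 (1 - d * l)"
  define m1 where "m1 = max 0 (1 / k - d)"
  define m2 where "m2 = c / k"
  define m3 where "m3 = c / max (c * k) (k - l)"
  have k1: "1 / k \<le> 1" using r by simp
  have c01: "0 \<le> c" "c \<le> 1" using d r by (auto simp: c_def)
  have m2: "0 \<le> m2" "m2 \<le> 1 / k" using c01 r by (auto simp: m2_def divide_right_mono)
  have m3: "0 \<le> m3" "m3 \<le> 1 / k"
  proof -
    show "0 \<le> m3" using c01 r by (auto simp: m3_def intro!: divide_nonneg_nonneg)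
    show "m3 \<le> 1 / k"
    proof (cases "c = 0")
      case False
      then have "c / max (c * k) (k - l) \<le> c / (c * k)" using c01 r by (intro divide_left_mono) (auto simp: max_def)
      then show ?thesis using False by (simp add: m3_def)
    qed (use r in \<open>simp add: m3_def\<close>)
  qed
  let ?u = "\<lambda>\<alpha>. of_int s * (real L * \<alpha> - of_int b)"
  let ?b = "\<lambda>lo hi \<alpha>. of_bool (lo \<le> ?u \<alpha> \<and> ?u \<alpha> \<le> hi) :: real"
  have far_mx: "max 0 (m2 - 0) = m2" "max 0 (m3 - 0) = m3" "max 0 (1 / k - d) = m1" using m2 m3 by (auto simp: m1_def)
  obtain I1 where I1: "(?b d (1 / k) has_integral I1) {\<beta>..\<gamma>}" "0 \<le> I1" "I1 \<le> m1 / l"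
    "1 \<le> \<bar>of_int b - real L * \<beta>\<bar> \<Longrightarrow> 1 \<le> \<bar>of_int b - real L * \<gamma>\<bar> \<Longrightarrow> I1 = (if real L * \<beta> \<le> of_int b \<and> of_int b < real L * \<gamma> then m1 / l else 0)"
    using has_integral_of_bool_affine[OF s _ d k1 \<beta>\<gamma>, of L b] LK unfolding l_def m1_def by auto
  obtain I2 where I2: "(?b 0 m2 has_integral I2) {\<beta>..\<gamma>}" "0 \<le> I2" "I2 \<le> m2 / l"
    "1 \<le> \<bar>of_int b - real L * \<beta>\<bar> \<Longrightarrow> 1 \<le> \<bar>of_int b - real L * \<gamma>\<bar> \<Longrightarrow> I2 = (if real L * \<beta> \<le> of_int b \<and> of_int b < real L * \<gamma> then m2 / l else 0)"
    using has_integral_of_bool_affine[OF s _ order.refl _ \<beta>\<gamma>, of L m2 b] LK m2 k1 far_mx unfolding l_def by auto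
  obtain I3 where I3: "(?b 0 m3 has_integral I3) {\<beta>..\<gamma>}" "0 \<le> I3" "I3 \<le> m3 / l"
    "1 \<le> \<bar>of_int b - real L * \<beta>\<bar> \<Longrightarrow> 1 \<le> \<bar>of_int b - real L * \<gamma>\<bar> \<Longrightarrow> I3 = (if real L * \<beta> \<le> of_int b \<and> of_int b < real L * \<gamma> then m3 / l else 0)"
    using has_integral_of_bool_affine[OF s _ order.refl _ \<beta>\<gamma>, of L m3 b] LK m3 k1 far_mx unfolding l_def by auto
  define I where "I = ((N - l) * I1 + (N - k) * I2 + (k + l - N) * I3) / N"
  have hI0: "((\<lambda>\<alpha>. ((N - l) * ?b d (1 / k) \<alpha> + (N - k) * ?b 0 m2 \<alpha> + (k + l - N) * ?b 0 m3 \<alpha>) / N) has_integral I) {\<beta>..\<gamma>}"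
    unfolding I_def by (intro has_integral_divide has_integral_add has_integral_mult_right I1 I2 I3)
  \<comment> \<open>Off the two ends of the arc, each of the three thresholds cuts out an initial or
    final segment of \<open>{0..1 / k}\<close>. The exceptional points are absorbed by
    \<open>has_integral_spike_finite\<close>.\<close>
  have weight: "gap_weight Q d L K u = ((N - l) * of_bool (d \<le> u \<and> u \<le> 1 / k) + (N - k) * of_bool (0 \<le> u \<and> u \<le> m2) + (k + l - N) * of_bool (0 \<le> u \<and> u \<le> m3)) / N"
    if u: "u \<noteq> 0" "u \<noteq> 1 / k" for u
  proof -
    have inside: "0 < u \<and> k * u < 1 \<longleftrightarrow> 0 < u \<and> u < 1 / k" using r by (auto simp: field_simps)
    show ?thesis
    proof (cases "0 < u \<and> u < 1 / k")
      case False
      then have n: "(0 < u \<and> u < 1 / k) = False" "(d \<le> u \<and> u \<le> 1 / k) = False"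
        "(0 \<le> u \<and> u \<le> m2) = False" "(0 \<le> u \<and> u \<le> m3) = False"
        using u d m2 m3 by auto
      show ?thesis unfolding gap_weight_def k_def[symmetric] inside n by simp
    next
      case True
      have e1: "(d \<le> u \<and> u \<le> 1 / k) = (d \<le> u)" "(0 < u \<and> u < 1 / k) = True" using True by auto
      have e2: "d \<le> (1 - k * u) / l \<longleftrightarrow> 0 \<le> u \<and> u \<le> m2"
      proof -
        have "d \<le> (1 - k * u) / l \<longleftrightarrow> k * u \<le> 1 - d * l" using r by (auto simp: field_simps)
        also have "\<dots> \<longleftrightarrow> k * u \<le> c" using True r by (auto simp: c_def max_def) (smt (verit) mult_pos_pos)
        also have "\<dots> \<longleftrightarrow> 0 \<le> u \<and> u \<le> m2" using True r by (auto simp: m2_def field_simps)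
        finally show ?thesis .
      qed
      have e3: "d \<le> u + (1 - k * u) / l \<longleftrightarrow> 0 \<le> u \<and> u \<le> m3"
      proof -
        have "d \<le> u + (1 - k * u) / l \<longleftrightarrow> (k - l) * u \<le> 1 - d * l" using r by (auto simp: field_simps)
        also have "\<dots> \<longleftrightarrow> (k - l) * u \<le> c" using True r by (auto simp: c_def max_def) (smt (verit) mult_pos_pos)
        also have "\<dots> \<longleftrightarrow> u * max (c * k) (k - l) \<le> c"
        proof -
          have "u * (c * k) \<le> c"
          proof -
            have "(u * k) * c \<le> 1 * c" using True r c01 by (intro mult_right_mono) (auto simp: field_simps)
            then show ?thesis by (simp add: mult_ac)
          qed
          moreover have "u * (k - l) \<le> u * (c * k)" if "k - l \<le> c * k" using that True by (intro mult_left_mono) auto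
          ultimately show ?thesis by (auto simp: max_def mult.commute[of "k - l"])
        qed
        also have "\<dots> \<longleftrightarrow> 0 \<le> u \<and> u \<le> m3" using True r by (auto simp: m3_def le_divide_eq max_def)
        finally show ?thesis .
      qed
      show ?thesis unfolding gap_weight_def k_def[symmetric] inside l_def[symmetric] N_def[symmetric] e1 e2 e3 by simp
    qed
  qed
  have spike: "gap_weight Q d L K (?u \<alpha>) = ((N - l) * ?b d (1 / k) \<alpha> + (N - k) * ?b 0 m2 \<alpha> + (k + l - N) * ?b 0 m3 \<alpha>) / N"
    if "\<alpha> \<in> {\<beta>..\<gamma>} - {of_int b / l, (of_int b + of_int s / k) / l}" for \<alpha>
  proof -
    have key: "\<alpha> = (of_int b + of_int s * v) / l" if v: "?u \<alpha> = v" for v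
    proof -
      have "of_int s * v = (of_int s * of_int s) * (l * \<alpha> - of_int b)" unfolding v[symmetric] l_def by (simp only: mult.assoc)
      also have "of_int s * of_int s = (1 :: real)" using s by auto
      finally have "\<alpha> * l = of_int b + of_int s * v" by (simp add: mult.commute)
      then show ?thesis using r(1) by (simp add: nonzero_eq_divide_eq)
    qed
    have "?u \<alpha> \<noteq> 0" using key[of 0] that by auto
    moreover have "?u \<alpha> \<noteq> 1 / k" using key[of "1 / k"] that by auto
    ultimately show ?thesis by (rule weight)
  qed
  have hI: "((\<lambda>\<alpha>. gap_weight Q d L K (?u \<alpha>)) has_integral I) {\<beta>..\<gamma>}"
    by (rule has_integral_spike_finite[of "{of_int b / l, (of_int b + of_int s / k) / l}", OF _ spike hI0]) simp_all
  have mass: "gap_mass Q d L K = ((N - l) * (m1 / l) + (N - k) * (m2 / l) + (k + l - N) * (m3 / l)) / N"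
  proof -
    have "gap_mass Q d L K = ((N - l) * m1 + (N - k) * m2 + (k + l - N) * m3) / (N * l)"
      unfolding gap_mass_def k_def l_def N_def c_def m1_def m2_def m3_def by (rule refl)
    also have "\<dots> = ((N - l) * (m1 / l) + (N - k) * (m2 / l) + (k + l - N) * (m3 / l)) / N"
      by (simp only: times_divide_eq_right add_divide_distrib[symmetric] divide_divide_eq_left mult.commute[of l N])
    finally show ?thesis .
  qed
  have "I \<le> gap_mass Q d L K" unfolding mass I_def
    using r I1 I2 I3 by (intro divide_right_mono add_mono mult_left_mono) auto
  moreover have "0 \<le> I" unfolding I_def using r I1 I2 I3 by (intro divide_nonneg_nonneg add_nonneg_nonneg mult_nonneg_nonneg) auto
  moreover have "I = (if real L * \<beta> \<le> of_int b \<and> of_int b < real L * \<gamma> then gap_mass Q d L K else 0)"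
    if "1 \<le> \<bar>of_int b - real L * \<beta>\<bar>" "1 \<le> \<bar>of_int b - real L * \<gamma>\<bar>"
    unfolding mass I_def I1(4)[OF that] I2(4)[OF that] I3(4)[OF that] by simp
  ultimately show ?thesis using hI by blast
qed

section \<open>Integrals over Farey arcs\<close>

text \<open>Here \<open>s = K / Q\<close> and \<open>t = L / Q\<close>. As in
  \<open>gap_mass\<close> this is \<open>min (1 / s) (c / (s - t))\<close> with
  \<open>c = max 0 (1 - lam * t)\<close>, written as one quotient that stays meaningful on the
  diagonal \<open>s = t\<close>.\<close>

definition mid_mass :: "real \<Rightarrow> real \<Rightarrow> real \<Rightarrow> real" where
  "mid_mass lam s t = max 0 (1 - lam * t) / max (max 0 (1 - lam * t) * s) (s - t)"

definition mass_pos :: "real \<Rightarrow> real \<Rightarrow> real \<Rightarrow> real" where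
  "mass_pos lam s t = (1 - t) / t * max 0 (1 / s - lam) + (1 - s) / t * (max 0 (1 - lam * t) / s) + mid_mass lam s t"

text \<open>The sum of the two gaps has the coefficient
  \<open>(s + t - 1) / t = 1 - (1 - s) / t\<close>. The 1 is kept in \<open>mass_pos\<close>, and
  the rest is subtracted.\<close>

definition mass_neg :: "real \<Rightarrow> real \<Rightarrow> real \<Rightarrow> real" where
  "mass_neg lam s t = (1 - s) / t * mid_mass lam s t"

text \<open>
  The density \<open>mass_pos - mass_neg\<close> is not monotone, but both parts are decreasing in \<open>s\<close> and in \<open>t\<close>
  on the triangle, which is all that partial summation needs.
\<close>
definition farey_triangle :: "(real \<times> real) set" where
  "farey_triangle = {(s, t). 0 < t \<and> t \<le> s \<and> s \<le> 1 \<and> 1 \<le> s + t}"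

lemma mid_mass_bounds: "0 < s \<Longrightarrow> t \<le> s \<Longrightarrow> 0 \<le> mid_mass lam s t \<and> mid_mass lam s t \<le> 1 / s"
proof -
  assume s: "0 < s" "t \<le> s"
  define c where "c = max 0 (1 - lam * t)"
  have c: "c \<ge> 0" by (simp add: c_def)
  show ?thesis
  proof (cases "c = 0")
    case False
    then have "c / max (c * s) (s - t) \<le> c / (c * s)" using c s by (intro divide_left_mono mult_pos_pos) (auto simp: less_max_iff_disj)
    then show ?thesis using False c s unfolding mid_mass_def c_def[symmetric]
      by (auto intro!: divide_nonneg_nonneg simp: max_def)
  qed (use s in \<open>simp add: mid_mass_def c_def[symmetric]\<close>)
qed

lemma mid_mass_antimono_s:
  assumes "0 < s" "t \<le> s" "s \<le> s'"
  shows "mid_mass lam s' t \<le> mid_mass lam s t"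
proof -
  define c where "c = max 0 (1 - lam * t)"
  have c: "c \<ge> 0" by (simp add: c_def)
  show ?thesis
  proof (cases "c = 0")
    case False
    then have pos: "max (c * s) (s - t) > 0" using c assms by (auto simp: less_max_iff_disj)
    have "max (c * s) (s - t) \<le> max (c * s') (s' - t)" using assms c by (intro max.mono) (auto intro: mult_left_mono)
    then show ?thesis unfolding mid_mass_def c_def[symmetric] using pos c by (intro divide_left_mono) auto
  qed (simp add: mid_mass_def c_def[symmetric])
qed

text \<open>For \<open>lam * s < 1\<close> the value is \<open>1 / s\<close>, constant in
  \<open>t\<close>. Otherwise it is \<open>(1 - lam * t) / (s - t)\<close> until the numerator
  reaches 0, and its derivative has the sign of \<open>1 - lam * s\<close>.\<close>

lemma mid_mass_antimono_t:
  assumes "0 < t" "t \<le> t'" "t' \<le> s" "0 \<le> lam"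
  shows "mid_mass lam s t' \<le> mid_mass lam s t"
proof (cases "lam * s < 1")
  case True
  have eq: "mid_mass lam s u = 1 / s" if "0 < u" "u \<le> s" for u
  proof -
    have "lam * u \<le> lam * s" using that assms by (intro mult_left_mono) auto
    then have c: "max 0 (1 - lam * u) = 1 - lam * u" "1 - lam * u > 0" using True by auto
    have "lam * s * u \<le> 1 * u" using True that by (intro mult_right_mono) auto
    then have "s - u \<le> (1 - lam * u) * s" by (simp add: algebra_simps)
    then show ?thesis unfolding mid_mass_def c(1) using c(2) by (simp add: max_absorb1)
  qed
  show ?thesis using eq[of t] eq[of t'] assms by simp
next
  case False
  have s: "s > 0" using assms by simp
  show ?thesis
  proof (cases "lam * t' \<ge> 1")
    case True
    then show ?thesis using mid_mass_bounds[of s t lam] s assms by (simp add: mid_mass_def)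
  next
    case lt: False
    have eq: "mid_mass lam s u = (1 - lam * u) / (s - u)" if "0 < u" "u \<le> t'" for u
    proof -
      have "lam * u \<le> lam * t'" using that assms by (intro mult_left_mono) auto
      then have c: "max 0 (1 - lam * u) = 1 - lam * u" using lt by auto
      have "1 * u \<le> lam * s * u" using False that by (intro mult_right_mono) auto
      then have "(1 - lam * u) * s \<le> s - u" by (simp add: algebra_simps)
      then show ?thesis unfolding mid_mass_def c by (simp add: max_absorb2)
    qed
    have "t' < s"
    proof (rule ccontr)
      assume "\<not> t' < s"
      then have "t' = s" using assms by simp
      then show False using lt False by simp
    qed
    have "(1 - lam * t') * (s - t) \<le> (1 - lam * t) * (s - t')"
    proof -
      have "(1 - lam * t) * (s - t') - (1 - lam * t') * (s - t) = (lam * s - 1) * (t' - t)" by (simp add: algebra_simps)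
      moreover have "\<dots> \<ge> 0" using False assms by (intro mult_nonneg_nonneg) auto
      ultimately show ?thesis by linarith
    qed
    then have "(1 - lam * t') / (s - t') \<le> (1 - lam * t) / (s - t)" using \<open>t' < s\<close> assms by (simp add: frac_le_eq divide_le_cancel field_simps)
    then show ?thesis using eq[of t] eq[of t'] assms by simp
  qed
qed

lemma triangle_facts:
  assumes "(s, t) \<in> farey_triangle"
  shows "0 < t" "t \<le> s" "s \<le> 1" "1 \<le> s + t" "1 / 2 \<le> s" "0 < s" "1 / s \<le> 2" "(1 - s) / t \<le> 1" "t \<le> 1" "0 \<le> (1 - s) / t" "0 \<le> (1 - t) / t"
proof -
  show 1: "0 < t" "t \<le> s" "s \<le> 1" "1 \<le> s + t" using assms by (auto simp: farey_triangle_def)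
  then show s: "1 / 2 \<le> s" "0 < s" "t \<le> 1" by auto
  show "1 / s \<le> 2" using s by (simp add: field_simps)
  show "(1 - s) / t \<le> 1" "0 \<le> (1 - s) / t" "0 \<le> (1 - t) / t" using 1 by (auto simp: field_simps)
qed

lemma mass_nonneg:
  assumes "(s, t) \<in> farey_triangle"
  shows "0 \<le> mass_pos lam s t" "0 \<le> mass_neg lam s t"
proof -
  note f = triangle_facts[OF assms]
  have m: "0 \<le> mid_mass lam s t" using mid_mass_bounds[of s t lam] f(2,6) by blast
  have "0 \<le> max 0 (1 - lam * t) / s" using f(6) by (intro divide_nonneg_nonneg) simp_all
  then show "0 \<le> mass_pos lam s t" unfolding mass_pos_def
    by (intro add_nonneg_nonneg mult_nonneg_nonneg f(10) f(11) m) simp_all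
  show "0 \<le> mass_neg lam s t" unfolding mass_neg_def by (intro mult_nonneg_nonneg f(10) m)
qed

text \<open>The three terms of \<open>mass_pos\<close> are at most \<open>2 / t\<close>, 2 and 2,
  and \<open>t \<le> 1\<close>.\<close>

lemma mass_bound:
  assumes T: "(s, t) \<in> farey_triangle" and lam: "0 \<le> lam"
  shows "mass_pos lam s t \<le> 6 / t" "mass_neg lam s t \<le> 6 / t"
proof -
  note f = triangle_facts[OF T]
  have m: "0 \<le> mid_mass lam s t" "mid_mass lam s t \<le> 2" using mid_mass_bounds[of s t lam] f by auto
  have t1: "2 \<le> 2 / t" using f by (simp add: field_simps)
  have "(1 - t) / t * max 0 (1 / s - lam) \<le> 1 / t * 2"
    using f lam by (intro mult_mono divide_right_mono) auto
  moreover have "(1 - s) / t * (max 0 (1 - lam * t) / s) \<le> 1 * 2"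
  proof (rule mult_mono)
    have "max 0 (1 - lam * t) \<le> 1" using f lam by auto
    then have "max 0 (1 - lam * t) / s \<le> 1 / s" using f by (intro divide_right_mono) auto
    then show "max 0 (1 - lam * t) / s \<le> 2" using f by linarith
  qed (use f in auto)
  ultimately show "mass_pos lam s t \<le> 6 / t" unfolding mass_pos_def using m t1 by simp
  have "(1 - s) / t * mid_mass lam s t \<le> 1 * 2" using f m by (intro mult_mono) auto
  then show "mass_neg lam s t \<le> 6 / t" unfolding mass_neg_def using t1 by simp
qed

lemma mass_antimono_s:
  assumes T: "(s, t) \<in> farey_triangle" and T': "(s', t) \<in> farey_triangle" and le: "s \<le> s'"
  shows "mass_pos lam s' t \<le> mass_pos lam s t" "mass_neg lam s' t \<le> mass_neg lam s t"
proof -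
  note f = triangle_facts[OF T] and f' = triangle_facts[OF T']
  have m: "mid_mass lam s' t \<le> mid_mass lam s t" using f le by (intro mid_mass_antimono_s) auto
  have i: "1 / s' \<le> 1 / s" using f le by (intro divide_left_mono) auto
  have "(1 - t) / t * max 0 (1 / s' - lam) \<le> (1 - t) / t * max 0 (1 / s - lam)"
    using f i by (intro mult_left_mono max.mono) auto
  moreover have q: "(1 - s') / t \<le> (1 - s) / t" using f le by (intro divide_right_mono) auto
  moreover have "(1 - s') / t * (max 0 (1 - lam * t) / s') \<le> (1 - s) / t * (max 0 (1 - lam * t) / s)"
    using q f f' le by (intro mult_mono divide_left_mono) auto
  ultimately show "mass_pos lam s' t \<le> mass_pos lam s t" unfolding mass_pos_def using m by simp
  show "mass_neg lam s' t \<le> mass_neg lam s t" unfolding mass_neg_def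
    using q m f f' mid_mass_bounds[of s' t lam] by (intro mult_mono) auto
qed

lemma mass_antimono_t:
  assumes T: "(s, t) \<in> farey_triangle" and T': "(s, t') \<in> farey_triangle" and le: "t \<le> t'" and lam: "0 \<le> lam"
  shows "mass_pos lam s t' \<le> mass_pos lam s t" "mass_neg lam s t' \<le> mass_neg lam s t"
proof -
  note f = triangle_facts[OF T] and f' = triangle_facts[OF T']
  have m: "mid_mass lam s t' \<le> mid_mass lam s t" using f f' le lam by (intro mid_mass_antimono_t) auto
  have "(1 - t') / t' \<le> (1 - t) / t" using f f' le by (intro frac_le) auto
  then have "(1 - t') / t' * max 0 (1 / s - lam) \<le> (1 - t) / t * max 0 (1 / s - lam)"
    by (intro mult_right_mono) auto
  moreover have q: "(1 - s) / t' \<le> (1 - s) / t" using f f' le by (intro divide_left_mono) auto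
  moreover have "max 0 (1 - lam * t') / s \<le> max 0 (1 - lam * t) / s"
    using f le lam by (intro divide_right_mono max.mono) (auto intro: mult_left_mono)
  then have "(1 - s) / t' * (max 0 (1 - lam * t') / s) \<le> (1 - s) / t * (max 0 (1 - lam * t) / s)"
    using q f f' by (intro mult_mono) auto
  ultimately show "mass_pos lam s t' \<le> mass_pos lam s t" unfolding mass_pos_def using m by simp
  show "mass_neg lam s t' \<le> mass_neg lam s t" unfolding mass_neg_def
    using q m f f' mid_mass_bounds[of s t' lam] by (intro mult_mono) auto
qed

lemma gap_mass_scaled:
  assumes L: "L \<in> {1..<Q}" and K: "K \<in> larger_denoms Q L"
  shows "gap_mass Q (lam / real Q) L K =
    (mass_pos lam (of_int K / real Q) (real L / real Q) - mass_neg lam (of_int K / real Q) (real L / real Q)) / (real Q)\<^sup>2"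
    "(of_int K / real Q, real L / real Q) \<in> farey_triangle"
proof -
  have LK: "1 \<le> L" "int L < K" "K < int Q" "int Q \<le> K + int L" "L < Q"
    using L K by (auto simp: larger_denoms_def)
  define k where "k = real_of_int K"
  define l where "l = real L"
  define N where "N = real Q"
  have r: "1 \<le> l" "l < k" "k < N" "N \<le> k + l"
    using LK unfolding k_def l_def N_def by (auto simp: of_int_less_iff[symmetric] simp del: of_int_less_iff)
  have N0: "N > 0" using r by simp
  show "(of_int K / real Q, real L / real Q) \<in> farey_triangle"
    unfolding farey_triangle_def k_def[symmetric] l_def[symmetric] N_def[symmetric] using r by (auto simp: field_simps)
  define c where "c = max 0 (1 - lam / N * l)"
  have c': "max 0 (1 - lam * (l / N)) = c" by (simp add: c_def)
  have mid: "mid_mass lam (k / N) (l / N) = N * (c / max (c * k) (k - l))"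
  proof -
    have "max (c * (k / N)) (k / N - l / N) = max (c * k) (k - l) / N"
      using N0 by (auto simp: max_def diff_divide_distrib[symmetric] divide_right_mono divide_le_cancel)
    then show ?thesis unfolding mid_mass_def c' by simp
  qed
  have m1: "max 0 (1 / (k / N) - lam) = N * max 0 (1 / k - lam / N)"
    using N0 r by (auto simp: max_def field_simps)
  have e1: "mass_pos lam (k / N) (l / N) = N * ((N - l) / l * max 0 (1 / k - lam / N) + (N - k) / l * (c / k) + c / max (c * k) (k - l))"
    unfolding mass_pos_def mid m1 c' using N0 r by (simp add: field_simps)
  have e2: "mass_neg lam (k / N) (l / N) = N * ((N - k) / l * (c / max (c * k) (k - l)))"
    unfolding mass_neg_def mid using N0 r by (simp add: field_simps)
  have "gap_mass Q (lam / N) L K = ((N - l) * max 0 (1 / k - lam / N) + (N - k) * (c / k) + (k + l - N) * (c / max (c * k) (k - l))) / (N * l)"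
    unfolding gap_mass_def k_def[symmetric] l_def[symmetric] N_def[symmetric] c_def[symmetric] by simp
  also have "\<dots> = (mass_pos lam (k / N) (l / N) - mass_neg lam (k / N) (l / N)) / N\<^sup>2"
  proof -
    define X0 where "X0 = c / max (c * k) (k - l)"
    define Y where "Y = max 0 (1 / k - lam / N)"
    show ?thesis unfolding e1 e2 X0_def[symmetric] Y_def[symmetric] using N0 r
      by (simp add: field_simps power2_eq_square)
  qed
  finally show "gap_mass Q (lam / real Q) L K =
    (mass_pos lam (of_int K / real Q) (real L / real Q) - mass_neg lam (of_int K / real Q) (real L / real Q)) / (real Q)\<^sup>2"
    by (simp add: k_def l_def N_def)
qed

section \<open>Partial summation over the larger denominator\<close>

lemma abel_bound_nat:
  fixes a d :: "nat \<Rightarrow> real"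
  assumes S: "\<And>n. n \<le> N \<Longrightarrow> \<bar>\<Sum>i<n. a i\<bar> \<le> E"
    and d: "\<And>i j. i \<le> j \<Longrightarrow> j < N \<Longrightarrow> d j \<le> d i" "\<And>i. i < N \<Longrightarrow> 0 \<le> d i" "\<And>i. i < N \<Longrightarrow> d i \<le> M" and M: "0 \<le> M"
  shows "\<bar>\<Sum>i<N. a i * d i\<bar> \<le> E * M"
proof (cases N)
  case 0
  then show ?thesis using S[of 0] M by simp
next
  case (Suc n)
  have E: "E \<ge> 0" using S[of 0] by simp
  have id: "(\<Sum>i<Suc n. a i * d i) = (\<Sum>i<Suc n. a i) * d n + (\<Sum>i<n. (\<Sum>j<Suc i. a j) * (d i - d (Suc i)))" for n
    by (induction n) (simp_all add: algebra_simps)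
  have "\<bar>\<Sum>i<Suc n. a i * d i\<bar> \<le> \<bar>\<Sum>i<Suc n. a i\<bar> * d n + (\<Sum>i<n. \<bar>\<Sum>j<Suc i. a j\<bar> * (d i - d (Suc i)))"
  proof -
    have "\<bar>(\<Sum>i<n. (\<Sum>j<Suc i. a j) * (d i - d (Suc i)))\<bar> \<le> (\<Sum>i<n. \<bar>(\<Sum>j<Suc i. a j) * (d i - d (Suc i))\<bar>)" by (rule sum_abs)
    also have "\<dots> = (\<Sum>i<n. \<bar>\<Sum>j<Suc i. a j\<bar> * (d i - d (Suc i)))"
      using d(1) Suc by (intro sum.cong refl) (simp add: abs_mult)
    finally show ?thesis unfolding id using d(2)[of n] Suc
      by (intro order.trans[OF abs_triangle_ineq] add_mono) (simp_all add: abs_mult)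
  qed
  also have "\<dots> \<le> E * d n + (\<Sum>i<n. E * (d i - d (Suc i)))"
    using S d Suc by (intro add_mono mult_right_mono sum_mono) (auto simp del: sum.lessThan_Suc)
  also have "(\<Sum>i<n. E * (d i - d (Suc i))) = E * (d 0 - d n)"
    by (simp add: sum_distrib_left[symmetric] sum_lessThan_telescope')
  also have "E * d n + E * (d 0 - d n) = E * d 0" by (simp add: algebra_simps)
  also have "\<dots> \<le> E * M" using d(3)[of 0] E Suc by (intro mult_left_mono) auto
  finally show ?thesis using Suc by simp
qed

lemma abel_bound:
  fixes a d :: "int \<Rightarrow> real"
  assumes S: "\<And>k. k1 \<le> k \<Longrightarrow> k \<le> k2 \<Longrightarrow> \<bar>\<Sum>K\<in>{k1..<k}. a K\<bar> \<le> E" and le: "k1 \<le> k2"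
    and d: "\<And>i j. k1 \<le> i \<Longrightarrow> i \<le> j \<Longrightarrow> j < k2 \<Longrightarrow> d j \<le> d i"
      "\<And>i. k1 \<le> i \<Longrightarrow> i < k2 \<Longrightarrow> 0 \<le> d i" "\<And>i. k1 \<le> i \<Longrightarrow> i < k2 \<Longrightarrow> d i \<le> M" and M: "0 \<le> M"
  shows "\<bar>\<Sum>K\<in>{k1..<k2}. a K * d K\<bar> \<le> E * M"
proof -
  have re: "(\<Sum>K\<in>{k1..<k1 + int n}. f K) = (\<Sum>i<n. f (k1 + int i))" for f :: "int \<Rightarrow> real" and n
    by (rule sum.reindex_bij_witness[of _ "\<lambda>i. k1 + int i" "\<lambda>K. nat (K - k1)"]) auto
  define N where "N = nat (k2 - k1)"
  have k2: "k2 = k1 + int N" using le by (simp add: N_def)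
  have "\<bar>\<Sum>i<N. a (k1 + int i) * d (k1 + int i)\<bar> \<le> E * M"
  proof (rule abel_bound_nat)
    fix n assume "n \<le> N"
    then show "\<bar>\<Sum>i<n. a (k1 + int i)\<bar> \<le> E" using S[of "k1 + int n"] k2 by (simp add: re)
  qed (use d M k2 in auto)
  then show ?thesis unfolding k2 re .
qed

text \<open>The three weights add up to \<open>Q\<close>, each of the lengths is at most
  \<open>1 / K\<close>, and \<open>K > Q / 2\<close>.\<close>

lemma gap_mass_bounds:
  assumes L: "L \<in> {1..<Q}" and K: "K \<in> larger_denoms Q L" and d: "d \<ge> 0"
  shows "0 \<le> gap_mass Q d L K" "gap_mass Q d L K \<le> 2 / (real Q * real L)"
proof -
  have LK: "1 \<le> L" "int L < K" "K < int Q" "int Q \<le> K + int L" "L < Q"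
    using L K by (auto simp: larger_denoms_def)
  define k where "k = real_of_int K"
  define l where "l = real L"
  define N where "N = real Q"
  have r: "1 \<le> l" "l < k" "k < N" "N \<le> k + l"
    using LK unfolding k_def l_def N_def by (auto simp: of_int_less_iff[symmetric] simp del: of_int_less_iff)
  define c where "c = max 0 (1 - d * l)"
  have c: "0 \<le> c" "c \<le> 1" using d r by (auto simp: c_def)
  define X0 where "X0 = c / max (c * k) (k - l)"
  have X0: "0 \<le> X0" "X0 \<le> 1 / k"
  proof -
    show "0 \<le> X0" using c r by (auto simp: X0_def intro!: divide_nonneg_nonneg)
    show "X0 \<le> 1 / k"
    proof (cases "c = 0")
      case False
      then have "c / max (c * k) (k - l) \<le> c / (c * k)" using c r by (intro divide_left_mono) (auto simp: max_def)
      then show ?thesis using False by (simp add: X0_def)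
    qed (use r in \<open>simp add: X0_def\<close>)
  qed
  have e: "gap_mass Q d L K = ((N - l) * max 0 (1 / k - d) + (N - k) * (c / k) + (k + l - N) * X0) / (N * l)"
    unfolding gap_mass_def k_def[symmetric] l_def[symmetric] N_def[symmetric] c_def[symmetric] X0_def by simp
  show "0 \<le> gap_mass Q d L K" unfolding e using r c X0 by (intro divide_nonneg_nonneg add_nonneg_nonneg mult_nonneg_nonneg) auto
  have "(N - l) * max 0 (1 / k - d) + (N - k) * (c / k) + (k + l - N) * X0 \<le> (N - l) * (1 / k) + (N - k) * (1 / k) + (k + l - N) * (1 / k)"
    using r c X0 d by (intro add_mono mult_left_mono divide_right_mono) auto
  also have "\<dots> = N / k" by (simp add: add_divide_distrib[symmetric])
  also have "\<dots> \<le> 2" using r by (simp add: field_simps)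
  finally show "gap_mass Q d L K \<le> 2 / (real Q * real L)"
    unfolding e using r by (simp add: N_def l_def divide_right_mono)
qed

text \<open>The candidates for \<open>K\<close> lie among at most \<open>L\<close> consecutive
  integers, and \<open>b\<close> is invertible modulo \<open>L\<close> once the congruence has a
  solution. Hence a numerator near the end of the window spoils at most one arc for each
  sign.\<close>

lemma inverse_residue_unique:
  fixes b s :: int
  assumes s: "s = 1 \<or> s = -1" and L: "L > 0"
  shows "(\<Sum>K\<in>larger_denoms Q L. of_bool ([b * K = - s] (mod int L)) :: real) \<le> 1"
proof -
  have "card {K \<in> larger_denoms Q L. [b * K = - s] (mod int L)} \<le> 1"
  proof (rule ccontr)
    assume "\<not> ?thesis"
    moreover have fin: "finite {K \<in> larger_denoms Q L. [b * K = - s] (mod int L)}"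
      by (rule finite_subset[of _ "larger_denoms Q L"]) (auto simp: larger_denoms_def)
    ultimately obtain K K' where K: "K \<in> larger_denoms Q L" "K' \<in> larger_denoms Q L" "K \<noteq> K'"
      "[b * K = - s] (mod int L)" "[b * K' = - s] (mod int L)"
      using card_le_Suc0_iff_eq[OF fin] by auto
    have "[- s * (b * K) = - s * (- s)] (mod int L)" using K(4) by (rule cong_scalar_left)
    then have "[b * (- s * K) = 1] (mod int L)" using s by (auto simp: mult_ac)
    then have cop: "coprime b (int L)" using coprime_iff_invertible_int by blast
    have "[b * K = b * K'] (mod int L)" using K(4,5) by (metis cong_sym cong_trans)
    then have "[K = K'] (mod int L)" using cop by (simp add: cong_mult_lcancel)
    then have "int L dvd K - K'" by (simp add: cong_iff_dvd_diff)
    moreover have "\<bar>K - K'\<bar> < int L" using K(1,2) by (auto simp: larger_denoms_def)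
    ultimately show False using K(3) zdvd_imp_le[of "int L" "\<bar>K - K'\<bar>"] by auto
  qed
  moreover have "(\<Sum>K\<in>larger_denoms Q L. of_bool ([b * K = - s] (mod int L)) :: real) =
     real (card {K \<in> larger_denoms Q L. [b * K = - s] (mod int L)})"
    by (simp add: of_bool_def sum.If_cases larger_denoms_def Int_def)
  ultimately show ?thesis by simp
qed

text \<open>Partial summation in \<open>K\<close>: the partial sums are discrepancies, and each of
  the two monotone parts is at most \<open>6 * Q / L\<close>. With the factor
  \<open>1 / Q ^ 2\<close> from the scaling this gives 12.\<close>

lemma mass_equidistribution:
  fixes s b1 b2 :: int
  assumes s: "s = 1 \<or> s = -1" and L: "L \<in> {1..<Q}" and lam: "lam \<ge> 0"
  shows "\<bar>(\<Sum>K\<in>larger_denoms Q L. \<Sum>b\<in>{b1..<b2}. of_bool ([b * K = - s] (mod int L)) * gap_mass Q (lam / real Q) L K) -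
     real (card {b1..<b2}) / real L * (\<Sum>K\<in>larger_denoms Q L. of_bool (coprime K (int L)) * gap_mass Q (lam / real Q) L K)\<bar>
     \<le> 12 / (real Q * real L) * discrepancy_bound L"
proof -
  define k1 where "k1 = max (int Q - int L) (int L + 1)"
  have J: "larger_denoms Q L = {k1..<int Q}" by (simp add: larger_denoms_def k1_def)
  define a where "a = (\<lambda>K. (\<Sum>b\<in>{b1..<b2}. if [b * K = - s] (mod int L) then 1 else (0::real)) - real (card {b1..<b2}) / real L * (if coprime K (int L) then 1 else 0))"
  have Q0: "real Q > 0" "real L > 0" using L by auto
  have LL: "0 < L" using L by simp
  have D0: "0 \<le> discrepancy_bound L"
    using hyperbola_discrepancy[OF LL, of 1 0 0 0 0] by simp
  show ?thesis
  proof (cases "k1 \<le> int Q")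
    case False
    then show ?thesis unfolding J using D0 Q0 by simp
  next
    case True
    have pre: "\<bar>\<Sum>K\<in>{k1..<k}. a K\<bar> \<le> discrepancy_bound L" if k: "k1 \<le> k" "k \<le> int Q" for k
    proof -
      have "(\<Sum>K\<in>{k1..<k}. a K) = (\<Sum>K\<in>{k1..<k}. \<Sum>b\<in>{b1..<b2}. if [b * K = - s] (mod int L) then 1 else 0) -
         real (card {b1..<b2}) / real L * (\<Sum>K\<in>{k1..<k}. if coprime K (int L) then 1 else 0)"
        unfolding a_def sum_subtractf sum_distrib_left by simp
      then show ?thesis using s k by (simp only:) (rule hyperbola_discrepancy[OF LL], auto simp: k1_def)
    qed
    have tri: "(of_int K / real Q, real L / real Q) \<in> farey_triangle" if "K \<in> {k1..<int Q}" for K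
      using gap_mass_scaled(2)[OF L] that J by simp
    have bnd: "\<bar>\<Sum>K\<in>{k1..<int Q}. a K * f (of_int K / real Q) (real L / real Q)\<bar> \<le> discrepancy_bound L * (6 / (real L / real Q))"
      if f: "f = mass_pos lam \<or> f = mass_neg lam" for f
    proof (rule abel_bound[OF pre True])
      fix i j :: int assume ij: "k1 \<le> i" "i \<le> j" "j < int Q"
      have "real_of_int i / real Q \<le> real_of_int j / real Q" using ij Q0 by (intro divide_right_mono) auto
      then show "f (of_int j / real Q) (real L / real Q) \<le> f (of_int i / real Q) (real L / real Q)"
        using f mass_antimono_s[OF tri[of i] tri[of j]] ij by auto
    next
      fix i :: int assume i: "k1 \<le> i" "i < int Q"
      show "0 \<le> f (of_int i / real Q) (real L / real Q)" using f mass_nonneg[OF tri[of i]] i by auto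
      show "f (of_int i / real Q) (real L / real Q) \<le> 6 / (real L / real Q)" using f mass_bound[OF tri[of i] lam] i by auto
    qed (use Q0 in auto)
    have mass: "gap_mass Q (lam / real Q) L K = (mass_pos lam (of_int K / real Q) (real L / real Q) - mass_neg lam (of_int K / real Q) (real L / real Q)) / (real Q)\<^sup>2"
      if "K \<in> {k1..<int Q}" for K using gap_mass_scaled(1)[OF L] that J by simp
    have "(\<Sum>K\<in>larger_denoms Q L. \<Sum>b\<in>{b1..<b2}. of_bool ([b * K = - s] (mod int L)) * gap_mass Q (lam / real Q) L K) -
     real (card {b1..<b2}) / real L * (\<Sum>K\<in>larger_denoms Q L. of_bool (coprime K (int L)) * gap_mass Q (lam / real Q) L K) =
     (\<Sum>K\<in>{k1..<int Q}. a K * gap_mass Q (lam / real Q) L K)"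
      unfolding J a_def of_bool_def sum_distrib_right[symmetric] sum_distrib_left sum_subtractf[symmetric] left_diff_distrib
      by (simp only: mult.assoc)
    also have "\<dots> = ((\<Sum>K\<in>{k1..<int Q}. a K * mass_pos lam (of_int K / real Q) (real L / real Q)) -
        (\<Sum>K\<in>{k1..<int Q}. a K * mass_neg lam (of_int K / real Q) (real L / real Q))) / (real Q)\<^sup>2"
      unfolding sum_subtractf[symmetric] sum_divide_distrib by (intro sum.cong refl) (simp add: mass right_diff_distrib)
    also have "\<bar>\<dots>\<bar> \<le> (discrepancy_bound L * (6 / (real L / real Q)) + discrepancy_bound L * (6 / (real L / real Q))) / (real Q)\<^sup>2"
      unfolding abs_divide using bnd[of "mass_pos lam"] bnd[of "mass_neg lam"]
      by (simp only: abs_power2) (intro divide_right_mono order.trans[OF abs_triangle_ineq4] add_mono, auto)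
    also have "\<dots> = 12 / (real Q * real L) * discrepancy_bound L" using Q0 by (simp add: field_simps power2_eq_square)
    finally show ?thesis .
  qed
qed

definition pair_sum :: "nat \<Rightarrow> real \<Rightarrow> real" where
  "pair_sum Q d = (\<Sum>L=1..<Q. \<Sum>K\<in>larger_denoms Q L. of_bool (coprime K (int L)) * gap_mass Q d L K)"

text \<open>Put \<open>w = 2 / (Q * L)\<close>, the bound for one arc. For each \<open>L\<close> and
  sign, four numerators near the ends of the window cost \<open>4 * w\<close>; replacing the number
  of integers from \<open>L * \<beta>\<close> to \<open>L * \<gamma>\<close> by
  \<open>L * \<eta>\<close> costs another \<open>w\<close>; the rest is equidistribution. The factor
  2 counts the two signs \<open>s\<close>.\<close>

lemma gap_integral_estimate:
  assumes Q: "Q \<ge> 3" and lam: "lam \<ge> 0" and eta: "0 < \<eta>" "\<eta> \<le> 1"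
  shows "\<bar>integral {\<beta>..\<beta> + \<eta>} (\<lambda>\<alpha>. real (big_gap_count lam \<alpha> Q) / real Q) - 2 * \<eta> * pair_sum Q (lam / real Q)\<bar>
    \<le> (\<Sum>L=1..<Q. 2 * (12 / (real Q * real L) * discrepancy_bound L + 10 / (real Q * real L)))"
proof -
  define d where "d = lam / real Q"
  have d0: "d \<ge> 0" using lam by (simp add: d_def)
  define \<gamma> where "\<gamma> = \<beta> + \<eta>"
  have bg: "\<beta> \<le> \<gamma>" using eta by (simp add: \<gamma>_def)
  define R where "R = (\<lambda>L. {\<lfloor>real L * \<beta>\<rfloor> - 1..\<lceil>real L * \<gamma>\<rceil> + 1})"
  define B where "B = (\<lambda>L. {\<lceil>real L * \<beta>\<rceil>..<\<lceil>real L * \<gamma>\<rceil>})"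
  define val where "val = (\<lambda>(s, L, K, b) \<alpha>. of_bool ([b * K = - s] (mod int L)) * gap_weight Q d L K (of_int s * (real L * \<alpha> - of_int b)))"
  define Iv where "Iv = (\<lambda>s L K b. integral {\<beta>..\<gamma>} (\<lambda>\<alpha>. gap_weight Q d L K (of_int s * (real L * \<alpha> - of_int b))))"
  have Iv: "((\<lambda>\<alpha>. gap_weight Q d L K (of_int s * (real L * \<alpha> - of_int b))) has_integral Iv s L K b) {\<beta>..\<gamma>}"
    "0 \<le> Iv s L K b" "Iv s L K b \<le> gap_mass Q d L K"
    "1 \<le> \<bar>of_int b - real L * \<beta>\<bar> \<Longrightarrow> 1 \<le> \<bar>of_int b - real L * \<gamma>\<bar> \<Longrightarrow>
      Iv s L K b = (if real L * \<beta> \<le> of_int b \<and> of_int b < real L * \<gamma> then gap_mass Q d L K else 0)"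
    if hyp: "s = 1 \<or> s = -1" "L \<in> {1..<Q}" "K \<in> larger_denoms Q L" for s L K b
  proof -
    obtain I where I: "((\<lambda>\<alpha>. gap_weight Q d L K (of_int s * (real L * \<alpha> - of_int b))) has_integral I) {\<beta>..\<gamma>}"
      "0 \<le> I" "I \<le> gap_mass Q d L K" "1 \<le> \<bar>of_int b - real L * \<beta>\<bar> \<Longrightarrow> 1 \<le> \<bar>of_int b - real L * \<gamma>\<bar> \<Longrightarrow>
      I = (if real L * \<beta> \<le> of_int b \<and> of_int b < real L * \<gamma> then gap_mass Q d L K else 0)"
      using gap_weight_has_integral[OF hyp d0 bg, of b] by blast
    have eq: "Iv s L K b = I" unfolding Iv_def using I(1) by (rule integral_unique)
    show "((\<lambda>\<alpha>. gap_weight Q d L K (of_int s * (real L * \<alpha> - of_int b))) has_integral Iv s L K b) {\<beta>..\<gamma>}"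
      "0 \<le> Iv s L K b" "Iv s L K b \<le> gap_mass Q d L K"
      "1 \<le> \<bar>of_int b - real L * \<beta>\<bar> \<Longrightarrow> 1 \<le> \<bar>of_int b - real L * \<gamma>\<bar> \<Longrightarrow>
      Iv s L K b = (if real L * \<beta> \<le> of_int b \<and> of_int b < real L * \<gamma> then gap_mass Q d L K else 0)"
      unfolding eq by (fact I)+
  qed
  have finR: "finite (R L)" for L by (simp add: R_def)
  have finI: "finite (gap_index Q R)" unfolding gap_index_def using finR by (auto simp: larger_denoms_def)
  have "((\<lambda>\<alpha>. \<Sum>t\<in>gap_index Q R. val t \<alpha>) has_integral
     (\<Sum>t\<in>gap_index Q R. case t of (s, L, K, b) \<Rightarrow> of_bool ([b * K = - s] (mod int L)) * Iv s L K b)) {\<beta>..\<gamma>}"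
  proof (rule has_integral_sum[OF finI])
    fix t assume t: "t \<in> gap_index Q R"
    obtain s L K b where e: "t = (s, L, K, b)" by (metis prod.exhaust)
    have "s = 1 \<or> s = -1" "L \<in> {1..<Q}" "K \<in> larger_denoms Q L" using t by (auto simp: e gap_index_def)
    from Iv(1)[OF this, of b] show "(val t has_integral (case t of (s, L, K, b) \<Rightarrow> of_bool ([b * K = - s] (mod int L)) * Iv s L K b)) {\<beta>..\<gamma>}"
      unfolding e val_def prod.case by (rule has_integral_mult_right)
  qed
  \<comment> \<open>Rational \<open>\<alpha>\<close> form a null set, so the identity for irrational
    \<open>\<alpha>\<close> yields integrability of the gap count together with its
    integral.\<close>
  then have hi: "((\<lambda>\<alpha>. real (big_gap_count lam \<alpha> Q) / real Q) has_integral
     (\<Sum>t\<in>gap_index Q R. case t of (s, L, K, b) \<Rightarrow> of_bool ([b * K = - s] (mod int L)) * Iv s L K b)) {\<beta>..\<gamma>}"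
  proof (rule has_integral_spike[rotated 2])
    show "negligible (\<rat> :: real set)" using countable_imp_null_set_lborel[OF countable_rat] null_sets_completionI negligible_iff_null_sets by blast
    fix \<alpha> assume \<alpha>: "\<alpha> \<in> {\<beta>..\<gamma>} - \<rat>"
    have "real (big_gap_count lam \<alpha> Q) / real Q =
      (\<Sum>(s, L, K, b)\<in>gap_index Q R. of_bool ([b * K = - s] (mod int L)) * gap_weight Q (lam / real Q) L K (of_int s * (real L * \<alpha> - of_int b)))"
    proof (rule gap_count_as_sum[OF _ Q finR])
      fix L b assume "L \<in> {1..<Q}" and b: "\<bar>real L * \<alpha> - of_int b\<bar> < 1"
      have "real L * \<beta> \<le> real L * \<alpha>" "real L * \<alpha> \<le> real L * \<gamma>" using \<alpha> by (auto intro: mult_left_mono)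
      then show "b \<in> R L" using b unfolding R_def by (auto simp: abs_less_iff) linarith+
    qed (use \<alpha> in auto)
    then show "real (big_gap_count lam \<alpha> Q) / real Q = (\<Sum>t\<in>gap_index Q R. val t \<alpha>)"
      by (simp add: val_def d_def case_prod_unfold)
  qed
  then have "integral {\<beta>..\<gamma>} (\<lambda>\<alpha>. real (big_gap_count lam \<alpha> Q) / real Q) =
     (\<Sum>t\<in>gap_index Q R. case t of (s, L, K, b) \<Rightarrow> of_bool ([b * K = - s] (mod int L)) * Iv s L K b)" by (rule integral_unique)
  also have "\<dots> = (\<Sum>s\<in>{1, -1}. \<Sum>L=1..<Q. \<Sum>K\<in>larger_denoms Q L. \<Sum>b\<in>R L. of_bool ([b * K = - s] (mod int L)) * Iv s L K b)"
  proof -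
    have "(\<Sum>t\<in>gap_index Q R. case t of (s, L, K, b) \<Rightarrow> g s L K b) =
       (\<Sum>s\<in>{1, -1}. \<Sum>L=1..<Q. \<Sum>K\<in>larger_denoms Q L. \<Sum>b\<in>R L. g s L K b)" for g :: "int \<Rightarrow> nat \<Rightarrow> int \<Rightarrow> int \<Rightarrow> real"
    proof -
      have fD: "finite (larger_denoms Q L)" for L by (simp add: larger_denoms_def)
      show ?thesis unfolding gap_index_def using finR fD
        by (simp add: sum.Sigma)
    qed
    then show ?thesis .
  qed
  finally have int_eq: "integral {\<beta>..\<gamma>} (\<lambda>\<alpha>. real (big_gap_count lam \<alpha> Q) / real Q) =
     (\<Sum>s\<in>{1, -1}. \<Sum>L=1..<Q. \<Sum>K\<in>larger_denoms Q L. \<Sum>b\<in>R L. of_bool ([b * K = - s] (mod int L)) * Iv s L K b)" .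
  have main: "\<bar>(\<Sum>K\<in>larger_denoms Q L. \<Sum>b\<in>R L. of_bool ([b * K = - s] (mod int L)) * Iv s L K b) -
      \<eta> * (\<Sum>K\<in>larger_denoms Q L. of_bool (coprime K (int L)) * gap_mass Q d L K)\<bar>
      \<le> 12 / (real Q * real L) * discrepancy_bound L + 10 / (real Q * real L)"
    if s: "s = 1 \<or> s = -1" and L: "L \<in> {1..<Q}" for s L
  proof -
    define D where "D = larger_denoms Q L"
    define w where "w = 2 / (real Q * real L)"
    have w0: "w \<ge> 0" by (simp add: w_def)
    have finD: "finite D" by (simp add: D_def larger_denoms_def)
    have mb: "0 \<le> gap_mass Q d L K" "gap_mass Q d L K \<le> w" if "K \<in> D" for K
      using gap_mass_bounds[OF L _ d0] that by (auto simp: D_def w_def)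
    define near where "near = {\<lfloor>real L * \<beta>\<rfloor>, \<lfloor>real L * \<beta>\<rfloor> + 1, \<lfloor>real L * \<gamma>\<rfloor>, \<lfloor>real L * \<gamma>\<rfloor> + 1}"
    have near: "b \<in> near" if "\<bar>of_int b - real L * \<beta>\<bar> < 1 \<or> \<bar>of_int b - real L * \<gamma>\<bar> < 1" for b
    proof -
      have "b \<in> {\<lfloor>x\<rfloor>, \<lfloor>x\<rfloor> + 1}" if "\<bar>of_int b - x\<bar> < 1" for x :: real
        using that by (simp add: abs_less_iff) linarith
      then show ?thesis using that unfolding near_def by blast
    qed
    have Bsub: "B L \<subseteq> R L" by (auto simp: B_def R_def) linarith
    have inB: "b \<in> B L \<longleftrightarrow> real L * \<beta> \<le> of_int b \<and> of_int b < real L * \<gamma>" for b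
      by (auto simp: B_def ceiling_le_iff less_ceiling_iff)
    have "(\<Sum>K\<in>D. \<Sum>b\<in>R L. of_bool ([b * K = - s] (mod int L)) * Iv s L K b) -
       (\<Sum>K\<in>D. \<Sum>b\<in>B L. of_bool ([b * K = - s] (mod int L)) * gap_mass Q d L K) =
       (\<Sum>K\<in>D. \<Sum>b\<in>R L. of_bool ([b * K = - s] (mod int L)) * (Iv s L K b - of_bool (b \<in> B L) * gap_mass Q d L K))"
    proof -
      have "(\<Sum>b\<in>B L. of_bool ([b * K = - s] (mod int L)) * gap_mass Q d L K) =
         (\<Sum>b\<in>R L. of_bool ([b * K = - s] (mod int L)) * (of_bool (b \<in> B L) * gap_mass Q d L K))" for K
        using Bsub finR by (intro sum.mono_neutral_cong_left) auto
      then show ?thesis by (simp add: sum_subtractf[symmetric] right_diff_distrib)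
    qed
    also have "\<bar>\<dots>\<bar> \<le> (\<Sum>K\<in>D. \<Sum>b\<in>R L. of_bool ([b * K = - s] (mod int L)) * (of_bool (b \<in> near) * w))"
    proof (rule order.trans[OF sum_abs], rule sum_mono, rule order.trans[OF sum_abs], rule sum_mono)
      fix K b assume K: "K \<in> D" and "b \<in> R L"
      note I = Iv[OF s L K[unfolded D_def], of b]
      have "\<bar>Iv s L K b - of_bool (b \<in> B L) * gap_mass Q d L K\<bar> \<le> of_bool (b \<in> near) * w"
      proof (cases "\<bar>of_int b - real L * \<beta>\<bar> < 1 \<or> \<bar>of_int b - real L * \<gamma>\<bar> < 1")
        case True
        then have "b \<in> near" by (rule near)
        then show ?thesis using I(2,3) mb[OF K] by (auto simp: abs_le_iff)
      next
        case False
        then have "Iv s L K b = (if real L * \<beta> \<le> of_int b \<and> of_int b < real L * \<gamma> then gap_mass Q d L K else 0)" by (intro I(4)) auto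
        then show ?thesis using w0 by (auto simp: inB)
      qed
      then show "\<bar>of_bool ([b * K = - s] (mod int L)) * (Iv s L K b - of_bool (b \<in> B L) * gap_mass Q d L K)\<bar>
         \<le> of_bool ([b * K = - s] (mod int L)) * (of_bool (b \<in> near) * w)"
        unfolding abs_mult by (intro mult_mono) auto
    qed
    also have "\<dots> = (\<Sum>b\<in>R L. \<Sum>K\<in>D. of_bool ([b * K = - s] (mod int L)) * (of_bool (b \<in> near) * w))" by (rule sum.swap)
    also have "\<dots> \<le> (\<Sum>b\<in>R L. 1 * (of_bool (b \<in> near) * w))"
      unfolding sum_distrib_right[symmetric] D_def using w0 L
      by (intro sum_mono mult_right_mono inverse_residue_unique[OF s]) auto
    also have "\<dots> = (\<Sum>b\<in>R L. of_bool (b \<in> near)) * w" by (simp only: mult_1_left sum_distrib_right)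
    also have "(\<Sum>b\<in>R L. of_bool (b \<in> near)) * w = real (card (R L \<inter> near)) * w" using finR by (simp add: of_bool_def sum.If_cases)
    also have "\<dots> \<le> 4 * w"
    proof (intro mult_right_mono w0)
      have "card (R L \<inter> near) \<le> card near" by (intro card_mono) (auto simp: near_def)
      also have "card near \<le> 4" unfolding near_def by (simp add: card_insert_if)
      finally show "real (card (R L \<inter> near)) \<le> 4" by simp
    qed
    finally have e1: "\<bar>(\<Sum>K\<in>D. \<Sum>b\<in>R L. of_bool ([b * K = - s] (mod int L)) * Iv s L K b) -
       (\<Sum>K\<in>D. \<Sum>b\<in>B L. of_bool ([b * K = - s] (mod int L)) * gap_mass Q d L K)\<bar> \<le> 4 * w" .
    define P where "P = (\<Sum>K\<in>D. of_bool (coprime K (int L)) * gap_mass Q d L K)"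
    have e2: "\<bar>(\<Sum>K\<in>D. \<Sum>b\<in>B L. of_bool ([b * K = - s] (mod int L)) * gap_mass Q d L K) - real (card (B L)) / real L * P\<bar>
        \<le> 12 / (real Q * real L) * discrepancy_bound L"
      unfolding B_def D_def P_def d_def by (rule mass_equidistribution[OF s L lam])
    have P: "0 \<le> P" "P \<le> real L * w"
    proof -
      show "0 \<le> P" unfolding P_def using mb by (intro sum_nonneg mult_nonneg_nonneg) auto
      have "P \<le> (\<Sum>K\<in>D. 1 * w)" unfolding P_def using mb w0 by (intro sum_mono mult_mono) auto
      also have "\<dots> = real (card D) * w" by simp
      also have "\<dots> \<le> real L * w" using L by (intro mult_right_mono w0) (auto simp: D_def larger_denoms_def)
      finally show "P \<le> real L * w" .
    qed
    have e3: "\<bar>real (card (B L)) / real L * P - \<eta> * P\<bar> \<le> w"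
    proof -
      have mono: "real L * \<beta> \<le> real L * \<gamma>" using bg by (intro mult_left_mono) auto
      have "real (card (B L)) = of_int (\<lceil>real L * \<gamma>\<rceil> - \<lceil>real L * \<beta>\<rceil>)" using mono by (simp add: B_def ceiling_mono)
      moreover have "real L * \<gamma> - real L * \<beta> = real L * \<eta>" by (simp add: \<gamma>_def algebra_simps)
      ultimately have "\<bar>real (card (B L)) - real L * \<eta>\<bar> \<le> 1" by (simp add: abs_le_iff) linarith
      then have "\<bar>real (card (B L)) - real L * \<eta>\<bar> * P \<le> 1 * P" using P by (intro mult_right_mono) auto
      then have "\<bar>real (card (B L)) - real L * \<eta>\<bar> * P / real L \<le> P / real L" by (simp add: divide_right_mono)
      also have "P / real L \<le> w" using P L by (simp add: field_simps)
      also have "\<bar>real (card (B L)) - real L * \<eta>\<bar> * P / real L = \<bar>real (card (B L)) / real L * P - \<eta> * P\<bar>"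
      proof -
        have "real (card (B L)) / real L * P - \<eta> * P = (real (card (B L)) - real L * \<eta>) * P / real L"
          using L by (simp add: field_simps)
        then show ?thesis using P by (simp add: abs_mult)
      qed
      finally show ?thesis .
    qed
    have "\<bar>(\<Sum>K\<in>D. \<Sum>b\<in>R L. of_bool ([b * K = - s] (mod int L)) * Iv s L K b) - \<eta> * P\<bar>
       \<le> 12 / (real Q * real L) * discrepancy_bound L + 5 * w"
    proof -
      have "\<bar>x1 - x4\<bar> \<le> y2 + 5 * w" if "\<bar>x1 - x2\<bar> \<le> 4 * w" "\<bar>x2 - x3\<bar> \<le> y2" "\<bar>x3 - x4\<bar> \<le> w" for x1 x2 x3 x4 y2 :: real
        using that by linarith
      from this[OF e1 e2 e3] show ?thesis .
    qed
    then show ?thesis by (simp add: P_def D_def w_def)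
  qed
  have twice: "(\<Sum>s\<in>{1, -1::int}. \<Sum>L\<in>A. g L) = (\<Sum>L\<in>A. 2 * g L)" for A :: "nat set" and g :: "nat \<Rightarrow> real"
    by (simp add: sum_distrib_left[symmetric])
  have "integral {\<beta>..\<gamma>} (\<lambda>\<alpha>. real (big_gap_count lam \<alpha> Q) / real Q) - 2 * \<eta> * pair_sum Q d =
     (\<Sum>s\<in>{1, -1::int}. \<Sum>L=1..<Q. (\<Sum>K\<in>larger_denoms Q L. \<Sum>b\<in>R L. of_bool ([b * K = - s] (mod int L)) * Iv s L K b) -
      \<eta> * (\<Sum>K\<in>larger_denoms Q L. of_bool (coprime K (int L)) * gap_mass Q d L K))"
    unfolding int_eq pair_sum_def sum_subtractf sum_distrib_left[symmetric] by simp
  also have "\<bar>\<dots>\<bar> \<le> (\<Sum>s\<in>{1, -1::int}. \<Sum>L=1..<Q. 12 / (real Q * real L) * discrepancy_bound L + 10 / (real Q * real L))"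
    by (rule order.trans[OF sum_abs], rule sum_mono, rule order.trans[OF sum_abs], rule sum_mono, rule main) auto
  also have "\<dots> = (\<Sum>L=1..<Q. 2 * (12 / (real Q * real L) * discrepancy_bound L + 10 / (real Q * real L)))"
    by (rule twice)
  finally show ?thesis unfolding \<gamma>_def d_def .
qed

section \<open>Summation over coprime pairs\<close>

lemma integrable_indicator_Icc: "integrable lborel (indicator {a..b} :: real \<Rightarrow> real)"
  by (rule integrable_real_indicator) (auto simp: emeasure_lborel_Icc_eq)

text \<open>Comparison with two step functions. Above \<open>f\<close>, each grid value covers the
  cell to its right and \<open>M\<close> covers one cell at \<open>a\<close>. Below
  \<open>f\<close>, each grid value covers the cell to its left, leaving out at most one grid point
  whose cell would reach below \<open>a\<close>.\<close>

lemma antimono_riemann_sum: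
  fixes f :: "real \<Rightarrow> real"
  assumes f: "f \<in> borel_measurable borel" and h: "h > 0" and M: "0 \<le> M"
    and anti: "\<And>x y. a \<le> x \<Longrightarrow> x \<le> y \<Longrightarrow> y \<le> b \<Longrightarrow> f y \<le> f x"
    and bnd: "\<And>x. a \<le> x \<Longrightarrow> x \<le> b \<Longrightarrow> 0 \<le> f x \<and> f x \<le> M"
  shows "\<bar>h * (\<Sum>k | a \<le> h * of_int k \<and> h * of_int k \<le> b. f (h * of_int k)) -
     (LINT x|lborel. indicator {a..b} x * f x)\<bar> \<le> h * M"
proof -
  define S where "S = {k :: int. a \<le> h * of_int k \<and> h * of_int k \<le> b}"
  have "S \<subseteq> {\<lceil>a / h\<rceil>..\<lfloor>b / h\<rfloor>}" using h by (auto simp: S_def ceiling_le_iff le_floor_iff field_simps)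
  then have finS: "finite S" by (rule finite_subset) simp
  define u where "u = (\<lambda>x. indicator {a..b} x * f x)"
  have int_u: "integrable lborel u"
  proof (rule Bochner_Integration.integrable_bound[where f = "\<lambda>x. M * indicator {a..b} x"])
    show "integrable lborel (\<lambda>x. M * indicator {a..b} x)" by (intro integrable_mult_right integrable_indicator_Icc)
    show "u \<in> borel_measurable lborel" unfolding u_def using f by simp
    show "AE x in lborel. norm (u x) \<le> norm (M * indicator {a..b} x)"
      using bnd M by (auto simp: u_def indicator_def)
  qed
  define v where "v = (\<lambda>x. M * indicator {a..<a + h} x + (\<Sum>k\<in>S. f (h * of_int k) * indicator {h * of_int k..<h * of_int k + h} x))"
  have int_ind: "integrable lborel (indicator {x..<x + h} :: real \<Rightarrow> real)" "(LINT y|lborel. indicator {x..<x + h} y) = h" for x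
    using h by (auto simp: integrable_indicator_iff)
  have int_v: "integrable lborel v" unfolding v_def using int_ind by simp
  have "integral\<^sup>L lborel u \<le> integral\<^sup>L lborel v"
  proof (rule integral_mono[OF int_u int_v])
    fix x
    have nn: "0 \<le> (\<Sum>k\<in>S. f (h * of_int k) * indicator {h * of_int k..<h * of_int k + h} x)"
      using bnd by (intro sum_nonneg) (auto simp: S_def)
    show "u x \<le> v x"
    proof (cases "a \<le> x \<and> x \<le> b")
      case False
      then have "u x = 0" by (auto simp: u_def indicator_def)
      then show ?thesis using nn M by (simp add: v_def)
    next
      case True
      define k where "k = \<lfloor>x / h\<rfloor>"
      have "of_int k \<le> x / h" "x / h < of_int k + 1" unfolding k_def by linarith+
      then have k: "h * of_int k \<le> x" "x < h * of_int k + h" using h by (auto simp: field_simps)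
      show ?thesis
      proof (cases "a \<le> h * of_int k")
        case T: True
        then have kS: "k \<in> S" using k True by (auto simp: S_def)
        have "u x = f x" using True by (simp add: u_def)
        also have "f x \<le> f (h * of_int k) * indicator {h * of_int k..<h * of_int k + h} x"
          using anti[of "h * of_int k" x] T True k by simp
        also have "\<dots> \<le> (\<Sum>k\<in>S. f (h * of_int k) * indicator {h * of_int k..<h * of_int k + h} x)"
          by (rule member_le_sum[OF kS _ finS]) (use bnd in \<open>auto simp: S_def\<close>)
        finally show ?thesis using M by (simp add: v_def add_increasing)
      next
        case F: False
        then have "x \<in> {a..<a + h}" using True k by auto
        then have "u x \<le> M * indicator {a..<a + h} x" using bnd[of x] True by (simp add: u_def)
        then show ?thesis using nn by (simp add: v_def)
      qed
    qed
  qed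
  also have "integral\<^sup>L lborel v = M * h + (\<Sum>k\<in>S. f (h * of_int k) * h)"
    unfolding v_def using int_ind by simp
  finally have upper: "integral\<^sup>L lborel u \<le> M * h + h * (\<Sum>k\<in>S. f (h * of_int k))"
    by (simp add: sum_distrib_left mult.commute)
  define S' where "S' = {k\<in>S. a \<le> h * of_int k - h}"
  have finS': "finite S'" using finS by (simp add: S'_def)
  define w where "w = (\<lambda>x. \<Sum>k\<in>S'. f (h * of_int k) * indicator {h * of_int k - h<..h * of_int k} x)"
  have int_ind': "integrable lborel (indicator {x - h<..x} :: real \<Rightarrow> real)" "(LINT y|lborel. indicator {x - h<..x} y) = h" for x
    using h by (auto simp: integrable_indicator_iff)
  have int_w: "integrable lborel w" unfolding w_def using int_ind' by simp
  have "integral\<^sup>L lborel w \<le> integral\<^sup>L lborel u"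
  proof (rule integral_mono[OF int_w int_u])
    fix x
    define k where "k = \<lceil>x / h\<rceil>"
    have "x / h \<le> of_int k" "of_int k - 1 < x / h" unfolding k_def by linarith+
    then have k: "x \<le> h * of_int k" "h * of_int k - h < x" using h by (auto simp: field_simps)
    have uniq: "j = k" if "h * of_int j - h < x" "x \<le> h * of_int j" for j
    proof -
      have "of_int j - 1 < x / h" "x / h \<le> of_int j" using that h by (auto simp: field_simps)
      then show ?thesis unfolding k_def by linarith
    qed
    have "w x = (\<Sum>j\<in>S'. if j = k then f (h * of_int k) else 0)" unfolding w_def
    proof (intro sum.cong refl)
      fix j
      have "x \<in> {h * of_int j - h<..h * of_int j} \<longleftrightarrow> j = k" using uniq[of j] k by auto
      then show "f (h * of_int j) * indicator {h * of_int j - h<..h * of_int j} x = (if j = k then f (h * of_int k) else 0)"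
        by (cases "j = k") (simp_all del: greaterThanAtMost_iff)
    qed
    also have "\<dots> = (if k \<in> S' then f (h * of_int k) else 0)" using finS' by simp
    also have "\<dots> \<le> u x"
    proof (cases "k \<in> S'")
      case True
      then have "a \<le> h * of_int k - h" and kb: "h * of_int k \<le> b" by (simp_all add: S'_def S_def)
      then have "a \<le> x" using k by linarith
      then show ?thesis using kb True k anti[of x "h * of_int k"] by (simp add: u_def)
    next
      case False
      then show ?thesis using bnd[of x] by (simp add: u_def indicator_def)
    qed
    finally show "w x \<le> u x" .
  qed
  moreover have "integral\<^sup>L lborel w = (\<Sum>k\<in>S'. f (h * of_int k) * h)"
    unfolding w_def using int_ind' by simp
  ultimately have low: "h * (\<Sum>k\<in>S'. f (h * of_int k)) \<le> integral\<^sup>L lborel u"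
    by (simp add: sum_distrib_left mult.commute)
  have "(\<Sum>k\<in>S. f (h * of_int k)) \<le> (\<Sum>k\<in>S'. f (h * of_int k)) + M"
  proof -
    have "S - S' \<subseteq> {\<lceil>a / h\<rceil>}"
    proof
      fix k assume "k \<in> S - S'"
      then have "a \<le> h * of_int k" "h * of_int k - h < a" by (auto simp: S'_def S_def)
      then have "a / h \<le> of_int k" "of_int k - 1 < a / h" using h by (auto simp: field_simps)
      then show "k \<in> {\<lceil>a / h\<rceil>}" by simp linarith
    qed
    then have c: "card (S - S') \<le> 1" using card_mono[of "{\<lceil>a / h\<rceil>}" "S - S'"] by simp
    have "(\<Sum>k\<in>S. f (h * of_int k)) = (\<Sum>k\<in>S'. f (h * of_int k)) + (\<Sum>k\<in>S - S'. f (h * of_int k))"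
      using sum.subset_diff[of S' S "\<lambda>k. f (h * of_int k)"] finS by (simp add: S'_def add.commute)
    also have "(\<Sum>k\<in>S - S'. f (h * of_int k)) \<le> (\<Sum>k\<in>S - S'. M)" using bnd by (intro sum_mono) (auto simp: S_def)
    also have "\<dots> \<le> M" using mult_right_mono[of "real (card (S - S'))" 1 M] c M by simp
    finally show ?thesis by simp
  qed
  then have "h * (\<Sum>k\<in>S. f (h * of_int k)) \<le> h * (\<Sum>k\<in>S'. f (h * of_int k)) + h * M"
    using h by (simp add: distrib_left[symmetric])
  then show ?thesis using upper low unfolding S_def[symmetric] u_def[symmetric] by (simp add: abs_le_iff algebra_simps)
qed

text \<open>The properties shared by \<open>mass_pos\<close> and \<open>mass_neg\<close>. The bound
  \<open>6 / t\<close> lets the inner integral grow logarithmically as \<open>s\<close> tends to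
  1.\<close>

locale triangle_density =
  fixes f :: "real \<Rightarrow> real \<Rightarrow> real"
  assumes meas: "(\<lambda>(s, t). f s t) \<in> borel_measurable (borel \<Otimes>\<^sub>M borel)"
    and nonneg: "\<And>s t. (s, t) \<in> farey_triangle \<Longrightarrow> 0 \<le> f s t"
    and bound: "\<And>s t. (s, t) \<in> farey_triangle \<Longrightarrow> f s t \<le> 6 / t"
    and anti_s: "\<And>s s' t. (s, t) \<in> farey_triangle \<Longrightarrow> (s', t) \<in> farey_triangle \<Longrightarrow> s \<le> s' \<Longrightarrow> f s' t \<le> f s t"
    and anti_t: "\<And>s t t'. (s, t) \<in> farey_triangle \<Longrightarrow> (s, t') \<in> farey_triangle \<Longrightarrow> t \<le> t' \<Longrightarrow> f s t' \<le> f s t"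
begin

definition inner :: "real \<Rightarrow> real" where
  "inner s = (LINT t|lborel. indicator {1 - s..s} t * f s t)"

lemma meas1 [measurable]: "(\<lambda>s. f s t) \<in> borel_measurable borel" "(\<lambda>t. f s t) \<in> borel_measurable borel"
proof -
  have "(\<lambda>s. (s, t)) \<in> borel \<rightarrow>\<^sub>M borel \<Otimes>\<^sub>M borel" "(\<lambda>t. (s, t)) \<in> borel \<rightarrow>\<^sub>M borel \<Otimes>\<^sub>M borel"
    by measurable
  from this[THEN measurable_compose, OF meas]
  show "(\<lambda>s. f s t) \<in> borel_measurable borel" "(\<lambda>t. f s t) \<in> borel_measurable borel" by simp_all
qed

lemma inner_measurable [measurable]: "inner \<in> borel_measurable borel"
proof -
  have "(\<lambda>(s, t). indicator {1 - s..s} t * f s t) \<in> borel_measurable (borel \<Otimes>\<^sub>M lborel)"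
  proof -
    have "(\<lambda>x. (if 1 - fst x \<le> snd x \<and> snd x \<le> fst x then 1 else 0) * (case x of (s, t) \<Rightarrow> f s t)) \<in> borel_measurable (borel \<Otimes>\<^sub>M borel)"
      using meas by measurable
    also have "(\<lambda>x. (if 1 - fst x \<le> snd x \<and> snd x \<le> fst x then 1 else 0) * (case x of (s, t) \<Rightarrow> f s t)) = (\<lambda>(s, t). indicator {1 - s..s} t * f s t)"
      by (auto simp: fun_eq_iff indicator_def)
    finally show ?thesis by simp
  qed
  then show ?thesis unfolding inner_def by (intro lborel.borel_measurable_lebesgue_integral) 
qed

lemma section_in: "s < 1 \<Longrightarrow> t \<in> {1 - s..s} \<Longrightarrow> (s, t) \<in> farey_triangle"
  by (auto simp: farey_triangle_def)

text \<open>The natural bound is \<open>- 6 * ln (1 - s)\<close>. The larger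
  \<open>12 / sqrt (1 - s)\<close> has an elementary integral, and its tail beyond
  \<open>1 - 1 / Q\<close> is of order \<open>1 / sqrt Q\<close>, which the final error can
  afford.\<close>

lemma inner_bounds:
  assumes "s < 1"
  shows "integrable lborel (\<lambda>t. indicator {1 - s..s} t * f s t)" "0 \<le> inner s" "inner s \<le> 12 / sqrt (1 - s)"
proof -
  show int: "integrable lborel (\<lambda>t. indicator {1 - s..s} t * f s t)"
  proof (rule Bochner_Integration.integrable_bound[where f = "\<lambda>t. (6 / (1 - s)) * indicator {1 - s..s} t"])
    show "AE t in lborel. norm (indicator {1 - s..s} t * f s t) \<le> norm (6 / (1 - s) * indicator {1 - s..s} t)"
    proof (rule AE_I2)
      fix t
      show "norm (indicator {1 - s..s} t * f s t) \<le> norm (6 / (1 - s) * indicator {1 - s..s} t)"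
      proof (cases "t \<in> {1 - s..s}")
        case True
        note T = section_in[OF assms True]
        have "f s t \<le> 6 / t" by (rule bound[OF T])
        also have "\<dots> \<le> 6 / (1 - s)" using True assms by (intro divide_left_mono) auto
        finally show ?thesis using True nonneg[OF T] assms by simp
      qed simp
    qed
    show "integrable lborel (\<lambda>t. 6 / (1 - s) * indicator {1 - s..s} t)" by (intro integrable_mult_right integrable_indicator_Icc)
  qed auto
  show "0 \<le> inner s" unfolding inner_def
  proof (rule Bochner_Integration.integral_nonneg)
    fix t show "0 \<le> indicator {1 - s..s} t * f s t"
      using nonneg[OF section_in[OF assms]] by (cases "t \<in> {1 - s..s}") auto
  qed
  show "inner s \<le> 12 / sqrt (1 - s)"
  proof (cases "1 - s \<le> s")
    case False
    then show ?thesis using assms by (simp add: inner_def)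
  next
    case True
    have "((\<lambda>t. 6 / t) has_integral (6 * ln s - 6 * ln (1 - s))) {1 - s..s}"
      using assms True by (intro fundamental_theorem_of_calculus)
        (auto intro!: derivative_eq_intros simp: has_real_derivative_iff_has_vector_derivative[symmetric])
    moreover have ai: "set_integrable lborel {1 - s..s} (\<lambda>t. 6 / t)"
      using assms by (intro borel_integrable_atLeastAtMost') (auto intro!: continuous_intros)
    ultimately have eq: "(LINT t:{1 - s..s}|lborel. 6 / t) = 6 * ln s - 6 * ln (1 - s)"
      using set_borel_integral_eq_integral(2) by (metis integral_unique)
    have "inner s \<le> (LINT t:{1 - s..s}|lborel. 6 / t)"
      unfolding inner_def set_lebesgue_integral_def
    proof (rule integral_mono[OF int])
      show "integrable lborel (\<lambda>t. indicator {1 - s..s} t *\<^sub>R (6 / t))" using ai by (simp add: set_integrable_def)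
      fix t show "indicator {1 - s..s} t * f s t \<le> indicator {1 - s..s} t *\<^sub>R (6 / t)"
        using bound[OF section_in[OF assms]] by (cases "t \<in> {1 - s..s}") auto
    qed
    also have "\<dots> \<le> - 6 * ln (1 - s)" using eq assms True by (simp add: ln_le_zero_iff)
    also have "\<dots> = 12 * ln (1 / sqrt (1 - s))" using assms by (simp add: ln_div ln_sqrt)
    also have "\<dots> \<le> 12 * (1 / sqrt (1 - s) - 1)" using assms ln_le_minus_one[of "1 / sqrt (1 - s)"] by simp
    finally show ?thesis by simp
  qed
qed

definition mass_integral :: real where
  "mass_integral = (LINT s|lborel. indicator {1/2..<1} s * inner s)"

text \<open>The larger denominator is at most \<open>Q - 1\<close>, so the grid points have
  \<open>s \<le> 1 - 1 / Q\<close>. This keeps \<open>t \<ge> 1 / Q\<close>, away from the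
  singularity.\<close>

definition cut_integral :: "nat \<Rightarrow> real" where
  "cut_integral Q = (LINT s|lborel. indicator {1/2..1 - 1 / real Q} s * inner s)"

lemma inverse_sqrt_integral:
  assumes "c < 1"
  shows "integrable lborel (\<lambda>s. indicator {c..<1} s * (12 / sqrt (1 - s)))"
    "(LINT s|lborel. indicator {c..<1} s * (12 / sqrt (1 - s))) = 24 * sqrt (1 - c)"
proof -
  have "((\<lambda>s. 12 / sqrt (1 - s)) has_integral (- 24 * sqrt (1 - 1) - (- 24 * sqrt (1 - c)))) {c..1}"
    using assms by (intro fundamental_theorem_of_calculus_interior)
     (auto intro!: continuous_intros derivative_eq_intros simp: has_real_derivative_iff_has_vector_derivative[symmetric] field_simps)
  then have hi: "((\<lambda>s. 12 / sqrt (1 - s)) has_integral 24 * sqrt (1 - c)) {c..1}" by simp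
  have hi': "((\<lambda>s. indicator {c..<1} s * (12 / sqrt (1 - s))) has_integral 24 * sqrt (1 - c)) {c..1}"
    by (rule has_integral_spike_finite[of "{1}", OF _ _ hi]) (auto simp: indicator_def)
  then have hi2: "((\<lambda>s. indicator {c..<1} s * (12 / sqrt (1 - s))) has_integral 24 * sqrt (1 - c)) UNIV"
    by (rule has_integral_on_superset) (auto simp: indicator_def)
  have hb: "has_bochner_integral lborel (\<lambda>s. indicator {c..<1} s * (12 / sqrt (1 - s))) (24 * sqrt (1 - c))"
  proof -
    have "(\<integral>\<^sup>+ s. ennreal (indicator {c..<1} s * (12 / sqrt (1 - s))) \<partial>lborel) = ennreal (24 * sqrt (1 - c))"
      by (rule nn_integral_has_integral_lborel[OF _ _ hi2]) (auto simp: indicator_def)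
    then show ?thesis using assms by (intro has_bochner_integral_nn_integral) (auto simp: indicator_def)
  qed
  then show "integrable lborel (\<lambda>s. indicator {c..<1} s * (12 / sqrt (1 - s)))"
    "(LINT s|lborel. indicator {c..<1} s * (12 / sqrt (1 - s))) = 24 * sqrt (1 - c)"
    by (auto simp: has_bochner_integral_iff)
qed

lemma inner_integrable:
  assumes "A \<subseteq> {1/2..<1}" "A \<in> sets borel"
  shows "integrable lborel (\<lambda>s. indicator A s * inner s)"
proof (rule Bochner_Integration.integrable_bound[OF inverse_sqrt_integral(1)[of "1/2"]])
  show "AE s in lborel. norm (indicator A s * inner s) \<le> norm (indicator {1/2..<1} s * (12 / sqrt (1 - s)))"
  proof (rule AE_I2)
    fix s
    show "norm (indicator A s * inner s) \<le> norm (indicator {1/2..<1} s * (12 / sqrt (1 - s)))"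
    proof (cases "s \<in> A")
      case True
      then have "s \<in> {1/2..<1}" using assms(1) by blast
      then show ?thesis using True inner_bounds(2,3)[of s] by simp
    qed simp
  qed
qed (use assms(2) in auto)

lemma cut_integral_error:
  assumes "Q \<ge> 2"
  shows "0 \<le> cut_integral Q" "cut_integral Q \<le> 24" "\<bar>mass_integral - cut_integral Q\<bar> \<le> 24 / sqrt (real Q)"
proof -
  define c where "c = 1 - 1 / real Q"
  have q: "1 / 2 \<le> c" "c < 1" using assms by (auto simp: field_simps c_def)
  have nn: "0 \<le> inner s" "inner s \<le> 12 / sqrt (1 - s)" if "s \<le> c \<or> s < 1" for s
    using inner_bounds(2,3)[of s] that q by auto
  have I1: "integrable lborel (\<lambda>s. indicator {1/2..<1} s * inner s)" by (intro inner_integrable) auto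
  have I2: "integrable lborel (\<lambda>s. indicator {1/2..c} s * inner s)" using q by (intro inner_integrable) auto
  have p1: "0 \<le> indicator {1/2..c} s * inner s" for s using nn[of s] by (cases "s \<in> {1/2..c}") auto
  have p2: "0 \<le> indicator {1/2..<1} s * inner s - indicator {1/2..c} s * inner s" for s
  proof (cases "s \<in> {1/2..<1}")
    case True then show ?thesis using nn[of s] by (cases "s \<in> {1/2..c}") auto
  next
    case False
    then have "s \<notin> {1/2..c}" using q by auto
    with False show ?thesis by simp
  qed
  have p3: "indicator {1/2..<1} s * inner s - indicator {1/2..c} s * inner s \<le> indicator {c..<1} s * (12 / sqrt (1 - s))" for s
  proof (cases "s \<in> {c..<1}")
    case True
    then have "s \<in> {1/2..<1}" using q by auto
    then show ?thesis using True nn[of s] by (cases "s \<in> {1/2..c}") auto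
  next
    case False
    then have "s \<in> {1/2..<1} \<longleftrightarrow> s \<in> {1/2..c}" using q by auto
    with False show ?thesis by (auto simp: indicator_def)
  qed
  have p4: "indicator {1/2..c} s * inner s \<le> indicator {1/2..<1} s * (12 / sqrt (1 - s))" for s
  proof (cases "s \<in> {1/2..c}")
    case True
    then have "s \<in> {1/2..<1}" using q by auto
    with True show ?thesis using nn[of s] by simp
  next
    case False
    then show ?thesis by (cases "s \<in> {1/2..<1}") auto
  qed
  show "0 \<le> cut_integral Q" unfolding cut_integral_def c_def[symmetric] by (intro Bochner_Integration.integral_nonneg p1)
  have diff: "mass_integral - cut_integral Q = (LINT s|lborel. indicator {1/2..<1} s * inner s - indicator {1/2..c} s * inner s)"
    unfolding mass_integral_def cut_integral_def c_def[symmetric]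
    by (rule Bochner_Integration.integral_diff[OF I1 I2, symmetric])
  have "0 \<le> mass_integral - cut_integral Q" unfolding diff by (intro Bochner_Integration.integral_nonneg p2)
  moreover have "mass_integral - cut_integral Q \<le> (LINT s|lborel. indicator {c..<1} s * (12 / sqrt (1 - s)))"
    unfolding diff using I1 I2 q(2)
    by (intro integral_mono inverse_sqrt_integral(1) Bochner_Integration.integrable_diff p3) auto
  moreover have "\<dots> = 24 / sqrt (real Q)"
    using inverse_sqrt_integral(2)[of c] q by (simp add: c_def real_sqrt_divide)
  ultimately show "\<bar>mass_integral - cut_integral Q\<bar> \<le> 24 / sqrt (real Q)" by simp
  have "cut_integral Q \<le> (LINT s|lborel. indicator {1/2..<1} s * (12 / sqrt (1 - s)))"
    unfolding cut_integral_def c_def[symmetric] using I2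
    by (intro integral_mono inverse_sqrt_integral(1) p4) auto
  also have "\<dots> = 24 * sqrt (1 / 2)" using inverse_sqrt_integral(2)[of "1/2"] by simp
  also have "\<dots> \<le> 24" by simp
  finally show "cut_integral Q \<le> 24" .
qed

end

section \<open>Moebius inversion\<close>

lemma sum_Pow_minus_one_power_card:
  assumes "finite A"
  shows "(\<Sum>S\<in>Pow A. (-1) ^ card S) = (of_bool (A = {}) :: real)"
  using assms
proof (induction A rule: finite_induct)
  case (insert x F)
  have "(\<Sum>S\<in>Pow (insert x F). (-1) ^ card S) = (\<Sum>S\<in>Pow F. (-1) ^ card S) + (\<Sum>S\<in>insert x ` Pow F. (-1) ^ card S :: real)"
    unfolding Pow_insert using insert by (intro sum.union_disjoint) auto
  also have "(\<Sum>S\<in>insert x ` Pow F. (-1) ^ card S :: real) = (\<Sum>S\<in>Pow F. (-1) ^ card (insert x S))"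
    using insert by (intro sum.reindex_cong[of "insert x"]) (auto simp: inj_on_def)
  also have "\<dots> = (\<Sum>S\<in>Pow F. - ((-1) ^ card S))"
  proof (intro sum.cong refl)
    fix S assume "S \<in> Pow F"
    then have "finite S" "x \<notin> S" using insert by (auto dest: finite_subset)
    then show "(-1) ^ card (insert x S) = - ((-1) ^ card S :: real)" by simp
  qed
  finally show ?case by (simp add: sum_negf)
qed simp

definition moebius_mu :: "nat \<Rightarrow> real" where
  "moebius_mu n = (if squarefree n then (-1) ^ card (prime_factors n) else 0)"

lemma abs_moebius_le: "\<bar>moebius_mu n\<bar> \<le> 1"
  by (simp add: moebius_mu_def power_abs)

lemma sum_moebius_divisors:
  assumes "n > 0"
  shows "(\<Sum>d | d dvd n. moebius_mu d) = of_bool (n = 1)"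
proof -
  have fin: "finite {d. d dvd n}" using assms by simp
  have pf: "prime_factors (\<Prod>S) = S" "squarefree (\<Prod>S)" "\<Prod>S dvd n" if S: "S \<subseteq> prime_factors n" for S
  proof -
    have finS: "finite S" using S finite_subset by blast
    have pr: "prime p" if "p \<in> S" for p using S that by auto
    have "prime_factors (prod id S) = \<Union> ((prime_factors \<circ> id) ` S)"
    proof (rule prime_factors_prod[OF finS])
      show "0 \<notin> id ` S" using pr[of 0] by auto
    qed
    also have "\<dots> = S" using pr by (auto simp: prime_factorization_prime)
    finally show "prime_factors (\<Prod>S) = S" by (simp add: id_def)
    have cop: "coprime p q" if "p \<in> S" "q \<in> S" "p \<noteq> q" for p q using that pr primes_coprime by blast
    show "squarefree (\<Prod>S)" 
      using pr cop by (intro squarefree_prod_coprime) (auto intro: squarefree_prime prime_imp_prime_elem)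
    have "\<Prod>S dvd \<Prod>(prime_factors n)" using S by (intro prod_dvd_prod_subset) auto
    also have "\<dots> dvd (\<Prod>p\<in>prime_factors n. p ^ multiplicity p n)"
    proof (rule prod_dvd_prod)
      fix p assume "p \<in> prime_factors n"
      then have "multiplicity p n > 0" by (auto simp: prime_factors_multiplicity)
      then show "p dvd p ^ multiplicity p n" by (rule dvd_power[OF disjI1])
    qed
    also have "\<dots> = n" using assms by (rule prime_factorization_nat[symmetric])
    finally show "\<Prod>S dvd n" .
  qed
  have "(\<Sum>d | d dvd n. moebius_mu d) = (\<Sum>d | d dvd n \<and> squarefree d. (-1) ^ card (prime_factors d))"
    using fin by (intro sum.mono_neutral_cong_right) (auto simp: moebius_mu_def)
  also have "\<dots> = (\<Sum>S\<in>Pow (prime_factors n). (-1) ^ card S)"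
  proof (rule sum.reindex_bij_witness[of _ "\<lambda>S. \<Prod>S" prime_factors])
    fix d assume "d \<in> {d. d dvd n \<and> squarefree d}"
    then have d: "d dvd n" "squarefree d" "d > 0" using assms by (auto intro: Nat.gr0I)
    have "\<Prod>(prime_factors d) = (\<Prod>p\<in>prime_factors d. p ^ multiplicity p d)"
      using d squarefree_factorial_semiring'[of d] by (intro prod.cong refl) simp
    also have "\<dots> = d" using d(3) by (rule prime_factorization_nat[symmetric])
    finally show "\<Prod>(prime_factors d) = d" .
    show "prime_factors d \<in> Pow (prime_factors n)" using d assms by (auto simp: dvd_prime_factors)
  qed (use pf in auto)
  also have "\<dots> = of_bool (prime_factors n = {})" by (rule sum_Pow_minus_one_power_card) simp
  also have "prime_factors n = {} \<longleftrightarrow> n = 1" using assms by (simp add: prime_factorization_empty_iff)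
  finally show ?thesis .
qed

lemma of_bool_coprime_eq_sum_moebius:
  fixes K L :: int
  assumes "0 < L" "L \<le> int Q"
  shows "of_bool (coprime K L) = (\<Sum>d=1..Q. moebius_mu d * of_bool (int d dvd K \<and> int d dvd L))"
proof -
  define g where "g = nat (gcd K L)"
  have g: "int g = gcd K L" "g > 0" using assms by (auto simp: g_def gcd_pos_int)
  have "{d \<in> {1..Q}. int d dvd K \<and> int d dvd L} = {d. d dvd g}"
  proof (intro equalityI subsetI)
    fix d assume "d \<in> {d \<in> {1..Q}. int d dvd K \<and> int d dvd L}"
    then have "int d dvd int g" unfolding g by simp
    then show "d \<in> {d. d dvd g}" by simp
  next
    fix d assume "d \<in> {d. d dvd g}"
    then have dg: "d dvd g" by simp
    then have "int d dvd gcd K L" using g(1) by (metis int_dvd_int_iff)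
    then have "int d dvd K" "int d dvd L" by auto
    moreover from this(2) have "int d \<le> L" using assms(1) by (rule zdvd_imp_le)
    moreover have "d > 0" using dg g by (auto intro: Nat.gr0I)
    ultimately show "d \<in> {d \<in> {1..Q}. int d dvd K \<and> int d dvd L}" using assms by auto
  qed
  moreover have "(\<Sum>d=1..Q. moebius_mu d * of_bool (int d dvd K \<and> int d dvd L)) = (\<Sum>d\<in>{d \<in> {1..Q}. int d dvd K \<and> int d dvd L}. moebius_mu d)"
    by (intro sum.mono_neutral_cong_right) auto
  moreover have "coprime K L \<longleftrightarrow> g = 1" using g by (metis coprime_iff_gcd_eq_1 of_nat_1_eq_iff)
  ultimately show ?thesis using sum_moebius_divisors[OF g(2)] by simp
qed

section \<open>Lattice sums over the truncated triangle\<close>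

definition cut_triangle :: "nat \<Rightarrow> (real \<times> real) set" where
  "cut_triangle Q = {(s, t). 1 - s \<le> t \<and> t \<le> s \<and> s \<le> 1 - 1 / real Q}"

lemma cut_triangle_facts:
  assumes "(s, t) \<in> cut_triangle Q" "Q > 0"
  shows "1 / real Q \<le> t" "t \<le> s" "s \<le> 1 - 1 / real Q" "1 / 2 \<le> s" "(s, t) \<in> farey_triangle" "s < 1" "0 < t"
proof -
  have st: "1 - s \<le> t" "t \<le> s" "s \<le> 1 - 1 / real Q" and q: "0 < 1 / real Q" using assms by (auto simp: cut_triangle_def)
  then show f: "1 / real Q \<le> t" "t \<le> s" "s \<le> 1 - 1 / real Q" "1 / 2 \<le> s" "s < 1" "0 < t" by linarith+
  then show "(s, t) \<in> farey_triangle" using st by (simp add: farey_triangle_def)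
qed

text \<open>With mesh \<open>h = d / Q\<close> these are the pairs of denominators divisible by
  \<open>d\<close>, after division by \<open>d\<close>.\<close>

definition cut_grid :: "real \<Rightarrow> nat \<Rightarrow> (int \<times> int) set" where
  "cut_grid h Q = {(k, l). (h * of_int k, h * of_int l) \<in> cut_triangle Q}"

lemma finite_cut_grid: "h > 0 \<Longrightarrow> Q > 0 \<Longrightarrow> finite (cut_grid h Q)"
proof -
  assume h: "h > 0" "Q > 0"
  have "cut_grid h Q \<subseteq> {0..\<lfloor>1 / h\<rfloor>} \<times> {0..\<lfloor>1 / h\<rfloor>}"
  proof
    fix x assume x: "x \<in> cut_grid h Q"
    obtain k l where e: "x = (k, l)" by (cases x)
    have kl: "(h * of_int k, h * of_int l) \<in> cut_triangle Q" using x by (simp add: e cut_grid_def)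
    note f = cut_triangle_facts[OF kl h(2)]
    have "h * of_int l > 0" "h * of_int k > 0" "h * of_int k \<le> 1" "h * of_int l \<le> 1" using f by linarith+
    then have "of_int l > (0::real)" "of_int k > (0::real)" "of_int k \<le> 1 / h" "of_int l \<le> 1 / h" using h by (auto simp: zero_less_mult_iff field_simps)
    then show "x \<in> {0..\<lfloor>1 / h\<rfloor>} \<times> {0..\<lfloor>1 / h\<rfloor>}" by (simp add: e le_floor_iff)
  qed
  then show ?thesis by (rule finite_subset) simp
qed

lemma inverse_integral:
  assumes "Q \<ge> 2"
  shows "integrable lborel (\<lambda>s. indicator {1/2..1 - 1 / real Q} s * (1 / (1 - s)))"
    "(LINT s|lborel. indicator {1/2..1 - 1 / real Q} s * (1 / (1 - s))) \<le> ln (real Q)"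
proof -
  define c where "c = 1 - 1 / real Q"
  have c: "1 / 2 \<le> c" "c < 1" using assms by (auto simp: field_simps c_def)
  have "((\<lambda>s. 1 / (1 - s)) has_integral (- ln (1 - c) - (- ln (1 - 1 / 2)))) {1/2..c}"
    using c by (intro fundamental_theorem_of_calculus)
      (auto intro!: derivative_eq_intros simp: has_real_derivative_iff_has_vector_derivative[symmetric])
  moreover have ai: "set_integrable lborel {1/2..c} (\<lambda>s. 1 / (1 - s))"
    using c by (intro borel_integrable_atLeastAtMost') (auto intro!: continuous_intros)
  ultimately have eq: "(LINT s:{1/2..c}|lborel. 1 / (1 - s)) = - ln (1 - c) - (- ln (1 - 1 / 2))"
    using set_borel_integral_eq_integral(2) by (metis integral_unique)
  show "integrable lborel (\<lambda>s. indicator {1/2..1 - 1 / real Q} s * (1 / (1 - s)))"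
    using ai by (simp add: set_integrable_def c_def)
  have "- ln (1 - c) = ln (real Q)" using assms by (simp add: c_def ln_div)
  moreover have "ln (1 / 2 :: real) \<le> 0" by simp
  ultimately show "(LINT s|lborel. indicator {1/2..1 - 1 / real Q} s * (1 / (1 - s))) \<le> ln (real Q)"
    using eq by (simp add: set_lebesgue_integral_def c_def)
qed

context triangle_density
begin

text \<open>Two one-dimensional Riemann sums in succession. For fixed \<open>t = h * l\<close>,
  summing over \<open>k\<close> errs by \<open>6 / l\<close>, which adds up to a logarithm over the
  rows \<open>l\<close>. For fixed \<open>s\<close>, the remaining sum over \<open>l\<close> errs by
  \<open>6 * h / (1 - s)\<close>, and integrating this up to \<open>1 - 1 / Q\<close> gives the
  second logarithm.\<close>

lemma grid_sum_error:
  assumes Q: "Q \<ge> 2" and h: "1 / real Q \<le> h"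
  shows "\<bar>h\<^sup>2 * (\<Sum>(k, l)\<in>cut_grid h Q. f (h * of_int k) (h * of_int l)) - cut_integral Q\<bar> \<le> 12 * h * (1 + ln (real Q))"
proof -
  have Q0: "Q > 0" using Q by simp
  then have "0 < 1 / real Q" by simp
  then have h0: "h > 0" using h by linarith
  define c where "c = 1 - 1 / real Q"
  have c: "1 / 2 \<le> c" "c < 1" using Q by (auto simp: field_simps c_def)
  define n where "n = nat \<lfloor>1 / h\<rfloor>"
  have nQ: "n \<le> Q"
  proof -
    have "1 / h \<le> real Q" using h h0 Q0 by (simp add: field_simps)
    then show ?thesis unfolding n_def by linarith
  qed
  have l_range: "l \<in> {1..int n}" if "0 < h * of_int l" "h * of_int l \<le> 1" for l
  proof -
    have "of_int l > (0::real)" "of_int l \<le> 1 / h" using that h0 by (auto simp: zero_less_mult_iff field_simps)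
    then have "l \<ge> 1" "l \<le> \<lfloor>1 / h\<rfloor>" by (simp_all add: le_floor_iff)
    then show ?thesis unfolding n_def using h0 by auto
  qed
  define low where "low = (\<lambda>t::real. max t (1 - t))"
  have sec: "(s, t) \<in> cut_triangle Q \<longleftrightarrow> low t \<le> s \<and> s \<le> c" for s t
    by (auto simp: cut_triangle_def low_def c_def)
  define S where "S = (\<lambda>l::int. {k::int. low (h * of_int l) \<le> h * of_int k \<and> h * of_int k \<le> c})"
  have grid: "cut_grid h Q = (\<lambda>(l, k). (k, l)) ` (SIGMA l:{1..int n}. S l)"
  proof -
    have "l \<in> {1..int n}" if "(h * of_int k, h * of_int l) \<in> cut_triangle Q" for k l
      using cut_triangle_facts[OF that Q0] by (intro l_range) auto
    then show ?thesis unfolding cut_grid_def S_def by (auto simp: sec image_iff)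
  qed
  have finS: "finite (S l)" for l
  proof (rule finite_subset)
    show "S l \<subseteq> {\<lceil>low (h * of_int l) / h\<rceil>..\<lfloor>c / h\<rfloor>}" using h0 by (auto simp: S_def ceiling_le_iff le_floor_iff field_simps)
  qed simp
  have "(\<Sum>(k, l)\<in>cut_grid h Q. f (h * of_int k) (h * of_int l)) = (\<Sum>(l, k)\<in>(SIGMA l:{1..int n}. S l). f (h * of_int k) (h * of_int l))"
    unfolding grid by (subst sum.reindex) (auto simp: inj_on_def case_prod_unfold)
  also have "\<dots> = (\<Sum>l=1..int n. \<Sum>k\<in>S l. f (h * of_int k) (h * of_int l))"
    using finS by (intro sum.Sigma[symmetric]) auto
  finally have gs: "(\<Sum>(k, l)\<in>cut_grid h Q. f (h * of_int k) (h * of_int l)) = (\<Sum>l=1..int n. \<Sum>k\<in>S l. f (h * of_int k) (h * of_int l))" .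
  define R where "R = (\<lambda>l::int. LINT s|lborel. indicator {low (h * of_int l)..c} s * f s (h * of_int l))"
  have tri: "(s, h * of_int l) \<in> farey_triangle" if "low (h * of_int l) \<le> s" "s \<le> c" for s l
    using cut_triangle_facts(5)[OF _ Q0] that sec by blast
  have e1: "\<bar>h * (\<Sum>k\<in>S l. f (h * of_int k) (h * of_int l)) - R l\<bar> \<le> 6 / of_int l" if l: "l \<in> {1..int n}" for l
  proof -
    have t0: "h * of_int l > 0" using l h0 by simp
    have "\<bar>h * (\<Sum>k\<in>S l. f (h * of_int k) (h * of_int l)) - R l\<bar> \<le> h * (6 / (h * of_int l))"
      unfolding S_def R_def
    proof (rule antimono_riemann_sum[where f = "\<lambda>s. f s (h * of_int l)", OF meas1(1) h0])
      show "0 \<le> 6 / (h * of_int l)" using t0 by simp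
      fix x y assume xy: "low (h * of_int l) \<le> x" "x \<le> y" "y \<le> c"
      have "(x, h * of_int l) \<in> farey_triangle" "(y, h * of_int l) \<in> farey_triangle" using xy by (auto intro!: tri)
      then show "f y (h * of_int l) \<le> f x (h * of_int l)" using xy(2) by (rule anti_s)
    next
      fix x assume x: "low (h * of_int l) \<le> x" "x \<le> c"
      show "0 \<le> f x (h * of_int l) \<and> f x (h * of_int l) \<le> 6 / (h * of_int l)"
        using nonneg[OF tri[OF x]] bound[OF tri[OF x]] by blast
    qed
    then show ?thesis using h0 by simp
  qed
  have harm: "(\<Sum>l=1..int n. 6 / of_int l) \<le> 6 * (1 + ln (real Q))"
  proof (cases "n = 0")
    case True
    then show ?thesis using Q0 by simp
  next
    case False
    have "(\<Sum>l=1..int n. 6 / of_int l) = (\<Sum>k=1..n. 6 / real k)"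
      by (rule sum.reindex_bij_witness[of _ int nat]) auto
    also have "\<dots> = 6 * (\<Sum>k=1..n. 1 / real k)" by (simp add: sum_distrib_left)
    also have "\<dots> \<le> 6 * (1 + ln (real n))" using harm_le_ln[of n] False by simp
    also have "\<dots> \<le> 6 * (1 + ln (real Q))" using nQ False by simp
    finally show ?thesis .
  qed
  have step1: "\<bar>h\<^sup>2 * (\<Sum>(k, l)\<in>cut_grid h Q. f (h * of_int k) (h * of_int l)) - h * (\<Sum>l=1..int n. R l)\<bar> \<le> 6 * h * (1 + ln (real Q))"
  proof -
    have "h\<^sup>2 * (\<Sum>(k, l)\<in>cut_grid h Q. f (h * of_int k) (h * of_int l)) - h * (\<Sum>l=1..int n. R l) =
        h * (\<Sum>l=1..int n. h * (\<Sum>k\<in>S l. f (h * of_int k) (h * of_int l)) - R l)"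
      unfolding gs sum_subtractf sum_distrib_left[symmetric] by (simp add: power2_eq_square algebra_simps)
    also have "\<bar>\<dots>\<bar> \<le> h * (\<Sum>l=1..int n. 6 / of_int l)"
      unfolding abs_mult using h0 e1 by (intro mult_mono order.trans[OF sum_abs] sum_mono) (auto intro!: sum_nonneg)
    also have "\<dots> \<le> h * (6 * (1 + ln (real Q)))" using harm h0 by (intro mult_left_mono) auto
    finally show ?thesis by (simp add: mult_ac)
  qed
  define u where "u = (\<lambda>s. h * (\<Sum>l=1..int n. indicator {low (h * of_int l)..c} s * f s (h * of_int l)))"
  have int1: "integrable lborel (\<lambda>s. indicator {low (h * of_int l)..c} s * f s (h * of_int l))" if l: "l \<in> {1..int n}" for l
  proof (rule Bochner_Integration.integrable_bound[where f = "\<lambda>s. (6 / (h * of_int l)) * indicator {low (h * of_int l)..c} s"])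
    show "integrable lborel (\<lambda>s. 6 / (h * of_int l) * indicator {low (h * of_int l)..c} s)" by (intro integrable_mult_right integrable_indicator_Icc)
    show "AE s in lborel. norm (indicator {low (h * of_int l)..c} s * f s (h * of_int l)) \<le> norm (6 / (h * of_int l) * indicator {low (h * of_int l)..c} s)"
    proof (rule AE_I2)
      fix s
      show "norm (indicator {low (h * of_int l)..c} s * f s (h * of_int l)) \<le> norm (6 / (h * of_int l) * indicator {low (h * of_int l)..c} s)"
      proof (cases "s \<in> {low (h * of_int l)..c}")
        case True
        then have T: "(s, h * of_int l) \<in> farey_triangle" by (intro tri) auto
        have "h * of_int l > 0" using l h0 by simp
        then show ?thesis using True nonneg[OF T] bound[OF T] by simp
      qed simp
    qed
  qed auto
  have int_u: "integrable lborel u" unfolding u_def using int1 by (intro integrable_mult_right Bochner_Integration.integrable_sum)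
  have Iu: "integral\<^sup>L lborel u = h * (\<Sum>l=1..int n. R l)"
    unfolding u_def R_def integral_mult_right_zero
    by (rule arg_cong[of _ _ "\<lambda>x. h * x"], rule Bochner_Integration.integral_sum[OF int1])
  have int_i: "integrable lborel (\<lambda>s. indicator {1/2..c} s * inner s)" using c by (intro inner_integrable) auto
  have pw: "\<bar>u s - indicator {1/2..c} s * inner s\<bar> \<le> 6 * h * (indicator {1/2..c} s * (1 / (1 - s)))" for s
  proof (cases "s \<in> {1/2..c}")
    case False
    have z: "indicator {low (h * of_int l)..c} s * f s (h * of_int l) = 0" for l
      using False by (auto simp: indicator_def low_def)
    show ?thesis using False unfolding u_def z by simp
  next
    case True
    then have s: "1 / 2 \<le> s" "s \<le> c" "s < 1" using c by auto
    have iff: "low (h * of_int l) \<le> s \<longleftrightarrow> 1 - s \<le> h * of_int l \<and> h * of_int l \<le> s" for l by (auto simp: low_def)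
    have "u s = h * (\<Sum>l | 1 - s \<le> h * of_int l \<and> h * of_int l \<le> s. f s (h * of_int l))"
    proof -
      have "l \<in> {1..int n}" if "1 - s \<le> h * of_int l" "h * of_int l \<le> s" for l
        using that s by (intro l_range) auto
      then have "(\<Sum>l=1..int n. indicator {low (h * of_int l)..c} s * f s (h * of_int l)) = (\<Sum>l | 1 - s \<le> h * of_int l \<and> h * of_int l \<le> s. f s (h * of_int l))"
        using s by (intro sum.mono_neutral_cong_right) (auto simp: iff indicator_def)
      then show ?thesis by (simp add: u_def)
    qed
    moreover have "\<bar>h * (\<Sum>l | 1 - s \<le> h * of_int l \<and> h * of_int l \<le> s. f s (h * of_int l)) - inner s\<bar> \<le> h * (6 / (1 - s))"
      unfolding inner_def
    proof (rule antimono_riemann_sum[OF meas1(2) h0])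
      show "0 \<le> 6 / (1 - s)" using s by simp
      fix x y assume xy: "1 - s \<le> x" "x \<le> y" "y \<le> s"
      show "f s y \<le> f s x" by (rule anti_t[OF section_in section_in xy(2)]) (use s xy in auto)
    next
      fix x assume x: "1 - s \<le> x" "x \<le> s"
      have T: "(s, x) \<in> farey_triangle" by (rule section_in) (use s x in auto)
      have "f s x \<le> 6 / x" by (rule bound[OF T])
      also have "\<dots> \<le> 6 / (1 - s)" using x s by (intro divide_left_mono) auto
      finally show "0 \<le> f s x \<and> f s x \<le> 6 / (1 - s)" using nonneg[OF T] by blast
    qed
    ultimately show ?thesis using True by (simp add: mult.commute[of h 6])
  qed
  have "\<bar>h * (\<Sum>l=1..int n. R l) - cut_integral Q\<bar> \<le> 6 * h * ln (real Q)"
  proof -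
    have "\<bar>h * (\<Sum>l=1..int n. R l) - cut_integral Q\<bar> = \<bar>LINT s|lborel. u s - indicator {1/2..c} s * inner s\<bar>"
      unfolding Iu[symmetric] cut_integral_def c_def[symmetric]
      by (subst Bochner_Integration.integral_diff[OF int_u int_i]) simp
    also have "\<dots> \<le> (LINT s|lborel. \<bar>u s - indicator {1/2..c} s * inner s\<bar>)" by (rule integral_abs_bound)
    also have "\<dots> \<le> (LINT s|lborel. 6 * h * (indicator {1/2..c} s * (1 / (1 - s))))"
      using inverse_integral(1)[OF Q] int_u int_i unfolding c_def[symmetric]
      by (intro integral_mono pw integrable_mult_right integrable_abs Bochner_Integration.integrable_diff)
    also have "\<dots> = 6 * h * (LINT s|lborel. indicator {1/2..c} s * (1 / (1 - s)))" by (rule integral_mult_right_zero)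
    also have "\<dots> \<le> 6 * h * ln (real Q)" using inverse_integral(2)[OF Q] h0 unfolding c_def[symmetric] by (intro mult_left_mono) auto
    finally show ?thesis .
  qed
  moreover have "0 \<le> 6 * h" using h0 by simp
  ultimately show ?thesis using step1 by (simp add: algebra_simps)
qed

text \<open>Moebius inversion leads to grids of mesh \<open>d / Q\<close>. Their errors,
  proportional to \<open>d / Q\<close> and weighted by \<open>1 / d ^ 2\<close>, add up to a squared
  logarithm over \<open>Q\<close>; restoring the truncated part of the integral costs
  \<open>24 / sqrt Q\<close> times a logarithm. The Moebius sum stays finite and
  unevaluated.\<close>

lemma coprime_sum_error:
  assumes Q: "Q \<ge> 2"
  shows "\<bar>(\<Sum>(K, L)\<in>cut_grid (1 / real Q) Q. of_bool (coprime K L) * f (of_int K / real Q) (of_int L / real Q)) / (real Q)\<^sup>2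
     - (\<Sum>d=1..Q. moebius_mu d / (real d)\<^sup>2) * mass_integral\<bar> \<le> 36 * (1 + ln (real Q))\<^sup>2 / sqrt (real Q)"
proof -
  have Q0: "real Q > 0" using Q by simp
  define T where "T = cut_grid (1 / real Q) Q"
  have finT: "finite T" unfolding T_def using Q by (intro finite_cut_grid) auto
  have T: "0 < L" "L \<le> int Q" if "(K, L) \<in> T" for K L
  proof -
    have "(of_int K / real Q, of_int L / real Q) \<in> cut_triangle Q" using that by (simp add: T_def cut_grid_def)
    from cut_triangle_facts[OF this] have "0 < of_int L / real Q" "of_int L / real Q \<le> 1" using Q by linarith+
    then have "0 < real_of_int L" "real_of_int L \<le> real_of_int (int Q)" using Q0 by (auto simp: field_simps)
    then show "0 < L" "L \<le> int Q" by linarith+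
  qed
  define A where "A = (\<lambda>d. \<Sum>(k, l)\<in>cut_grid (real d / real Q) Q. f (real d / real Q * of_int k) (real d / real Q * of_int l))"
  have mult: "(\<Sum>(K, L)\<in>T. of_bool (int d dvd K \<and> int d dvd L) * f (of_int K / real Q) (of_int L / real Q)) = A d" if d: "d \<in> {1..Q}" for d
  proof -
    have "(\<Sum>(K, L)\<in>T. of_bool (int d dvd K \<and> int d dvd L) * f (of_int K / real Q) (of_int L / real Q)) =
      (\<Sum>(K, L)\<in>{(K, L)\<in>T. int d dvd K \<and> int d dvd L}. f (of_int K / real Q) (of_int L / real Q))"
      using finT by (intro sum.mono_neutral_cong_right) auto
    also have "\<dots> = A d" unfolding A_def
      using d by (intro sum.reindex_bij_witness[of _ "\<lambda>(k, l). (int d * k, int d * l)" "\<lambda>(K, L). (K div int d, L div int d)"])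
        (auto simp: T_def cut_grid_def elim!: dvdE)
    finally show ?thesis .
  qed
  have "(\<Sum>(K, L)\<in>T. of_bool (coprime K L) * f (of_int K / real Q) (of_int L / real Q)) =
     (\<Sum>(K, L)\<in>T. \<Sum>d=1..Q. moebius_mu d * (of_bool (int d dvd K \<and> int d dvd L) * f (of_int K / real Q) (of_int L / real Q)))"
  proof (intro sum.cong refl)
    fix x assume "x \<in> T"
    moreover obtain K L where e: "x = (K, L)" by (cases x)
    ultimately have c: "of_bool (coprime K L) = (\<Sum>d=1..Q. moebius_mu d * of_bool (int d dvd K \<and> int d dvd L))"
      using T[of K L] by (intro of_bool_coprime_eq_sum_moebius) auto
    show "(case x of (K, L) \<Rightarrow> of_bool (coprime K L) * f (of_int K / real Q) (of_int L / real Q)) =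
      (case x of (K, L) \<Rightarrow> \<Sum>d=1..Q. moebius_mu d * (of_bool (int d dvd K \<and> int d dvd L) * f (of_int K / real Q) (of_int L / real Q)))"
      unfolding e prod.case c sum_distrib_right by (simp only: mult.assoc)
  qed
  also have "\<dots> = (\<Sum>d=1..Q. moebius_mu d * (\<Sum>(K, L)\<in>T. of_bool (int d dvd K \<and> int d dvd L) * f (of_int K / real Q) (of_int L / real Q)))"
    unfolding case_prod_unfold sum_distrib_left by (rule sum.swap)
  also have "\<dots> = (\<Sum>d=1..Q. moebius_mu d * A d)" using mult by (intro sum.cong refl) simp
  finally have main: "(\<Sum>(K, L)\<in>T. of_bool (coprime K L) * f (of_int K / real Q) (of_int L / real Q)) = (\<Sum>d=1..Q. moebius_mu d * A d)" .
  define lnQ where "lnQ = 1 + ln (real Q)"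
  have lnQ: "lnQ \<ge> 1" using Q by (simp add: lnQ_def)
  define M where "M = (\<Sum>d=1..Q. moebius_mu d / (real d)\<^sup>2)"
  have harm: "(\<Sum>d=1..Q. 1 / real d) \<le> lnQ" unfolding lnQ_def using harm_le_ln[of Q] Q by simp
  have "(\<Sum>d=1..Q. moebius_mu d * A d) / (real Q)\<^sup>2 - M * cut_integral Q =
    (\<Sum>d=1..Q. moebius_mu d / (real d)\<^sup>2 * ((real d / real Q)\<^sup>2 * A d - cut_integral Q))"
    unfolding M_def sum_distrib_right sum_divide_distrib sum_subtractf[symmetric]
    by (intro sum.cong refl) (simp add: field_simps)
  also have "\<bar>\<dots>\<bar> \<le> (\<Sum>d=1..Q. 12 * lnQ / real Q * (1 / real d))"
  proof (rule order.trans[OF sum_abs], rule sum_mono)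
    fix d assume d: "d \<in> {1..Q}"
    have "\<bar>(real d / real Q)\<^sup>2 * A d - cut_integral Q\<bar> \<le> 12 * (real d / real Q) * lnQ"
      unfolding A_def lnQ_def using d by (intro grid_sum_error[OF Q] divide_right_mono) auto
    moreover have "\<bar>moebius_mu d / (real d)\<^sup>2\<bar> \<le> 1 / (real d)\<^sup>2" using abs_moebius_le[of d] by (simp add: divide_right_mono)
    ultimately have "\<bar>moebius_mu d / (real d)\<^sup>2 * ((real d / real Q)\<^sup>2 * A d - cut_integral Q)\<bar> \<le> 1 / (real d)\<^sup>2 * (12 * (real d / real Q) * lnQ)"
      unfolding abs_mult by (intro mult_mono) auto
    also have "\<dots> = 12 * lnQ / real Q * (1 / real d)" using d by (simp add: power2_eq_square)
    finally show "\<bar>moebius_mu d / (real d)\<^sup>2 * ((real d / real Q)\<^sup>2 * A d - cut_integral Q)\<bar> \<le> 12 * lnQ / real Q * (1 / real d)" .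
  qed
  also have "\<dots> = 12 * lnQ / real Q * (\<Sum>d=1..Q. 1 / real d)" by (rule sum_distrib_left[symmetric])
  also have "\<dots> \<le> 12 * lnQ / real Q * lnQ" using harm lnQ Q0 by (intro mult_left_mono) auto
  also have "\<dots> = 12 * lnQ\<^sup>2 / real Q" by (simp add: power2_eq_square)
  also have "\<dots> \<le> 12 * lnQ\<^sup>2 / sqrt (real Q)"
  proof (rule divide_left_mono)
    have "sqrt (real Q) * 1 \<le> sqrt (real Q) * sqrt (real Q)" using Q by (intro mult_left_mono) auto
    then show "sqrt (real Q) \<le> real Q" by simp
  qed (use Q0 in auto)
  finally have e1: "\<bar>(\<Sum>d=1..Q. moebius_mu d * A d) / (real Q)\<^sup>2 - M * cut_integral Q\<bar> \<le> 12 * lnQ\<^sup>2 / sqrt (real Q)" .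
  have M: "\<bar>M\<bar> \<le> lnQ"
  proof -
    have "\<bar>M\<bar> \<le> (\<Sum>d=1..Q. 1 / real d)" unfolding M_def
    proof (rule order.trans[OF sum_abs], rule sum_mono)
      fix d assume d: "d \<in> {1..Q}"
      have "\<bar>moebius_mu d / (real d)\<^sup>2\<bar> \<le> 1 / (real d)\<^sup>2" using abs_moebius_le[of d] by (simp add: divide_right_mono)
      also have "\<dots> \<le> 1 / real d" using d by (intro divide_left_mono) (auto simp: power2_eq_square)
      finally show "\<bar>moebius_mu d / (real d)\<^sup>2\<bar> \<le> 1 / real d" .
    qed
    then show ?thesis using harm by linarith
  qed
  have "\<bar>M * cut_integral Q - M * mass_integral\<bar> \<le> lnQ * (24 / sqrt (real Q))"
    unfolding right_diff_distrib[symmetric] abs_mult using M cut_integral_error(3)[OF Q] lnQ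
    by (intro mult_mono) (auto simp: abs_minus_commute)
  also have "\<dots> \<le> lnQ\<^sup>2 * (24 / sqrt (real Q))" using lnQ by (intro mult_right_mono) (auto simp: power2_eq_square)
  finally have e2: "\<bar>M * cut_integral Q - M * mass_integral\<bar> \<le> 24 * lnQ\<^sup>2 / sqrt (real Q)" by (simp add: mult_ac)
  have "\<bar>(\<Sum>d=1..Q. moebius_mu d * A d) / (real Q)\<^sup>2 - M * mass_integral\<bar> \<le> 12 * lnQ\<^sup>2 / sqrt (real Q) + 24 * lnQ\<^sup>2 / sqrt (real Q)"
    using e1 e2 by linarith
  also have "\<dots> = 36 * lnQ\<^sup>2 / sqrt (real Q)" by (simp add: add_divide_distrib[symmetric])
  finally show ?thesis unfolding T_def[symmetric] main M_def lnQ_def .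
qed

end

section \<open>The dilogarithm and explicit primitives\<close>

lemma Li2_summable: "\<bar>x\<bar> \<le> 1 \<Longrightarrow> summable (\<lambda>n. x ^ Suc n / (real (Suc n))\<^sup>2)"
proof (rule summable_comparison_test'[of "\<lambda>n. 1 / (real (Suc n))\<^sup>2" 0])
  show "summable (\<lambda>n. 1 / (real (Suc n))\<^sup>2)" using inverse_squares_sums by (simp add: sums_iff add.commute)
  fix n assume "\<bar>x\<bar> \<le> 1"
  then show "norm (x ^ Suc n / (real (Suc n))\<^sup>2) \<le> 1 / (real (Suc n))\<^sup>2"
    by (simp only: real_norm_def abs_divide power_abs abs_power2 abs_of_nat) (intro divide_right_mono power_le_one, auto)
qed

lemma continuous_on_Li2: "continuous_on {0..1} Li2"
proof -
  have "uniform_limit {0..1} (\<lambda>n x. \<Sum>i<n. x ^ Suc i / (real (Suc i))\<^sup>2) (\<lambda>x. \<Sum>i. x ^ Suc i / (real (Suc i))\<^sup>2) sequentially"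
  proof (rule Weierstrass_m_test)
    show "summable (\<lambda>n. 1 / (real (Suc n))\<^sup>2)" using inverse_squares_sums by (simp add: sums_iff add.commute)
    fix n and x :: real assume "x \<in> {0..1}"
    then show "norm (x ^ Suc n / (real (Suc n))\<^sup>2) \<le> 1 / (real (Suc n))\<^sup>2"
      by (simp only: real_norm_def abs_divide power_abs abs_power2 abs_of_nat) (intro divide_right_mono power_le_one, auto)
  qed
  then have "continuous_on {0..1} (\<lambda>x::real. \<Sum>i. x ^ Suc i / (real (Suc i))\<^sup>2)"
    by (rule uniform_limit_theorem[rotated]) (auto intro!: continuous_intros always_eventually)
  then show ?thesis by (simp add: Li2_def[abs_def])
qed

lemma continuous_on_Li2_compose [continuous_intros]:
  "continuous_on S f \<Longrightarrow> f ` S \<subseteq> {0..1} \<Longrightarrow> continuous_on S (\<lambda>x. Li2 (f x))"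
  using continuous_on_compose2[OF continuous_on_Li2] by blast

lemma DERIV_Li2:
  assumes "0 < x" "x < 1"
  shows "(Li2 has_real_derivative - ln (1 - x) / x) (at x)"
proof -
  \<comment> \<open>The coefficients of \<open>Li2\<close> as a power series starting at exponent 0,
    the form that termwise differentiation expects.\<close>
  define c where "c = (\<lambda>n. if n = 0 then 0 else 1 / (real n)\<^sup>2)"
  have sm: "summable (\<lambda>n. c n * x ^ n)" if "\<bar>x\<bar> \<le> 1" for x
    using Li2_summable[OF that] by (subst summable_Suc_iff[symmetric]) (simp add: c_def)
  have eq: "Li2 x = (\<Sum>n. c n * x ^ n)" if "\<bar>x\<bar> \<le> 1" for x
    using suminf_split_head[OF sm[OF that]] by (simp add: Li2_def c_def)
  have "((\<lambda>x. \<Sum>n. c n * x ^ n) has_real_derivative (\<Sum>n. diffs c n * x ^ n)) (at x)"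
    using sm[of 1] assms by (intro termdiffs_strong[of c 1]) auto
  moreover have "(\<Sum>n. diffs c n * x ^ n) = - ln (1 - x) / x"
  proof -
    have "ln (1 - x) = (\<Sum>n. (-1) ^ n * (1 / real (n + 1)) * ((1 - x) - 1) ^ Suc n)"
      using assms by (intro ln_series) auto
    also have "(\<lambda>n. (-1) ^ n * (1 / real (n + 1)) * ((1 - x) - 1) ^ Suc n) = (\<lambda>n. - x * (diffs c n * x ^ n))"
    proof
      fix n
      have p: "(-1) ^ n * (- x) ^ n = x ^ n" by (subst power_mult_distrib[symmetric]) simp
      have d: "diffs c n = 1 / real (n + 1)" by (simp add: diffs_def c_def power2_eq_square)
      have "(-1) ^ n * (1 / real (n + 1)) * ((1 - x) - 1) ^ Suc n = (1 / real (n + 1)) * (- x) * ((-1) ^ n * (- x) ^ n)"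
        by (simp only: power_Suc diff_diff_eq2 diff_0 cancel_comm_monoid_add_class.diff_cancel diff_add_eq mult_ac) simp
      then show "(-1) ^ n * (1 / real (n + 1)) * ((1 - x) - 1) ^ Suc n = - x * (diffs c n * x ^ n)"
        unfolding p d by simp
    qed
    also have "(\<Sum>n. - x * (diffs c n * x ^ n)) = - x * (\<Sum>n. diffs c n * x ^ n)"
    proof (rule suminf_mult)
      show "summable (\<lambda>n. diffs c n * x ^ n)"
        using termdiff_converges[of x 1 c] sm assms by auto
    qed
    finally show ?thesis using assms by simp
  qed
  ultimately have "((\<lambda>x. \<Sum>n. c n * x ^ n) has_real_derivative - ln (1 - x) / x) (at x)" by simp
  then show ?thesis
    by (rule has_field_derivative_transform_within_open[of _ _ _ "{0<..<1}"]) (use assms eq in auto)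
qed

lemma Li2_0: "Li2 0 = 0"
  by (simp add: Li2_def)

lemma Li2_1: "Li2 1 = pi\<^sup>2 / 6"
  using inverse_squares_sums by (simp add: Li2_def sums_iff add.commute)

text \<open>With the convention \<open>ln 0 = 0\<close> the function \<open>x * ln x\<close> is
  continuous at 0. The primitives below are therefore continuous up to the ends of their intervals,
  where some logarithms have argument 0.\<close>

lemma continuous_on_mult_ln [continuous_intros]:
  fixes f :: "'a :: topological_space \<Rightarrow> real"
  assumes "continuous_on S f" "\<And>x. x \<in> S \<Longrightarrow> 0 \<le> f x"
  shows "continuous_on S (\<lambda>x. f x * ln (f x))"
proof -
  have "continuous_on {0..} (\<lambda>x::real. x * ln x)"
  proof (rule continuous_on_eq_continuous_within[THEN iffD2], rule ballI)
    fix x :: real assume x: "x \<in> {0..}"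
    show "continuous (at x within {0..}) (\<lambda>x. x * ln x)"
    proof (cases "x = 0")
      case True
      have "((\<lambda>x::real. x * ln x) \<longlongrightarrow> 0) (at_right 0)" by real_asymp
      moreover have "at (0::real) within {0..} = at_right 0"
      proof -
        have "{0..} - {0} = {0<..} - {0::real}" by auto
        then show ?thesis unfolding at_within_def by simp
      qed
      ultimately show ?thesis using True by (simp add: continuous_within)
    next
      case False
      then show ?thesis using x by (intro continuous_intros) auto
    qed
  qed
  from continuous_on_compose2[OF this assms(1)] assms(2) show ?thesis by auto
qed

text \<open>Euler's reflection formula: \<open>D\<close> is constant, and its values at 1 and at
  \<open>1 / 2\<close> are compared. At 1 the product of logarithms is 0, which is also its limit
  from the left.\<close>

lemma Li2_half: "Li2 (1 / 2) = pi\<^sup>2 / 12 - (ln 2)\<^sup>2 / 2"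
proof -
  define D where "D = (\<lambda>x. Li2 x + Li2 (1 - x) + ln x * ln (1 - x))"
  have cont: "continuous_on {1/2..1} D"
  proof -
    have "continuous_on {1/2..1} (\<lambda>x. ln x * ln (1 - x) :: real)"
    proof (rule continuous_on_eq_continuous_within[THEN iffD2], rule ballI)
      fix x :: real assume x: "x \<in> {1/2..1}"
      show "continuous (at x within {1/2..1}) (\<lambda>x. ln x * ln (1 - x))"
      proof (cases "x = 1")
        case True
        have "((\<lambda>x::real. ln x * ln (1 - x)) \<longlongrightarrow> 0) (at_left 1)" by real_asymp
        moreover have "at (1::real) within {1/2..1} = at_left 1" by (rule at_within_Icc_at_left) simp
        ultimately show ?thesis using True by (simp add: continuous_within)
      next
        case False
        then show ?thesis using x by (intro continuous_intros) auto
      qed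
    qed
    then show ?thesis unfolding D_def
      by (intro continuous_on_add continuous_on_Li2_compose continuous_on_id continuous_on_diff continuous_on_const) auto
  qed
  have "D 1 = D (1 / 2)"
  proof (rule DERIV_isconst_end[OF _ cont])
    fix x :: real assume x: "1 / 2 < x" "x < 1"
    have "((\<lambda>x. Li2 (1 - x)) has_real_derivative (- ln (1 - (1 - x)) / (1 - x)) * (-1)) (at x)"
      by (rule DERIV_chain2[OF DERIV_Li2]) (use x in \<open>auto intro!: derivative_eq_intros\<close>)
    moreover have "((\<lambda>x. ln x * ln (1 - x)) has_real_derivative (ln (1 - x) / x - ln x / (1 - x))) (at x)"
      using x by (auto intro!: derivative_eq_intros simp: field_simps)
    ultimately have "(D has_real_derivative (- ln (1 - x) / x + (- ln (1 - (1 - x)) / (1 - x)) * (-1) + (ln (1 - x) / x - ln x / (1 - x)))) (at x)"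
      unfolding D_def using x by (intro DERIV_add DERIV_Li2) auto
    then show "(D has_real_derivative 0) (at x)" by simp
  qed simp
  then have "Li2 1 + Li2 0 = Li2 (1 / 2) + Li2 (1 / 2) + ln (1 / 2) * ln (1 / 2)" by (simp add: D_def)
  moreover have "ln (1 / 2 :: real) = - ln 2" by (simp add: ln_div)
  ultimately show ?thesis unfolding Li2_1 Li2_0 by (simp only: minus_mult_minus power2_eq_square)
qed

text \<open>An instance of Abel's five-term relation, with one argument frozen at \<open>1 / 2\<close>.\<close>
lemma Li2_five_term:
  assumes "0 < x" "x < 1 / 2"
  shows "Li2 x - Li2 (2 * x) + Li2 (1 / 2) + Li2 (x / (1 - x)) - Li2 (1 / (2 * (1 - x))) = ln 2 * ln (1 - x)"
proof -
  define D where "D = (\<lambda>x. Li2 x - Li2 (2 * x) + Li2 (1 / 2) + Li2 (x / (1 - x)) - Li2 (1 / (2 * (1 - x))) - ln 2 * ln (1 - x))"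
  have cont: "continuous_on {0..x} D"
    unfolding D_def using assms by (intro continuous_intros) (auto simp: divide_le_eq le_divide_eq)
  have "D x = D 0"
  proof (rule DERIV_isconst_end[OF assms(1) cont])
    fix y assume y: "0 < y" "y < x"
    then have y2: "y < 1 / 2" using assms by simp
    have d2: "((\<lambda>x. Li2 (2 * x)) has_real_derivative (- ln (1 - 2 * y) / (2 * y)) * 2) (at y)"
      by (rule DERIV_chain2[OF DERIV_Li2]) (use y y2 in \<open>auto intro!: derivative_eq_intros\<close>)
    have d3: "((\<lambda>x. Li2 (x / (1 - x))) has_real_derivative (- ln (1 - y / (1 - y)) / (y / (1 - y))) * (1 / (1 - y)\<^sup>2)) (at y)"
      by (rule DERIV_chain2[OF DERIV_Li2]) (use y y2 in \<open>auto intro!: derivative_eq_intros simp: field_simps power2_eq_square\<close>)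
    have d4': "((\<lambda>x. 1 / (2 * (1 - x))) has_real_derivative 1 / (2 * (1 - y)\<^sup>2)) (at y)"
    proof -
      have "((\<lambda>z::real. 1 / (2 * z)) has_real_derivative - 1 / (2 * z\<^sup>2)) (at z)" if "z \<noteq> 0" for z
        using that by (auto intro!: derivative_eq_intros simp: field_simps power2_eq_square)
      then have "((\<lambda>z::real. 1 / (2 * z)) has_real_derivative - 1 / (2 * (1 - y)\<^sup>2)) (at (1 - y))" using y2 by simp
      moreover have "((\<lambda>x. 1 - x) has_real_derivative - 1) (at y)" by (auto intro!: derivative_eq_intros)
      ultimately show ?thesis using DERIV_chain2[where f = "\<lambda>z. 1 / (2 * z)" and g = "\<lambda>x. 1 - x" and x = y] by fastforce
    qed
    have d4: "((\<lambda>x. Li2 (1 / (2 * (1 - x)))) has_real_derivative (- ln (1 - 1 / (2 * (1 - y))) / (1 / (2 * (1 - y)))) * (1 / (2 * (1 - y)\<^sup>2))) (at y)"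
      by (rule DERIV_chain2[OF DERIV_Li2 d4']) (use y y2 in \<open>simp_all add: divide_less_eq\<close>)
    have d5: "((\<lambda>x. ln 2 * ln (1 - x)) has_real_derivative (- ln 2 / (1 - y))) (at y)"
      using y y2 by (auto intro!: derivative_eq_intros)
    have l3: "ln (1 - y / (1 - y)) = ln (1 - 2 * y) - ln (1 - y)"
    proof -
      have "1 - y / (1 - y) = (1 - 2 * y) / (1 - y)" using y2 by (simp add: field_simps)
      then show ?thesis using y y2 by (simp add: ln_div)
    qed
    have l4: "ln (1 - 1 / (2 * (1 - y))) = ln (1 - 2 * y) - ln 2 - ln (1 - y)"
    proof -
      have 1: "1 - 1 / (2 * (1 - y)) = (1 - 2 * y) / (2 * (1 - y))" using y2 by (simp add: field_simps)
      have "ln ((1 - 2 * y) / (2 * m)) = ln (1 - 2 * y) - ln 2 - ln m" if "m > 0" for m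
        using that y2 by (simp add: ln_div ln_mult)
      from this[of "1 - y"] show ?thesis unfolding 1 using y2 by simp
    qed
    have "(D has_real_derivative (- ln (1 - y) / y - (- ln (1 - 2 * y) / (2 * y)) * 2 + 0 + (- ln (1 - y / (1 - y)) / (y / (1 - y))) * (1 / (1 - y)\<^sup>2)
       - (- ln (1 - 1 / (2 * (1 - y))) / (1 / (2 * (1 - y)))) * (1 / (2 * (1 - y)\<^sup>2)) - (- ln 2 / (1 - y)))) (at y)"
      unfolding D_def using y y2 by (intro DERIV_add DERIV_diff DERIV_Li2 d2 d3 d4 d5 DERIV_const) auto
    moreover have "- a / y - (- b / (2 * y)) * 2 + 0 + (- (b - a) / (y / (1 - y))) * (1 / (1 - y)\<^sup>2)
       - (- (b - c - a) / (1 / (2 * (1 - y)))) * (1 / (2 * (1 - y)\<^sup>2)) - (- c / (1 - y)) = 0" for a b c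
    proof -
      have "(- (b - a) / (y / (1 - y))) * (1 / (1 - y)\<^sup>2) = - (b - a) / (y * (1 - y))"
        using y y2 by (simp add: power2_eq_square)
      also have "\<dots> = - (b - a) / y - (b - a) / (1 - y)" using y y2 by (simp add: field_simps)
      finally have 1: "(- (b - a) / (y / (1 - y))) * (1 / (1 - y)\<^sup>2) = - (b - a) / y - (b - a) / (1 - y)" .
      have "(- z / (1 / (2 * m))) * (1 / (2 * m\<^sup>2)) = - z / m" if "m \<noteq> 0" for m z :: real
        using that by (simp add: power2_eq_square)
      from this[of "1 - y"] have 2: "(- (b - c - a) / (1 / (2 * (1 - y)))) * (1 / (2 * (1 - y)\<^sup>2)) = - (b - c - a) / (1 - y)"
        using y2 by auto
      show ?thesis unfolding 1 2 by (simp add: diff_divide_distrib minus_divide_left[symmetric])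
    qed
    ultimately show "(D has_real_derivative 0) (at y)" unfolding l3 l4 by simp
  qed
  then show ?thesis by (simp add: D_def Li2_0)
qed

text \<open>The density integrated over \<open>t\<close> from \<open>1 - s\<close> to
  \<open>s\<close> when \<open>lam * s < 1\<close>, see \<open>density_inner_low\<close>.\<close>

definition low_inner :: "real \<Rightarrow> real \<Rightarrow> real" where
  "low_inner lam s = ((1 - lam * s) * ln (s / (1 - s)) + lam * (2 * s - 1)\<^sup>2) / s"

text \<open>The first two terms come from \<open>ln (s / (1 - s)) / s\<close>, the next group from
  \<open>- lam * ln (s / (1 - s))\<close>, and the last from
  \<open>lam * (2 * s - 1) ^ 2 / s\<close>.\<close>

definition low_primitive :: "real \<Rightarrow> real \<Rightarrow> real" where
  "low_primitive lam s = (ln s)\<^sup>2 / 2 + Li2 s - lam * (s * ln s + (1 - s) * ln (1 - s)) + lam * (2 * s\<^sup>2 - 4 * s + ln s)"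

lemma low_inner_integral:
  assumes "1 / 2 \<le> b" "b \<le> 1"
  shows "(low_inner lam has_integral (low_primitive lam b - low_primitive lam (1 / 2))) {1/2..b}"
proof (rule fundamental_theorem_of_calculus_interior)
  show "continuous_on {1/2..b} (low_primitive lam)"
  proof -
    have c: "continuous_on {1/2..b} (\<lambda>s. (1 - s) * ln (1 - s))"
      using assms by (intro continuous_on_mult_ln continuous_intros) auto
    show ?thesis unfolding low_primitive_def
      by (intro c continuous_on_add continuous_on_diff continuous_on_mult continuous_on_divide continuous_on_power continuous_on_const continuous_on_id
         continuous_on_Li2_compose continuous_on_ln) (use assms in auto)
  qed
  fix s assume "s \<in> {1/2<..<b}"
  then have s: "0 < s" "s < 1" "s \<noteq> 0" "1 - s \<noteq> 0" using assms by auto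
  have d1: "((\<lambda>s. (ln s)\<^sup>2 / 2) has_real_derivative (ln s / s)) (at s)"
    using s by (auto intro!: derivative_eq_intros)
  have d2: "((\<lambda>s. lam * (s * ln s + (1 - s) * ln (1 - s))) has_real_derivative (lam * (ln s - ln (1 - s)))) (at s)"
    using s by (auto intro!: derivative_eq_intros)
  have d3: "((\<lambda>s. lam * (2 * s\<^sup>2 - 4 * s + ln s)) has_real_derivative (lam * (4 * s - 4 + 1 / s))) (at s)"
    using s by (auto intro!: derivative_eq_intros)
  have "(low_primitive lam has_real_derivative (ln s / s + (- ln (1 - s) / s) - lam * (ln s - ln (1 - s)) + lam * (4 * s - 4 + 1 / s))) (at s)"
    unfolding low_primitive_def using s by (intro DERIV_add DERIV_diff d1 d2 d3 DERIV_Li2)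
  moreover have "ln s / s + (- ln (1 - s) / s) - lam * (ln s - ln (1 - s)) + lam * (4 * s - 4 + 1 / s) = low_inner lam s"
  proof -
    have l: "ln (s / (1 - s)) = ln s - ln (1 - s)" using s by (simp add: ln_div)
    show ?thesis unfolding low_inner_def l using s by (simp add: field_simps power2_eq_square)
  qed
  ultimately show "(low_primitive lam has_vector_derivative low_inner lam s) (at s)"
    by (simp add: has_real_derivative_iff_has_vector_derivative)
qed (use assms in auto)

definition high_inner :: "real \<Rightarrow> real \<Rightarrow> real" where
  "high_inner lam s = (2 * s - 1) / s * (1 - lam * (1 - s) + (lam * s - 1) * ln ((lam * s - 1) / (lam * (2 * s - 1))))"

text \<open>The logarithm in \<open>high_inner\<close> is split into
  \<open>ln (lam * s - 1)\<close>, \<open>ln lam\<close> and \<open>ln (2 * s - 1)\<close>. The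
  first and the last, divided by \<open>s\<close>, integrate to dilogarithms; the reciprocal
  arguments keep these in \<open>{0..1}\<close>. The remaining terms arise from integration by
  parts.\<close>

definition high_primitive :: "real \<Rightarrow> real \<Rightarrow> real" where
  "high_primitive lam s = lam * s\<^sup>2 + (1 - 5 / 2 * lam) * s - (1 - lam) * ln s
     + (s - 1 - 1 / lam) * ((lam * s - 1) * ln (lam * s - 1)) + (ln (lam * s))\<^sup>2 / 2 + Li2 (1 / (lam * s))
     - (lam * s / 2 - 1 - lam / 4) * ((2 * s - 1) * ln (2 * s - 1)) - (ln (2 * s))\<^sup>2 / 2 - Li2 (1 / (2 * s))
     - ln lam * (lam * s\<^sup>2 - (2 + lam) * s + ln s)"

lemma DERIV_Li2_reciprocal:
  assumes "0 < c" "1 < c * s"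
  shows "((\<lambda>s. (ln (c * s))\<^sup>2 / 2 + Li2 (1 / (c * s))) has_real_derivative ln (c * s - 1) / s) (at s)"
proof -
  have s: "s > 0" using assms by (smt (verit) zero_less_mult_iff)
  have d1: "((\<lambda>s. Li2 (1 / (c * s))) has_real_derivative (- ln (1 - 1 / (c * s)) / (1 / (c * s))) * (- 1 / (c * s\<^sup>2))) (at s)"
    by (rule DERIV_chain2[OF DERIV_Li2]) (use assms s in \<open>auto intro!: derivative_eq_intros simp: field_simps power2_eq_square\<close>)
  have d2: "((\<lambda>s. (ln (c * s))\<^sup>2 / 2) has_real_derivative (ln (c * s) / s)) (at s)"
    using assms s by (auto intro!: derivative_eq_intros simp: field_simps)
  have "1 - 1 / (c * s) = (c * s - 1) / (c * s)" using assms s by (simp add: field_simps)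
  then have l: "ln (1 - 1 / (c * s)) = ln (c * s - 1) - ln (c * s)" using assms s by (simp add: ln_div)
  have "ln (c * s) / s + (- (ln (c * s - 1) - ln (c * s)) / (1 / (c * s))) * (- 1 / (c * s\<^sup>2)) = ln (c * s - 1) / s"
    using assms(1) s by (simp add: power2_eq_square field_simps)
  then show ?thesis using DERIV_add[OF d2 d1] unfolding l by simp
qed

lemma high_inner_integral:
  assumes lam: "1 < lam" and a: "1 / 2 < a" "1 / lam \<le> a" "a \<le> 1"
  shows "(high_inner lam has_integral (high_primitive lam 1 - high_primitive lam a)) {a..1}"
proof (rule fundamental_theorem_of_calculus_interior)
  have la: "1 \<le> lam * s" if "a \<le> s" for s
  proof -
    have "1 / lam \<le> s" using that a by linarith
    then show ?thesis using lam by (simp add: field_simps)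
  qed
  have c1: "continuous_on {a..1} (\<lambda>s. (lam * s - 1) * ln (lam * s - 1))"
    using la by (intro continuous_on_mult_ln continuous_intros) auto
  have c2: "continuous_on {a..1} (\<lambda>s. (2 * s - 1) * ln (2 * s - 1))"
    using a by (intro continuous_on_mult_ln continuous_intros) auto
  have nz: "s \<noteq> 0" "lam * s \<noteq> 0" "lam \<noteq> 0" if "s \<in> {a..1}" for s using la[of s] that a lam by auto
  show "continuous_on {a..1} (high_primitive lam)"
    unfolding high_primitive_def
  proof (intro c1 c2 continuous_on_add continuous_on_diff continuous_on_mult continuous_on_divide continuous_on_power continuous_on_const continuous_on_id
         continuous_on_Li2_compose continuous_on_ln)
    show "(\<lambda>s. 1 / (lam * s)) ` {a..1} \<subseteq> {0..1}" "(\<lambda>s. 1 / (2 * s)) ` {a..1} \<subseteq> {0..1}"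
      using la a lam by (auto simp: divide_le_eq intro: order.trans[OF zero_le_one la])
  qed (use nz a in auto)
  fix s assume "s \<in> {a<..<1}"
  then have s: "a < s" "s < 1" "1 / 2 < s" "0 < s" using a by auto
  have ls: "1 < lam * s"
  proof -
    have "1 / lam < s" using s a by linarith
    then show ?thesis using lam by (simp add: field_simps)
  qed
  define x where "x = ln (lam * s - 1)"
  define y where "y = ln (2 * s - 1)"
  have d1: "((\<lambda>s. lam * s\<^sup>2 + (1 - 5 / 2 * lam) * s - (1 - lam) * ln s) has_real_derivative (2 * lam * s + (1 - 5 / 2 * lam) - (1 - lam) / s)) (at s)"
    using s by (auto intro!: derivative_eq_intros)
  have xlnx: "((\<lambda>s. (c * s - 1) * ln (c * s - 1)) has_real_derivative (c * ln (c * s - 1) + c)) (at s)" if "1 < c * s" for c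
    using that by (auto intro!: derivative_eq_intros)
  have d2: "((\<lambda>s. (s - 1 - 1 / lam) * ((lam * s - 1) * ln (lam * s - 1))) has_real_derivative
     (1 * ((lam * s - 1) * x) + (lam * x + lam) * (s - 1 - 1 / lam))) (at s)"
    unfolding x_def by (rule DERIV_mult[OF _ xlnx[OF ls]]) (auto intro!: derivative_eq_intros)
  have d3: "((\<lambda>s. (lam * s / 2 - 1 - lam / 4) * ((2 * s - 1) * ln (2 * s - 1))) has_real_derivative
     (lam / 2 * ((2 * s - 1) * y) + (2 * y + 2) * (lam * s / 2 - 1 - lam / 4))) (at s)"
    unfolding y_def by (rule DERIV_mult[OF _ xlnx]) (use s in \<open>auto intro!: derivative_eq_intros\<close>)
  have d4: "((\<lambda>s. ln lam * (lam * s\<^sup>2 - (2 + lam) * s + ln s)) has_real_derivative (ln lam * (2 * lam * s - (2 + lam) + 1 / s))) (at s)"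
    using s by (auto intro!: derivative_eq_intros)
  have d5: "((\<lambda>s. (ln (lam * s))\<^sup>2 / 2 + Li2 (1 / (lam * s))) has_real_derivative x / s) (at s)"
    unfolding x_def using lam ls by (intro DERIV_Li2_reciprocal) auto
  have d6: "((\<lambda>s. (ln (2 * s))\<^sup>2 / 2 + Li2 (1 / (2 * s))) has_real_derivative y / s) (at s)"
    unfolding y_def using s by (intro DERIV_Li2_reciprocal) auto
  have "((\<lambda>s. (lam * s\<^sup>2 + (1 - 5 / 2 * lam) * s - (1 - lam) * ln s) + (s - 1 - 1 / lam) * ((lam * s - 1) * ln (lam * s - 1))
      + ((ln (lam * s))\<^sup>2 / 2 + Li2 (1 / (lam * s))) - (lam * s / 2 - 1 - lam / 4) * ((2 * s - 1) * ln (2 * s - 1))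
      - ((ln (2 * s))\<^sup>2 / 2 + Li2 (1 / (2 * s))) - ln lam * (lam * s\<^sup>2 - (2 + lam) * s + ln s))
     has_real_derivative ((2 * lam * s + (1 - 5 / 2 * lam) - (1 - lam) / s) + (1 * ((lam * s - 1) * x) + (lam * x + lam) * (s - 1 - 1 / lam))
      + x / s - (lam / 2 * ((2 * s - 1) * y) + (2 * y + 2) * (lam * s / 2 - 1 - lam / 4)) - y / s
      - (ln lam * (2 * lam * s - (2 + lam) + 1 / s)))) (at s)"
    by (intro DERIV_add DERIV_diff d1 d2 d3 d4 d5 d6)
  moreover have "(\<lambda>s. (lam * s\<^sup>2 + (1 - 5 / 2 * lam) * s - (1 - lam) * ln s) + (s - 1 - 1 / lam) * ((lam * s - 1) * ln (lam * s - 1))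
      + ((ln (lam * s))\<^sup>2 / 2 + Li2 (1 / (lam * s))) - (lam * s / 2 - 1 - lam / 4) * ((2 * s - 1) * ln (2 * s - 1))
      - ((ln (2 * s))\<^sup>2 / 2 + Li2 (1 / (2 * s))) - ln lam * (lam * s\<^sup>2 - (2 + lam) * s + ln s)) = high_primitive lam"
    unfolding high_primitive_def by (rule ext) simp
  moreover have "(2 * lam * s + (1 - 5 / 2 * lam) - (1 - lam) / s) + (1 * ((lam * s - 1) * x) + (lam * x + lam) * (s - 1 - 1 / lam))
      + x / s - (lam / 2 * ((2 * s - 1) * y) + (2 * y + 2) * (lam * s / 2 - 1 - lam / 4)) - y / s
      - (ln lam * (2 * lam * s - (2 + lam) + 1 / s)) = high_inner lam s"
  proof -
    have l: "ln ((lam * s - 1) / (lam * (2 * s - 1))) = x - ln lam - y"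
      using ls s lam by (simp add: x_def y_def ln_div ln_mult)
    have "(lam * x + lam) * (s - 1 - 1 / lam) = (lam * s - lam - 1) * (x + 1)" using lam by (simp add: field_simps)
    then show ?thesis unfolding high_inner_def l using s(4) lam by (simp add: field_simps)
  qed
  ultimately show "(high_primitive lam has_vector_derivative high_inner lam s) (at s)"
    by (simp add: has_real_derivative_iff_has_vector_derivative)
qed (use a in auto)

lemma low_value:
  "low_primitive lam 1 - low_primitive lam (1 / 2) = pi\<^sup>2 / 12 - lam / 2"
  by (simp add: low_primitive_def Li2_1 Li2_half ln_div power2_eq_square algebra_simps)

lemma formula_low:
  assumes "lam < 1"
  shows "g1_formula lam = 12 / pi\<^sup>2 * (low_primitive lam 1 - low_primitive lam (1 / 2))"
  unfolding low_value using assms by (simp add: g1_formula_def algebra_simps)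

text \<open>The range of \<open>s\<close> breaks at \<open>1 / lam\<close>, where
  \<open>lam * s - 1\<close> changes sign. Once all logarithms are expressed by \<open>a\<close>,
  \<open>b\<close>, \<open>c\<close>, \<open>e\<close>, a rational identity in these and the
  dilogarithm values remains.\<close>

lemma formula_mid:
  assumes "1 < lam" "lam < 2"
  shows "g1_formula lam = 12 / pi\<^sup>2 * ((low_primitive lam (1 / lam) - low_primitive lam (1 / 2)) +
    (high_primitive lam 1 - high_primitive lam (1 / lam)))"
proof -
  define a where "a = ln lam"
  define b where "b = ln (lam - 1)"
  define c where "c = ln (2 - lam)"
  define e where "e = ln (2::real)"
  have lam0: "lam \<noteq> 0" "lam > 0" using assms by auto
  have l: "ln (1 / lam) = - a" "ln (1 - 1 / lam) = b - a" "ln (2 / lam - 1) = c - a" "ln (2 * (1 / lam)) = e - a"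
    "ln ((2 - lam) / (lam - 1)) = c - b" "ln (lam / (lam - 1)) = a - b" "ln (4 / lam) = 2 * e - a"
  proof -
    show "ln (1 / lam) = - a" using assms by (simp add: a_def ln_div)
    have "1 - 1 / lam = (lam - 1) / lam" "2 / lam - 1 = (2 - lam) / lam" using assms by (auto simp: field_simps)
    then show "ln (1 - 1 / lam) = b - a" "ln (2 / lam - 1) = c - a" using assms by (simp_all add: a_def b_def c_def ln_div)
    show "ln (2 * (1 / lam)) = e - a" using assms by (simp add: a_def e_def ln_div)
    show "ln ((2 - lam) / (lam - 1)) = c - b" "ln (lam / (lam - 1)) = a - b" using assms by (simp_all add: a_def b_def c_def ln_div)
    have "ln (4::real) = 2 * e" using ln_realpow[of "2::real" 2] by (simp add: e_def)
    then show "ln (4 / lam) = 2 * e - a" using assms by (simp add: a_def ln_div)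
  qed
  have p1: "low_primitive lam (1 / lam) = a\<^sup>2 / 2 + Li2 (1 / lam) - lam * (1 / lam * (- a) + (1 - 1 / lam) * (b - a)) + lam * (2 * (1 / lam)\<^sup>2 - 4 * (1 / lam) - a)"
    unfolding low_primitive_def l by simp
  have p2: "low_primitive lam (1 / 2) = pi\<^sup>2 / 12 - 3 / 2 * lam"
    using low_value[of lam] by (simp add: low_primitive_def Li2_1)
  have p3: "high_primitive lam 1 = lam + (1 - 5 / 2 * lam) - (1 / lam) * ((lam - 1) * b) + a\<^sup>2 / 2 + Li2 (1 / lam)
     - e\<^sup>2 / 2 - Li2 (1 / 2) - a * (lam - (2 + lam))"
    unfolding high_primitive_def by (simp add: a_def b_def e_def)
  have p4: "high_primitive lam (1 / lam) = lam * (1 / lam)\<^sup>2 + (1 - 5 / 2 * lam) * (1 / lam) + (1 - lam) * a + pi\<^sup>2 / 6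
     - (1 / 2 - 1 - lam / 4) * ((2 / lam - 1) * (c - a)) - (e - a)\<^sup>2 / 2 - Li2 (lam / 2)
     - a * (lam * (1 / lam)\<^sup>2 - (2 + lam) * (1 / lam) - a)"
    unfolding high_primitive_def l using lam0 by (simp add: Li2_1 l(3) a_def[symmetric])
  have eq: "(low_primitive lam (1 / lam) - low_primitive lam (1 / 2)) + (high_primitive lam 1 - high_primitive lam (1 / lam)) =
    (e\<^sup>2 - 2 * pi\<^sup>2 / 3 - 1 + (lam / 2 - 2 / lam) * (c - b) + 3 * lam / 2 * (a - b) - (2 * e - a) * a + 4 * Li2 (1 / lam) + 2 * Li2 (lam / 2)) / 2"
    unfolding p1 p2 p3 p4 Li2_half e_def[symmetric] using lam0 by (simp add: field_simps power2_eq_square)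
  have "g1_formula lam = 6 / pi\<^sup>2 * (e\<^sup>2 - 2 * pi\<^sup>2 / 3 - 1 + (lam / 2 - 2 / lam) * (c - b) + 3 * lam / 2 * (a - b) - (2 * e - a) * a + 4 * Li2 (1 / lam) + 2 * Li2 (lam / 2))"
    using assms unfolding g1_formula_def l(5-7) a_def[symmetric] e_def[symmetric] by simp
  moreover have "12 / pi\<^sup>2 * (z / 2) = 6 / pi\<^sup>2 * z" for z by simp
  ultimately show ?thesis unfolding eq by (simp only:)
qed

text \<open>The lower limit \<open>1 - 1 / lam\<close> introduces \<open>Li2 (1 / (lam - 1))\<close>
  and \<open>Li2 (lam / (2 * (lam - 1)))\<close>, which do not occur in the closed formula. The
  five-term relation at \<open>x = 1 / lam\<close> removes both.\<close>

lemma formula_high: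
  assumes "2 < lam"
  shows "g1_formula lam = 12 / pi\<^sup>2 * (high_primitive lam 1 - high_primitive lam (1 - 1 / lam))"
proof -
  define a where "a = ln lam"
  define b where "b = ln (lam - 1)"
  define c where "c = ln (lam - 2)"
  define e where "e = ln (2::real)"
  have lam0: "lam \<noteq> 0" "lam > 0" using assms by auto
  have q: "lam * (1 - 1 / lam) = lam - 1" "2 * (1 - 1 / lam) - 1 = (lam - 2) / lam" "2 * (1 - 1 / lam) = 2 * (lam - 1) / lam" "1 - 1 / lam = (lam - 1) / lam"
    using lam0 by (simp_all add: field_simps)
  have l: "ln ((lam - 1) / lam) = b - a" "ln ((lam - 2) / lam) = c - a" "ln (2 * (lam - 1) / lam) = e + b - a"
    "ln ((lam - 2) / (lam - 1)) = c - b" "ln (lam / (lam - 1)) = a - b"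
  proof -
    show "ln ((lam - 1) / lam) = b - a" "ln ((lam - 2) / lam) = c - a" "ln ((lam - 2) / (lam - 1)) = c - b" "ln (lam / (lam - 1)) = a - b"
      using assms by (simp_all add: a_def b_def c_def ln_div)
    have "ln (2 * m / lam) = ln 2 + ln m - ln lam" if "m > 0" for m using assms that by (simp add: ln_div ln_mult)
    from this[of "lam - 1"] show "ln (2 * (lam - 1) / lam) = e + b - a" using assms unfolding a_def b_def e_def by simp
  qed
  have five: "Li2 (1 / lam) - Li2 (2 / lam) + Li2 (1 / 2) + Li2 (1 / (lam - 1)) - Li2 (lam / (2 * (lam - 1))) = e * (b - a)"
  proof -
    have 1: "(1 / lam) / (1 - 1 / lam) = 1 / (lam - 1)" "1 / (2 * (1 - 1 / lam)) = lam / (2 * (lam - 1))"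
      using assms by (simp_all add: field_simps)
    show ?thesis using Li2_five_term[of "1 / lam"] assms unfolding 1 unfolding q(4) l e_def by simp
  qed
  have p1: "high_primitive lam 1 = lam + (1 - 5 / 2 * lam) - (1 / lam) * ((lam - 1) * b) + a\<^sup>2 / 2 + Li2 (1 / lam)
     - e\<^sup>2 / 2 - Li2 (1 / 2) - a * (lam - (2 + lam))"
    unfolding high_primitive_def by (simp add: a_def b_def e_def)
  have p2: "high_primitive lam (1 - 1 / lam) = lam * ((lam - 1) / lam)\<^sup>2 + (1 - 5 / 2 * lam) * ((lam - 1) / lam) - (1 - lam) * (b - a)
     + (- 2 / lam) * ((lam - 2) * c) + b\<^sup>2 / 2 + Li2 (1 / (lam - 1))
     - ((lam - 1) / 2 - 1 - lam / 4) * ((lam - 2) / lam * (c - a)) - (e + b - a)\<^sup>2 / 2 - Li2 (lam / (2 * (lam - 1)))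
     - a * (lam * ((lam - 1) / lam)\<^sup>2 - (2 + lam) * ((lam - 1) / lam) + (b - a))"
  proof -
    have r: "1 / (2 * (lam - 1) / lam) = lam / (2 * (lam - 1))" "(lam - 1) / lam - 1 - 1 / lam = - 2 / lam" "lam - 1 - 1 = lam - 2"
      using lam0 by (simp_all add: field_simps)
    show ?thesis unfolding high_primitive_def q(1,2) unfolding q(3) unfolding q(4) r unfolding l
      unfolding a_def[symmetric] b_def[symmetric] c_def[symmetric] ..
  qed
  have eq: "high_primitive lam 1 - high_primitive lam (1 - 1 / lam) =
    (- 1 + (lam / 2 - 2 / lam) * (c - b) + 3 * lam / 2 * (a - b) + 4 * Li2 (1 / lam) - 2 * Li2 (2 / lam)) / 2"
  proof -
    have L5: "Li2 (lam / (2 * (lam - 1))) = Li2 (1 / lam) - Li2 (2 / lam) + Li2 (1 / 2) + Li2 (1 / (lam - 1)) - e * (b - a)"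
      using five by simp
    show ?thesis unfolding p1 p2 L5 using lam0 by (simp add: field_simps power2_eq_square)
  qed
  have "g1_formula lam = 6 / pi\<^sup>2 * (- 1 + (lam / 2 - 2 / lam) * (c - b) + 3 * lam / 2 * (a - b) + 4 * Li2 (1 / lam) - 2 * Li2 (2 / lam))"
    using assms unfolding g1_formula_def l(4,5) by simp
  moreover have "12 / pi\<^sup>2 * (z / 2) = 6 / pi\<^sup>2 * z" for z by simp
  ultimately show ?thesis unfolding eq by (simp only:)
qed

section \<open>The limiting gap distribution\<close>

lemma mass_measurable:
  "(\<lambda>(s, t). mass_pos lam s t) \<in> borel_measurable (borel \<Otimes>\<^sub>M borel)"
  "(\<lambda>(s, t). mass_neg lam s t) \<in> borel_measurable (borel \<Otimes>\<^sub>M borel)"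
  unfolding mass_pos_def mass_neg_def mid_mass_def case_prod_unfold by measurable

lemma triangle_density_mass:
  assumes "0 \<le> lam"
  shows "triangle_density (mass_pos lam)" "triangle_density (mass_neg lam)"
  using mass_measurable[of lam] mass_nonneg[of _ _ lam] mass_bound[of _ _ lam] mass_antimono_s[of _ _ _ lam] mass_antimono_t[of _ _ _ lam] assms
  by (auto intro!: triangle_density.intro)

definition density_integral :: "real \<Rightarrow> real" where
  "density_integral lam = triangle_density.mass_integral (mass_pos lam) - triangle_density.mass_integral (mass_neg lam)"

lemma cut_grid_unit_iff:
  assumes "Q > 0"
  shows "(K, L) \<in> cut_grid (1 / real Q) Q \<longleftrightarrow> int Q \<le> K + L \<and> L \<le> K \<and> K < int Q"
proof -
  have "1 - 1 / real Q * of_int K \<le> 1 / real Q * of_int L \<longleftrightarrow> real_of_int (int Q) \<le> of_int (K + L)"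
  proof -
    have "1 - 1 / real Q * of_int K = (real Q - of_int K) / real Q" using assms by (simp add: diff_divide_distrib)
    then have "1 - 1 / real Q * of_int K \<le> 1 / real Q * of_int L \<longleftrightarrow> (real Q - of_int K) / real Q \<le> of_int L / real Q" by simp
    also have "\<dots> \<longleftrightarrow> real Q - of_int K \<le> of_int L" using assms by (simp add: divide_le_cancel)
    finally show ?thesis by auto
  qed
  moreover have "1 / real Q * of_int L \<le> 1 / real Q * of_int K \<longleftrightarrow> L \<le> K"
    using assms by (simp add: field_simps)
  moreover have "1 / real Q * of_int K \<le> 1 - 1 / real Q \<longleftrightarrow> real_of_int (K + 1) \<le> of_int (int Q)"
    using assms by (simp add: field_simps)
  ultimately show ?thesis unfolding cut_grid_def cut_triangle_def mem_Collect_eq prod.case of_int_le_iff by linarith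
qed

text \<open>The grid contains the diagonal \<open>K = L\<close>, which \<open>larger_denoms\<close>
  excludes. Diagonal pairs contribute nothing: \<open>2 * K \<ge> Q \<ge> 3\<close> gives
  \<open>K \<ge> 2\<close>, so they are not coprime.\<close>

lemma pair_sum_estimate:
  assumes Q: "Q \<ge> 3" and lam: "0 \<le> lam"
  shows "\<bar>pair_sum Q (lam / real Q) - (\<Sum>d=1..Q. moebius_mu d / (real d)\<^sup>2) * density_integral lam\<bar> \<le> 72 * (1 + ln (real Q))\<^sup>2 / sqrt (real Q)"
proof -
  have Q0: "Q > 0" "Q \<ge> 2" using Q by auto
  define T where "T = cut_grid (1 / real Q) Q"
  have T: "(K, L) \<in> T \<longleftrightarrow> int Q \<le> K + L \<and> L \<le> K \<and> K < int Q" for K L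
    unfolding T_def by (rule cut_grid_unit_iff) (use Q in simp)
  have finT: "finite T" unfolding T_def using Q0 by (intro finite_cut_grid) auto
  define G where "G = (\<lambda>f. (\<Sum>(K, L)\<in>T. of_bool (coprime K L) * f (of_int K / real Q) (of_int L / real Q)) :: real)"
  define F where "F = (\<lambda>K L. of_bool (coprime K L) * ((mass_pos lam (of_int K / real Q) (of_int L / real Q) - mass_neg lam (of_int K / real Q) (of_int L / real Q)) / (real Q)\<^sup>2))"
  have "pair_sum Q (lam / real Q) = (\<Sum>L=1..<Q. \<Sum>K\<in>larger_denoms Q L. F K (int L))"
    unfolding pair_sum_def F_def by (intro sum.cong refl) (simp add: gap_mass_scaled(1))
  also have "\<dots> = (\<Sum>(L, K)\<in>(SIGMA L:{1..<Q}. larger_denoms Q L). F K (int L))"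
    by (rule sum.Sigma) (auto simp: larger_denoms_def)
  also have "\<dots> = (\<Sum>(K, L)\<in>{(K, L)\<in>T. L < K}. F K L)"
  proof (rule sum.reindex_bij_witness[of _ "\<lambda>(K, L). (nat L, K)" "\<lambda>(L, K). (K, int L)"])
    fix x assume "x \<in> {(K, L)\<in>T. L < K}"
    moreover obtain K L where e: "x = (K, L)" by (cases x)
    ultimately have "int Q \<le> K + L" "L < K" "K < int Q" using T by auto
    then show "(case case x of (K, L) \<Rightarrow> (nat L, K) of (L, K) \<Rightarrow> (K, int L)) = x"
      "(case x of (K, L) \<Rightarrow> (nat L, K)) \<in> (SIGMA L:{1..<Q}. larger_denoms Q L)"
      by (auto simp: e larger_denoms_def)
  qed (auto simp: T larger_denoms_def)
  also have "\<dots> = (\<Sum>(K, L)\<in>T. F K L)"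
  proof (rule sum.mono_neutral_left[OF finT])
    show "\<forall>x\<in>T - {(K, L)\<in>T. L < K}. (case x of (K, L) \<Rightarrow> F K L) = 0"
    proof
      fix x assume x: "x \<in> T - {(K, L)\<in>T. L < K}"
      obtain K L where e: "x = (K, L)" by (cases x)
      have "L = K" "int Q \<le> K + L" using x T[of K L] by (auto simp: e)
      then have "\<not> coprime K L" using Q by auto
      then show "(case x of (K, L) \<Rightarrow> F K L) = 0" by (simp add: e F_def)
    qed
  qed auto
  also have "\<dots> = (G (mass_pos lam) - G (mass_neg lam)) / (real Q)\<^sup>2"
    unfolding G_def F_def sum_subtractf[symmetric] sum_divide_distrib
    by (intro sum.cong refl) (auto simp: diff_divide_distrib right_diff_distrib)
  finally have eq: "pair_sum Q (lam / real Q) = G (mass_pos lam) / (real Q)\<^sup>2 - G (mass_neg lam) / (real Q)\<^sup>2" by (simp add: diff_divide_distrib)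
  have "\<bar>G f / (real Q)\<^sup>2 - (\<Sum>d=1..Q. moebius_mu d / (real d)\<^sup>2) * triangle_density.mass_integral f\<bar> \<le> 36 * (1 + ln (real Q))\<^sup>2 / sqrt (real Q)"
    if "triangle_density f" for f
    unfolding G_def T_def by (rule triangle_density.coprime_sum_error[OF that Q0(2)])
  from this[OF triangle_density_mass(1)[OF lam]] this[OF triangle_density_mass(2)[OF lam]]
  show ?thesis unfolding eq density_integral_def right_diff_distrib by linarith
qed

lemma density_integral_bound:
  assumes "0 \<le> lam"
  shows "\<bar>density_integral lam\<bar> \<le> 96"
proof -
  have "\<bar>triangle_density.mass_integral f\<bar> \<le> 48" if "triangle_density f" for f
  proof -
    interpret triangle_density f by fact
    have "24 / sqrt (real 2) \<le> 24 / 1" by (intro divide_left_mono) auto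
    then show ?thesis using cut_integral_error[of 2] by linarith
  qed
  from this[OF triangle_density_mass(1)[OF assms]] this[OF triangle_density_mass(2)[OF assms]]
  show ?thesis unfolding density_integral_def by linarith
qed

section \<open>Evaluation of the double integral\<close>

lemma mass_diff_low:
  assumes "0 < t" "t \<le> s" "0 \<le> lam" "lam * s < 1"
  shows "mass_pos lam s t - mass_neg lam s t = (1 - lam * s) / s * (1 / t) + lam * (2 * s - 1) / s"
proof -
  have s: "s > 0" using assms by simp
  have "lam * t \<le> lam * s" using assms by (intro mult_left_mono) auto
  then have c: "max 0 (1 - lam * t) = 1 - lam * t" "1 - lam * t > 0" using assms by auto
  have "lam * s * t \<le> 1 * t" using assms by (intro mult_right_mono) auto
  then have "s - t \<le> (1 - lam * t) * s" by (simp add: algebra_simps)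
  then have mid: "mid_mass lam s t = 1 / s" unfolding mid_mass_def c(1) using c(2) by (simp add: max_absorb1)
  have m: "max 0 (1 / s - lam) = 1 / s - lam" using assms s by (simp add: field_simps)
  show ?thesis unfolding mass_pos_def mass_neg_def mid m c(1) using assms(1) s by (simp add: field_simps)
qed

text \<open>The first term of \<open>mass_pos\<close> vanishes. The others share the factor
  \<open>1 - lam * t\<close> and combine by
  \<open>(1 - s) * (s - t) + s * t - (1 - s) * s = t * (2 * s - 1)\<close>, so that the pole at
  \<open>t = 0\<close> cancels.\<close>

lemma mass_diff_high:
  assumes "0 < t" "t \<le> s" "1 < lam * s"
  shows "mass_pos lam s t - mass_neg lam s t = (2 * s - 1) / s * (max 0 (1 - lam * t) / (s - t))"
proof -
  have s: "s > 0" using assms by simp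
  have m: "max 0 (1 / s - lam) = 0" using assms s by (simp add: field_simps)
  show ?thesis
  proof (cases "lam * t < 1")
    case True
    then have c: "max 0 (1 - lam * t) = 1 - lam * t" by simp
    have "1 * t \<le> lam * s * t" using assms by (intro mult_right_mono) auto
    then have "(1 - lam * t) * s \<le> s - t" by (simp add: algebra_simps)
    then have mid: "mid_mass lam s t = (1 - lam * t) / (s - t)" unfolding mid_mass_def c by (simp add: max_absorb2)
    have st: "s - t \<noteq> 0" using True assms by auto
    define w where "w = s - t"
    have t: "t = s - w" "w \<noteq> 0" using st by (auto simp: w_def)
    define C where "C = 1 - lam * t"
    have "(1 - s) / t * (C / s) + C / w - (1 - s) / t * (C / w) = (2 * s - 1) / s * (C / w)"
    proof -
      have "(1 - s) / t * (C / s) + C / w - (1 - s) / t * (C / w) = C * ((1 - s) * w + s * t - (1 - s) * s) / (t * s * w)"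
        using assms(1) s t(2) by (simp add: field_simps)
      also have "(1 - s) * w + s * t - (1 - s) * s = t * (2 * s - 1)" by (simp add: w_def algebra_simps)
      also have "C * (t * (2 * s - 1)) / (t * s * w) = (2 * s - 1) / s * (C / w)" using assms(1) by simp
      finally show ?thesis .
    qed
    then show ?thesis unfolding mass_pos_def mass_neg_def mid m c w_def C_def by simp
  qed (use m in \<open>simp add: mass_pos_def mass_neg_def mid_mass_def\<close>)
qed

definition density_inner :: "real \<Rightarrow> real \<Rightarrow> real" where
  "density_inner lam s = triangle_density.inner (mass_pos lam) s - triangle_density.inner (mass_neg lam) s"

lemma density_inner_has_integral:
  assumes "0 \<le> lam" "s < 1"
  shows "((\<lambda>t. mass_pos lam s t - mass_neg lam s t) has_integral density_inner lam s) {1 - s..s}"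
proof -
  have "((\<lambda>t. f s t) has_integral triangle_density.inner f s) {1 - s..s}" if "triangle_density f" for f
  proof -
    interpret triangle_density f by fact
    have "((\<lambda>t. indicator {1 - s..s} t * f s t) has_integral inner s) UNIV"
      using has_integral_integral_lborel[OF inner_bounds(1)[OF assms(2)]] by (simp add: inner_def)
    moreover have "(\<lambda>t. indicator {1 - s..s} t * f s t) = (\<lambda>t. if t \<in> {1 - s..s} then f s t else 0)" by auto
    ultimately show ?thesis using has_integral_restrict_UNIV[of "{1 - s..s}" "f s"] by simp
  qed
  from has_integral_diff[OF this[OF triangle_density_mass(1)[OF assms(1)]] this[OF triangle_density_mass(2)[OF assms(1)]]]
  show ?thesis by (simp add: density_inner_def)
qed

lemma density_integral_has_integral:
  assumes "0 \<le> lam"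
  shows "((\<lambda>s. indicator {1/2..<1} s * density_inner lam s) has_integral density_integral lam) {1/2..1}"
proof -
  have "((\<lambda>s. indicator {1/2..<1} s * triangle_density.inner f s) has_integral triangle_density.mass_integral f) {1/2..1}" if "triangle_density f" for f
  proof -
    interpret triangle_density f by fact
    have "integrable lborel (\<lambda>s. indicator {1/2..<1} s * inner s)" by (intro inner_integrable) auto
    then have "((\<lambda>s. indicator {1/2..<1} s * inner s) has_integral mass_integral) UNIV"
      using has_integral_integral_lborel by (simp add: mass_integral_def)
    moreover have "(\<lambda>s. indicator {1/2..<1} s * inner s) = (\<lambda>s. if s \<in> {1/2..1} then indicator {1/2..<1} s * inner s else 0)"
    proof
      fix s show "indicator {1/2..<1} s * inner s = (if s \<in> {1/2..1} then indicator {1/2..<1} s * inner s else 0)"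
      proof (cases "s \<in> {1/2..1}")
        case False
        then have "s \<notin> {1/2..<1}" by auto
        with False show ?thesis by simp
      qed simp
    qed
    ultimately show ?thesis using has_integral_restrict_UNIV[of "{1/2..1}" "\<lambda>s. indicator {1/2..<1} s * inner s"] by simp
  qed
  from has_integral_diff[OF this[OF triangle_density_mass(1)[OF assms(1)]] this[OF triangle_density_mass(2)[OF assms(1)]]]
  show ?thesis by (simp add: density_inner_def density_integral_def right_diff_distrib)
qed

lemma density_inner_low:
  assumes "0 \<le> lam" "1 / 2 \<le> s" "s < 1" "lam * s < 1"
  shows "density_inner lam s = low_inner lam s"
proof -
  have "((\<lambda>t. (1 - lam * s) / s * (1 / t) + lam * (2 * s - 1) / s) has_integral
    (((1 - lam * s) / s * ln s + lam * (2 * s - 1) / s * s) - ((1 - lam * s) / s * ln (1 - s) + lam * (2 * s - 1) / s * (1 - s)))) {1 - s..s}"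
  proof (rule fundamental_theorem_of_calculus)
    fix t assume t: "t \<in> {1 - s..s}"
    then have "t > 0" using assms by auto
    then have "((\<lambda>t. (1 - lam * s) / s * ln t + lam * (2 * s - 1) / s * t) has_real_derivative (1 - lam * s) / s * (1 / t) + lam * (2 * s - 1) / s) (at t within {1 - s..s})"
      by (intro derivative_eq_intros refl | simp)+
    then show "((\<lambda>t. (1 - lam * s) / s * ln t + lam * (2 * s - 1) / s * t) has_vector_derivative (1 - lam * s) / s * (1 / t) + lam * (2 * s - 1) / s) (at t within {1 - s..s})"
      by (simp add: has_real_derivative_iff_has_vector_derivative)
  qed (use assms in auto)
  moreover have "((\<lambda>t. (1 - lam * s) / s * (1 / t) + lam * (2 * s - 1) / s) has_integral density_inner lam s) {1 - s..s}"
    by (rule has_integral_eq[OF _ density_inner_has_integral[OF assms(1,3)]], rule mass_diff_low) (use assms in auto)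
  ultimately have e: "density_inner lam s = (((1 - lam * s) / s * ln s + lam * (2 * s - 1) / s * s) - ((1 - lam * s) / s * ln (1 - s) + lam * (2 * s - 1) / s * (1 - s)))"
    by (metis has_integral_unique)
  have l: "ln (s / (1 - s)) = ln s - ln (1 - s)" using assms by (simp add: ln_div)
  show ?thesis unfolding e low_inner_def l using assms(2) by (simp add: field_simps power2_eq_square)
qed

text \<open>The integrand is supported on \<open>t < 1 / lam\<close>, to the left of the pole
  \<open>t = s\<close>. The range \<open>{1 - s..s}\<close> misses this support when
  \<open>s \<le> 1 - 1 / lam\<close>.\<close>

lemma density_inner_high:
  assumes "0 \<le> lam" "1 / 2 \<le> s" "s < 1" "1 < lam * s"
  shows "density_inner lam s = (if s \<le> 1 - 1 / lam then 0 else high_inner lam s)"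
proof -
  have lam0: "lam > 0" using assms by (smt (verit) mult_eq_0_iff)
  have ils: "1 / lam < s" using assms(4) lam0 by (simp add: field_simps)
  have H: "((\<lambda>t. (2 * s - 1) / s * (max 0 (1 - lam * t) / (s - t))) has_integral density_inner lam s) {1 - s..s}"
    by (rule has_integral_eq[OF _ density_inner_has_integral[OF assms(1,3)]], rule mass_diff_high) (use assms in auto)
  have zero: "(2 * s - 1) / s * (max 0 (1 - lam * t) / (s - t)) = 0" if "1 / lam \<le> t" for t
  proof -
    have "1 \<le> lam * t" using that lam0 by (simp add: field_simps)
    then show ?thesis by simp
  qed
  show ?thesis
  proof (cases "s \<le> 1 - 1 / lam")
    case True
    have "((\<lambda>t. 0) has_integral density_inner lam s) {1 - s..s}"
      by (rule has_integral_eq[OF _ H], rule zero) (use True in auto)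
    then show ?thesis using True has_integral_unique[OF _ has_integral_0] by auto
  next
    case False
    then have ils': "1 - s < 1 / lam" "s > 1 / 2" using ils by auto
    define P where "P = (\<lambda>t. (2 * s - 1) / s * (lam * t + (lam * s - 1) * ln (s - t)))"
    have "((\<lambda>t. (2 * s - 1) / s * (max 0 (1 - lam * t) / (s - t))) has_integral (P (1 / lam) - P (1 - s))) {1 - s..1 / lam}"
    proof (rule fundamental_theorem_of_calculus)
      fix t assume t: "t \<in> {1 - s..1 / lam}"
      have st: "s - t > 0" using t ils by auto
      have "lam * t \<le> 1" using t lam0 by (simp add: field_simps)
      then have m: "max 0 (1 - lam * t) = 1 - lam * t" by simp
      have "(P has_real_derivative (2 * s - 1) / s * (lam + (lam * s - 1) * (- 1 / (s - t)))) (at t within {1 - s..1 / lam})"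
        unfolding P_def using st by (intro derivative_eq_intros refl | simp)+
      moreover have "lam + (lam * s - 1) * (- 1 / (s - t)) = (1 - lam * t) / (s - t)" using st by (simp add: field_simps)
      ultimately have "(P has_real_derivative (2 * s - 1) / s * ((1 - lam * t) / (s - t))) (at t within {1 - s..1 / lam})" by (simp only:)
      then show "(P has_vector_derivative (2 * s - 1) / s * (max 0 (1 - lam * t) / (s - t))) (at t within {1 - s..1 / lam})"
        unfolding m has_real_derivative_iff_has_vector_derivative .
    qed (use ils' in auto)
    moreover have "((\<lambda>t. (2 * s - 1) / s * (max 0 (1 - lam * t) / (s - t))) has_integral 0) {1 / lam..s}"
      by (rule has_integral_eq[OF _ has_integral_0], rule zero[symmetric]) auto
    ultimately have "((\<lambda>t. (2 * s - 1) / s * (max 0 (1 - lam * t) / (s - t))) has_integral (P (1 / lam) - P (1 - s) + 0)) {1 - s..s}"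
      by (intro has_integral_combine[of "1 - s" "1 / lam" s]) (use ils ils' in auto)
    then have e: "density_inner lam s = P (1 / lam) - P (1 - s)" using has_integral_unique[OF H] by simp
    have l: "ln ((lam * s - 1) / (lam * (2 * s - 1))) = ln (s - 1 / lam) - ln (2 * s - 1)"
    proof -
      have "(lam * s - 1) / (lam * (2 * s - 1)) = (s - 1 / lam) / (2 * s - 1)" using lam0 by (simp add: field_simps)
      then show ?thesis using ils ils' by (simp add: ln_div)
    qed
    have "P (1 / lam) - P (1 - s) = (2 * s - 1) / s * ((1 + (lam * s - 1) * ln (s - 1 / lam)) - (lam * (1 - s) + (lam * s - 1) * ln (2 * s - 1)))"
      unfolding P_def right_diff_distrib[symmetric] using lam0 by simp
    also have "\<dots> = high_inner lam s" unfolding high_inner_def l by (simp add: algebra_simps)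
    finally show ?thesis using False e by simp
  qed
qed

lemma density_integral_low:
  assumes "0 \<le> lam" "lam < 1"
  shows "density_integral lam = low_primitive lam 1 - low_primitive lam (1 / 2)"
proof (rule has_integral_unique[OF density_integral_has_integral[OF assms(1)]])
  show "((\<lambda>s. indicator {1/2..<1} s * density_inner lam s) has_integral (low_primitive lam 1 - low_primitive lam (1 / 2))) {1/2..1}"
  proof (rule has_integral_spike_finite[OF _ _ low_inner_integral])
    fix s assume "s \<in> {1/2..1} - {1 :: real}"
    then have s: "1 / 2 \<le> s" "s < 1" by auto
    have "lam * s \<le> lam * 1" using s assms by (intro mult_left_mono) auto
    then show "indicator {1/2..<1} s * density_inner lam s = low_inner lam s"
      using s assms by (simp add: density_inner_low)
  qed auto
qed

lemma density_integral_mid: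
  assumes "1 < lam" "lam < 2"
  shows "density_integral lam = (low_primitive lam (1 / lam) - low_primitive lam (1 / 2)) + (high_primitive lam 1 - high_primitive lam (1 / lam))"
proof (rule has_integral_unique[OF density_integral_has_integral])
  \<comment> \<open>For \<open>lam < 2\<close> the threshold \<open>1 - 1 / lam\<close> lies below
    \<open>1 / 2\<close>, so the zero branch of \<open>density_inner_high\<close> does not
    occur.\<close>
  have il: "1 / 2 < 1 / lam" "1 / lam < 1" "1 - 1 / lam < 1 / 2" using assms by (auto simp: field_simps)
  have "((\<lambda>s. indicator {1/2..<1} s * density_inner lam s) has_integral (low_primitive lam (1 / lam) - low_primitive lam (1 / 2))) {1/2..1 / lam}"
  proof (rule has_integral_spike_finite[OF _ _ low_inner_integral])
    fix s assume "s \<in> {1/2..1 / lam} - {1 / lam}"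
    then have s: "1 / 2 \<le> s" "s < 1 / lam" by auto
    then have ls: "lam * s < 1" using assms by (simp add: field_simps)
    have s1: "s < 1" using s il(2) by linarith
    have "density_inner lam s = low_inner lam s" using assms by (intro density_inner_low s s1 ls) simp
    moreover have "s \<in> {1/2..<1}" using s(1) s1 by simp
    ultimately show "indicator {1/2..<1} s * density_inner lam s = low_inner lam s" by simp
  qed (use il in auto)
  moreover have "((\<lambda>s. indicator {1/2..<1} s * density_inner lam s) has_integral (high_primitive lam 1 - high_primitive lam (1 / lam))) {1 / lam..1}"
  proof (rule has_integral_spike_finite[OF _ _ high_inner_integral])
    fix s assume "s \<in> {1 / lam..1} - {1 / lam, 1}"
    then have s: "1 / lam < s" "s < 1" by auto
    then have ls: "1 < lam * s" using assms by (simp add: field_simps)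
    have h: "1 / 2 \<le> s" using s il by linarith
    have "density_inner lam s = (if s \<le> 1 - 1 / lam then 0 else high_inner lam s)"
      using assms by (intro density_inner_high h s(2) ls) simp
    moreover have "\<not> s \<le> 1 - 1 / lam" using h il by linarith
    moreover have "s \<in> {1/2..<1}" using h s(2) by simp
    ultimately show "indicator {1/2..<1} s * density_inner lam s = high_inner lam s" by simp
  qed (use il assms in auto)
  ultimately show "((\<lambda>s. indicator {1/2..<1} s * density_inner lam s) has_integral
     (low_primitive lam (1 / lam) - low_primitive lam (1 / 2)) + (high_primitive lam 1 - high_primitive lam (1 / lam))) {1/2..1}"
    by (intro has_integral_combine[of "1 / 2" "1 / lam" 1]) (use il in auto)
qed (use assms in auto)

lemma density_integral_high:
  assumes "2 < lam"
  shows "density_integral lam = high_primitive lam 1 - high_primitive lam (1 - 1 / lam)"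
proof (rule has_integral_unique[OF density_integral_has_integral])
  \<comment> \<open>For \<open>lam > 2\<close> already \<open>s = 1 / 2\<close> exceeds
    \<open>1 / lam\<close>, so the whole range belongs to the case
    \<open>lam * s > 1\<close>.\<close>
  have il: "1 / 2 < 1 - 1 / lam" "1 - 1 / lam < 1" "1 / lam < 1 / 2" using assms by (auto simp: field_simps)
  have ls: "1 < lam * s" if "1 / 2 \<le> s" for s
  proof -
    have "1 / lam < s" using that il by linarith
    then show ?thesis using assms by (simp add: field_simps)
  qed
  have "((\<lambda>s. indicator {1/2..<1} s * density_inner lam s) has_integral 0) {1/2..1 - 1 / lam}"
  proof (rule has_integral_eq[OF _ has_integral_0])
    fix s assume "s \<in> {1/2..1 - 1 / lam}"
    then have s: "1 / 2 \<le> s" "s \<le> 1 - 1 / lam" by auto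
    have s1: "s < 1" using s il(2) by linarith
    have "density_inner lam s = (if s \<le> 1 - 1 / lam then 0 else high_inner lam s)"
      using assms by (intro density_inner_high s(1) s1 ls) simp
    then show "0 = indicator {1/2..<1} s * density_inner lam s" using s(2) by simp
  qed
  moreover have "((\<lambda>s. indicator {1/2..<1} s * density_inner lam s) has_integral (high_primitive lam 1 - high_primitive lam (1 - 1 / lam))) {1 - 1 / lam..1}"
  proof (rule has_integral_spike_finite[OF _ _ high_inner_integral])
    fix s assume "s \<in> {1 - 1 / lam..1} - {1 - 1 / lam, 1}"
    then have s: "1 - 1 / lam < s" "s < 1" by auto
    then have h: "1 / 2 \<le> s" using il by linarith
    have "density_inner lam s = (if s \<le> 1 - 1 / lam then 0 else high_inner lam s)"
      using assms by (intro density_inner_high h s(2) ls) simp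
    moreover have "\<not> s \<le> 1 - 1 / lam" using s(1) by linarith
    moreover have "s \<in> {1/2..<1}" using h s(2) by simp
    ultimately show "indicator {1/2..<1} s * density_inner lam s = high_inner lam s" by simp
  qed (use il assms in auto)
  ultimately have "((\<lambda>s. indicator {1/2..<1} s * density_inner lam s) has_integral
     0 + (high_primitive lam 1 - high_primitive lam (1 - 1 / lam))) {1/2..1}"
    by (intro has_integral_combine[of "1 / 2" "1 - 1 / lam" 1]) (use il in auto)
  then show "((\<lambda>s. indicator {1/2..<1} s * density_inner lam s) has_integral
     (high_primitive lam 1 - high_primitive lam (1 - 1 / lam))) {1/2..1}" by simp
qed (use assms in auto)

lemma density_integral_formula:
  assumes "0 < lam" "lam \<noteq> 1" "lam \<noteq> 2"
  shows "12 / pi\<^sup>2 * density_integral lam = g1_formula lam"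
proof -
  consider "lam < 1" | "1 < lam" "lam < 2" | "2 < lam" using assms by linarith
  then show ?thesis
  proof cases
    case 1
    then show ?thesis using assms by (simp add: density_integral_low formula_low)
  next
    case 2
    then show ?thesis by (simp only: density_integral_mid formula_mid)
  next
    case 3
    then show ?thesis by (simp only: density_integral_high formula_high)
  qed
qed

section \<open>The error term and the limit\<close>

lemma big_gap_count_le: "big_gap_count lam \<alpha> Q \<le> Q"
proof -
  have "big_gap_count lam \<alpha> Q \<le> length (gaps \<alpha> Q)" unfolding big_gap_count_def by (rule length_filter_le)
  also have "\<dots> = Q" by (simp add: gaps_def Let_def)
  finally show ?thesis .
qed

text \<open>For rational \<open>\<alpha>\<close> coinciding points give gaps of length 0, which
  count as well. The integrand used for the calibration at \<open>lam = 0\<close> is thus the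
  constant 1.\<close>

lemma big_gap_count_zero: "big_gap_count 0 \<alpha> Q = Q"
proof -
  define xs where "xs = sorted_fracs \<alpha> Q"
  have len: "length xs = Q" by (simp add: xs_def sorted_fracs_def)
  have sorted: "sorted xs" by (simp add: xs_def sorted_fracs_def)
  have rng: "0 \<le> xs ! i \<and> xs ! i < 1" if "i < Q" for i
  proof -
    have "xs ! i \<in> set xs" using that len by simp
    then show ?thesis by (auto simp: xs_def sorted_fracs_def frac_lt_1)
  qed
  have "g \<ge> 0" if g: "g \<in> set (gaps \<alpha> Q)" for g
  proof -
    obtain i where i: "i < Q" "g = (if Suc i < Q then xs ! Suc i else xs ! 0 + 1) - xs ! i"
      using g by (auto simp: gaps_def Let_def xs_def)
    show ?thesis
    proof (cases "Suc i < Q")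
      case True
      then show ?thesis using i sorted_nth_mono[OF sorted, of i "Suc i"] len by simp
    next
      case False
      have "0 \<le> xs ! 0" "xs ! i < 1" using rng[of 0] rng[of i] i by auto
      then show ?thesis using False i by simp
    qed
  qed
  then have "filter (\<lambda>g. g \<ge> 0 / real Q) (gaps \<alpha> Q) = gaps \<alpha> Q" by (intro filter_True) simp
  then show ?thesis unfolding big_gap_count_def by (simp add: gaps_def Let_def)
qed

text \<open>The error of \<open>gap_integral_estimate\<close> plus twice that of
  \<open>pair_sum_estimate\<close>. It does not depend on \<open>lam\<close>, so the calibration at
  \<open>lam = 0\<close> is equally precise.\<close>

definition total_error :: "nat \<Rightarrow> real" where
  "total_error Q = (\<Sum>L=1..<Q. 2 * (12 / (real Q * real L) * discrepancy_bound L + 10 / (real Q * real L)))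
     + 144 * (1 + ln (real Q))\<^sup>2 / sqrt (real Q)"

lemma gap_integral_main:
  assumes Q: "Q \<ge> 3" and lam: "lam \<ge> 0" and eta: "0 < \<eta>" "\<eta> \<le> 1"
  shows "\<bar>integral {\<beta>..\<beta> + \<eta>} (\<lambda>\<alpha>. real (big_gap_count lam \<alpha> Q) / real Q)
     - 2 * \<eta> * ((\<Sum>d=1..Q. moebius_mu d / (real d)\<^sup>2) * density_integral lam)\<bar> \<le> total_error Q"
proof -
  define M where "M = (\<Sum>d=1..Q. moebius_mu d / (real d)\<^sup>2) * density_integral lam"
  have "\<bar>2 * \<eta> * pair_sum Q (lam / real Q) - 2 * \<eta> * M\<bar> = 2 * \<eta> * \<bar>pair_sum Q (lam / real Q) - M\<bar>"
    unfolding right_diff_distrib[symmetric] abs_mult using eta by simp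
  also have "\<dots> \<le> 2 * 1 * (72 * (1 + ln (real Q))\<^sup>2 / sqrt (real Q))"
    using pair_sum_estimate[OF Q lam] eta unfolding M_def by (intro mult_mono) auto
  also have "\<dots> = 144 * (1 + ln (real Q))\<^sup>2 / sqrt (real Q)" by simp
  finally show ?thesis using gap_integral_estimate[OF Q lam eta, of \<beta>] unfolding total_error_def M_def by linarith
qed

text \<open>For \<open>lam = 0\<close> every gap is counted, which determines the density of coprime pairs.\<close>
lemma moebius_sum_estimate:
  assumes Q: "Q \<ge> 3"
  shows "\<bar>(\<Sum>d=1..Q. moebius_mu d / (real d)\<^sup>2) - 6 / pi\<^sup>2\<bar> \<le> total_error Q"
proof -
  define M where "M = (\<Sum>d=1..Q. moebius_mu d / (real d)\<^sup>2)"
  have J: "density_integral 0 = pi\<^sup>2 / 12" by (simp add: density_integral_low low_value)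
  have c: "integral {0..0 + 1} (\<lambda>\<alpha>. real (big_gap_count 0 \<alpha> Q) / real Q) = 1"
    unfolding big_gap_count_zero using Q by simp
  have *: "\<bar>1 - M * (pi\<^sup>2 / 6)\<bar> \<le> total_error Q"
    using gap_integral_main[OF Q order.refl zero_less_one order.refl, of 0] unfolding c J M_def[symmetric] by simp
  have p: "6 / pi\<^sup>2 \<le> 1"
  proof -
    have "3 * 3 \<le> pi * pi" using pi_gt3 by (intro mult_mono) auto
    then show ?thesis by (simp add: power2_eq_square divide_le_eq)
  qed
  have "\<bar>M - 6 / pi\<^sup>2\<bar> = 6 / pi\<^sup>2 * \<bar>1 - M * (pi\<^sup>2 / 6)\<bar>"
  proof -
    have e: "M - 6 / pi\<^sup>2 = - (6 / pi\<^sup>2 * (1 - M * (pi\<^sup>2 / 6)))" by (simp add: field_simps)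
    show ?thesis unfolding e abs_minus_cancel abs_mult by simp
  qed
  also have "\<dots> \<le> 1 * total_error Q" using p * by (intro mult_mono) auto
  finally show ?thesis by (simp add: M_def)
qed

text \<open>\<open>193 = 1 + 2 * 96\<close>: the error of the integral, and that of the Moebius sum
  multiplied by the bound 96 for \<open>density_integral\<close>.\<close>

lemma g1_fin_estimate:
  assumes Q: "Q \<ge> 3" and lam: "lam \<ge> 0" and eta: "0 < \<eta>" "\<eta> \<le> 1"
  shows "\<bar>g1_fin \<beta> \<eta> lam Q - 12 / pi\<^sup>2 * density_integral lam\<bar> \<le> 193 * total_error Q / \<eta>"
proof -
  define M where "M = (\<Sum>d=1..Q. moebius_mu d / (real d)\<^sup>2)"
  define J where "J = density_integral lam"
  define I where "I = integral {\<beta>..\<beta> + \<eta>} (\<lambda>\<alpha>. real (big_gap_count lam \<alpha> Q) / real Q)"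
  have 1: "\<bar>I - 2 * \<eta> * (M * J)\<bar> \<le> total_error Q"
    unfolding I_def M_def J_def by (rule gap_integral_main[OF Q lam eta])
  have E0: "0 \<le> total_error Q" using 1 by linarith
  have "\<bar>2 * \<eta> * (M * J) - 2 * \<eta> * (6 / pi\<^sup>2 * J)\<bar> = 2 * \<eta> * (\<bar>M - 6 / pi\<^sup>2\<bar> * \<bar>J\<bar>)"
  proof -
    have "2 * \<eta> * (M * J) - 2 * \<eta> * (6 / pi\<^sup>2 * J) = 2 * \<eta> * ((M - 6 / pi\<^sup>2) * J)" by (simp add: algebra_simps)
    then show ?thesis using eta by (simp only: abs_mult)
  qed
  also have "\<dots> \<le> 2 * 1 * (total_error Q * 96)"
    using moebius_sum_estimate[OF Q] density_integral_bound[OF lam] eta E0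
    unfolding M_def J_def by (intro mult_mono) auto
  finally have 2: "\<bar>2 * \<eta> * (M * J) - 2 * \<eta> * (6 / pi\<^sup>2 * J)\<bar> \<le> 2 * 1 * (total_error Q * 96)" .
  have "\<bar>a - c\<bar> \<le> 193 * E" if "\<bar>a - b\<bar> \<le> E" "\<bar>b - c\<bar> \<le> 2 * 1 * (E * 96)" for a b c E :: real using that by linarith
  from this[OF 1 2] have "\<bar>I - 2 * \<eta> * (6 / pi\<^sup>2 * J)\<bar> \<le> 193 * total_error Q" .
  then have "\<bar>I - 2 * \<eta> * (6 / pi\<^sup>2 * J)\<bar> / \<eta> \<le> 193 * total_error Q / \<eta>" using eta by (intro divide_right_mono) auto
  moreover have "g1_fin \<beta> \<eta> lam Q - 12 / pi\<^sup>2 * J = (I - 2 * \<eta> * (6 / pi\<^sup>2 * J)) / \<eta>"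
    unfolding g1_fin_def I_def[symmetric] using eta by (simp add: diff_divide_distrib)
  ultimately show ?thesis using eta by (simp add: J_def)
qed

lemma total_error_bound:
  assumes e: "\<epsilon> > 0"
  shows "\<exists>C\<ge>0. \<forall>Q\<ge>1. total_error Q \<le> C * real Q powr (\<epsilon> - 1 / 2)"
proof -
  obtain C where C: "\<And>Q. Q > 0 \<Longrightarrow> (\<Sum>L=1..Q. discrepancy_bound L / real L) \<le> C * real Q powr (1 / 2 + \<epsilon>)"
    using sum_discrepancy_bound[OF e] by blast
  \<comment> \<open>The logarithm occurs squared, hence the exponent \<open>\<epsilon> / 2\<close>.
    It enters with the coefficient 144 from \<open>total_error\<close> and with 20 from the harmonic
    sum, which it dominates; together 164.\<close>
  define B where "B = (2 + 1 / (\<epsilon> / 2))\<^sup>2"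
  have "total_error Q \<le> (24 * \<bar>C\<bar> + 164 * B) * real Q powr (\<epsilon> - 1 / 2)" if Q: "Q \<ge> 1" for Q
  proof -
    have q: "real Q \<ge> 1" "real Q > 0" using Q by auto
    have ln0: "ln (real Q) \<ge> 0" using q by simp
    have disc0: "0 \<le> discrepancy_bound L" for L
      unfolding discrepancy_bound_def by (intro mult_nonneg_nonneg) auto
    have sq: "sqrt (real Q) = real Q powr (1 / 2)" using q by (simp add: powr_half_sqrt)
    have lnb: "(1 + ln (real Q))\<^sup>2 / sqrt (real Q) \<le> B * real Q powr (\<epsilon> - 1 / 2)"
    proof -
      have "(1 + ln (real Q))\<^sup>2 \<le> ((2 + 1 / (\<epsilon> / 2)) * real Q powr (\<epsilon> / 2))\<^sup>2"
        using ln_powr_bound[of "\<epsilon> / 2" "real Q"] e q ln0 by (intro power_mono) auto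
      also have "\<dots> = B * real Q powr \<epsilon>"
        unfolding B_def power_mult_distrib by (simp add: power2_eq_square powr_add[symmetric])
      finally have "(1 + ln (real Q))\<^sup>2 / sqrt (real Q) \<le> B * real Q powr \<epsilon> / sqrt (real Q)" by (intro divide_right_mono) auto
      then show ?thesis unfolding sq by (simp add: powr_diff)
    qed
    have "(\<Sum>L=1..<Q. 2 * (12 / (real Q * real L) * discrepancy_bound L + 10 / (real Q * real L)))
       = 24 / real Q * (\<Sum>L=1..<Q. discrepancy_bound L / real L) + 20 / real Q * (\<Sum>L=1..<Q. 1 / real L)"
      unfolding sum_distrib_left sum.distrib[symmetric] by (intro sum.cong refl) simp
    also have "\<dots> \<le> 24 / real Q * (\<Sum>L=1..Q. discrepancy_bound L / real L) + 20 / real Q * (\<Sum>L=1..Q. 1 / real L)"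
      using disc0 by (intro add_mono mult_left_mono sum_mono2) auto
    also have "\<dots> \<le> 24 / real Q * (\<bar>C\<bar> * real Q powr (1 / 2 + \<epsilon>)) + 20 / real Q * (1 + ln (real Q))"
    proof (intro add_mono mult_left_mono)
      have "C * real Q powr (1 / 2 + \<epsilon>) \<le> \<bar>C\<bar> * real Q powr (1 / 2 + \<epsilon>)" by (intro mult_right_mono) auto
      then show "(\<Sum>L=1..Q. discrepancy_bound L / real L) \<le> \<bar>C\<bar> * real Q powr (1 / 2 + \<epsilon>)" using C[of Q] Q by linarith
      show "(\<Sum>L=1..Q. 1 / real L) \<le> 1 + ln (real Q)" using Q by (intro harm_le_ln) auto
    qed auto
    also have "24 / real Q * (\<bar>C\<bar> * real Q powr (1 / 2 + \<epsilon>)) = 24 * \<bar>C\<bar> * real Q powr (\<epsilon> - 1 / 2)"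
    proof -
      have "real Q powr (1 / 2 + \<epsilon>) / real Q = real Q powr (1 / 2 + \<epsilon> - 1)" using q by (subst powr_diff) simp
      also have "1 / 2 + \<epsilon> - 1 = \<epsilon> - 1 / 2" by simp
      finally have p: "real Q powr (1 / 2 + \<epsilon>) / real Q = real Q powr (\<epsilon> - 1 / 2)" .
      have "24 / real Q * (\<bar>C\<bar> * real Q powr (1 / 2 + \<epsilon>)) = 24 * \<bar>C\<bar> * (real Q powr (1 / 2 + \<epsilon>) / real Q)" by simp
      then show ?thesis unfolding p .
    qed
    also have "20 / real Q * (1 + ln (real Q)) \<le> 20 * ((1 + ln (real Q))\<^sup>2 / sqrt (real Q))"
    proof -
      have "1 / real Q \<le> 1 / sqrt (real Q)"
      proof (rule divide_left_mono)
        have "sqrt (real Q) * 1 \<le> sqrt (real Q) * sqrt (real Q)" using q by (intro mult_left_mono) auto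
        then show "sqrt (real Q) \<le> real Q" by simp
      qed (use q in auto)
      moreover have "1 + ln (real Q) \<le> (1 + ln (real Q))\<^sup>2" using ln0 by (intro self_le_power) auto
      ultimately have "1 / real Q * (1 + ln (real Q)) \<le> 1 / sqrt (real Q) * (1 + ln (real Q))\<^sup>2"
        using ln0 q by (intro mult_mono) simp_all
      moreover have "20 / a * x \<le> 20 * (y / b)" if "1 / a * x \<le> 1 / b * y" for a b x y :: real using that by simp
      ultimately show ?thesis by blast
    qed
    finally show ?thesis unfolding total_error_def using lnb by (simp add: algebra_simps)
  qed
  then show ?thesis by (intro exI[of _ "24 * \<bar>C\<bar> + 164 * B"]) (auto simp: B_def)
qed

text \<open>The integrand lies between 0 and 1. A non-integrable function has integral 0 by
  convention, so the case distinction replaces a proof of integrability.\<close>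

lemma g1_fin_bounds:
  assumes "0 < \<eta>" "Q \<ge> 1"
  shows "\<bar>g1_fin \<beta> \<eta> lam Q\<bar> \<le> 1"
proof -
  let ?f = "\<lambda>\<alpha>. real (big_gap_count lam \<alpha> Q) / real Q"
  have b: "\<bar>?f \<alpha>\<bar> \<le> 1" for \<alpha> using big_gap_count_le[of lam \<alpha> Q] assms by simp
  define I where "I = integral {\<beta>..\<beta> + \<eta>} ?f"
  have "\<bar>I\<bar> \<le> \<eta>"
  proof (cases "?f integrable_on {\<beta>..\<beta> + \<eta>}")
    case True
    have "norm (integral (cbox \<beta> (\<beta> + \<eta>)) ?f) \<le> 1 * measure lborel (cbox \<beta> (\<beta> + \<eta>))"
      by (rule integrable_bound) (use b True in auto)
    moreover have "measure lborel (cbox \<beta> (\<beta> + \<eta>)) = \<eta>" using assms by simp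
    ultimately show ?thesis unfolding real_norm_def cbox_interval I_def by linarith
  next
    case False
    then show ?thesis using assms unfolding I_def not_integrable_integral[OF False] by simp
  qed
  then have "\<bar>I\<bar> / \<eta> \<le> 1" using assms by simp
  then show ?thesis unfolding g1_fin_def I_def[symmetric] abs_mult using assms by simp
qed

lemma g1_fin_error:
  assumes e: "\<epsilon> > 0"
  shows "\<exists>C. \<forall>\<beta> \<eta> lam (Q::nat). 0 < \<eta> \<longrightarrow> \<eta> \<le> 1 \<longrightarrow> 0 < lam \<longrightarrow> 1 \<le> Q \<longrightarrow>
    \<bar>g1_fin \<beta> \<eta> lam Q - 12 / pi\<^sup>2 * density_integral lam\<bar> \<le> C * (1 + lam) * real Q powr (\<epsilon> - 1/2) / \<eta>"
proof -
  obtain C where C: "C \<ge> 0" "\<And>Q. Q \<ge> 1 \<Longrightarrow> total_error Q \<le> C * real Q powr (\<epsilon> - 1 / 2)"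
    using total_error_bound[OF e] by blast
  \<comment> \<open>The 400 covers \<open>Q < 3\<close>: there the difference is at most
    \<open>1 + 192 < 200\<close>, while
    \<open>Q powr (\<epsilon> - 1 / 2) \<ge> 1 / 2\<close>.\<close>
  define D where "D = 193 * C + 400"
  have "\<bar>g1_fin \<beta> \<eta> lam Q - 12 / pi\<^sup>2 * density_integral lam\<bar> \<le> D * (1 + lam) * real Q powr (\<epsilon> - 1/2) / \<eta>"
    if h: "0 < \<eta>" "\<eta> \<le> 1" "0 < lam" "1 \<le> Q" for \<beta> \<eta> lam Q
  proof -
    define P where "P = real Q powr (\<epsilon> - 1 / 2)"
    have P0: "P \<ge> 0" by (simp add: P_def)
    have "\<bar>g1_fin \<beta> \<eta> lam Q - 12 / pi\<^sup>2 * density_integral lam\<bar> \<le> D * P / \<eta>"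
    proof (cases "Q \<ge> 3")
      case True
      have "\<bar>g1_fin \<beta> \<eta> lam Q - 12 / pi\<^sup>2 * density_integral lam\<bar> \<le> 193 * total_error Q / \<eta>"
        using h True by (intro g1_fin_estimate) auto
      also have "\<dots> \<le> 193 * (C * P) / \<eta>" using C(2)[of Q] h unfolding P_def by (intro divide_right_mono mult_left_mono) auto
      also have "\<dots> \<le> D * P / \<eta>" using h P0 by (intro divide_right_mono) (auto simp: D_def algebra_simps)
      finally show ?thesis .
    next
      case False
      have "12 / pi\<^sup>2 \<le> 2"
      proof -
        have "3 * 3 \<le> pi * pi" using pi_gt3 by (intro mult_mono) auto
        then show ?thesis by (simp add: power2_eq_square divide_le_eq)
      qed
      then have "\<bar>12 / pi\<^sup>2 * density_integral lam\<bar> \<le> 2 * 96"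
        unfolding abs_mult using density_integral_bound[of lam] h by (intro mult_mono) auto
      then have a: "\<bar>g1_fin \<beta> \<eta> lam Q - 12 / pi\<^sup>2 * density_integral lam\<bar> \<le> 200"
        using g1_fin_bounds[of \<eta> Q \<beta> lam] h by linarith
      have "1 / 2 \<le> P"
      proof -
        have "(1 / 2 :: real) = 2 powr (-1)" by (simp add: powr_minus_divide)
        also have "\<dots> \<le> real Q powr (- 1)" using False h by (simp add: powr_minus_divide field_simps)
        also have "\<dots> \<le> P" unfolding P_def using h e by (intro powr_mono) auto
        finally show ?thesis .
      qed
      then have "200 \<le> D * P" using C(1) mult_mono[of 400 D "1/2" P] by (simp add: D_def)
      also have "\<dots> \<le> D * P / \<eta>"
      proof -
        have "0 \<le> D * P" using C(1) P0 by (simp add: D_def)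
        then have "D * P * \<eta> \<le> D * P * 1" using h by (intro mult_left_mono) auto
        then show ?thesis using h by (simp add: le_divide_eq)
      qed
      finally show ?thesis using a by linarith
    qed
    also have "\<dots> \<le> D * (1 + lam) * P / \<eta>"
    proof -
      have "0 \<le> D * P" using C(1) P0 by (simp add: D_def)
      then have "D * P * 1 \<le> D * P * (1 + lam)" using h by (intro mult_left_mono) auto
      then show ?thesis using h by (intro divide_right_mono) (auto simp: mult_ac)
    qed
    finally show ?thesis unfolding P_def .
  qed
  then show ?thesis by blast
qed

theorem theorem1:
  "\<exists>g1 :: real \<Rightarrow> real.
     (\<forall>lam>0. lam \<noteq> 1 \<longrightarrow> lam \<noteq> 2 \<longrightarrow> g1 lam = g1_formula lam) \<and>
     (\<forall>\<beta> \<eta> lam. 0 < \<eta> \<longrightarrow> \<eta> \<le> 1 \<longrightarrow> 0 < lam \<longrightarrow>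
        (\<lambda>Q. g1_fin \<beta> \<eta> lam Q) \<longlonglongrightarrow> g1 lam) \<and>
     (\<forall>\<epsilon>>0. \<exists>C. \<forall>\<beta> \<eta> lam (Q::nat). 0 < \<eta> \<longrightarrow> \<eta> \<le> 1 \<longrightarrow> 0 < lam \<longrightarrow> 1 \<le> Q \<longrightarrow>
        \<bar>g1_fin \<beta> \<eta> lam Q - g1 lam\<bar> \<le> C * (1 + lam) * real Q powr (\<epsilon> - 1/2) / \<eta>)"
\<comment> \<open>The double integral itself serves as the limit function. It is also defined at
  \<open>lam = 1\<close> and \<open>lam = 2\<close>, where convergence is asserted but the closed
  formula is not.\<close>
proof (intro exI[of _ "\<lambda>lam. 12 / pi\<^sup>2 * density_integral lam"] conjI allI impI)
  fix lam :: real assume "lam > 0" "lam \<noteq> 1" "lam \<noteq> 2"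
  then show "12 / pi\<^sup>2 * density_integral lam = g1_formula lam" by (rule density_integral_formula)
next
  fix \<beta> \<eta> lam :: real assume h: "0 < \<eta>" "\<eta> \<le> 1" "0 < lam"
  \<comment> \<open>Any exponent strictly between 0 and \<open>1 / 2\<close> lets the bound tend to
    0.\<close>
  have "0 < (1 / 4 :: real)" by simp
  from g1_fin_error[OF this] obtain C where C: "\<And>Q::nat. 1 \<le> Q \<Longrightarrow>
    \<bar>g1_fin \<beta> \<eta> lam Q - 12 / pi\<^sup>2 * density_integral lam\<bar> \<le> C * (1 + lam) * real Q powr (1 / 4 - 1/2) / \<eta>"
    using h by blast
  have "(\<lambda>Q. g1_fin \<beta> \<eta> lam Q - 12 / pi\<^sup>2 * density_integral lam) \<longlonglongrightarrow> 0"
  proof (rule Lim_null_comparison)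
    show "\<forall>\<^sub>F Q in sequentially. norm (g1_fin \<beta> \<eta> lam Q - 12 / pi\<^sup>2 * density_integral lam) \<le> C * (1 + lam) / \<eta> * real Q powr (- 1 / 4)"
      using eventually_ge_at_top[of 1] by eventually_elim (use C in simp)
    have "(\<lambda>Q. real Q powr (- 1 / 4)) \<longlonglongrightarrow> 0" by real_asymp
    from tendsto_mult_right_zero[OF this] show "(\<lambda>Q. C * (1 + lam) / \<eta> * real Q powr (- 1 / 4)) \<longlonglongrightarrow> 0" .
  qed
  then show "(\<lambda>Q. g1_fin \<beta> \<eta> lam Q) \<longlonglongrightarrow> 12 / pi\<^sup>2 * density_integral lam" by (rule LIM_zero_cancel)
next
  fix \<epsilon> :: real assume "\<epsilon> > 0"
  then show "\<exists>C. \<forall>\<beta> \<eta> lam (Q::nat). 0 < \<eta> \<longrightarrow> \<eta> \<le> 1 \<longrightarrow> 0 < lam \<longrightarrow> 1 \<le> Q \<longrightarrow>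
    \<bar>g1_fin \<beta> \<eta> lam Q - 12 / pi\<^sup>2 * density_integral lam\<bar> \<le> C * (1 + lam) * real Q powr (\<epsilon> - 1/2) / \<eta>"
    by (rule g1_fin_error)
qed

end
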